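(* Let $\mathfrak g$ be a Kac-Moody Lie algebra, let $A$ be a finitely generated commutative associative unital $\mathbb C$-algebra, and let $\widetilde{\mathfrak g}=\mathfrak g'\otimes A\oplus\mathfrak h''$ and $\widetilde{\mathfrak h}=\mathfrak h'\otimes A\oplus\mathfrak h''$. Let $I$ be a cofinite ideal of $A$ such that $I=\bigcap_{i=1}^k\mathfrak m_i$, where $\mathfrak m_1,\dots,\mathfrak m_k$ are distinct maximal ideals of $A$. Let $\psi_1,\dots,\psi_k:\widetilde{\mathfrak h}\to\mathbb C$ be linear maps such that $\psi_i|_{\mathfrak h'\otimes\mathfrak m_i}=0$ and $\psi_i|_{\mathfrak h}=\lambda_i$ is a dominant integral weight, for each $1\le i\le k$. Put $\psi=\sum_{i=1}^k\psi_i$ (so $\psi|_{\mathfrak h}=\lambda:=\sum_{i=1}^k\lambda_i$). Then, as $\widetilde{\mathfrak g}$-modules, $$W(\psi,I)\;\cong\;\bigotimes_{i=1}^k W(\psi_i,\mathfrak m_i).$$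
   Context: Setting. $\mathfrak g$ is a Kac-Moody Lie algebra over $\mathbb C$ with Cartan subalgebra $\mathfrak h$, triangular decomposition $\mathfrak g=N^-\oplus\mathfrak h\oplus N^+$, simple roots $\alpha_1,\dots,\alpha_l$, simple coroots $\alpha_1^\vee,\dots,\alpha_l^\vee$, and set of positive roots $\Delta^+$. Put $\mathfrak g'=[\mathfrak g,\mathfrak g]$, $\mathfrak h'=\mathfrak g'\cap\mathfrak h$, and fix a subspace $\mathfrak h''$ with $\mathfrak h=\mathfrak h'\oplus\mathfrak h''$. $A$ is a finitely generated commutative associative unital $\mathbb C$-algebra. An ideal $I$ of $A$ is cofinite if $\dim_{\mathbb C}A/I<\infty$. A weight $\lambda\in\mathfrak h^*$ is dominant integral if $\lambda(\alpha_i^\vee)\in\mathbb Z_{\ge0}$ for all $i$. The Lie algebra $\widetilde{\mathfrak g}=\mathfrak g'\otimes A\oplus\mathfrak h''$ has bracket $[X\otimes a,Y\otimes b]=[X,Y]\otimes ab$, $[h,X\otimes a]=[h,X]\otimes a$, $[h,h_1]=0$ for $X,Y\in\mathfrak g'$, $a,b\in A$, $h,h_1\in\mathfrak h''$. Put $\widetilde{\mathfrak h}=\mathfrak h'\otimes A\oplus\mathfrak h''$ and $\widetilde N^{\pm}=N^{\pm}\otimes A$, so $\widetilde{\mathfrak g}=\widetilde N^+\oplus\widetilde{\mathfrak h}\oplus\widetilde N^-$. We identify $\mathfrak g=\mathfrak g'\otimes1\oplus\mathfrak h''\subset\widetilde{\mathfrak g}$ and $\mathfrak h=\mathfrak h'\otimes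 1\oplus\mathfrak h''\subset\widetilde{\mathfrak h}$. Tensor products of $\widetilde{\mathfrak g}$-modules carry the usual action $x(u\otimes w)=xu\otimes w+u\otimes xw$. Verma module. For a linear map $\psi:\widetilde{\mathfrak h}\to\mathbb C$, $M(\psi)=U(\widetilde{\mathfrak g})\otimes_{U(\widetilde N^+\oplus\widetilde{\mathfrak h})}\mathbb C$, where $\widetilde N^+$ acts on $\mathbb C$ by $0$ and $\widetilde{\mathfrak h}$ acts by $\psi$; $v$ denotes its highest weight vector $1\otimes1$ (and its images in quotients). The module $M(\psi,I)$. Let $I$ be a cofinite ideal and $\psi$ a linear map with $\psi|_{\mathfrak h'\otimes I}=0$ and $\psi|_{\mathfrak h}=\lambda$ dominant integral. For $\alpha=\sum_i m_i\alpha_i\in\Delta^+$ put $N_{\lambda,\alpha}=\sum_i m_i\lambda(\alpha_i^\vee)$. Then $M(\psi,I)$ is the quotient of $M(\psi)$ by the submodule generated by all $(X_{-\alpha}\otimes a)v$ with $\alpha\in\Delta^+$, $X_{-\alpha}$ a root vector of root $-\alpha$, and $a\in I^{N_{\lambda,\alpha}}$ (with $I^0=A$). The Weyl module $W(\psi,I)$. A $\widetilde{\mathfrak g}$-module is called integrable if, as a $\mathfrak g$-module, $\mathfrak h$ acts diagonalizably and all Chevalley generators $X_{\pm\alpha_i}$ $(1\le i\le l)$ act locally nilpotently. $W(\psi,I)$ is the maximal integrable quotient of $M(\psi,I)$: it is an integrable quotient of $M(\psi,I)$ such that every integrable quotient of $M(\psi,I)$ is a quotient of $W(\psi,I)$.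 *)

theory Defs
  imports
    "HOL-Algebra.Module"
    "HOL-Algebra.QuotRing"
    "HOL-Algebra.Ideal_Product"
    "HOL-Algebra.Subrings"
    "HOL-Library.Poly_Mapping"
    "HOL-Analysis.Cartesian_Space"
begin

section \<open>Complex vector spaces\<close>

text \<open>
  A complex vector space is a HOL-Algebra module over the following ring. The ring is
  itself a module record, so that it also serves as the one-dimensional vector space.
  For a vector space that is not an algebra, the record fields \<open>mult\<close> and \<open>one\<close> are junk.
\<close>

definition cplx :: "(complex, complex) module" where
  "cplx = \<lparr>carrier = UNIV, mult = (*), one = 1, zero = 0, add = (+), smult = (*)\<rparr>"

definition vspan :: "(complex, 'v, 'm) module_scheme \<Rightarrow> 'v set \<Rightarrow> 'v set" where
  "vspan V S = \<Inter>{N. submodule N cplx V \<and> S \<subseteq> N}"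

definition lin_indep :: "(complex, 'v, 'm) module_scheme \<Rightarrow> 'i set \<Rightarrow> ('i \<Rightarrow> 'v) \<Rightarrow> bool" where
  "lin_indep V J b \<longleftrightarrow> (\<forall>i\<in>J. b i \<in> carrier V) \<and>
     (\<forall>c :: 'i \<Rightarrow> complex. (\<Oplus>\<^bsub>V\<^esub>i\<in>J. c i \<odot>\<^bsub>V\<^esub> b i) = \<zero>\<^bsub>V\<^esub> \<longrightarrow> (\<forall>i\<in>J. c i = 0))"

definition finite_basis :: "(complex, 'v, 'm) module_scheme \<Rightarrow> 'v set \<Rightarrow> bool" where
  "finite_basis V B \<longleftrightarrow> finite B \<and> lin_indep V B (\<lambda>b. b) \<and> vspan V B = carrier V"

definition fin_dim :: "(complex, 'v, 'm) module_scheme \<Rightarrow> bool" where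
  "fin_dim V \<longleftrightarrow> (\<exists>B. finite_basis V B)"

definition lin_form :: "(complex, 'v, 'm) module_scheme \<Rightarrow> 'v set \<Rightarrow> ('v \<Rightarrow> complex) \<Rightarrow> bool" where
  "lin_form V S \<phi> \<longleftrightarrow>
     (\<forall>x\<in>S. \<forall>y\<in>S. \<phi> (x \<oplus>\<^bsub>V\<^esub> y) = \<phi> x + \<phi> y) \<and> (\<forall>c. \<forall>x\<in>S. \<phi> (c \<odot>\<^bsub>V\<^esub> x) = c * \<phi> x)"

text \<open>
  The quotient by a subspace, realised on cosets. If \<open>V\<close> carries a ring structure and \<open>N\<close> is
  an ideal, this is the quotient algebra.
\<close>

definition vquot :: "(complex, 'v, 'm) module_scheme \<Rightarrow> 'v set \<Rightarrow> (complex, 'v set) module" where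
  "vquot V N = \<lparr>carrier = a_rcosets\<^bsub>V\<^esub> N, mult = rcoset_mult V N, one = N +>\<^bsub>V\<^esub> \<one>\<^bsub>V\<^esub>,
     zero = N, add = set_add V, smult = (\<lambda>c X. \<Union>x\<in>X. N +>\<^bsub>V\<^esub> (c \<odot>\<^bsub>V\<^esub> x))\<rparr>"

definition free_vs :: "'x set \<Rightarrow> (complex, 'x \<Rightarrow>\<^sub>0 complex) module" where
  "free_vs S = \<lparr>carrier = {p. Poly_Mapping.keys p \<subseteq> S}, mult = undefined, one = undefined,
     zero = 0, add = (+), smult = (\<lambda>c p. Poly_Mapping.map ((*) c) p)\<rparr>"

text \<open>
  The vector space with generators \<open>S\<close> and linear relations \<open>R\<close>, and the class of a generator.
\<close>

definition pres :: "'x set \<Rightarrow> ('x \<Rightarrow>\<^sub>0 complex) set \<Rightarrow> (complex, ('x \<Rightarrow>\<^sub>0 complex) set) module" where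
  "pres S R = vquot (free_vs S) (vspan (free_vs S) R)"

definition pres_gen :: "'x set \<Rightarrow> ('x \<Rightarrow>\<^sub>0 complex) set \<Rightarrow> 'x \<Rightarrow> ('x \<Rightarrow>\<^sub>0 complex) set" where
  "pres_gen S R x = vspan (free_vs S) R +>\<^bsub>free_vs S\<^esub> Poly_Mapping.single x 1"

text \<open>
  The linear map from a quotient of a free vector space to \<open>E\<close> that sends the class of each
  generator \<open>x\<close> to \<open>f x\<close>, evaluated on an arbitrary representative. It is only applied to \<open>f\<close>
  compatible with the relations, so the choice of the representative is immaterial.
\<close>

definition lin_ext ::
  "(complex, 'e, 'm) module_scheme \<Rightarrow> ('x \<Rightarrow> 'e) \<Rightarrow> ('x \<Rightarrow>\<^sub>0 complex) set \<Rightarrow> 'e" where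
  "lin_ext E f X = (let p = (SOME p. p \<in> X) in
     \<Oplus>\<^bsub>E\<^esub>x\<in>Poly_Mapping.keys p. Poly_Mapping.lookup p x \<odot>\<^bsub>E\<^esub> f x)"


section \<open>Tensor products\<close>

definition bilin_rels ::
  "(complex, 'v, 'm) module_scheme \<Rightarrow> (complex, 'w, 'k) module_scheme
     \<Rightarrow> (('v \<times> 'w) \<Rightarrow>\<^sub>0 complex) set" where
  "bilin_rels V W =
     {Poly_Mapping.single (x \<oplus>\<^bsub>V\<^esub> y, w) 1 - Poly_Mapping.single (x, w) 1 - Poly_Mapping.single (y, w) 1
        | x y w. x \<in> carrier V \<and> y \<in> carrier V \<and> w \<in> carrier W}
   \<union> {Poly_Mapping.single (x, v \<oplus>\<^bsub>W\<^esub> w) 1 - Poly_Mapping.single (x, v) 1 - Poly_Mapping.single (x, w) 1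
        | x v w. x \<in> carrier V \<and> v \<in> carrier W \<and> w \<in> carrier W}
   \<union> {Poly_Mapping.single (c \<odot>\<^bsub>V\<^esub> x, w) 1 - Poly_Mapping.single (x, w) c
        | c x w. x \<in> carrier V \<and> w \<in> carrier W}
   \<union> {Poly_Mapping.single (x, c \<odot>\<^bsub>W\<^esub> w) 1 - Poly_Mapping.single (x, w) c
        | c x w. x \<in> carrier V \<and> w \<in> carrier W}"

definition tensor ::
  "(complex, 'v, 'm) module_scheme \<Rightarrow> (complex, 'w, 'k) module_scheme
     \<Rightarrow> (complex, (('v \<times> 'w) \<Rightarrow>\<^sub>0 complex) set) module" where
  "tensor V W = pres (carrier V \<times> carrier W) (bilin_rels V W)"

definition tensor_pure ::
  "(complex, 'v, 'm) module_scheme \<Rightarrow> (complex, 'w, 'k) module_scheme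
     \<Rightarrow> 'v \<Rightarrow> 'w \<Rightarrow> (('v \<times> 'w) \<Rightarrow>\<^sub>0 complex) set" where
  "tensor_pure V W x y = pres_gen (carrier V \<times> carrier W) (bilin_rels V W) (x, y)"

text \<open>
  \<open>V \<otimes>\<^sub>R W\<close> for a complex algebra with underlying set \<open>R\<close>, acting on \<open>V\<close> from the right by \<open>rt\<close>
  and on \<open>W\<close> from the left by \<open>lt\<close>.
\<close>

definition balanced_rels ::
  "'r set \<Rightarrow> (complex, 'v, 'm) module_scheme \<Rightarrow> ('v \<Rightarrow> 'r \<Rightarrow> 'v)
     \<Rightarrow> (complex, 'w, 'k) module_scheme \<Rightarrow> ('r \<Rightarrow> 'w \<Rightarrow> 'w) \<Rightarrow> (('v \<times> 'w) \<Rightarrow>\<^sub>0 complex) set" where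
  "balanced_rels R V rt W lt = bilin_rels V W
   \<union> {Poly_Mapping.single (rt v r, w) 1 - Poly_Mapping.single (v, lt r w) 1
        | v r w. v \<in> carrier V \<and> r \<in> R \<and> w \<in> carrier W}"

definition tensor_over ::
  "'r set \<Rightarrow> (complex, 'v, 'm) module_scheme \<Rightarrow> ('v \<Rightarrow> 'r \<Rightarrow> 'v)
     \<Rightarrow> (complex, 'w, 'k) module_scheme \<Rightarrow> ('r \<Rightarrow> 'w \<Rightarrow> 'w)
     \<Rightarrow> (complex, (('v \<times> 'w) \<Rightarrow>\<^sub>0 complex) set) module" where
  "tensor_over R V rt W lt = pres (carrier V \<times> carrier W) (balanced_rels R V rt W lt)"

definition tensor_over_pure ::
  "'r set \<Rightarrow> (complex, 'v, 'm) module_scheme \<Rightarrow> ('v \<Rightarrow> 'r \<Rightarrow> 'v)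
     \<Rightarrow> (complex, 'w, 'k) module_scheme \<Rightarrow> ('r \<Rightarrow> 'w \<Rightarrow> 'w)
     \<Rightarrow> 'v \<Rightarrow> 'w \<Rightarrow> (('v \<times> 'w) \<Rightarrow>\<^sub>0 complex) set" where
  "tensor_over_pure R V rt W lt v w =
     pres_gen (carrier V \<times> carrier W) (balanced_rels R V rt W lt) (v, w)"

definition multilin_rels ::
  "'i set \<Rightarrow> ('i \<Rightarrow> (complex, 'v, 'm) module_scheme) \<Rightarrow> (('i \<Rightarrow> 'v) \<Rightarrow>\<^sub>0 complex) set" where
  "multilin_rels J V =
     {Poly_Mapping.single (u(i := x \<oplus>\<^bsub>V i\<^esub> y)) 1
        - Poly_Mapping.single (u(i := x)) 1 - Poly_Mapping.single (u(i := y)) 1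
        | u i x y. i \<in> J \<and> u \<in> (\<Pi>\<^sub>E j\<in>J. carrier (V j)) \<and> x \<in> carrier (V i) \<and> y \<in> carrier (V i)}
   \<union> {Poly_Mapping.single (u(i := c \<odot>\<^bsub>V i\<^esub> x)) 1 - Poly_Mapping.single (u(i := x)) c
        | u i c x. i \<in> J \<and> u \<in> (\<Pi>\<^sub>E j\<in>J. carrier (V j)) \<and> x \<in> carrier (V i)}"


section \<open>Lie algebras and their modules\<close>

record 'g lie = "(complex, 'g) module" +
  brack :: "'g \<Rightarrow> 'g \<Rightarrow> 'g"

locale lie_algebra = Module.module cplx L for L :: "('g, 'm) lie_scheme" (structure) +
  assumes brack_closed: "\<lbrakk>x \<in> carrier L; y \<in> carrier L\<rbrakk> \<Longrightarrow> brack L x y \<in> carrier L"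
    and brack_add_left: "\<lbrakk>x \<in> carrier L; y \<in> carrier L; z \<in> carrier L\<rbrakk>
      \<Longrightarrow> brack L (x \<oplus> y) z = brack L x z \<oplus> brack L y z"
    and brack_add_right: "\<lbrakk>x \<in> carrier L; y \<in> carrier L; z \<in> carrier L\<rbrakk>
      \<Longrightarrow> brack L x (y \<oplus> z) = brack L x y \<oplus> brack L x z"
    and brack_smult_left: "\<lbrakk>x \<in> carrier L; y \<in> carrier L\<rbrakk>
      \<Longrightarrow> brack L (c \<odot> x) y = c \<odot> brack L x y"
    and brack_smult_right: "\<lbrakk>x \<in> carrier L; y \<in> carrier L\<rbrakk>
      \<Longrightarrow> brack L x (c \<odot> y) = c \<odot> brack L x y"
    and brack_self: "x \<in> carrier L \<Longrightarrow> brack L x x = \<zero>"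
    and jacobi: "\<lbrakk>x \<in> carrier L; y \<in> carrier L; z \<in> carrier L\<rbrakk>
      \<Longrightarrow> brack L x (brack L y z) \<oplus> brack L y (brack L z x) \<oplus> brack L z (brack L x y) = \<zero>"

definition lie_subalgebra :: "('g, 'm) lie_scheme \<Rightarrow> 'g set \<Rightarrow> bool" where
  "lie_subalgebra L S \<longleftrightarrow> submodule S cplx L \<and> (\<forall>x\<in>S. \<forall>y\<in>S. brack L x y \<in> S)"

definition lie_ideal :: "('g, 'm) lie_scheme \<Rightarrow> 'g set \<Rightarrow> bool" where
  "lie_ideal L S \<longleftrightarrow> submodule S cplx L \<and> (\<forall>x\<in>carrier L. \<forall>y\<in>S. brack L x y \<in> S)"

definition derived :: "('g, 'm) lie_scheme \<Rightarrow> 'g set" where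
  "derived L = vspan L {brack L x y | x y. x \<in> carrier L \<and> y \<in> carrier L}"

record ('x, 'v) lmod = "(complex, 'v) module" +
  act :: "'x \<Rightarrow> 'v \<Rightarrow> 'v"

locale lie_module = lie_algebra L + V?: Module.module cplx V
  for L :: "('x, 'm) lie_scheme" and V :: "('x, 'v, 'k) lmod_scheme" +
  assumes act_closed: "\<lbrakk>x \<in> carrier L; v \<in> carrier V\<rbrakk> \<Longrightarrow> act V x v \<in> carrier V"
    and act_add_left: "\<lbrakk>x \<in> carrier L; y \<in> carrier L; v \<in> carrier V\<rbrakk>
      \<Longrightarrow> act V (x \<oplus>\<^bsub>L\<^esub> y) v = act V x v \<oplus>\<^bsub>V\<^esub> act V y v"
    and act_smult_left: "\<lbrakk>x \<in> carrier L; v \<in> carrier V\<rbrakk>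
      \<Longrightarrow> act V (c \<odot>\<^bsub>L\<^esub> x) v = c \<odot>\<^bsub>V\<^esub> act V x v"
    and act_add_right: "\<lbrakk>x \<in> carrier L; v \<in> carrier V; w \<in> carrier V\<rbrakk>
      \<Longrightarrow> act V x (v \<oplus>\<^bsub>V\<^esub> w) = act V x v \<oplus>\<^bsub>V\<^esub> act V x w"
    and act_smult_right: "\<lbrakk>x \<in> carrier L; v \<in> carrier V\<rbrakk>
      \<Longrightarrow> act V x (c \<odot>\<^bsub>V\<^esub> v) = c \<odot>\<^bsub>V\<^esub> act V x v"
    and act_brack: "\<lbrakk>x \<in> carrier L; y \<in> carrier L; v \<in> carrier V\<rbrakk>
      \<Longrightarrow> act V (brack L x y) v = act V x (act V y v) \<ominus>\<^bsub>V\<^esub> act V y (act V x v)"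

definition lie_submodule ::
  "('x, 'm) lie_scheme \<Rightarrow> ('x, 'v, 'k) lmod_scheme \<Rightarrow> 'v set \<Rightarrow> bool" where
  "lie_submodule L V N \<longleftrightarrow> submodule N cplx V \<and> (\<forall>x\<in>carrier L. \<forall>v\<in>N. act V x v \<in> N)"

definition gen_submodule ::
  "('x, 'm) lie_scheme \<Rightarrow> ('x, 'v, 'k) lmod_scheme \<Rightarrow> 'v set \<Rightarrow> 'v set" where
  "gen_submodule L V S = \<Inter>{N. lie_submodule L V N \<and> S \<subseteq> N}"

definition lmod_quot :: "('x, 'v, 'k) lmod_scheme \<Rightarrow> 'v set \<Rightarrow> ('x, 'v set) lmod" where
  "lmod_quot V N = module.extend (vquot V N)
     (lmod.fields (\<lambda>x X. \<Union>v\<in>X. N +>\<^bsub>V\<^esub> act V x v))"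

definition lmod_iso ::
  "('x, 'm) lie_scheme \<Rightarrow> ('x, 'v, 'k) lmod_scheme \<Rightarrow> ('x, 'w, 'j) lmod_scheme \<Rightarrow> bool" where
  "lmod_iso L V W \<longleftrightarrow> lie_module L V \<and> lie_module L W \<and>
     (\<exists>f. bij_betw f (carrier V) (carrier W) \<and>
        (\<forall>u\<in>carrier V. \<forall>v\<in>carrier V. f (u \<oplus>\<^bsub>V\<^esub> v) = f u \<oplus>\<^bsub>W\<^esub> f v) \<and>
        (\<forall>c. \<forall>v\<in>carrier V. f (c \<odot>\<^bsub>V\<^esub> v) = c \<odot>\<^bsub>W\<^esub> f v) \<and>
        (\<forall>x\<in>carrier L. \<forall>v\<in>carrier V. f (act V x v) = act W x (f v)))"

text \<open>
  The tensor product of a finite family of modules; pure tensors are the classes of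
  \<open>u \<in> (\<Pi>\<^sub>E j\<in>J. carrier (V j))\<close>, and \<open>x\<close> acts by the Leibniz rule.
\<close>

definition tensor_family ::
  "'i set \<Rightarrow> ('i \<Rightarrow> ('x, 'v, 'k) lmod_scheme) \<Rightarrow> ('x, (('i \<Rightarrow> 'v) \<Rightarrow>\<^sub>0 complex) set) lmod" where
  "tensor_family J V =
    (let S = (\<Pi>\<^sub>E j\<in>J. carrier (V j)); R = multilin_rels J V; T = pres S R
     in module.extend T (lmod.fields (\<lambda>x.
          lin_ext T (\<lambda>u. \<Oplus>\<^bsub>T\<^esub>i\<in>J. pres_gen S R (u(i := act (V i) x (u i)))))))"


section \<open>Universal enveloping algebras\<close>

definition free_alg :: "'x set \<Rightarrow> (complex, 'x list \<Rightarrow>\<^sub>0 complex) module" where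
  "free_alg S = \<lparr>carrier = {p. Poly_Mapping.keys p \<subseteq> lists S},
     mult = (\<lambda>p q. \<Sum>u\<in>Poly_Mapping.keys p. \<Sum>w\<in>Poly_Mapping.keys q.
        Poly_Mapping.single (u @ w) (Poly_Mapping.lookup p u * Poly_Mapping.lookup q w)),
     one = Poly_Mapping.single [] 1, zero = 0, add = (+),
     smult = (\<lambda>c p. Poly_Mapping.map ((*) c) p)\<rparr>"

text \<open>
  The first two families of relations turn the free algebra on the set \<open>carrier L\<close> into the
  tensor algebra of the vector space \<open>L\<close>.
\<close>

definition uea_rels :: "('x, 'm) lie_scheme \<Rightarrow> ('x list \<Rightarrow>\<^sub>0 complex) set" where
  "uea_rels L =
     {Poly_Mapping.single [x \<oplus>\<^bsub>L\<^esub> y] 1 - Poly_Mapping.single [x] 1 - Poly_Mapping.single [y] 1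
        | x y. x \<in> carrier L \<and> y \<in> carrier L}
   \<union> {Poly_Mapping.single [c \<odot>\<^bsub>L\<^esub> x] 1 - Poly_Mapping.single [x] c | c x. x \<in> carrier L}
   \<union> {Poly_Mapping.single [x, y] 1 - Poly_Mapping.single [y, x] 1 - Poly_Mapping.single [brack L x y] 1
        | x y. x \<in> carrier L \<and> y \<in> carrier L}"

definition uea :: "('x, 'm) lie_scheme \<Rightarrow> (complex, ('x list \<Rightarrow>\<^sub>0 complex) set) module" where
  "uea L = vquot (free_alg (carrier L)) (genideal (free_alg (carrier L)) (uea_rels L))"

definition uea_incl :: "('x, 'm) lie_scheme \<Rightarrow> 'x \<Rightarrow> ('x list \<Rightarrow>\<^sub>0 complex) set" where
  "uea_incl L x = genideal (free_alg (carrier L)) (uea_rels L)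
     +>\<^bsub>free_alg (carrier L)\<^esub> Poly_Mapping.single [x] 1"

text \<open>
  The homomorphism from an enveloping algebra to the associative algebra \<open>E\<close> that extends the
  Lie homomorphism \<open>\<phi>\<close>.
\<close>

definition uea_ext ::
  "(complex, 'e, 'm) module_scheme \<Rightarrow> ('x \<Rightarrow> 'e) \<Rightarrow> ('x list \<Rightarrow>\<^sub>0 complex) set \<Rightarrow> 'e" where
  "uea_ext E \<phi> = lin_ext E (\<lambda>w. foldr (\<lambda>x r. \<phi> x \<otimes>\<^bsub>E\<^esub> r) w \<one>\<^bsub>E\<^esub>)"


section \<open>Kac-Moody algebras\<close>

record ('g, 'n) km = "'g lie" +
  cartan :: "'g set"
  sroot :: "'n \<Rightarrow> 'g \<Rightarrow> complex"
  coroot :: "'n \<Rightarrow> 'g"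
  chev_e :: "'n \<Rightarrow> 'g"
  chev_f :: "'n \<Rightarrow> 'g"

definition gcm :: "int^'n^'n \<Rightarrow> bool" where
  "gcm C \<longleftrightarrow> (\<forall>i. C $ i $ i = 2) \<and> (\<forall>i j. i \<noteq> j \<longrightarrow> C $ i $ j \<le> 0) \<and>
     (\<forall>i j. C $ i $ j = 0 \<longrightarrow> C $ j $ i = 0)"

text \<open>
  The Kac-Moody algebra of the generalised Cartan matrix \<open>C\<close> in the sense of Kac: \<open>cartan\<close>,
  \<open>sroot\<close>, \<open>coroot\<close> form a minimal realisation of \<open>C\<close>, and the algebra is the quotient of the
  Lie algebra generated by \<open>cartan\<close> and the Chevalley generators with the relations below by its
  largest ideal that meets \<open>cartan\<close> trivially. Up to isomorphism, that quotient is the Lie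
  algebra which satisfies the relations, is generated by these elements, contains \<open>cartan\<close>, and
  has no nonzero ideal meeting \<open>cartan\<close> trivially.
\<close>

locale kac_moody = lie_algebra G
  for C :: "int^'n^'n" and G :: "('g, 'n::finite) km" (structure) +
  assumes gcm: "gcm C"
    and cartan_sub: "submodule (cartan G) cplx G"
    and cartan_dim: "\<exists>B. finite_basis (G\<lparr>carrier := cartan G\<rparr>) B \<and>
      card B + rank (\<chi> i j. complex_of_int (C $ i $ j)) = 2 * CARD('n)"
    and sroot_linear: "lin_form G (cartan G) (sroot G i)"
    and sroot_indep: "(\<forall>h\<in>cartan G. (\<Sum>i\<in>UNIV. c i * sroot G i h) = 0) \<Longrightarrow> c i = 0"
    and coroot_cartan: "coroot G i \<in> cartan G"
    and coroot_indep: "lin_indep G UNIV (coroot G)"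
    and sroot_coroot: "sroot G j (coroot G i) = of_int (C $ i $ j)"
    and chev_carrier: "chev_e G i \<in> carrier G" "chev_f G i \<in> carrier G"
    and brack_cartan: "\<lbrakk>h \<in> cartan G; h' \<in> cartan G\<rbrakk> \<Longrightarrow> brack G h h' = \<zero>"
    and brack_cartan_e: "h \<in> cartan G \<Longrightarrow> brack G h (chev_e G i) = sroot G i h \<odot> chev_e G i"
    and brack_cartan_f: "h \<in> cartan G \<Longrightarrow> brack G h (chev_f G i) = (- sroot G i h) \<odot> chev_f G i"
    and brack_e_f: "brack G (chev_e G i) (chev_f G j) = (if i = j then coroot G i else \<zero>)"
    and generated: "\<lbrakk>lie_subalgebra G S; cartan G \<subseteq> S;
        \<And>i. chev_e G i \<in> S; \<And>i. chev_f G i \<in> S\<rbrakk> \<Longrightarrow> S = carrier G"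
    and no_ideal: "\<lbrakk>lie_ideal G S; S \<inter> cartan G = {\<zero>}\<rbrakk> \<Longrightarrow> S = {\<zero>}"

text \<open>
  As the simple roots are linearly independent, the elements of the root lattice with nonnegative
  coefficients are represented by their coefficient vectors \<open>m\<close>.
\<close>

definition root_of :: "('g, 'n::finite) km \<Rightarrow> ('n \<Rightarrow> nat) \<Rightarrow> 'g \<Rightarrow> complex" where
  "root_of G m h = (\<Sum>i\<in>UNIV. of_nat (m i) * sroot G i h)"

definition root_space :: "('g, 'n) km \<Rightarrow> ('g \<Rightarrow> complex) \<Rightarrow> 'g set" where
  "root_space G \<beta> = {x \<in> carrier G. \<forall>h\<in>cartan G. brack G h x = \<beta> h \<odot>\<^bsub>G\<^esub> x}"

definition pos_roots :: "('g, 'n::finite) km \<Rightarrow> ('n \<Rightarrow> nat) set" where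
  "pos_roots G = {m. m \<noteq> (\<lambda>_. 0) \<and> root_space G (root_of G m) \<noteq> {\<zero>\<^bsub>G\<^esub>}}"

definition nil_plus :: "('g, 'n::finite) km \<Rightarrow> 'g set" where
  "nil_plus G = vspan G (\<Union>m\<in>pos_roots G. root_space G (root_of G m))"

definition cartan' :: "('g, 'n) km \<Rightarrow> 'g set" where
  "cartan' G = derived G \<inter> cartan G"

definition cartan_complement :: "('g, 'n) km \<Rightarrow> 'g set \<Rightarrow> bool" where
  "cartan_complement G H2 \<longleftrightarrow> submodule H2 cplx G \<and> H2 \<subseteq> cartan G \<and>
     cartan' G \<inter> H2 = {\<zero>\<^bsub>G\<^esub>} \<and> cartan' G <+>\<^bsub>G\<^esub> H2 = cartan G"

definition dominant :: "('g, 'n) km \<Rightarrow> ('g \<Rightarrow> complex) \<Rightarrow> bool" where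
  "dominant G lam \<longleftrightarrow> lin_form G (cartan G) lam \<and> (\<forall>i. lam (coroot G i) \<in> \<nat>)"

definition N_wt :: "('g, 'n::finite) km \<Rightarrow> ('g \<Rightarrow> complex) \<Rightarrow> ('n \<Rightarrow> nat) \<Rightarrow> nat" where
  "N_wt G lam m = (THE N. of_nat N = (\<Sum>i\<in>UNIV. of_nat (m i) * lam (coroot G i)))"


section \<open>The coefficient algebra\<close>

definition fg_comm_algebra :: "(complex, 'a) module \<Rightarrow> bool" where
  "fg_comm_algebra A \<longleftrightarrow> Module.algebra cplx A \<and>
     (\<exists>S. finite S \<and> S \<subseteq> carrier A \<and>
        (\<forall>B. subring B A \<and> submodule B cplx A \<and> S \<subseteq> B \<longrightarrow> B = carrier A))"

definition cofinite_ideal :: "(complex, 'a) module \<Rightarrow> 'a set \<Rightarrow> bool" where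
  "cofinite_ideal A I \<longleftrightarrow> ideal I A \<and> fin_dim (vquot A I)"

primrec ideal_power :: "(complex, 'a) module \<Rightarrow> 'a set \<Rightarrow> nat \<Rightarrow> 'a set" where
  "ideal_power A I 0 = carrier A"
| "ideal_power A I (Suc n) = ideal_prod A I (ideal_power A I n)"


section \<open>The algebra \<open>g' \<otimes> A \<oplus> h''\<close>\<close>

type_synonym ('g, 'a) cur = "(('g \<times> 'a) \<Rightarrow>\<^sub>0 complex) set \<times> 'g"

text \<open>
  Throughout, \<open>H2\<close> is the chosen complement of \<open>cartan' G\<close> in \<open>cartan G\<close>.
\<close>

definition current :: "('g, 'n) km \<Rightarrow> (complex, 'a) module \<Rightarrow> 'g set \<Rightarrow> ('g, 'a) cur lie" where
  "current G A H2 =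
    (let G' = G\<lparr>carrier := derived G\<rparr>;
         T = tensor G' A;
         tt = (\<lambda>s t. lin_ext T (\<lambda>(X, a). lin_ext T (\<lambda>(Y, b).
                 tensor_pure G' A (brack G X Y) (a \<otimes>\<^bsub>A\<^esub> b)) t) s);
         ht = (\<lambda>h t. lin_ext T (\<lambda>(X, a). tensor_pure G' A (brack G h X) a) t)
     in \<lparr>carrier = carrier T \<times> H2, mult = undefined, one = undefined,
         zero = (\<zero>\<^bsub>T\<^esub>, \<zero>\<^bsub>G\<^esub>),
         add = (\<lambda>(s, h) (t, k). (s \<oplus>\<^bsub>T\<^esub> t, h \<oplus>\<^bsub>G\<^esub> k)),
         smult = (\<lambda>c (t, h). (c \<odot>\<^bsub>T\<^esub> t, c \<odot>\<^bsub>G\<^esub> h)),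
         brack = (\<lambda>(s, h) (t, k). ((tt s t \<oplus>\<^bsub>T\<^esub> ht h t) \<ominus>\<^bsub>T\<^esub> ht k s, \<zero>\<^bsub>G\<^esub>))\<rparr>)"

definition cur_tensor ::
  "('g, 'n) km \<Rightarrow> (complex, 'a) module \<Rightarrow> 'g \<Rightarrow> 'a \<Rightarrow> ('g, 'a) cur" where
  "cur_tensor G A X a = (tensor_pure (G\<lparr>carrier := derived G\<rparr>) A X a, \<zero>\<^bsub>G\<^esub>)"

definition cur_h :: "('g, 'n) km \<Rightarrow> (complex, 'a) module \<Rightarrow> 'g \<Rightarrow> ('g, 'a) cur" where
  "cur_h G A h = (\<zero>\<^bsub>tensor (G\<lparr>carrier := derived G\<rparr>) A\<^esub>, h)"

text \<open>
  The identification of \<open>G\<close> with \<open>g' \<otimes> 1 \<oplus> h''\<close>, using \<open>g = g' \<oplus> h''\<close>.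
\<close>

definition cur_emb ::
  "('g, 'n) km \<Rightarrow> (complex, 'a) module \<Rightarrow> 'g set \<Rightarrow> 'g \<Rightarrow> ('g, 'a) cur" where
  "cur_emb G A H2 x = (THE y. \<exists>X\<in>derived G. \<exists>h\<in>H2. x = X \<oplus>\<^bsub>G\<^esub> h \<and>
     y = cur_tensor G A X \<one>\<^bsub>A\<^esub> \<oplus>\<^bsub>current G A H2\<^esub> cur_h G A h)"

definition cur_sub ::
  "('g, 'n) km \<Rightarrow> (complex, 'a) module \<Rightarrow> 'g set \<Rightarrow> 'g set \<Rightarrow> 'a set \<Rightarrow> ('g, 'a) cur set" where
  "cur_sub G A H2 S B = vspan (current G A H2) {cur_tensor G A X a | X a. X \<in> S \<and> a \<in> B}"

definition cur_cartan ::
  "('g, 'n) km \<Rightarrow> (complex, 'a) module \<Rightarrow> 'g set \<Rightarrow> ('g, 'a) cur set" where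
  "cur_cartan G A H2 =
     cur_sub G A H2 (cartan' G) (carrier A) <+>\<^bsub>current G A H2\<^esub> cur_h G A ` H2"

definition cur_plus ::
  "('g, 'n::finite) km \<Rightarrow> (complex, 'a) module \<Rightarrow> 'g set \<Rightarrow> ('g, 'a) cur set" where
  "cur_plus G A H2 = cur_sub G A H2 (nil_plus G) (carrier A)"

definition cur_weight ::
  "('g, 'n) km \<Rightarrow> (complex, 'a) module \<Rightarrow> 'g set \<Rightarrow> (('g, 'a) cur \<Rightarrow> complex) \<Rightarrow> 'g \<Rightarrow> complex" where
  "cur_weight G A H2 \<psi> h = \<psi> (cur_emb G A H2 h)"


section \<open>Verma modules and Weyl modules\<close>

definition borel ::
  "('g, 'n::finite) km \<Rightarrow> (complex, 'a) module \<Rightarrow> 'g set \<Rightarrow> ('g, 'a) cur lie" where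
  "borel G A H2 = (current G A H2)
     \<lparr>carrier := cur_plus G A H2 <+>\<^bsub>current G A H2\<^esub> cur_cartan G A H2\<rparr>"

definition borel_char ::
  "('g, 'n::finite) km \<Rightarrow> (complex, 'a) module \<Rightarrow> 'g set \<Rightarrow> (('g, 'a) cur \<Rightarrow> complex)
     \<Rightarrow> ('g, 'a) cur \<Rightarrow> complex" where
  "borel_char G A H2 \<psi> b = (THE z. \<exists>n\<in>cur_plus G A H2. \<exists>h\<in>cur_cartan G A H2.
     b = n \<oplus>\<^bsub>current G A H2\<^esub> h \<and> z = \<psi> h)"

text \<open>
  \<open>U(g~) \<otimes> \<complex>\<close> over \<open>U(b)\<close>, where \<open>b\<close> is \<open>borel\<close>: the right action on \<open>U(g~)\<close> is
  multiplication through the map \<open>U(b) \<rightarrow> U(g~)\<close> induced by the inclusion.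
\<close>

definition verma_right ::
  "('g, 'n::finite) km \<Rightarrow> (complex, 'a) module \<Rightarrow> 'g set
     \<Rightarrow> (('g, 'a) cur list \<Rightarrow>\<^sub>0 complex) set \<Rightarrow> (('g, 'a) cur list \<Rightarrow>\<^sub>0 complex) set
     \<Rightarrow> (('g, 'a) cur list \<Rightarrow>\<^sub>0 complex) set" where
  "verma_right G A H2 u r = (let L = current G A H2 in
     u \<otimes>\<^bsub>uea L\<^esub> uea_ext (uea L) (uea_incl L) r)"

definition verma_left ::
  "('g, 'n::finite) km \<Rightarrow> (complex, 'a) module \<Rightarrow> 'g set \<Rightarrow> (('g, 'a) cur \<Rightarrow> complex)
     \<Rightarrow> (('g, 'a) cur list \<Rightarrow>\<^sub>0 complex) set \<Rightarrow> complex \<Rightarrow> complex" where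
  "verma_left G A H2 \<psi> r z = uea_ext cplx (borel_char G A H2 \<psi>) r * z"

type_synonym ('g, 'a) verma_elt =
  "(((('g, 'a) cur list \<Rightarrow>\<^sub>0 complex) set \<times> complex) \<Rightarrow>\<^sub>0 complex) set"

definition verma_pure ::
  "('g, 'n::finite) km \<Rightarrow> (complex, 'a) module \<Rightarrow> 'g set \<Rightarrow> (('g, 'a) cur \<Rightarrow> complex)
     \<Rightarrow> (('g, 'a) cur list \<Rightarrow>\<^sub>0 complex) set \<Rightarrow> complex \<Rightarrow> ('g, 'a) verma_elt" where
  "verma_pure G A H2 \<psi> = tensor_over_pure (carrier (uea (borel G A H2)))
     (uea (current G A H2)) (verma_right G A H2) cplx (verma_left G A H2 \<psi>)"

definition verma ::
  "('g, 'n::finite) km \<Rightarrow> (complex, 'a) module \<Rightarrow> 'g set \<Rightarrow> (('g, 'a) cur \<Rightarrow> complex)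
     \<Rightarrow> (('g, 'a) cur, ('g, 'a) verma_elt) lmod" where
  "verma G A H2 \<psi> =
    (let L = current G A H2;
         T = tensor_over (carrier (uea (borel G A H2)))
               (uea L) (verma_right G A H2) cplx (verma_left G A H2 \<psi>)
     in module.extend T (lmod.fields (\<lambda>x.
          lin_ext T (\<lambda>(u, z). verma_pure G A H2 \<psi> (uea_incl L x \<otimes>\<^bsub>uea L\<^esub> u) z))))"

definition verma_hw ::
  "('g, 'n::finite) km \<Rightarrow> (complex, 'a) module \<Rightarrow> 'g set \<Rightarrow> (('g, 'a) cur \<Rightarrow> complex)
     \<Rightarrow> ('g, 'a) verma_elt" where
  "verma_hw G A H2 \<psi> = verma_pure G A H2 \<psi> \<one>\<^bsub>uea (current G A H2)\<^esub> 1"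

definition M_mod ::
  "('g, 'n::finite) km \<Rightarrow> (complex, 'a) module \<Rightarrow> 'g set \<Rightarrow> (('g, 'a) cur \<Rightarrow> complex) \<Rightarrow> 'a set
     \<Rightarrow> (('g, 'a) cur, ('g, 'a) verma_elt set) lmod" where
  "M_mod G A H2 \<psi> I = lmod_quot (verma G A H2 \<psi>)
     (gen_submodule (current G A H2) (verma G A H2 \<psi>)
       {act (verma G A H2 \<psi>) (cur_tensor G A X a) (verma_hw G A H2 \<psi>) | m X a.
          m \<in> pos_roots G \<and> X \<in> root_space G (\<lambda>h. - root_of G m h) \<and>
          a \<in> ideal_power A I (N_wt G (cur_weight G A H2 \<psi>) m)})"

definition diagonalizable ::
  "('g, 'n) km \<Rightarrow> (complex, 'a) module \<Rightarrow> 'g set \<Rightarrow> (('g, 'a) cur, 'v, 'k) lmod_scheme \<Rightarrow> bool" where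
  "diagonalizable G A H2 V \<longleftrightarrow>
     vspan V {v \<in> carrier V. \<exists>\<mu>. \<forall>h\<in>cartan G. act V (cur_emb G A H2 h) v = \<mu> h \<odot>\<^bsub>V\<^esub> v} = carrier V"

definition locally_nilpotent :: "('x, 'v, 'k) lmod_scheme \<Rightarrow> 'x \<Rightarrow> bool" where
  "locally_nilpotent V x \<longleftrightarrow> (\<forall>v\<in>carrier V. \<exists>n. (act V x ^^ n) v = \<zero>\<^bsub>V\<^esub>)"

definition integrable ::
  "('g, 'n) km \<Rightarrow> (complex, 'a) module \<Rightarrow> 'g set \<Rightarrow> (('g, 'a) cur, 'v, 'k) lmod_scheme \<Rightarrow> bool" where
  "integrable G A H2 V \<longleftrightarrow> diagonalizable G A H2 V \<and>
     (\<forall>i. locally_nilpotent V (cur_emb G A H2 (chev_e G i)) \<and>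
          locally_nilpotent V (cur_emb G A H2 (chev_f G i)))"

text \<open>
  The kernel of the projection to the maximal integrable quotient: a quotient of \<open>M\<close> by \<open>N'\<close> is a
  quotient of the one by \<open>N\<close> iff \<open>N \<subseteq> N'\<close>.
\<close>

definition is_max_integrable_kernel ::
  "('g, 'n) km \<Rightarrow> (complex, 'a) module \<Rightarrow> 'g set \<Rightarrow> (('g, 'a) cur, 'v, 'k) lmod_scheme
     \<Rightarrow> 'v set \<Rightarrow> bool" where
  "is_max_integrable_kernel G A H2 M N \<longleftrightarrow>
     lie_submodule (current G A H2) M N \<and> integrable G A H2 (lmod_quot M N) \<and>
     (\<forall>N'. lie_submodule (current G A H2) M N' \<and> integrable G A H2 (lmod_quot M N') \<longrightarrow> N \<subseteq> N')"

definition weyl ::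
  "('g, 'n::finite) km \<Rightarrow> (complex, 'a) module \<Rightarrow> 'g set \<Rightarrow> (('g, 'a) cur \<Rightarrow> complex) \<Rightarrow> 'a set
     \<Rightarrow> (('g, 'a) cur, ('g, 'a) verma_elt set set) lmod" where
  "weyl G A H2 \<psi> I = lmod_quot (M_mod G A H2 \<psi> I)
     (THE N. is_max_integrable_kernel G A H2 (M_mod G A H2 \<psi> I) N)"

end

theory Submission imports Defs begin

text \<open>
  The Weyl module \<open>W(\<psi>, I)\<close> is the universal highest weight module of weight \<open>\<psi>\<close> on whose generator \<open>v\<close>
  the lowering operators \<open>f\<^sub>i\<close> are nilpotent. Indeed the relations \<open>(X \<otimes> I\<^sup>N) v = 0\<close> are automatic:
  applying elements \<open>e\<^sub>i \<otimes> a\<close> with \<open>a \<in> I\<close> repeatedly to \<open>f\<^sub>i\<^sup>n\<^sup>+\<^sup>1 v = 0\<close> gives \<open>(f\<^sub>i \<otimes> I\<^sup>n) v = 0\<close> (Garland),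
  and negative root vectors are iterated brackets of the \<open>f\<^sub>i\<close>. So \<open>V = W(\<psi>, I)\<close> maps to the tensor product
  of the \<open>W(\<psi>\<^sub>i, m\<^sub>i)\<close>. This map is onto: if \<open>e \<equiv> 1\<close> modulo \<open>m\<^sub>i\<^sup>N\<close> and \<open>e \<equiv> 0\<close> modulo the other \<open>m\<^sub>j\<^sup>N\<close>,
  then \<open>X \<otimes> e\<close> moves only the \<open>i\<close>-th factor of a given pure tensor once \<open>N\<close> is large.

  For the inverse, the same elements split the action of \<open>g' \<otimes> A\<close> on \<open>V\<close> into commuting actions \<open>\<rho>\<^sub>i\<close>. With a
  scalar correction on \<open>h''\<close> the action \<open>\<rho>\<^sub>i\<close> turns \<open>V\<close> into a module in which \<open>v\<close> has highest weight \<open>\<psi>\<^sub>i\<close>,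
  so \<open>W(\<psi>\<^sub>i, m\<^sub>i)\<close> maps to \<open>V\<close>. Because the \<open>\<rho>\<^sub>i\<close> commute, these maps can be applied one factor after the
  other; the result is a multilinear map, hence a linear left inverse.
\<close>

section \<open>Vector spaces and linear forms\<close>

text \<open>How large \<open>N\<close> must be for \<open>X \<otimes> I^N\<close> to kill a vector
  depends on \<open>X\<close> and on the vector. The elements \<open>ee i N\<close> therefore act as
  orthogonal idempotents with sum 1 only for large \<open>N\<close>, one vector at a time, and
  \<open>rho i\<close> is defined by an eventual value.

  The summand \<open>h''\<close> carries no factor \<open>A\<close> and cannot be split in this way.
  Each \<open>rho i\<close> lives on \<open>g' \<otimes> A\<close>; in the copy \<open>Vt i\<close>
  the space \<open>h''\<close> acts as on \<open>V\<close> up to a scalar. This suffices because a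
  highest weight module is generated from its highest weight vector by \<open>g' \<otimes> A\<close>
  alone (\<open>j0_generated\<close>), so the left inverse only has to commute with that part.

  Two facts come from sl2. The exponent with which a Chevalley generator \<open>f\<close> kills
  \<open>v\<close> is at most the value of the weight at the coroot plus one, uniformly over all
  integrable quotients; hence a largest integrable quotient exists. And \<open>f\<close> stays
  nilpotent on \<open>v\<close> under \<open>rho i\<close>, because the eigenvalues of the coroot
  under \<open>rho i\<close> separate the terms of the expanded power of \<open>f\<close>.\<close>

abbreviation "single \<equiv> Poly_Mapping.single"
abbreviation "keys \<equiv> Poly_Mapping.keys"

lemma cplx_simps [simp]:
  "carrier cplx = UNIV" "mult cplx = (*)" "one cplx = 1" "zero cplx = 0" "add cplx = (+)" "smult cplx = (*)"
  by (simp_all add: cplx_def)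

lemma cring_cplx: "cring cplx"
proof (rule cringI)
  show "abelian_group cplx"
    by (rule abelian_groupI) (auto simp: add.assoc add.commute intro: exI[of _ "- _"])
  show "Group.comm_monoid cplx" by (rule comm_monoidI) (auto simp: ac_simps)
qed (auto simp: algebra_simps)

text \<open>The module axioms over \<open>cplx\<close> with its ring operations replaced by complex
  arithmetic, so that simplification works with numbers instead of record fields.\<close>

locale vspace = abelian_group V for V :: "(complex, 'v, 'm) module_scheme" (structure) +
  assumes sm_closed [simp, intro]: "x \<in> carrier V \<Longrightarrow> c \<odot> x \<in> carrier V"
    and sm_add_l: "x \<in> carrier V \<Longrightarrow> (c + d) \<odot> x = c \<odot> x \<oplus> d \<odot> x"
    and sm_add_r: "\<lbrakk>x \<in> carrier V; y \<in> carrier V\<rbrakk> \<Longrightarrow> c \<odot> (x \<oplus> y) = c \<odot> x \<oplus> c \<odot> y"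
    and sm_assoc: "x \<in> carrier V \<Longrightarrow> c \<odot> (d \<odot> x) = (c * d) \<odot> x"
    and sm_one [simp]: "x \<in> carrier V \<Longrightarrow> 1 \<odot> x = x"

lemma module_iff_vspace: "Module.module cplx V \<longleftrightarrow> vspace V"
proof
  assume "Module.module cplx V"
  then interpret M: Module.module cplx V .
  show "vspace V"
    using M.smult_closed M.smult_l_distr M.smult_r_distr M.smult_assoc1 M.smult_one
    by unfold_locales auto
next
  assume "vspace V"
  then interpret vspace V .
  show "Module.module cplx V"
    by (rule moduleI) (auto simp: cring_cplx abelian_group_axioms sm_add_l sm_add_r sm_assoc)
qed

lemma vspace_cplx: "vspace cplx"
proof -
  interpret cring cplx by (rule cring_cplx)
  show ?thesis by unfold_locales (auto simp: algebra_simps)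
qed

abbreviation lf :: "(complex, 'v, 'm) module_scheme \<Rightarrow> ('v \<Rightarrow> complex) \<Rightarrow> bool" where
  "lf V \<equiv> lin_form V (carrier V)"

definition subsp :: "(complex, 'v, 'm) module_scheme \<Rightarrow> 'v set \<Rightarrow> bool" where
  "subsp V N \<longleftrightarrow> N \<subseteq> carrier V \<and> \<zero>\<^bsub>V\<^esub> \<in> N \<and> (\<forall>x\<in>N. \<forall>y\<in>N. x \<oplus>\<^bsub>V\<^esub> y \<in> N) \<and> (\<forall>c. \<forall>x\<in>N. c \<odot>\<^bsub>V\<^esub> x \<in> N)"

definition lin_map :: "(complex, 'v, 'm) module_scheme \<Rightarrow> (complex, 'w, 'k) module_scheme \<Rightarrow> ('v \<Rightarrow> 'w) \<Rightarrow> bool" where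
  "lin_map V W f \<longleftrightarrow> (\<forall>x\<in>carrier V. f x \<in> carrier W) \<and>
     (\<forall>x\<in>carrier V. \<forall>y\<in>carrier V. f (x \<oplus>\<^bsub>V\<^esub> y) = f x \<oplus>\<^bsub>W\<^esub> f y) \<and>
     (\<forall>c. \<forall>x\<in>carrier V. f (c \<odot>\<^bsub>V\<^esub> x) = c \<odot>\<^bsub>W\<^esub> f x)"

lemma subspD:
  assumes "subsp V N"
  shows "x \<in> N \<Longrightarrow> x \<in> carrier V" "\<zero>\<^bsub>V\<^esub> \<in> N" "\<lbrakk>x \<in> N; y \<in> N\<rbrakk> \<Longrightarrow> x \<oplus>\<^bsub>V\<^esub> y \<in> N" "x \<in> N \<Longrightarrow> c \<odot>\<^bsub>V\<^esub> x \<in> N"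
  using assms by (auto simp: subsp_def)

lemma lin_mapD:
  assumes "lin_map V W f"
  shows "x \<in> carrier V \<Longrightarrow> f x \<in> carrier W"
    "\<lbrakk>x \<in> carrier V; y \<in> carrier V\<rbrakk> \<Longrightarrow> f (x \<oplus>\<^bsub>V\<^esub> y) = f x \<oplus>\<^bsub>W\<^esub> f y"
    "x \<in> carrier V \<Longrightarrow> f (c \<odot>\<^bsub>V\<^esub> x) = c \<odot>\<^bsub>W\<^esub> f x"
  using assms by (auto simp: lin_map_def)

lemma lin_mapI:
  assumes "\<And>x. x \<in> carrier V \<Longrightarrow> f x \<in> carrier W"
    "\<And>x y. \<lbrakk>x \<in> carrier V; y \<in> carrier V\<rbrakk> \<Longrightarrow> f (x \<oplus>\<^bsub>V\<^esub> y) = f x \<oplus>\<^bsub>W\<^esub> f y"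
    "\<And>c x. x \<in> carrier V \<Longrightarrow> f (c \<odot>\<^bsub>V\<^esub> x) = c \<odot>\<^bsub>W\<^esub> f x"
  shows "lin_map V W f"
  using assms by (auto simp: lin_map_def)

lemma lin_map_comp: "lin_map U V f \<Longrightarrow> lin_map V W g \<Longrightarrow> lin_map U W (\<lambda>x. g (f x))"
  by (simp add: lin_map_def)

lemma lf_comp: "lin_map V W f \<Longrightarrow> lf W \<phi> \<Longrightarrow> lf V (\<lambda>x. \<phi> (f x))"
  by (auto simp: lin_map_def lin_form_def)

lemma lin_formD:
  assumes "lin_form V S \<phi>"
  shows "\<lbrakk>x \<in> S; y \<in> S\<rbrakk> \<Longrightarrow> \<phi> (x \<oplus>\<^bsub>V\<^esub> y) = \<phi> x + \<phi> y" "x \<in> S \<Longrightarrow> \<phi> (c \<odot>\<^bsub>V\<^esub> x) = c * \<phi> x"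
  using assms by (auto simp: lin_form_def)

context vspace
begin

lemma sm_zero_l [simp]: assumes "x \<in> carrier V" shows "0 \<odot> x = \<zero>"
proof -
  have "0 \<odot> x \<oplus> 0 \<odot> x = 0 \<odot> x" using sm_add_l[OF assms, of 0 0] by simp
  then show ?thesis using assms by (metis add.r_cancel_one' sm_closed)
qed

lemma sm_zero_r [simp]: "c \<odot> \<zero> = \<zero>"
proof -
  have "c \<odot> \<zero> \<oplus> c \<odot> \<zero> = c \<odot> \<zero>" using sm_add_r[of \<zero> \<zero> c] by simp
  then show ?thesis by (metis add.r_cancel_one' sm_closed zero_closed)
qed

lemma neg_eq: assumes "x \<in> carrier V" shows "\<ominus> x = (-1) \<odot> x"
proof -
  have "(-1) \<odot> x \<oplus> x = \<zero>" using sm_add_l[OF assms, of "-1" 1] assms by simp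
  then show ?thesis using assms by (metis minus_equality sm_closed)
qed

lemma minus_eq': "\<lbrakk>x \<in> carrier V; y \<in> carrier V\<rbrakk> \<Longrightarrow> x \<ominus> y = x \<oplus> (-1) \<odot> y"
  by (simp add: a_minus_def neg_eq)

lemma lf_add: "\<lbrakk>lf V \<phi>; x \<in> carrier V; y \<in> carrier V\<rbrakk> \<Longrightarrow> \<phi> (x \<oplus> y) = \<phi> x + \<phi> y"
  by (simp add: lin_form_def)
lemma lf_smult: "\<lbrakk>lf V \<phi>; x \<in> carrier V\<rbrakk> \<Longrightarrow> \<phi> (c \<odot> x) = c * \<phi> x"
  by (simp add: lin_form_def)
lemma lf_zero: "lf V \<phi> \<Longrightarrow> \<phi> \<zero> = 0"
  using lf_smult[of \<phi> \<zero> 0] by simp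
lemma lf_neg: "\<lbrakk>lf V \<phi>; x \<in> carrier V\<rbrakk> \<Longrightarrow> \<phi> (\<ominus> x) = - \<phi> x"
  by (simp add: neg_eq lf_smult)
lemma lf_minus: "\<lbrakk>lf V \<phi>; x \<in> carrier V; y \<in> carrier V\<rbrakk> \<Longrightarrow> \<phi> (x \<ominus> y) = \<phi> x - \<phi> y"
  by (simp add: a_minus_def lf_add lf_neg)
lemma lf_finsum: assumes \<phi>: "lf V \<phi>" and f: "\<And>i. i \<in> A \<Longrightarrow> f i \<in> carrier V"
  shows "\<phi> (\<Oplus>i\<in>A. f i) = (\<Sum>i\<in>A. \<phi> (f i))"
proof (cases "finite A")
  case True
  then show ?thesis using f
    by (induct A rule: finite_induct) (auto simp: lf_zero[OF \<phi>] lf_add[OF \<phi>] Pi_def)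
qed (simp add: finsum_infinite lf_zero \<phi>)

lemmas lf_simps = lf_add lf_smult lf_zero lf_neg lf_minus lf_finsum

lemma subsp_carrier: "subsp V (carrier V)" by (simp add: subsp_def)
lemma subsp_zero: "subsp V {\<zero>}" by (simp add: subsp_def)

lemma subsp_minus: assumes "subsp V N" "x \<in> N" "y \<in> N" shows "x \<ominus> y \<in> N" "\<ominus> y \<in> N"
  using assms by (simp_all add: minus_eq' neg_eq subspD)

lemma subsp_finsum:
  assumes N: "subsp V N" and f: "\<And>i. i \<in> A \<Longrightarrow> f i \<in> N"
  shows "(\<Oplus>i\<in>A. f i) \<in> N"
proof (cases "finite A")
  case True
  then show ?thesis using f
    by (induct A rule: finite_induct) (auto simp: subspD[OF N] Pi_def)
qed (simp add: finsum_infinite subspD[OF N])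

lemma submodule_iff: "submodule N cplx V \<longleftrightarrow> subsp V N"
proof
  assume S: "submodule N cplx V"
  have M: "Module.module cplx V" by (simp add: module_iff_vspace vspace_axioms)
  note E = module.submoduleE[OF M S]
  then have "\<zero> \<in> N" using sm_zero_l by (metis UNIV_I cplx_simps(1) equals0I subsetD)
  then show "subsp V N" using E by (auto simp: subsp_def)
next
  assume S: "subsp V N"
  have M: "Module.module cplx V" by (simp add: module_iff_vspace vspace_axioms)
  show "submodule N cplx V"
    by (rule module.submoduleI[OF M]) (use S subsp_minus[OF S] in \<open>auto simp: subsp_def\<close>)
qed

lemma subsp_vspan:
  assumes "S \<subseteq> carrier V" shows "subsp V (vspan V S)"
proof -
  have "vspan V S \<subseteq> carrier V" unfolding vspan_def submodule_iff using assms subsp_carrier by blast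
  then show ?thesis unfolding subsp_def vspan_def submodule_iff by auto
qed

lemma vspan_superset: "S \<subseteq> vspan V S" by (auto simp: vspan_def)

lemma vspan_least: "\<lbrakk>subsp V N; S \<subseteq> N\<rbrakk> \<Longrightarrow> vspan V S \<subseteq> N"
  by (auto simp: vspan_def submodule_iff)

lemma vspan_induct [consumes 2, case_names base zero add smult]:
  assumes "y \<in> vspan V S" "S \<subseteq> carrier V"
    "\<And>x. x \<in> S \<Longrightarrow> P x" "P \<zero>"
    "\<And>x y. \<lbrakk>x \<in> carrier V; y \<in> carrier V; P x; P y\<rbrakk> \<Longrightarrow> P (x \<oplus> y)"
    "\<And>c x. \<lbrakk>x \<in> carrier V; P x\<rbrakk> \<Longrightarrow> P (c \<odot> x)"
  shows "P y"
proof -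
  have "subsp V {x \<in> carrier V. P x}" using assms by (auto simp: subsp_def)
  then have "vspan V S \<subseteq> {x \<in> carrier V. P x}" using assms by (intro vspan_least) auto
  then show ?thesis using assms(1) by auto
qed

lemma vspan_subset_carrier: "S \<subseteq> carrier V \<Longrightarrow> vspan V S \<subseteq> carrier V"
  using subsp_vspan by (auto simp: subsp_def)

lemma vspan_mono: "S \<subseteq> S' \<Longrightarrow> S' \<subseteq> carrier V \<Longrightarrow> vspan V S \<subseteq> vspan V S'"
  by (meson order_trans subsp_vspan vspan_least vspan_superset)

text \<open>By Zorn there is a maximal subspace \<open>M\<close> that avoids \<open>x\<close>. Every
  vector is then congruent modulo \<open>M\<close> to a unique multiple of \<open>x\<close>, and the
  multiple is a linear form with value 1 at \<open>x\<close>.\<close>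

lemma lf_exists:
  assumes x: "x \<in> carrier V" "x \<noteq> \<zero>"
  shows "\<exists>\<phi>. lf V \<phi> \<and> \<phi> x \<noteq> 0"
proof -
  let ?A = "{N. subsp V N \<and> x \<notin> N}"
  have "\<exists>M\<in>?A. \<forall>X\<in>?A. M \<subseteq> X \<longrightarrow> X = M"
  proof (rule subset_Zorn_nonempty)
    show "?A \<noteq> {}" using x subsp_zero by auto
    fix C assume "C \<noteq> {}" and C: "subset.chain ?A C"
    then have sub: "\<And>N. N \<in> C \<Longrightarrow> subsp V N \<and> x \<notin> N" and tot: "\<And>M N. M \<in> C \<Longrightarrow> N \<in> C \<Longrightarrow> M \<subseteq> N \<or> N \<subseteq> M"
      by (auto simp: subset.chain_def)
    have "subsp V (\<Union>C)" unfolding subsp_def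
    proof (intro conjI ballI allI)
      show "\<Union>C \<subseteq> carrier V" using sub unfolding subsp_def by blast
      show "\<zero> \<in> \<Union>C" using \<open>C \<noteq> {}\<close> sub by (auto simp: subsp_def)
      fix y assume "y \<in> \<Union>C" then obtain M where M: "M \<in> C" "y \<in> M" by auto
      show "c \<odot> y \<in> \<Union>C" for c using M subspD(4)[of V M] sub[OF M(1)] by auto
      fix z assume "z \<in> \<Union>C" then obtain N where N: "N \<in> C" "z \<in> N" by auto
      show "y \<oplus> z \<in> \<Union>C" using tot[OF M(1) N(1)] M N subspD(3)[of V M] subspD(3)[of V N] sub[OF M(1)] sub[OF N(1)] by (meson UnionI in_mono)
    qed
    then show "\<Union>C \<in> ?A" using sub by auto
  qed
  then obtain M where M: "subsp V M" "x \<notin> M" and max: "\<And>X. subsp V X \<Longrightarrow> x \<notin> X \<Longrightarrow> M \<subseteq> X \<Longrightarrow> X = M"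
    by auto
  note MD = subspD[OF M(1)]
  \<comment> \<open>Maximality of \<open>M\<close>: if \<open>y\<close> were not congruent to a
    multiple of \<open>x\<close>, the larger subspace \<open>M + C y\<close> would contain
    \<open>x\<close>, and \<open>x = m + c y\<close> could be solved for \<open>y\<close>; here
    \<open>c \<noteq> 0\<close> since \<open>x\<close> is not in \<open>M\<close>.\<close>
  have ex: "\<exists>c. y \<ominus> c \<odot> x \<in> M" if y: "y \<in> carrier V" for y
  proof (rule ccontr)
    assume H: "\<not> ?thesis"
    let ?X = "{m \<oplus> c \<odot> y | m c. m \<in> M}"
    have "subsp V ?X" unfolding subsp_def
    proof (intro conjI ballI allI)
      show "?X \<subseteq> carrier V" using y MD(1) by auto
      show "\<zero> \<in> ?X" using MD(2) y by (auto intro!: exI[of _ \<zero>] exI[of _ 0])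
      fix z assume "z \<in> ?X" then obtain m c where z: "z = m \<oplus> c \<odot> y" "m \<in> M" by auto
      show "d \<odot> z \<in> ?X" for d using z y MD(1,4) by (auto simp: sm_add_r sm_assoc intro!: exI[of _ "d \<odot> m"])
      fix w assume "w \<in> ?X" then obtain m' c' where w: "w = m' \<oplus> c' \<odot> y" "m' \<in> M" by auto
      have "z \<oplus> w = (m \<oplus> m') \<oplus> (c + c') \<odot> y" using z w y MD(1) by (simp add: sm_add_l a_ac)
      then show "z \<oplus> w \<in> ?X" using z w MD(3) by blast
    qed
    moreover have "M \<subseteq> ?X"
    proof
      fix m assume m: "m \<in> M"
      then have "m = m \<oplus> 0 \<odot> y" using y MD(1) by simp
      then show "m \<in> ?X" using m by blast
    qed
    moreover have "y \<in> ?X"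
    proof -
      have "y = \<zero> \<oplus> 1 \<odot> y" using y by simp
      then show ?thesis using MD(2) by blast
    qed
    moreover have "y \<notin> M" using H y x by (auto intro!: exI[of _ 0] dest: spec[of _ 0] simp: minus_eq')
    ultimately have "x \<in> ?X" using max by blast
    then obtain m c where mc: "x = m \<oplus> c \<odot> y" "m \<in> M" by auto
    have "c \<noteq> 0" using mc M(2) y MD(1) by auto
    have "y \<ominus> (1/c) \<odot> x = (-1/c) \<odot> m \<oplus> (y \<oplus> (-1) \<odot> y)" using mc y MD(1) \<open>c \<noteq> 0\<close>
      by (simp add: minus_eq' sm_add_r sm_assoc a_ac)
    also have "y \<oplus> (-1) \<odot> y = \<zero>" using y by (metis neg_eq r_neg)
    finally have "y \<ominus> (1/c) \<odot> x \<in> M" using mc MD by simp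
    then show False using H by blast
  qed
  have un: "c = d" if y: "y \<in> carrier V" and c: "y \<ominus> c \<odot> x \<in> M" and d: "y \<ominus> d \<odot> x \<in> M" for y c d
  proof (rule ccontr)
    assume "c \<noteq> d"
    have "(y \<oplus> (-d) \<odot> x) \<oplus> (-1) \<odot> (y \<oplus> (-c) \<odot> x) = (y \<oplus> (-1) \<odot> y) \<oplus> (c - d) \<odot> x"
      using y x sm_add_l[of x c "-d"] by (simp add: sm_add_r sm_assoc a_ac)
    also have "\<dots> = (c - d) \<odot> x" using y x by (metis l_zero neg_eq r_neg sm_closed)
    finally have "(c - d) \<odot> x \<in> M" using c d y x MD by (metis minus_eq' mult_minus1 sm_assoc sm_closed)
    then have "(1/(c-d)) \<odot> ((c - d) \<odot> x) \<in> M" using MD by blast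
    then show False using \<open>c \<noteq> d\<close> M(2) x by (simp add: sm_assoc)
  qed
  define \<phi> where "\<phi> y = (THE c. y \<ominus> c \<odot> x \<in> M)" for y
  have ph: "\<phi> y = c" if "y \<in> carrier V" "y \<ominus> c \<odot> x \<in> M" for y c
    unfolding \<phi>_def using that un by blast
  have phM: "y \<ominus> \<phi> y \<odot> x \<in> M" if "y \<in> carrier V" for y
    using ex[OF that] ph[OF that] by auto
  have "lf V \<phi>" unfolding lin_form_def
  proof (intro conjI ballI allI)
    fix y z c assume y: "y \<in> carrier V"
    have "c \<odot> y \<ominus> (c * \<phi> y) \<odot> x = c \<odot> (y \<ominus> \<phi> y \<odot> x)" using y x by (simp add: minus_eq' sm_add_r sm_assoc mult.commute)
    then have "c \<odot> y \<ominus> (c * \<phi> y) \<odot> x \<in> M" using phM[OF y] MD by simp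
    then show "\<phi> (c \<odot> y) = c * \<phi> y" using ph y by simp
    assume z: "z \<in> carrier V"
    have "(y \<oplus> z) \<ominus> (\<phi> y + \<phi> z) \<odot> x = (y \<ominus> \<phi> y \<odot> x) \<oplus> (z \<ominus> \<phi> z \<odot> x)" using y z x
      by (simp add: minus_eq' sm_add_r sm_assoc sm_add_l a_ac)
    then have "(y \<oplus> z) \<ominus> (\<phi> y + \<phi> z) \<odot> x \<in> M" using phM[OF y] phM[OF z] MD by simp
    then show "\<phi> (y \<oplus> z) = \<phi> y + \<phi> z" using ph y z by simp
  qed
  moreover have "\<phi> x = 1" using ph[OF x(1), of 1] x MD(2) by (simp add: a_minus_def r_neg)
  ultimately show ?thesis by (intro exI[of _ \<phi>]) auto
qed

text \<open>Linear forms reduce identities between vectors to arithmetic with complex numbers.\<close>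

lemma vs_eqI:
  assumes "x \<in> carrier V" "y \<in> carrier V" "\<And>\<phi>. lf V \<phi> \<Longrightarrow> \<phi> x = \<phi> y"
  shows "x = y"
proof (rule ccontr)
  assume "x \<noteq> y"
  then have "x \<ominus> y \<noteq> \<zero>" using assms by (metis a_inv_closed a_minus_def minus_equality minus_minus)
  then show False using lf_exists[of "x \<ominus> y"] assms lf_minus by fastforce
qed

end

sublocale lie_algebra \<subseteq> LV: vspace L
  using module_axioms module_iff_vspace by blast

sublocale lie_module \<subseteq> VV: vspace V
  using V.module_axioms module_iff_vspace by blast

section \<open>Quotients\<close>

context vspace
begin

lemma coset_iff:
  assumes N: "subsp V N" and x: "x \<in> carrier V"
  shows "y \<in> N +> x \<longleftrightarrow> y \<in> carrier V \<and> y \<ominus> x \<in> N"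
proof
  assume "y \<in> N +> x"
  then obtain n where n: "n \<in> N" "y = n \<oplus> x" by (auto simp: a_r_coset_def')
  have nc: "n \<in> carrier V" using n subspD(1)[OF N] by blast
  have "y \<ominus> x = n" by (rule vs_eqI) (use nc x n in \<open>auto simp: lf_simps\<close>)
  then show "y \<in> carrier V \<and> y \<ominus> x \<in> N" using n nc x by auto
next
  assume y: "y \<in> carrier V \<and> y \<ominus> x \<in> N"
  have "y = (y \<ominus> x) \<oplus> x" by (rule vs_eqI) (use y x in \<open>auto simp: lf_simps\<close>)
  then show "y \<in> N +> x" using y by (auto simp: a_r_coset_def')
qed

lemma coset_self: "\<lbrakk>subsp V N; x \<in> carrier V\<rbrakk> \<Longrightarrow> x \<in> N +> x"
  by (auto simp: coset_iff a_minus_def r_neg subspD)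

lemma coset_eq_iff:
  assumes N: "subsp V N" and x: "x \<in> carrier V" and y: "y \<in> carrier V"
  shows "N +> x = N +> y \<longleftrightarrow> x \<ominus> y \<in> N"
proof
  assume "N +> x = N +> y"
  then show "x \<ominus> y \<in> N" using coset_self[OF N x] coset_iff[OF N y] by auto
next
  assume xy: "x \<ominus> y \<in> N"
  have *: "z \<ominus> y = (z \<ominus> x) \<oplus> (x \<ominus> y)" "z \<ominus> x = (z \<ominus> y) \<ominus> (x \<ominus> y)" if "z \<in> carrier V" for z
    by (rule vs_eqI; use that x y in \<open>auto simp: lf_simps\<close>)+
  show "N +> x = N +> y"
  proof (rule Set.set_eqI)
    fix z
    show "z \<in> N +> x \<longleftrightarrow> z \<in> N +> y" unfolding coset_iff[OF N x] coset_iff[OF N y]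
      using *[of z] xy subspD(3)[OF N] subsp_minus[OF N] by metis
  qed
qed

lemma coset_zero: "subsp V N \<Longrightarrow> N +> \<zero> = N"
proof -
  assume N: "subsp V N"
  have "y \<ominus> \<zero> = y" if "y \<in> carrier V" for y using that by (simp add: a_minus_def)
  then show ?thesis using coset_iff[OF N zero_closed] subspD(1)[OF N] by (metis subsetI subset_antisym)
qed

text \<open>Scalar multiplication and the module action on a quotient are defined as unions over all
  representatives. The union collapses to one coset as soon as \<open>g\<close> respects congruence
  modulo \<open>N\<close>.\<close>

lemma coset_UN:
  assumes N: "subsp V N" and x: "x \<in> carrier V"
    and g: "\<And>y. y \<in> carrier V \<Longrightarrow> y \<ominus> x \<in> N \<Longrightarrow> g y \<in> carrier V \<and> g y \<ominus> g x \<in> N"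
  shows "(\<Union>y\<in>N +> x. N +> g y) = N +> g x"
proof -
  have "g x \<in> carrier V" using g[OF x] coset_self[OF N x] coset_iff[OF N x] by blast
  then have "N +> g y = N +> g x" if "y \<in> N +> x" for y
    using that g coset_iff[OF N x] coset_eq_iff[OF N] by auto
  then show ?thesis using coset_self[OF N x] by blast
qed

lemma vq_carrier: "carrier (vquot V N) = (\<lambda>x. N +> x) ` carrier V"
  by (auto simp: vquot_def A_RCOSETS_def')

lemma vq_zero: "subsp V N \<Longrightarrow> \<zero>\<^bsub>vquot V N\<^esub> = N +> \<zero>" by (simp add: coset_zero vquot_def)

lemma vq_add:
  assumes N: "subsp V N" and x: "x \<in> carrier V" and y: "y \<in> carrier V"
  shows "(N +> x) \<oplus>\<^bsub>vquot V N\<^esub> (N +> y) = N +> (x \<oplus> y)"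
proof -
  have "additive_subgroup N V"
    using N submodule_iff by (auto simp: submodule_def intro: additive_subgroupI)
  then have "abelian_subgroup N V" by (rule abelian_subgroupI3) (rule abelian_group_axioms)
  from abelian_subgroup.a_rcos_sum[OF this x y] show ?thesis by (simp add: vquot_def)
qed

lemma vq_smult:
  assumes N: "subsp V N" and x: "x \<in> carrier V"
  shows "c \<odot>\<^bsub>vquot V N\<^esub> (N +> x) = N +> (c \<odot> x)"
proof -
  have "c \<odot> y \<ominus> c \<odot> x = c \<odot> (y \<ominus> x)" if "y \<in> carrier V" for y
    by (rule vs_eqI) (use that x in \<open>auto simp: lf_simps algebra_simps\<close>)
  then have "(\<Union>y\<in>N +> x. N +> (c \<odot> y)) = N +> (c \<odot> x)"
    using subspD(4)[OF N] by (intro coset_UN[OF N x]) auto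
  then show ?thesis by (simp add: vquot_def)
qed

lemma vspace_vquot:
  assumes N: "subsp V N" shows "vspace (vquot V N)"
proof -
  note s = vq_carrier vq_zero[OF N] vq_add[OF N] vq_smult[OF N]
  have "abelian_group (vquot V N)"
    apply (rule abelian_groupI)
    subgoal by (auto simp: s)
    subgoal by (auto simp: s)
    subgoal by (auto simp: s a_ac)
    subgoal by (auto simp: s a_ac)
    subgoal by (auto simp: s)
    subgoal for x by (auto simp: s intro!: bexI[of _ "\<ominus> _"] simp: l_neg)
    done
  then show ?thesis
    by (intro vspace.intro vspace_axioms.intro) (auto simp: s sm_add_l sm_add_r sm_assoc)
qed

lemma lin_map_coset: "subsp V N \<Longrightarrow> lin_map V (vquot V N) (\<lambda>x. N +> x)"
  by (auto simp: lin_map_def vq_carrier vq_add vq_smult)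

text \<open>The representative picked by \<open>SOME\<close> differs from \<open>x\<close> by an
  element of \<open>N\<close>, which \<open>f\<close> sends to zero. The choice has the same form as
  in \<open>lin_ext\<close>, so the lift agrees with that definition.\<close>

lemma lin_map_lift:
  assumes N: "subsp V N" and E: "vspace E" and f: "lin_map V E f" and k: "\<And>x. x \<in> N \<Longrightarrow> f x = \<zero>\<^bsub>E\<^esub>"
  shows "lin_map (vquot V N) E (\<lambda>X. f (SOME p. p \<in> X))"
    "x \<in> carrier V \<Longrightarrow> f (SOME p. p \<in> N +> x) = f x"
proof -
  interpret E: vspace E by (rule E)
  note F = lin_mapD[OF f]
  have *: "f (SOME p. p \<in> N +> x) = f x" if x: "x \<in> carrier V" for x
  proof -
    have "(SOME p. p \<in> N +> x) \<in> N +> x" using coset_self[OF N x] by (rule someI)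
    then obtain p where p: "p = (SOME p. p \<in> N +> x)" "p \<in> carrier V" "p \<ominus> x \<in> N" using coset_iff[OF N x] by auto
    have "p = (p \<ominus> x) \<oplus> x" by (rule vs_eqI) (use p x in \<open>auto simp: lf_simps\<close>)
    then have "f p = f (p \<ominus> x) \<oplus>\<^bsub>E\<^esub> f x" using F(2) p x by (metis minus_closed)
    then show ?thesis using k[OF p(3)] F(1)[OF x] p(1) by simp
  qed
  then show "x \<in> carrier V \<Longrightarrow> f (SOME p. p \<in> N +> x) = f x" .
  show "lin_map (vquot V N) E (\<lambda>X. f (SOME p. p \<in> X))"
    using F by (intro lin_mapI) (auto simp: vq_carrier vq_add[OF N] vq_smult[OF N] *)
qed

end

section \<open>Free vector spaces and presentations\<close>

text \<open>Scalar counterpart of \<open>lsum\<close>: a linear form \<open>\<phi>\<close> takes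
  \<open>lsum E f p\<close> to \<open>csum (\<lambda>x. \<phi> (f x)) p\<close>, which moves
  calculations with formal sums to the complex numbers.\<close>

definition csum :: "('x \<Rightarrow> complex) \<Rightarrow> ('x \<Rightarrow>\<^sub>0 complex) \<Rightarrow> complex" where
  "csum g p = (\<Sum>x\<in>keys p. Poly_Mapping.lookup p x * g x)"

definition lsum :: "(complex, 'e, 'm) module_scheme \<Rightarrow> ('x \<Rightarrow> 'e) \<Rightarrow> ('x \<Rightarrow>\<^sub>0 complex) \<Rightarrow> 'e" where
  "lsum E f p = (\<Oplus>\<^bsub>E\<^esub>x\<in>keys p. Poly_Mapping.lookup p x \<odot>\<^bsub>E\<^esub> f x)"

lemma lookup_scale: "Poly_Mapping.lookup (Poly_Mapping.map ((*) c) p) k = (c::complex) * Poly_Mapping.lookup p k"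
  by (simp add: Poly_Mapping.map.rep_eq when_def)

lemma csum_superset:
  assumes "finite K" "keys p \<subseteq> K"
  shows "csum g p = (\<Sum>x\<in>K. Poly_Mapping.lookup p x * g x)"
  unfolding csum_def by (rule sum.mono_neutral_left) (use assms in \<open>auto simp: in_keys_iff\<close>)

lemma csum_add: "csum g (p + q) = csum g p + csum g q"
proof -
  let ?K = "keys p \<union> keys q"
  have K: "finite ?K" "keys p \<subseteq> ?K" "keys q \<subseteq> ?K" "keys (p + q) \<subseteq> ?K"
    using keys_add[of p q] by auto
  show ?thesis using csum_superset[OF K(1,2)] csum_superset[OF K(1,3)] csum_superset[OF K(1,4)]
    by (simp add: lookup_add algebra_simps sum.distrib)
qed

lemma csum_diff: "csum g (p - q) = csum g p - csum g q"
  using csum_add[of g "p - q" q] by simp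

lemma csum_zero [simp]: "csum g 0 = 0" by (simp add: csum_def)

lemma csum_single [simp]: "csum g (single x c) = c * g x"
  by (cases "c = 0") (simp_all add: csum_def)

lemma keys_scale: "keys (Poly_Mapping.map ((*) (c::complex)) p) \<subseteq> keys p"
  by (auto simp: in_keys_iff lookup_scale)

lemma csum_scale: "csum g (Poly_Mapping.map ((*) c) p) = c * csum g p"
  using csum_superset[OF finite_keys keys_scale, of g c p]
  by (simp add: csum_def lookup_scale sum_distrib_left mult.assoc)

lemma csum_cong: "(\<And>x. x \<in> keys p \<Longrightarrow> g x = h x) \<Longrightarrow> csum g p = csum h p"
  by (simp add: csum_def)

lemma pm_decomp: "p = (\<Sum>x\<in>keys p. single x (Poly_Mapping.lookup p x))"
  by (rule poly_mapping_eqI)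
     (auto simp: lookup_sum lookup_single when_def in_keys_iff)

lemma (in vspace) lf_lsum:
  assumes "lf V \<phi>" "\<And>x. x \<in> keys p \<Longrightarrow> f x \<in> carrier V"
  shows "\<phi> (lsum V f p) = csum (\<lambda>x. \<phi> (f x)) p"
  using assms by (simp add: lsum_def csum_def lf_finsum lf_smult)

lemma (in vspace) lsum_closed:
  "(\<And>x. x \<in> keys p \<Longrightarrow> f x \<in> carrier V) \<Longrightarrow> lsum V f p \<in> carrier V"
  by (auto simp: lsum_def intro!: finsum_closed)

lemma (in vspace) lsum_single: "f x \<in> carrier V \<Longrightarrow> lsum V f (single x c) = c \<odot> f x"
proof (rule vs_eqI)
  assume f: "f x \<in> carrier V"
  then have *: "\<And>y. y \<in> keys (single x c) \<Longrightarrow> f y \<in> carrier V" by (auto split: if_splits)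
  then show "lsum V f (single x c) \<in> carrier V" by (rule lsum_closed)
  show "\<phi> (lsum V f (single x c)) = \<phi> (c \<odot> f x)" if "lf V \<phi>" for \<phi>
    by (subst lf_lsum[OF that *]) (auto simp: lf_smult[OF that f])
qed (use sm_closed in auto)

lemma free_vs_simps:
  "carrier (free_vs S) = {p. keys p \<subseteq> S}" "\<zero>\<^bsub>free_vs S\<^esub> = 0"
  "p \<oplus>\<^bsub>free_vs S\<^esub> q = p + q" "c \<odot>\<^bsub>free_vs S\<^esub> p = Poly_Mapping.map ((*) c) p"
  by (simp_all add: free_vs_def)

lemma vspace_free_gen:
  assumes "carrier F = {p. keys p \<subseteq> S}" "zero F = 0" "add F = (+)"
    "smult F = (\<lambda>c p. Poly_Mapping.map ((*) c) p)"
  shows "vspace F"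
proof -
  have k: "keys (p + q) \<subseteq> S" if "keys p \<subseteq> S" "keys q \<subseteq> S" for p q :: "'a \<Rightarrow>\<^sub>0 complex"
    using keys_add[of p q] that by blast
  have k': "keys (Poly_Mapping.map ((*) c) p) \<subseteq> S" if "keys p \<subseteq> S" for p :: "'a \<Rightarrow>\<^sub>0 complex" and c
    using keys_scale[of c p] that by blast
  have "abelian_group F"
  proof (rule abelian_groupI)
    show "\<exists>y\<in>carrier F. y \<oplus>\<^bsub>F\<^esub> x = \<zero>\<^bsub>F\<^esub>" if "x \<in> carrier F" for x
      by (rule bexI[of _ "- x"]) (use that in \<open>auto simp: assms\<close>)
  qed (simp_all add: assms k ac_simps)
  then show ?thesis
    by (intro vspace.intro vspace_axioms.intro)
       (simp_all add: assms k', simp_all add: poly_mapping_eq_iff fun_eq_iff lookup_scale lookup_add algebra_simps)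
qed

lemma vspace_free: "vspace (free_vs S)"
  by (rule vspace_free_gen[of _ S]) (simp_all add: free_vs_def)

lemma lf_free:
  assumes \<phi>: "lf (free_vs S) \<phi>" and p: "keys p \<subseteq> S"
  shows "\<phi> p = csum (\<lambda>x. \<phi> (single x 1)) p"
proof -
  interpret F: vspace "free_vs S" by (rule vspace_free)
  have sc: "Poly_Mapping.map ((*) c) (single x 1) = single x c" for x :: 'a and c :: complex
    by (rule poly_mapping_eqI) (simp add: lookup_scale lookup_single when_def)
  have s: "\<phi> (single x c) = c * \<phi> (single x 1)" if "x \<in> S" for x c
    using F.lf_smult[OF \<phi>, of "single x 1" c] that by (simp add: free_vs_simps sc)
  have *: "keys (\<Sum>x\<in>K. single x (c x)) \<subseteq> S \<and>
    \<phi> (\<Sum>x\<in>K. single x (c x)) = (\<Sum>x\<in>K. c x * \<phi> (single x 1))"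
    if "finite K" "K \<subseteq> S" for K and c :: "'a \<Rightarrow> complex" using that
  proof (induct K rule: finite_induct)
    case empty then show ?case using F.lf_zero[OF \<phi>] by (simp add: free_vs_simps)
  next
    case (insert x K)
    have "keys (single x (c x)) \<subseteq> S" using insert by auto
    moreover have IH: "keys (\<Sum>x\<in>K. single x (c x)) \<subseteq> S"
      "\<phi> (\<Sum>x\<in>K. single x (c x)) = (\<Sum>x\<in>K. c x * \<phi> (single x 1))"
      using insert by simp_all
    ultimately have "keys (single x (c x) + (\<Sum>x\<in>K. single x (c x))) \<subseteq> S"
      "\<phi> (single x (c x) + (\<Sum>x\<in>K. single x (c x)))
        = \<phi> (single x (c x)) + \<phi> (\<Sum>x\<in>K. single x (c x))"
      using keys_add[of "single x (c x)" "\<Sum>x\<in>K. single x (c x)"]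
        F.lf_add[OF \<phi>, of "single x (c x)" "\<Sum>x\<in>K. single x (c x)"]
      unfolding free_vs_simps mem_Collect_eq by (blast, simp)
    then show ?case using insert(1,2,4) s[of x "c x"] IH(2) by simp
  qed
  show ?thesis by (subst pm_decomp[of p]) (simp add: csum_def conjunct2[OF *[OF finite_keys p, of "Poly_Mapping.lookup p"]])
qed

lemma lin_map_lsum:
  assumes "vspace E" "\<And>x. x \<in> S \<Longrightarrow> f x \<in> carrier E"
  shows "lin_map (free_vs S) E (lsum E f)"
proof -
  interpret E: vspace E by fact
  have f: "f x \<in> carrier E" if "x \<in> keys p" "keys p \<subseteq> S" for x p using assms that by auto
  have c: "lsum E f p \<in> carrier E" if "keys p \<subseteq> S" for p by (rule E.lsum_closed) (use f that in auto)
  have l: "\<phi> (lsum E f p) = csum (\<lambda>x. \<phi> (f x)) p" if "keys p \<subseteq> S" "lf E \<phi>" for p \<phi>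
    by (rule E.lf_lsum) (use f that in auto)
  show ?thesis
  proof (intro lin_mapI; unfold free_vs_simps; (elim CollectE)?)
    fix p q :: "'c \<Rightarrow>\<^sub>0 complex" and d assume p: "keys p \<subseteq> S"
    then show "lsum E f p \<in> carrier E" by (rule c)
    have kp: "keys (Poly_Mapping.map ((*) d) p) \<subseteq> S" using keys_scale[of d p] p by auto
    show "lsum E f (Poly_Mapping.map ((*) d) p) = d \<odot>\<^bsub>E\<^esub> lsum E f p"
      by (rule E.vs_eqI) (use p kp in \<open>auto simp: c l E.lf_simps csum_scale\<close>)
    assume q: "keys q \<subseteq> S"
    have kpq: "keys (p + q) \<subseteq> S" using keys_add[of p q] p q by auto
    show "lsum E f (p + q) = lsum E f p \<oplus>\<^bsub>E\<^esub> lsum E f q"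
      by (rule E.vs_eqI) (use p q kpq in \<open>auto simp: c l E.lf_simps csum_add\<close>)
  qed
qed

locale presentation =
  fixes S :: "'x set" and R :: "('x \<Rightarrow>\<^sub>0 complex) set"
  assumes rel: "\<And>r. r \<in> R \<Longrightarrow> keys r \<subseteq> S"
begin

sublocale F: vspace "free_vs S" by (rule vspace_free)

lemma rel_sub: "R \<subseteq> carrier (free_vs S)" using rel by (auto simp: free_vs_simps)
lemma rspan: "subsp (free_vs S) (vspan (free_vs S) R)" by (rule F.subsp_vspan[OF rel_sub])

sublocale P: vspace "pres S R" unfolding pres_def by (rule F.vspace_vquot[OF rspan])

lemma gen_closed [simp]: "x \<in> S \<Longrightarrow> pres_gen S R x \<in> carrier (pres S R)"
  by (auto simp: pres_gen_def pres_def F.vq_carrier free_vs_simps)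

lemma coset_lsum:
  assumes p: "keys p \<subseteq> S"
  shows "vspan (free_vs S) R +>\<^bsub>free_vs S\<^esub> p = lsum (pres S R) (pres_gen S R) p"
proof (rule P.vs_eqI)
  have L: "lin_map (free_vs S) (pres S R) (\<lambda>x. vspan (free_vs S) R +>\<^bsub>free_vs S\<^esub> x)"
    unfolding pres_def by (rule F.lin_map_coset[OF rspan])
  show "vspan (free_vs S) R +>\<^bsub>free_vs S\<^esub> p \<in> carrier (pres S R)" using lin_mapD(1)[OF L] p by (simp add: free_vs_simps)
  show "lsum (pres S R) (pres_gen S R) p \<in> carrier (pres S R)" by (rule P.lsum_closed) (use p in auto)
  fix \<phi> assume \<phi>: "lf (pres S R) \<phi>"
  show "\<phi> (vspan (free_vs S) R +>\<^bsub>free_vs S\<^esub> p) = \<phi> (lsum (pres S R) (pres_gen S R) p)"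
  proof -
    have "\<phi> (lsum (pres S R) (pres_gen S R) p) = csum (\<lambda>x. \<phi> (pres_gen S R x)) p"
      by (rule P.lf_lsum[OF \<phi>]) (use p in auto)
    then show ?thesis using lf_free[OF lf_comp[OF L \<phi>] p] by (simp add: pres_gen_def)
  qed
qed

lemma gen_rel: assumes "r \<in> R" shows "lsum (pres S R) (pres_gen S R) r = \<zero>\<^bsub>pres S R\<^esub>"
proof -
  have r: "r \<in> carrier (free_vs S)" "keys r \<subseteq> S" using assms rel_sub by (auto simp: free_vs_simps)
  have "r \<in> vspan (free_vs S) R" using assms F.vspan_superset by blast
  moreover have "r \<ominus>\<^bsub>free_vs S\<^esub> \<zero>\<^bsub>free_vs S\<^esub> = r" using r by (simp add: a_minus_def)
  ultimately have "vspan (free_vs S) R +>\<^bsub>free_vs S\<^esub> r = vspan (free_vs S) R +>\<^bsub>free_vs S\<^esub> \<zero>\<^bsub>free_vs S\<^esub>"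
    using F.coset_eq_iff[OF rspan r(1) F.zero_closed] by simp
  then show ?thesis using coset_lsum[OF r(2)] F.vq_zero[OF rspan] by (simp add: pres_def)
qed

text \<open>The form in which relations are used: after a linear form is applied, each relation of a
  presentation becomes one equation between numbers.\<close>

lemma gen_rel_lf: "\<lbrakk>lf (pres S R) \<phi>; r \<in> R\<rbrakk> \<Longrightarrow> csum (\<lambda>x. \<phi> (pres_gen S R x)) r = 0"
  using gen_rel[of r] P.lf_lsum[of \<phi> r "pres_gen S R"] P.lf_zero[of \<phi>] rel by force

lemma pres_induct [consumes 1, case_names gen zero add smult]:
  assumes t: "t \<in> carrier (pres S R)"
    and g: "\<And>x. x \<in> S \<Longrightarrow> Q (pres_gen S R x)" and z: "Q \<zero>\<^bsub>pres S R\<^esub>"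
    and a: "\<And>x y. \<lbrakk>x \<in> carrier (pres S R); y \<in> carrier (pres S R); Q x; Q y\<rbrakk> \<Longrightarrow> Q (x \<oplus>\<^bsub>pres S R\<^esub> y)"
    and s: "\<And>c x. \<lbrakk>x \<in> carrier (pres S R); Q x\<rbrakk> \<Longrightarrow> Q (c \<odot>\<^bsub>pres S R\<^esub> x)"
  shows "Q t"
proof -
  have sub: "subsp (pres S R) {x \<in> carrier (pres S R). Q x}" using z a s by (auto simp: subsp_def)
  obtain p where p: "keys p \<subseteq> S" "t = vspan (free_vs S) R +>\<^bsub>free_vs S\<^esub> p"
    using t by (auto simp: pres_def F.vq_carrier free_vs_simps)
  have "lsum (pres S R) (pres_gen S R) p \<in> {x \<in> carrier (pres S R). Q x}"
    unfolding lsum_def by (rule P.subsp_finsum[OF sub], rule subspD(4)[OF sub]) (use p g in auto)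
  then show ?thesis using coset_lsum p by auto
qed

lemma lin_map_eq:
  assumes "vspace E" "lin_map (pres S R) E f" "lin_map (pres S R) E g" "t \<in> carrier (pres S R)"
    "\<And>x. x \<in> S \<Longrightarrow> f (pres_gen S R x) = g (pres_gen S R x)"
  shows "f t = g t"
proof -
  interpret E: vspace E by fact
  note f = lin_mapD[OF assms(2)] and g = lin_mapD[OF assms(3)]
  have "f (0 \<odot>\<^bsub>pres S R\<^esub> \<zero>\<^bsub>pres S R\<^esub>) = g (0 \<odot>\<^bsub>pres S R\<^esub> \<zero>\<^bsub>pres S R\<^esub>)"
    unfolding f(3)[OF P.zero_closed] g(3)[OF P.zero_closed] using f(1) g(1) by simp
  with assms(4) show ?thesis by (induct t rule: pres_induct) (use assms f g in auto)
qed

lemma lin_ext_eq: "lin_ext E f = (\<lambda>X. lsum E f (SOME p. p \<in> X))"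
  by (simp add: lin_ext_def lsum_def Let_def fun_eq_iff)

text \<open>Compatibility with the relations is required only after linear forms, because forms
  separate points of \<open>E\<close>. The combinations of generators that map to zero form a
  subspace, so the whole span of the relations is killed.\<close>

lemma lin_ext:
  assumes E: "vspace E" and f: "\<And>x. x \<in> S \<Longrightarrow> f x \<in> carrier E"
    and r: "\<And>r \<phi>. r \<in> R \<Longrightarrow> lf E \<phi> \<Longrightarrow> csum (\<lambda>x. \<phi> (f x)) r = 0"
  shows "lin_map (pres S R) E (lin_ext E f)" "x \<in> S \<Longrightarrow> lin_ext E f (pres_gen S R x) = f x"
proof -
  interpret E: vspace E by fact
  have L: "lin_map (free_vs S) E (lsum E f)" by (rule lin_map_lsum[OF E f])
  have r0: "lsum E f r = \<zero>\<^bsub>E\<^esub>" if "r \<in> R" for r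
  proof (rule E.vs_eqI)
    have *: "f x \<in> carrier E" if "x \<in> keys r" for x using that rel[OF \<open>r \<in> R\<close>] f by auto
    then show "lsum E f r \<in> carrier E" by (rule E.lsum_closed)
    show "\<phi> (lsum E f r) = \<phi> \<zero>\<^bsub>E\<^esub>" if "lf E \<phi>" for \<phi>
      by (subst E.lf_lsum[OF that *]) (use r[OF \<open>r \<in> R\<close> that] E.lf_zero[OF that] in auto)
  qed simp
  have lsum0: "lsum E f \<zero>\<^bsub>free_vs S\<^esub> = \<zero>\<^bsub>E\<^esub>" by (simp add: lsum_def free_vs_simps(2))
  have "subsp (free_vs S) {p \<in> carrier (free_vs S). lsum E f p = \<zero>\<^bsub>E\<^esub>}"
    using lin_mapD[OF L] F.zero_closed lsum0 unfolding subsp_def by simp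
  then have "vspan (free_vs S) R \<subseteq> {p \<in> carrier (free_vs S). lsum E f p = \<zero>\<^bsub>E\<^esub>}"
    by (rule F.vspan_least) (use r0 rel_sub in auto)
  then have k: "\<And>p. p \<in> vspan (free_vs S) R \<Longrightarrow> lsum E f p = \<zero>\<^bsub>E\<^esub>" by auto
  show "lin_map (pres S R) E (lin_ext E f)" unfolding lin_ext_eq pres_def
    by (rule F.lin_map_lift(1)[OF rspan E L k])
  assume x: "x \<in> S"
  then have "single x 1 \<in> carrier (free_vs S)" by (simp add: free_vs_simps(1))
  from F.lin_map_lift(2)[OF rspan E L k this]
  have "lin_ext E f (pres_gen S R x) = lsum E f (single x 1)" unfolding lin_ext_eq pres_gen_def .
  then show "lin_ext E f (pres_gen S R x) = f x" using E.lsum_single[of f x 1] f[OF x] by simp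
qed

end

section \<open>Tensor products\<close>

definition bilin :: "(complex, 'v, 'm) module_scheme \<Rightarrow> (complex, 'w, 'k) module_scheme \<Rightarrow> (complex, 'e, 'j) module_scheme
    \<Rightarrow> ('v \<Rightarrow> 'w \<Rightarrow> 'e) \<Rightarrow> bool" where
  "bilin V W E f \<longleftrightarrow> (\<forall>x\<in>carrier V. lin_map W E (f x)) \<and> (\<forall>y\<in>carrier W. lin_map V E (\<lambda>x. f x y))"

lemma bilinD:
  assumes "bilin V W E f"
  shows "\<lbrakk>x \<in> carrier V; y \<in> carrier W\<rbrakk> \<Longrightarrow> f x y \<in> carrier E"
    "\<lbrakk>x \<in> carrier V; x' \<in> carrier V; y \<in> carrier W\<rbrakk> \<Longrightarrow> f (x \<oplus>\<^bsub>V\<^esub> x') y = f x y \<oplus>\<^bsub>E\<^esub> f x' y"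
    "\<lbrakk>x \<in> carrier V; y \<in> carrier W; y' \<in> carrier W\<rbrakk> \<Longrightarrow> f x (y \<oplus>\<^bsub>W\<^esub> y') = f x y \<oplus>\<^bsub>E\<^esub> f x y'"
    "\<lbrakk>x \<in> carrier V; y \<in> carrier W\<rbrakk> \<Longrightarrow> f (c \<odot>\<^bsub>V\<^esub> x) y = c \<odot>\<^bsub>E\<^esub> f x y"
    "\<lbrakk>x \<in> carrier V; y \<in> carrier W\<rbrakk> \<Longrightarrow> f x (c \<odot>\<^bsub>W\<^esub> y) = c \<odot>\<^bsub>E\<^esub> f x y"
  using assms by (auto simp: bilin_def lin_map_def)

lemma bilinI:
  assumes "\<And>x y. \<lbrakk>x \<in> carrier V; y \<in> carrier W\<rbrakk> \<Longrightarrow> f x y \<in> carrier E"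
    "\<And>x x' y. \<lbrakk>x \<in> carrier V; x' \<in> carrier V; y \<in> carrier W\<rbrakk> \<Longrightarrow> f (x \<oplus>\<^bsub>V\<^esub> x') y = f x y \<oplus>\<^bsub>E\<^esub> f x' y"
    "\<And>x y y'. \<lbrakk>x \<in> carrier V; y \<in> carrier W; y' \<in> carrier W\<rbrakk> \<Longrightarrow> f x (y \<oplus>\<^bsub>W\<^esub> y') = f x y \<oplus>\<^bsub>E\<^esub> f x y'"
    "\<And>x y c. \<lbrakk>x \<in> carrier V; y \<in> carrier W\<rbrakk> \<Longrightarrow> f (c \<odot>\<^bsub>V\<^esub> x) y = c \<odot>\<^bsub>E\<^esub> f x y"
    "\<And>x y c. \<lbrakk>x \<in> carrier V; y \<in> carrier W\<rbrakk> \<Longrightarrow> f x (c \<odot>\<^bsub>W\<^esub> y) = c \<odot>\<^bsub>E\<^esub> f x y"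
  shows "bilin V W E f"
  using assms by (auto simp: bilin_def lin_map_def)

text \<open>One locale covers two constructions: with \<open>R\<close> the enveloping algebra of a
  subalgebra it gives induced modules, with \<open>R\<close> empty it gives the ordinary tensor
  product over the complex numbers.\<close>

locale tens = V: vspace V + W: vspace W
  for V :: "(complex, 'v, 'm) module_scheme" and W :: "(complex, 'w, 'k) module_scheme" +
  fixes R :: "'r set" and rt :: "'v \<Rightarrow> 'r \<Rightarrow> 'v" and lt :: "'r \<Rightarrow> 'w \<Rightarrow> 'w"
  assumes rt: "\<lbrakk>v \<in> carrier V; r \<in> R\<rbrakk> \<Longrightarrow> rt v r \<in> carrier V"
    and lt: "\<lbrakk>w \<in> carrier W; r \<in> R\<rbrakk> \<Longrightarrow> lt r w \<in> carrier W"
begin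

sublocale PR: presentation "carrier V \<times> carrier W" "balanced_rels R V rt W lt"
proof
  fix r assume "r \<in> balanced_rels R V rt W lt"
  moreover have "keys (p - single b c - single b' c') \<subseteq> keys p \<union> {b, b'}"
    "keys (p - single b c) \<subseteq> keys p \<union> {b}"
    for p and b b' :: "'v \<times> 'w" and c c' :: complex
    using keys_diff[of "p - single b c" "single b' c'"] keys_diff[of p "single b c"]
    by (auto split: if_splits)
  note * = this[of "single _ _"]
  ultimately show "keys r \<subseteq> carrier V \<times> carrier W"
    unfolding balanced_rels_def bilin_rels_def
    by (elim UnE CollectE exE conjE; hypsubst; intro order_trans[OF *(1)] order_trans[OF *(2)]) (auto simp: rt lt split: if_splits)
qed

abbreviation T where "T \<equiv> tensor_over R V rt W lt"
abbreviation tp where "tp \<equiv> tensor_over_pure R V rt W lt"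

lemma T_eq: "T = pres (carrier V \<times> carrier W) (balanced_rels R V rt W lt)" by (simp add: tensor_over_def)
lemma tp_eq: "tp x y = pres_gen (carrier V \<times> carrier W) (balanced_rels R V rt W lt) (x, y)"
  by (simp add: tensor_over_pure_def)

sublocale TV: vspace T unfolding T_eq by (rule PR.P.vspace_axioms)

lemma tp_closed [simp]: "\<lbrakk>x \<in> carrier V; y \<in> carrier W\<rbrakk> \<Longrightarrow> tp x y \<in> carrier T"
  by (simp add: T_eq tp_eq)

lemma tp_bal: assumes "v \<in> carrier V" "r \<in> R" "w \<in> carrier W" shows "tp (rt v r) w = tp v (lt r w)"
proof (rule TV.vs_eqI)
  fix \<phi> assume \<phi>: "lf T \<phi>"
  have "single (rt v r, w) 1 - single (v, lt r w) 1 \<in> balanced_rels R V rt W lt"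
    unfolding balanced_rels_def using assms by blast
  from PR.gen_rel_lf[OF \<phi>[unfolded T_eq] this] show "\<phi> (tp (rt v r) w) = \<phi> (tp v (lt r w))"
    by (simp add: csum_diff tp_eq)
qed (use assms rt lt in auto)

lemma bilin_tp: "bilin V W T tp"
proof (rule bilinI)
  note A = TV.a_closed V.a_closed W.a_closed V.sm_closed W.sm_closed TV.sm_closed
  have rel: "csum (\<lambda>x. \<phi> (pres_gen (carrier V \<times> carrier W) (balanced_rels R V rt W lt) x)) r = 0"
    if "lf T \<phi>" "r \<in> bilin_rels V W" for \<phi> r
    by (rule PR.gen_rel_lf[OF that(1)[unfolded T_eq]]) (use that in \<open>auto simp: balanced_rels_def\<close>)
  fix x y assume x: "x \<in> carrier V" and y: "y \<in> carrier W"
  show "tp x y \<in> carrier T" using x y by simp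
  fix c
  show "tp (c \<odot>\<^bsub>V\<^esub> x) y = c \<odot>\<^bsub>T\<^esub> tp x y"
  proof (rule TV.vs_eqI)
    fix \<phi> assume \<phi>: "lf T \<phi>"
    have "single (c \<odot>\<^bsub>V\<^esub> x, y) 1 - single (x, y) c \<in> bilin_rels V W"
      unfolding bilin_rels_def using x y by blast
    from rel[OF \<phi> this] show "\<phi> (tp (c \<odot>\<^bsub>V\<^esub> x) y) = \<phi> (c \<odot>\<^bsub>T\<^esub> tp x y)"
      using x y by (simp add: csum_diff TV.lf_smult[OF \<phi>] flip: tp_eq)
  qed (use x y in auto)
  show "tp x (c \<odot>\<^bsub>W\<^esub> y) = c \<odot>\<^bsub>T\<^esub> tp x y"
  proof (rule TV.vs_eqI)
    fix \<phi> assume \<phi>: "lf T \<phi>"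
    have "single (x, c \<odot>\<^bsub>W\<^esub> y) 1 - single (x, y) c \<in> bilin_rels V W"
      unfolding bilin_rels_def using x y by blast
    from rel[OF \<phi> this] show "\<phi> (tp x (c \<odot>\<^bsub>W\<^esub> y)) = \<phi> (c \<odot>\<^bsub>T\<^esub> tp x y)"
      using x y by (simp add: csum_diff TV.lf_smult[OF \<phi>] flip: tp_eq)
  qed (use x y in auto)
  show "tp (x \<oplus>\<^bsub>V\<^esub> x') y = tp x y \<oplus>\<^bsub>T\<^esub> tp x' y" if x': "x' \<in> carrier V" for x'
  proof (rule TV.vs_eqI)
    fix \<phi> assume \<phi>: "lf T \<phi>"
    have "single (x \<oplus>\<^bsub>V\<^esub> x', y) 1 - single (x, y) 1 - single (x', y) 1 \<in> bilin_rels V W"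
      unfolding bilin_rels_def using x y x' by blast
    from rel[OF \<phi> this] show "\<phi> (tp (x \<oplus>\<^bsub>V\<^esub> x') y) = \<phi> (tp x y \<oplus>\<^bsub>T\<^esub> tp x' y)"
      using x y x' by (simp add: csum_diff csum_add TV.lf_add[OF \<phi>] algebra_simps flip: tp_eq)
  qed (use x y x' in auto)
  show "tp x (y \<oplus>\<^bsub>W\<^esub> y') = tp x y \<oplus>\<^bsub>T\<^esub> tp x y'" if y': "y' \<in> carrier W" for y'
  proof (rule TV.vs_eqI)
    fix \<phi> assume \<phi>: "lf T \<phi>"
    have "single (x, y \<oplus>\<^bsub>W\<^esub> y') 1 - single (x, y) 1 - single (x, y') 1 \<in> bilin_rels V W"
      unfolding bilin_rels_def using x y y' by blast
    from rel[OF \<phi> this] show "\<phi> (tp x (y \<oplus>\<^bsub>W\<^esub> y')) = \<phi> (tp x y \<oplus>\<^bsub>T\<^esub> tp x y')"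
      using x y y' by (simp add: csum_diff csum_add TV.lf_add[OF \<phi>] algebra_simps flip: tp_eq)
  qed (use x y y' in auto)
qed

lemmas tpD = bilinD[OF bilin_tp]

lemma T_induct [consumes 1, case_names pure zero add smult]:
  assumes "t \<in> carrier T"
    and "\<And>x y. \<lbrakk>x \<in> carrier V; y \<in> carrier W\<rbrakk> \<Longrightarrow> Q (tp x y)" and "Q \<zero>\<^bsub>T\<^esub>"
    and "\<And>x y. \<lbrakk>x \<in> carrier T; y \<in> carrier T; Q x; Q y\<rbrakk> \<Longrightarrow> Q (x \<oplus>\<^bsub>T\<^esub> y)"
    and "\<And>c x. \<lbrakk>x \<in> carrier T; Q x\<rbrakk> \<Longrightarrow> Q (c \<odot>\<^bsub>T\<^esub> x)"
  shows "Q t"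
  by (rule PR.pres_induct[OF assms(1)[unfolded T_eq], of Q]) (use assms in \<open>auto simp: T_eq tp_eq\<close>)

lemma lin_map_eqT:
  assumes "vspace E" "lin_map T E f" "lin_map T E g" "t \<in> carrier T"
    "\<And>x y. x \<in> carrier V \<Longrightarrow> y \<in> carrier W \<Longrightarrow> f (tp x y) = g (tp x y)"
  shows "f t = g t"
  by (rule PR.lin_map_eq[OF assms(1-4)[unfolded T_eq]]) (use assms(5) in \<open>auto simp: tp_eq\<close>)

lemma T_lift:
  assumes E: "vspace E" and f: "bilin V W E f"
    and bal: "\<And>v r w. \<lbrakk>v \<in> carrier V; r \<in> R; w \<in> carrier W\<rbrakk> \<Longrightarrow> f (rt v r) w = f v (lt r w)"
  shows "lin_map T E (lin_ext E (\<lambda>(x, y). f x y))"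
    "\<lbrakk>x \<in> carrier V; y \<in> carrier W\<rbrakk> \<Longrightarrow> lin_ext E (\<lambda>(x, y). f x y) (tp x y) = f x y"
proof -
  interpret E: vspace E by fact
  note F = bilinD[OF f]
  have c: "(\<lambda>(x, y). f x y) p \<in> carrier E" if "p \<in> carrier V \<times> carrier W" for p using that F(1) by auto
  have r: "csum (\<lambda>x. \<phi> (case x of (x, y) \<Rightarrow> f x y)) r = 0" if "r \<in> balanced_rels R V rt W lt" "lf E \<phi>" for r \<phi>
    using that(1) unfolding balanced_rels_def bilin_rels_def
    by (elim UnE CollectE exE conjE; hypsubst) (simp_all add: csum_diff F E.lf_simps[OF that(2)] bal)
  show "lin_map T E (lin_ext E (\<lambda>(x, y). f x y))" unfolding T_eq
    by (rule PR.lin_ext(1); (fact E | erule c | erule (1) r))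
  show "lin_ext E (\<lambda>(x, y). f x y) (tp x y) = f x y" if "x \<in> carrier V" "y \<in> carrier W"
  proof -
    have *: "lin_ext E (\<lambda>(x, y). f x y) (pres_gen (carrier V \<times> carrier W) (balanced_rels R V rt W lt) p) = (case p of (x, y) \<Rightarrow> f x y)"
      if "p \<in> carrier V \<times> carrier W" for p
      by (rule PR.lin_ext(2); (fact E | erule c | erule (1) r | fact that))
    show ?thesis
      unfolding tp_eq using that *[of "(x, y)"] by simp
  qed
qed

end

lemma tensor_over_empty:
  "tensor_over {} V rt W lt = tensor V W" "tensor_over_pure {} V rt W lt = tensor_pure V W"
  by (simp_all add: tensor_over_def tensor_def tensor_over_pure_def tensor_pure_def balanced_rels_def fun_eq_iff)

section \<open>Simultaneous eigenvectors\<close>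

context vspace
begin

text \<open>Induction on \<open>F\<close>. For \<open>h\<close> that separates \<open>m\<close> from
  the new index \<open>n\<close>, applying \<open>B h - ch n h\<close> to the vanishing sum removes
  the component \<open>n\<close> and rescales the others by \<open>ch m h - ch n h\<close>.\<close>

lemma eigen_indep:
  assumes "finite F"
    and B: "\<And>h. h \<in> H \<Longrightarrow> lin_map V V (B h)"
    and dist: "\<And>m m'. \<lbrakk>m \<in> F; m' \<in> F; m \<noteq> m'\<rbrakk> \<Longrightarrow> \<exists>h\<in>H. ch m h \<noteq> (ch m' h :: complex)"
    and x: "\<And>m. m \<in> F \<Longrightarrow> x m \<in> carrier V" "\<And>m h. m \<in> F \<Longrightarrow> h \<in> H \<Longrightarrow> B h (x m) = ch m h \<odot> x m"
    and sum0: "(\<Oplus>m\<in>F. x m) = \<zero>"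
  shows "\<forall>m\<in>F. x m = \<zero>"
  using assms(1) dist x sum0
proof (induct F arbitrary: x rule: finite_induct)
  case (insert n F)
  have xc: "\<And>m. m \<in> F \<Longrightarrow> x m \<in> carrier V" "x n \<in> carrier V" using insert.prems(2) by auto
  have s0: "x n \<oplus> (\<Oplus>m\<in>F. x m) = \<zero>" using insert.prems(4) insert.hyps xc by (simp add: Pi_def)
  have z: "x m = \<zero>" if m: "m \<in> F" for m
  proof -
    obtain h where h: "h \<in> H" "ch m h \<noteq> ch n h" using insert.prems(1)[of m n] m insert.hyps by auto
    have "(\<Oplus>m\<in>F. (ch m h - ch n h) \<odot> x m) = \<zero>"
    proof (rule vs_eqI)
      fix \<phi> assume \<phi>: "lf V \<phi>"
      note L = lf_comp[OF B[OF h(1)] \<phi>]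
      have 1: "\<phi> (x n) + (\<Sum>m\<in>F. \<phi> (x m)) = 0"
        using arg_cong[OF s0, of \<phi>] xc by (simp add: lf_simps[OF \<phi>])
      have "\<phi> (B h (x n)) + (\<Sum>m\<in>F. \<phi> (B h (x m))) = 0"
        using arg_cong[OF s0, of "\<lambda>x. \<phi> (B h x)"] xc by (simp add: lf_simps[OF L])
      then have 2: "ch n h * \<phi> (x n) + (\<Sum>m\<in>F. ch m h * \<phi> (x m)) = 0"
        using insert.prems(3) h(1) xc by (simp add: lf_simps[OF \<phi>])
      have "(\<Sum>m\<in>F. (ch m h - ch n h) * \<phi> (x m)) = (\<Sum>m\<in>F. ch m h * \<phi> (x m)) - ch n h * (\<Sum>m\<in>F. \<phi> (x m))"
        by (simp add: algebra_simps sum_subtractf sum_distrib_left)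
      also have "\<dots> = (ch n h * \<phi> (x n) + (\<Sum>m\<in>F. ch m h * \<phi> (x m))) - ch n h * (\<phi> (x n) + (\<Sum>m\<in>F. \<phi> (x m)))"
        by (simp add: algebra_simps)
      also have "\<dots> = 0" using 1 2 by simp
      finally show "\<phi> (\<Oplus>m\<in>F. (ch m h - ch n h) \<odot> x m) = \<phi> \<zero>" using xc by (simp add: lf_simps[OF \<phi>])
    qed (use xc in auto)
    then have "\<forall>m\<in>F. (ch m h - ch n h) \<odot> x m = \<zero>"
      using insert.prems xc
      by (intro insert.hyps(3)) (auto simp: lin_mapD(3)[OF B] sm_assoc mult.commute)
    then have "(1 / (ch m h - ch n h)) \<odot> ((ch m h - ch n h) \<odot> x m) = \<zero>" using m by simp
    then show ?thesis using h xc m by (simp add: sm_assoc)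
  qed
  then have "(\<Oplus>m\<in>F. x m) = (\<Oplus>m\<in>F. \<zero>)" by (intro finsum_cong') auto
  then show ?case using s0 xc z by simp
qed simp

text \<open>The components are indexed by all of \<open>J\<close> and vanish outside
  \<open>F\<close>, so that two decompositions can be added over the union of their
  supports.\<close>

lemma vspan_Union_decomp:
  assumes S: "\<And>m. m \<in> J \<Longrightarrow> subsp V (S m)" and y: "y \<in> vspan V (\<Union>m\<in>J. S m)"
  shows "\<exists>F x. finite F \<and> F \<subseteq> J \<and> (\<forall>m\<in>J. x m \<in> S m) \<and> (\<forall>m\<in>J - F. x m = \<zero>) \<and> y = (\<Oplus>m\<in>F. x m)"
proof -
  have SC: "\<And>m z. m \<in> J \<Longrightarrow> z \<in> S m \<Longrightarrow> z \<in> carrier V" using S unfolding subsp_def by blast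
  have ext: "(\<Oplus>m\<in>F. x m) = (\<Oplus>m\<in>F'. x m)"
    if "finite F'" "F \<subseteq> F'" "F' \<subseteq> J" "\<forall>m\<in>J. x m \<in> S m" "\<forall>m\<in>J - F. x m = \<zero>" for F F' x
  proof (rule vs_eqI)
    fix \<phi> assume \<phi>: "lf V \<phi>"
    have "(\<Sum>m\<in>F. \<phi> (x m)) = (\<Sum>m\<in>F'. \<phi> (x m))"
      by (rule sum.mono_neutral_left) (use that lf_zero[OF \<phi>] in auto)
    moreover have "\<And>m. m \<in> F \<Longrightarrow> x m \<in> carrier V" "\<And>m. m \<in> F' \<Longrightarrow> x m \<in> carrier V" using that SC by blast+
    ultimately show "\<phi> (\<Oplus>m\<in>F. x m) = \<phi> (\<Oplus>m\<in>F'. x m)" by (simp add: lf_finsum[OF \<phi>])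
  qed (use that SC in \<open>auto intro!: finsum_closed\<close>)
  have USub: "(\<Union>m\<in>J. S m) \<subseteq> carrier V" using SC by auto
  from y USub show ?thesis
  proof (induct rule: vspan_induct)
    case (base x)
    then obtain m where m: "m \<in> J" "x \<in> S m" by auto
    show ?case
      by (rule exI[of _ "{m}"], rule exI[of _ "\<lambda>n. if n = m then x else \<zero>"])
         (use m SC S in \<open>auto simp: subspD(2)\<close>)
  next
    case zero
    show ?case by (rule exI[of _ "{}"], rule exI[of _ "\<lambda>n. \<zero>"]) (use S in \<open>auto simp: subspD(2)\<close>)
  next
    case (add y y')
    then obtain F x F' x' where F: "finite F" "F \<subseteq> J" "\<forall>m\<in>J. x m \<in> S m" "\<forall>m\<in>J - F. x m = \<zero>" "y = (\<Oplus>m\<in>F. x m)"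
      and F': "finite F'" "F' \<subseteq> J" "\<forall>m\<in>J. x' m \<in> S m" "\<forall>m\<in>J - F'. x' m = \<zero>" "y' = (\<Oplus>m\<in>F'. x' m)" by blast
    have "y = (\<Oplus>m\<in>F \<union> F'. x m)" "y' = (\<Oplus>m\<in>F \<union> F'. x' m)"
      unfolding F(5) F'(5) using F F' by (intro ext; auto)+
    then have "y \<oplus> y' = (\<Oplus>m\<in>F \<union> F'. x m \<oplus> x' m)"
      using F F' SC by (subst finsum_addf) (auto simp: Pi_def subset_iff)
    then show ?case using F F' S
      by (intro exI[of _ "F \<union> F'"] exI[of _ "\<lambda>m. x m \<oplus> x' m"]) (auto simp: subspD(3))
  next
    case (smult c y)
    then obtain F x where F: "finite F" "F \<subseteq> J" "\<forall>m\<in>J. x m \<in> S m" "\<forall>m\<in>J - F. x m = \<zero>" "y = (\<Oplus>m\<in>F. x m)" by blast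
    have xc: "\<And>m. m \<in> F \<Longrightarrow> x m \<in> carrier V" using F SC by auto
    have "c \<odot> y = (\<Oplus>m\<in>F. c \<odot> x m)" unfolding F(5)
      by (rule vs_eqI) (use xc in \<open>auto simp: lf_simps sum_distrib_left\<close>)
    then show ?case using F S by (intro exI[of _ F] exI[of _ "\<lambda>m. c \<odot> x m"]) (auto simp: subspD(4))
  qed
qed

text \<open>Extraction of a weight component: a simultaneous eigenvector in a sum of eigenspaces
  lies in the eigenspace of its own weight. All weight arguments for the Lie algebras use this
  form.\<close>

lemma eigen_separation:
  assumes S: "\<And>m. m \<in> J \<Longrightarrow> subsp V (S m)"
    and B: "\<And>h. h \<in> H \<Longrightarrow> lin_map V V (B h)"
    and eig: "\<And>m h x. \<lbrakk>m \<in> J; x \<in> S m; h \<in> H\<rbrakk> \<Longrightarrow> B h x = ch m h \<odot> x"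
    and dist: "\<And>m m'. \<lbrakk>m \<in> J; m' \<in> J; m \<noteq> m'\<rbrakk> \<Longrightarrow> \<exists>h\<in>H. ch m h \<noteq> (ch m' h :: complex)"
    and y: "y \<in> vspan V (\<Union>m\<in>J. S m)" and m0: "m0 \<in> J" and ey: "\<And>h. h \<in> H \<Longrightarrow> B h y = ch m0 h \<odot> y"
  shows "y \<in> S m0"
proof -
  have SC: "\<And>m z. m \<in> J \<Longrightarrow> z \<in> S m \<Longrightarrow> z \<in> carrier V" using S unfolding subsp_def by blast
  obtain F x where F: "finite F" "F \<subseteq> J" "\<forall>m\<in>J. x m \<in> S m" "\<forall>m\<in>J - F. x m = \<zero>" "y = (\<Oplus>m\<in>F. x m)"
    using vspan_Union_decomp[of J S y] S y by blast
  have xc: "\<And>m. m \<in> J \<Longrightarrow> x m \<in> carrier V" using F SC by blast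
  have yc: "y \<in> carrier V" using F xc by (auto intro!: finsum_closed)
  \<comment> \<open>Subtracting \<open>y\<close> in degree \<open>m0\<close> turns the decomposition
    of \<open>y\<close> into a vanishing sum of eigenvectors. The index \<open>m0\<close> may lie
    outside \<open>F\<close>, where its component is zero.\<close>
  define x' where "x' m = (if m = m0 then x m \<ominus> y else x m)" for m
  have x'c: "\<And>m. m \<in> J \<Longrightarrow> x' m \<in> carrier V" using xc yc by (auto simp: x'_def)
  have "\<forall>m\<in>insert m0 F. x' m = \<zero>"
  proof (rule eigen_indep[where H = H and B = B and ch = ch])
    show "finite (insert m0 F)" using F by simp
    show "x' m \<in> carrier V" if "m \<in> insert m0 F" for m using x'c that F m0 by auto
    show "B h (x' m) = ch m h \<odot> x' m" if "m \<in> insert m0 F" "h \<in> H" for m h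
    proof -
      have mJ: "m \<in> J" using that m0 F by auto
      have L: "lin_map V V (B h)" using B that by auto
      have "B h (x m) = ch m h \<odot> x m" using eig mJ F that by auto
      moreover have "B h (x m0 \<ominus> y) = ch m0 h \<odot> (x m0 \<ominus> y)"
      proof -
        have "B h (x m0) = ch m0 h \<odot> x m0" using eig m0 F that by auto
        then show ?thesis using lin_mapD[OF L] xc m0 yc ey that
          by (simp add: minus_eq' sm_add_r sm_assoc mult.commute)
      qed
      ultimately show ?thesis by (simp add: x'_def)
    qed
    show "(\<Oplus>m\<in>insert m0 F. x' m) = \<zero>"
    proof (rule vs_eqI)
      fix \<phi> assume \<phi>: "lf V \<phi>"
      have c: "\<And>m. m \<in> insert m0 F \<Longrightarrow> x' m \<in> carrier V" "\<And>m. m \<in> F \<Longrightarrow> x m \<in> carrier V" using x'c xc F m0 by auto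
      have "\<phi> (\<Oplus>m\<in>insert m0 F. x' m) = (\<Sum>m\<in>insert m0 F. \<phi> (x' m))" by (rule lf_finsum[OF \<phi> c(1)])
      also have "\<dots> = (\<Sum>m\<in>insert m0 F. \<phi> (x m) - (if m = m0 then \<phi> y else 0))"
        by (rule sum.cong) (use xc yc m0 in \<open>auto simp: x'_def lf_minus[OF \<phi>]\<close>)
      also have "\<dots> = (\<Sum>m\<in>insert m0 F. \<phi> (x m)) - \<phi> y" using F by (simp add: sum_subtractf)
      also have "(\<Sum>m\<in>insert m0 F. \<phi> (x m)) = (\<Sum>m\<in>F. \<phi> (x m))"
        by (rule sum.mono_neutral_right) (use F m0 lf_zero[OF \<phi>] in auto)
      finally show "\<phi> (\<Oplus>m\<in>insert m0 F. x' m) = \<phi> \<zero>" using F(5) lf_finsum[OF \<phi> c(2), of F] lf_zero[OF \<phi>] by simp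
    qed (use x'c F m0 in \<open>auto intro!: finsum_closed\<close>)
    show "\<exists>h\<in>H. ch m h \<noteq> ch m' h" if "m \<in> insert m0 F" "m' \<in> insert m0 F" "m \<noteq> m'" for m m'
      using that F m0 by (intro dist) auto
  qed (use B in auto)
  then have "x m0 \<ominus> y = \<zero>" by (auto simp: x'_def)
  then have "y = x m0" using xc[OF m0] yc by (metis a_inv_closed a_minus_def minus_equality minus_minus)
  then show ?thesis using F m0 by auto
qed

end

section \<open>Modules over a Lie algebra\<close>

lemmas (in vspace) zc = zero_closed
lemmas (in vspace) vac = a_ac
lemmas (in vspace) fsc = finsum_closed

lemma vspace_cong:
  assumes "vspace V" "carrier W = carrier V" "zero W = zero V" "add W = add V" "smult W = smult V"
  shows "vspace W"
proof -
  interpret vspace V by fact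
  have "abelian_group W"
    by (rule abelian_groupI) (auto simp: assms(2-5) a_ac intro!: bexI[of _ "\<ominus>\<^bsub>V\<^esub> _"] l_neg)
  then show ?thesis
    by (intro vspace.intro vspace_axioms.intro) (simp_all add: assms(2-5) sm_add_l sm_add_r sm_assoc)
qed

lemma vspace_cong_ops:
  assumes "vspace V" "carrier W = carrier V" "zero W = zero V" "add W = add V" "smult W = smult V"
  shows "\<lbrakk>x \<in> carrier V; y \<in> carrier V\<rbrakk> \<Longrightarrow> x \<ominus>\<^bsub>W\<^esub> y = x \<ominus>\<^bsub>V\<^esub> y"
    "(\<And>i. i \<in> A \<Longrightarrow> f i \<in> carrier V) \<Longrightarrow> finsum W f A = finsum V f A"
proof -
  interpret V: vspace V by fact
  interpret W: vspace W by (rule vspace_cong[OF assms])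
  show "\<lbrakk>x \<in> carrier V; y \<in> carrier V\<rbrakk> \<Longrightarrow> x \<ominus>\<^bsub>W\<^esub> y = x \<ominus>\<^bsub>V\<^esub> y"
    using V.minus_eq' W.minus_eq' assms by simp
  have lf: "lf V \<phi> = lf W \<phi>" for \<phi> by (simp add: lin_form_def assms)
  show "(\<And>i. i \<in> A \<Longrightarrow> f i \<in> carrier V) \<Longrightarrow> finsum W f A = finsum V f A"
    by (rule V.vs_eqI) (use assms W.finsum_closed[of f A] in \<open>auto simp: V.lf_finsum W.lf_finsum lf[symmetric] W.lf_finsum[unfolded lf[symmetric]] intro!: V.finsum_closed\<close>)
qed

lemma module_extend_simps [simp]:
  "carrier (module.extend M r) = carrier M" "zero (module.extend M r) = zero M"
  "add (module.extend M r) = add M" "smult (module.extend M r) = smult M"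
  "act (module.extend M (lmod.fields f)) = f"
  by (simp_all add: module.extend_def lmod.fields_def)

lemma lie_moduleI:
  assumes "lie_algebra L" "vspace V" "bilin L V V (act V)"
    "\<And>x y v. \<lbrakk>x \<in> carrier L; y \<in> carrier L; v \<in> carrier V\<rbrakk> \<Longrightarrow>
       act V (brack L x y) v = act V x (act V y v) \<ominus>\<^bsub>V\<^esub> act V y (act V x v)"
  shows "lie_module L V"
  using assms bilinD[OF assms(3)]
  by (intro lie_module.intro lie_module_axioms.intro) (auto simp: module_iff_vspace)

context lie_algebra
begin

lemma brack_bilin: "bilin L L L (brack L)"
  by (rule bilinI) (simp_all add: brack_closed brack_add_left brack_add_right brack_smult_left brack_smult_right)

lemma lin_map_ad: "x \<in> carrier L \<Longrightarrow> lin_map L L (brack L x)"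
  using brack_bilin by (auto simp: bilin_def)

lemma brack_anti: assumes x: "x \<in> carrier L" and y: "y \<in> carrier L" shows "brack L x y = (-1) \<odot>\<^bsub>L\<^esub> brack L y x"
proof (rule LV.vs_eqI)
  fix \<phi> assume \<phi>: "lf L \<phi>"
  have "brack L (x \<oplus>\<^bsub>L\<^esub> y) (x \<oplus>\<^bsub>L\<^esub> y) = (brack L x x \<oplus>\<^bsub>L\<^esub> brack L x y) \<oplus>\<^bsub>L\<^esub> (brack L y x \<oplus>\<^bsub>L\<^esub> brack L y y)"
    using x y by (simp add: brack_add_left brack_add_right brack_closed LV.vac)
  then have "brack L x y \<oplus>\<^bsub>L\<^esub> brack L y x = \<zero>\<^bsub>L\<^esub>"
    using x y brack_self[of "x \<oplus>\<^bsub>L\<^esub> y"] by (simp add: brack_self brack_closed)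
  from arg_cong[OF this, of \<phi>] show "\<phi> (brack L x y) = \<phi> ((-1) \<odot>\<^bsub>L\<^esub> brack L y x)"
    using x y by (simp add: LV.lf_simps[OF \<phi>] brack_closed eq_neg_iff_add_eq_0)
qed (use x y brack_closed in auto)

lemma jacobi_ad:
  assumes x: "x \<in> carrier L" and y: "y \<in> carrier L" and z: "z \<in> carrier L"
  shows "brack L x (brack L y z) = brack L (brack L x y) z \<oplus>\<^bsub>L\<^esub> brack L y (brack L x z)"
proof (rule LV.vs_eqI)
  fix \<phi> assume \<phi>: "lf L \<phi>"
  have 1: "brack L z (brack L x y) = (-1) \<odot>\<^bsub>L\<^esub> brack L (brack L x y) z" using x y z by (intro brack_anti brack_closed)
  have 2: "brack L y (brack L z x) = (-1) \<odot>\<^bsub>L\<^esub> brack L y (brack L x z)"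
    using x y z by (simp add: brack_anti[OF z x] brack_smult_right brack_closed)
  have "\<phi> (brack L x (brack L y z)) + \<phi> (brack L y (brack L z x)) + \<phi> (brack L z (brack L x y)) = 0"
    using arg_cong[OF jacobi[OF x y z], of \<phi>] x y z by (simp add: LV.lf_simps[OF \<phi>] brack_closed)
  then show "\<phi> (brack L x (brack L y z)) = \<phi> (brack L (brack L x y) z \<oplus>\<^bsub>L\<^esub> brack L y (brack L x z))"
    using x y z unfolding 1 2 by (simp add: LV.lf_simps[OF \<phi>] brack_closed algebra_simps)
qed (use x y z brack_closed in auto)

lemma brack_zero: "x \<in> carrier L \<Longrightarrow> brack L x \<zero>\<^bsub>L\<^esub> = \<zero>\<^bsub>L\<^esub>" "x \<in> carrier L \<Longrightarrow> brack L \<zero>\<^bsub>L\<^esub> x = \<zero>\<^bsub>L\<^esub>"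
proof -
  assume x: "x \<in> carrier L"
  show "brack L x \<zero>\<^bsub>L\<^esub> = \<zero>\<^bsub>L\<^esub>" using brack_smult_right[OF x LV.zc, of 0] x brack_closed by simp
  show "brack L \<zero>\<^bsub>L\<^esub> x = \<zero>\<^bsub>L\<^esub>" using brack_smult_left[OF LV.zc x, of 0] x brack_closed by simp
qed

lemma lie_subalgebra_iff: "lie_subalgebra L S \<longleftrightarrow> subsp L S \<and> (\<forall>x\<in>S. \<forall>y\<in>S. brack L x y \<in> S)"
  by (simp add: lie_subalgebra_def LV.submodule_iff)

lemma lie_ideal_iff: "lie_ideal L S \<longleftrightarrow> subsp L S \<and> (\<forall>x\<in>carrier L. \<forall>y\<in>S. brack L x y \<in> S)"
  by (simp add: lie_ideal_def LV.submodule_iff)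

text \<open>The normalizer of a subspace is a subalgebra: hence it is enough to test an ideal on generators.\<close>

lemma normalizer_subalgebra:
  assumes S: "subsp L S"
  shows "lie_subalgebra L {x \<in> carrier L. \<forall>y\<in>S. brack L x y \<in> S}"
  unfolding lie_subalgebra_iff
proof (intro conjI ballI)
  have SC: "y \<in> carrier L" if "y \<in> S" for y using subspD(1)[OF S that] .
  have mn: "x \<oplus>\<^bsub>L\<^esub> (-1) \<odot>\<^bsub>L\<^esub> y \<in> S" if "x \<in> S" "y \<in> S" for x y using that subspD[OF S] by auto
  show "subsp L {x \<in> carrier L. \<forall>y\<in>S. brack L x y \<in> S}"
    using SC subspD[OF S] by (auto simp: subsp_def brack_add_left brack_smult_left brack_zero)
  fix x y assume x: "x \<in> {x \<in> carrier L. \<forall>y\<in>S. brack L x y \<in> S}" and y: "y \<in> {x \<in> carrier L. \<forall>y\<in>S. brack L x y \<in> S}"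
  have "brack L (brack L x y) z \<in> S" if z: "z \<in> S" for z
  proof -
    have "brack L (brack L x y) z = brack L x (brack L y z) \<oplus>\<^bsub>L\<^esub> (-1) \<odot>\<^bsub>L\<^esub> brack L y (brack L x z)"
    proof (rule LV.vs_eqI)
      fix \<phi> assume \<phi>: "lf L \<phi>"
      show "\<phi> (brack L (brack L x y) z) = \<phi> (brack L x (brack L y z) \<oplus>\<^bsub>L\<^esub> (-1) \<odot>\<^bsub>L\<^esub> brack L y (brack L x z))"
        using x y SC[OF z] by (simp add: jacobi_ad[of x y z] LV.lf_simps[OF \<phi>] brack_closed)
    qed (use x y SC[OF z] brack_closed in auto)
    then show ?thesis using x y z mn by auto
  qed
  then show "brack L x y \<in> {x \<in> carrier L. \<forall>y\<in>S. brack L x y \<in> S}" using x y brack_closed by auto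
qed

text \<open>Packaging the adjoint action as a module makes the lemmas on modules (powers of an
  operator, sl2 strings) available for iterated brackets.\<close>

definition adj :: "('g, 'g) lmod" where
  "adj = \<lparr>carrier = carrier L, mult = undefined, one = undefined, zero = zero L, add = add L, smult = smult L, act = brack L\<rparr>"

lemma adj_simps: "carrier adj = carrier L" "zero adj = zero L" "add adj = add L" "smult adj = smult L" "act adj = brack L"
  by (simp_all add: adj_def)

lemma adjoint_module: "lie_module L adj"
proof (rule lie_moduleI)
  show "lie_algebra L" by (rule lie_algebra_axioms)
  show V: "vspace adj" by (rule vspace_cong[OF LV.vspace_axioms]) (simp_all add: adj_simps)
  show "bilin L adj adj (act adj)" using brack_bilin by (simp add: bilin_def lin_map_def adj_simps)
  fix x y v assume x: "x \<in> carrier L" and y: "y \<in> carrier L" and v: "v \<in> carrier adj"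
  have vL: "v \<in> carrier L" using v by (simp add: adj_simps)
  have "brack L (brack L x y) v = brack L x (brack L y v) \<ominus>\<^bsub>L\<^esub> brack L y (brack L x v)"
  proof (rule LV.vs_eqI)
    fix \<phi> assume \<phi>: "lf L \<phi>"
    show "\<phi> (brack L (brack L x y) v) = \<phi> (brack L x (brack L y v) \<ominus>\<^bsub>L\<^esub> brack L y (brack L x v))"
      using x y vL by (simp add: jacobi_ad[of x y v] LV.lf_simps[OF \<phi>] brack_closed)
  qed (use x y vL brack_closed in auto)
  then show "act adj (brack L x y) v = act adj x (act adj y v) \<ominus>\<^bsub>adj\<^esub> act adj y (act adj x v)"
    using x y vL vspace_cong_ops(1)[OF LV.vspace_axioms, of adj] by (simp add: adj_simps brack_closed)
qed

end

context lie_module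
begin

lemma act_bilin: "bilin L V V (act V)"
  by (rule bilinI) (simp_all add: act_closed act_add_left act_add_right act_smult_left act_smult_right)

lemma lin_map_act: "x \<in> carrier L \<Longrightarrow> lin_map V V (act V x)"
  using act_bilin by (auto simp: bilin_def)

lemma act_zero: "x \<in> carrier L \<Longrightarrow> act V x \<zero>\<^bsub>V\<^esub> = \<zero>\<^bsub>V\<^esub>" "v \<in> carrier V \<Longrightarrow> act V \<zero>\<^bsub>L\<^esub> v = \<zero>\<^bsub>V\<^esub>"
proof -
  show "act V x \<zero>\<^bsub>V\<^esub> = \<zero>\<^bsub>V\<^esub>" if x: "x \<in> carrier L"
    using act_smult_right[OF x VV.zc, of 0] x act_closed by simp
  show "act V \<zero>\<^bsub>L\<^esub> v = \<zero>\<^bsub>V\<^esub>" if v: "v \<in> carrier V"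
    using act_smult_left[OF LV.zc v, of 0] v act_closed by simp
qed

lemma act_comm:
  assumes x: "x \<in> carrier L" and y: "y \<in> carrier L" and v: "v \<in> carrier V"
  shows "act V x (act V y v) = act V (brack L x y) v \<oplus>\<^bsub>V\<^esub> act V y (act V x v)"
  using x y v by (auto simp: act_brack VV.lf_simps act_closed intro!: VV.vs_eqI)

lemma act_pow_closed: "x \<in> carrier L \<Longrightarrow> v \<in> carrier V \<Longrightarrow> (act V x ^^ n) v \<in> carrier V"
  by (induct n) (auto simp: act_closed)

lemma act_pow_zero: "x \<in> carrier L \<Longrightarrow> (act V x ^^ n) \<zero>\<^bsub>V\<^esub> = \<zero>\<^bsub>V\<^esub>"
  by (induct n) (auto simp: act_zero)

lemma act_pow_mono:
  assumes "x \<in> carrier L" "(act V x ^^ n) v = \<zero>\<^bsub>V\<^esub>" "n \<le> m" shows "(act V x ^^ m) v = \<zero>\<^bsub>V\<^esub>"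
  using assms act_pow_zero[of x "m - n"] funpow_add[of "m - n" n "act V x"] by simp

lemma lin_map_act_pow: "x \<in> carrier L \<Longrightarrow> lin_map V V (act V x ^^ n)"
proof (induct n)
  case 0 then show ?case by (simp add: lin_map_def)
next
  case (Suc n) then show ?case using lin_map_comp[OF Suc(1) lin_map_act[of x]] by (simp add: o_def)
qed

text \<open>By the Leibniz rule one factor \<open>f\<close> moves either into the bracket with
  \<open>x\<close> or onto \<open>v\<close>. Each case lowers one of the two exponents, so induction
  on \<open>p + q\<close> replaces the binomial formula.\<close>

lemma ad_nilp_step:
  assumes f: "f \<in> carrier L" and x: "x \<in> carrier L" and v: "v \<in> carrier V"
    and p: "(brack L f ^^ p) x = \<zero>\<^bsub>L\<^esub>" and q: "(act V f ^^ q) v = \<zero>\<^bsub>V\<^esub>"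
  shows "(act V f ^^ (p + q)) (act V x v) = \<zero>\<^bsub>V\<^esub>"
  using x v p q
proof (induct "p + q" arbitrary: p q x v)
  case 0 then show ?case by (simp add: act_zero)
next
  case (Suc n)
  show ?case
  proof (cases "p = 0 \<or> q = 0")
    case True then show ?thesis using Suc.prems f by (auto simp: act_zero act_pow_zero)
  next
    case False
    then obtain p' q' where p': "p = Suc p'" and q': "q = Suc q'" by (metis not0_implies_Suc)
    have 1: "(act V f ^^ (p' + q)) (act V (brack L f x) v) = \<zero>\<^bsub>V\<^esub>"
      by (rule Suc.hyps(1)) (use Suc.hyps(2) Suc.prems p' f in \<open>auto simp: brack_closed funpow_swap1\<close>)
    have 2: "(act V f ^^ (p + q')) (act V x (act V f v)) = \<zero>\<^bsub>V\<^esub>"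
      by (rule Suc.hyps(1)) (use Suc.hyps(2) Suc.prems q' f in \<open>auto simp: act_closed funpow_swap1\<close>)
    have e: "p + q = Suc (p' + q)" "p + q' = p' + q" using p' q' by auto
    note L = lin_mapD[OF lin_map_act_pow[OF f, of "p' + q"]]
    have "(act V f ^^ (p + q)) (act V x v) = (act V f ^^ (p' + q)) (act V f (act V x v))"
      unfolding e by (simp add: funpow_swap1)
    also have "\<dots> = \<zero>\<^bsub>V\<^esub>" using 1 2 Suc.prems(1,2) f L by (simp add: act_comm[of f x v] act_closed brack_closed e)
    finally show ?thesis .
  qed
qed

lemma lie_submodule_iff: "lie_submodule L V N \<longleftrightarrow> subsp V N \<and> (\<forall>x\<in>carrier L. \<forall>v\<in>N. act V x v \<in> N)"
  by (simp add: lie_submodule_def VV.submodule_iff)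

lemma lie_submodule_carrier: "lie_submodule L V (carrier V)"
  using act_closed by (auto simp: lie_submodule_iff VV.subsp_carrier)

lemma gen_submodule_props:
  assumes "S \<subseteq> carrier V"
  shows "lie_submodule L V (gen_submodule L V S)" "S \<subseteq> gen_submodule L V S"
    "\<lbrakk>lie_submodule L V N; S \<subseteq> N\<rbrakk> \<Longrightarrow> gen_submodule L V S \<subseteq> N"
proof -
  have "gen_submodule L V S \<subseteq> carrier V" unfolding gen_submodule_def using assms lie_submodule_carrier by blast
  then show "lie_submodule L V (gen_submodule L V S)"
    unfolding lie_submodule_iff subsp_def by (auto simp: gen_submodule_def lie_submodule_iff subsp_def)
qed (auto simp: gen_submodule_def)

lemma lie_submodule_Inter:
  assumes "\<And>N. N \<in> X \<Longrightarrow> lie_submodule L V N" "X \<noteq> {}"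
  shows "lie_submodule L V (\<Inter>X)"
  using assms unfolding lie_submodule_iff subsp_def by blast

lemma quot_simps:
  "carrier (lmod_quot V N) = (\<lambda>x. N +>\<^bsub>V\<^esub> x) ` carrier V"
  by (simp add: lmod_quot_def VV.vq_carrier)

lemma quot_ops:
  assumes N: "lie_submodule L V N"
  shows "\<zero>\<^bsub>lmod_quot V N\<^esub> = N +>\<^bsub>V\<^esub> \<zero>\<^bsub>V\<^esub>"
    "\<lbrakk>u \<in> carrier V; v \<in> carrier V\<rbrakk> \<Longrightarrow> (N +>\<^bsub>V\<^esub> u) \<oplus>\<^bsub>lmod_quot V N\<^esub> (N +>\<^bsub>V\<^esub> v) = N +>\<^bsub>V\<^esub> (u \<oplus>\<^bsub>V\<^esub> v)"
    "u \<in> carrier V \<Longrightarrow> c \<odot>\<^bsub>lmod_quot V N\<^esub> (N +>\<^bsub>V\<^esub> u) = N +>\<^bsub>V\<^esub> (c \<odot>\<^bsub>V\<^esub> u)"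
    "\<lbrakk>x \<in> carrier L; u \<in> carrier V\<rbrakk> \<Longrightarrow> act (lmod_quot V N) x (N +>\<^bsub>V\<^esub> u) = N +>\<^bsub>V\<^esub> act V x u"
    "u \<in> carrier V \<Longrightarrow> N +>\<^bsub>V\<^esub> u = \<zero>\<^bsub>lmod_quot V N\<^esub> \<longleftrightarrow> u \<in> N"
proof -
  have S: "subsp V N" using N lie_submodule_iff by blast
  show z: "\<zero>\<^bsub>lmod_quot V N\<^esub> = N +>\<^bsub>V\<^esub> \<zero>\<^bsub>V\<^esub>" by (simp add: lmod_quot_def VV.vq_zero[OF S])
  show "\<lbrakk>u \<in> carrier V; v \<in> carrier V\<rbrakk> \<Longrightarrow> (N +>\<^bsub>V\<^esub> u) \<oplus>\<^bsub>lmod_quot V N\<^esub> (N +>\<^bsub>V\<^esub> v) = N +>\<^bsub>V\<^esub> (u \<oplus>\<^bsub>V\<^esub> v)"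
    by (simp add: lmod_quot_def VV.vq_add[OF S])
  show "u \<in> carrier V \<Longrightarrow> c \<odot>\<^bsub>lmod_quot V N\<^esub> (N +>\<^bsub>V\<^esub> u) = N +>\<^bsub>V\<^esub> (c \<odot>\<^bsub>V\<^esub> u)"
    by (simp add: lmod_quot_def VV.vq_smult[OF S])
  show "u \<in> carrier V \<Longrightarrow> N +>\<^bsub>V\<^esub> u = \<zero>\<^bsub>lmod_quot V N\<^esub> \<longleftrightarrow> u \<in> N"
    unfolding z using VV.coset_eq_iff[OF S, of u "\<zero>\<^bsub>V\<^esub>"] VV.minus_eq'[of u "\<zero>\<^bsub>V\<^esub>"] by simp
  assume x: "x \<in> carrier L" and u: "u \<in> carrier V"
  have "act V x v \<ominus>\<^bsub>V\<^esub> act V x u = act V x (v \<ominus>\<^bsub>V\<^esub> u)" if "v \<in> carrier V" for v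
    using x u that by (simp add: VV.minus_eq' act_closed act_add_right act_smult_right)
  then have "(\<Union>v\<in>N +>\<^bsub>V\<^esub> u. N +>\<^bsub>V\<^esub> act V x v) = N +>\<^bsub>V\<^esub> act V x u"
    using x N by (intro VV.coset_UN[OF S u]) (auto simp: act_closed lie_submodule_iff)
  then show "act (lmod_quot V N) x (N +>\<^bsub>V\<^esub> u) = N +>\<^bsub>V\<^esub> act V x u" by (simp add: lmod_quot_def)
qed

lemma quot_vspace:
  assumes N: "lie_submodule L V N" shows "vspace (lmod_quot V N)"
  using N by (intro vspace_cong[OF VV.vspace_vquot[of N]]) (simp_all add: lmod_quot_def lie_submodule_iff)

lemma quot_minus:
  assumes N: "lie_submodule L V N" and u: "u \<in> carrier V" and v: "v \<in> carrier V"
  shows "(N +>\<^bsub>V\<^esub> u) \<ominus>\<^bsub>lmod_quot V N\<^esub> (N +>\<^bsub>V\<^esub> v) = N +>\<^bsub>V\<^esub> (u \<ominus>\<^bsub>V\<^esub> v)"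
proof -
  interpret Q: vspace "lmod_quot V N" by (rule quot_vspace[OF N])
  show ?thesis using u v by (simp add: Q.minus_eq' VV.minus_eq' quot_simps quot_ops[OF N])
qed

lemma quot_module:
  assumes N: "lie_submodule L V N" shows "lie_module L (lmod_quot V N)"
proof (rule lie_moduleI[OF lie_algebra_axioms quot_vspace[OF N]])
  show "bilin L (lmod_quot V N) (lmod_quot V N) (act (lmod_quot V N))"
    by (rule bilinI) (auto simp: quot_simps quot_ops[OF N] act_closed act_add_left act_add_right act_smult_left act_smult_right)
  show "act (lmod_quot V N) (brack L x y) v = act (lmod_quot V N) x (act (lmod_quot V N) y v) \<ominus>\<^bsub>lmod_quot V N\<^esub> act (lmod_quot V N) y (act (lmod_quot V N) x v)"
    if "x \<in> carrier L" "y \<in> carrier L" "v \<in> carrier (lmod_quot V N)" for x y v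
    using that by (auto simp: quot_simps quot_ops(4)[OF N] quot_minus[OF N] act_closed brack_closed simp flip: act_brack)
qed

end

definition lhom :: "('x, 'm) lie_scheme \<Rightarrow> ('x, 'v, 'k) lmod_scheme \<Rightarrow> ('x, 'w, 'j) lmod_scheme \<Rightarrow> ('v \<Rightarrow> 'w) \<Rightarrow> bool" where
  "lhom L V W f \<longleftrightarrow> lin_map V W f \<and> (\<forall>x\<in>carrier L. \<forall>v\<in>carrier V. f (act V x v) = act W x (f v))"

lemma lhomD: "lhom L V W f \<Longrightarrow> lin_map V W f"
  "lhom L V W f \<Longrightarrow> x \<in> carrier L \<Longrightarrow> v \<in> carrier V \<Longrightarrow> f (act V x v) = act W x (f v)"
  by (auto simp: lhom_def)

lemma lin_map_zero: "lin_map V W f \<Longrightarrow> vspace V \<Longrightarrow> vspace W \<Longrightarrow> f \<zero>\<^bsub>V\<^esub> = \<zero>\<^bsub>W\<^esub>"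
proof -
  assume f: "lin_map V W f" and "vspace V" "vspace W"
  interpret V: vspace V by fact
  interpret W: vspace W by fact
  show ?thesis using lin_mapD(3)[OF f V.zero_closed, of 0] lin_mapD(1)[OF f V.zero_closed] by simp
qed

context lie_module
begin

lemma lhom_kernel:
  assumes W: "lie_module L W" and f: "lhom L V W f"
  shows "lie_submodule L V {v \<in> carrier V. f v = \<zero>\<^bsub>W\<^esub>}"
proof -
  interpret W: lie_module L W by fact
  note F = lin_mapD[OF lhomD(1)[OF f]] lhomD(2)[OF f]
  show ?thesis unfolding lie_submodule_iff subsp_def
    using F lin_map_zero[OF lhomD(1)[OF f] VV.vspace_axioms W.VV.vspace_axioms]
    by (auto simp: act_closed W.act_zero)
qed

lemma quot_lift:
  assumes N: "lie_submodule L V N" and W: "lie_module L W" and f: "lhom L V W f" and k: "\<And>v. v \<in> N \<Longrightarrow> f v = \<zero>\<^bsub>W\<^esub>"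
  shows "\<exists>g. lhom L (lmod_quot V N) W g \<and> (\<forall>v\<in>carrier V. g (N +>\<^bsub>V\<^esub> v) = f v)"
proof -
  interpret W: lie_module L W by fact
  have S: "subsp V N" using N lie_submodule_iff by blast
  note F = lin_mapD[OF lhomD(1)[OF f]] lhomD(2)[OF f]
  have g: "f (SOME p. p \<in> N +>\<^bsub>V\<^esub> x) = f x" if "x \<in> carrier V" for x
    by (rule VV.lin_map_lift(2)[OF S W.VV.vspace_axioms lhomD(1)[OF f] k that])
  show ?thesis
    by (rule exI[of _ "\<lambda>X. f (SOME p. p \<in> X)"])
       (auto simp: lhom_def g quot_simps quot_ops[OF N] F act_closed intro!: lin_mapI)
qed

end

section \<open>Free algebras\<close>

text \<open>The indicator functions among the \<open>g\<close> recover the coefficients. With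
  \<open>csum_mult\<close>, identities in the free algebra become identities between iterated sums
  over words.\<close>

lemma pm_eqI: fixes p q :: "'x \<Rightarrow>\<^sub>0 complex" shows "(\<And>g. csum g p = csum g q) \<Longrightarrow> p = q"
proof (rule poly_mapping_eqI)
  fix k :: 'x assume *: "\<And>g. csum g p = csum g q"
  have "csum (\<lambda>x. if x = k then 1 else 0) r = Poly_Mapping.lookup r k" for r
    by (simp add: csum_def if_distrib in_keys_iff cong: if_cong)
  then show "Poly_Mapping.lookup p k = Poly_Mapping.lookup q k" using * by metis
qed

lemma csum_sum: "csum g (\<Sum>i\<in>A. f i) = (\<Sum>i\<in>A. csum g (f i))"
  by (induct A rule: infinite_finite_induct) (auto simp: csum_add)

lemma csum_const: "csum (\<lambda>u. a * g u) p = a * csum g p" "csum (\<lambda>u. g u * a) p = csum g p * a"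
  by (simp_all add: csum_def sum_distrib_left sum_distrib_right mult.left_commute mult.assoc)

lemma csum_plus: "csum (\<lambda>u. g u + h u) p = csum g p + csum h p"
  by (simp add: csum_def sum.distrib algebra_simps)

lemma free_alg_simps:
  "carrier (free_alg S) = {p. keys p \<subseteq> lists S}" "\<zero>\<^bsub>free_alg S\<^esub> = 0"
  "p \<oplus>\<^bsub>free_alg S\<^esub> q = p + q" "c \<odot>\<^bsub>free_alg S\<^esub> p = Poly_Mapping.map ((*) c) p"
  "\<one>\<^bsub>free_alg S\<^esub> = single [] 1"
  by (simp_all add: free_alg_def)

lemma csum_mult: "csum g (p \<otimes>\<^bsub>free_alg S\<^esub> q) = csum (\<lambda>u. csum (\<lambda>w. g (u @ w)) q) p"
  by (simp add: free_alg_def csum_sum csum_def[of _ p] csum_def[of _ q] sum_distrib_left mult.assoc)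

lemma free_alg_mult_closed:
  assumes "keys p \<subseteq> lists S" "keys q \<subseteq> lists S"
  shows "keys (p \<otimes>\<^bsub>free_alg S\<^esub> q) \<subseteq> lists S"
proof
  fix z assume z: "z \<in> keys (p \<otimes>\<^bsub>free_alg S\<^esub> q)"
  show "z \<in> lists S"
  proof (rule ccontr)
    assume n: "z \<notin> lists S"
    define g where "g x = (if x = z then 1 else 0 :: complex)" for x
    have "Poly_Mapping.lookup (p \<otimes>\<^bsub>free_alg S\<^esub> q) z = csum g (p \<otimes>\<^bsub>free_alg S\<^esub> q)"
      by (simp add: csum_def g_def if_distrib in_keys_iff cong: if_cong)
    also have "\<dots> = csum (\<lambda>u. csum (\<lambda>w. 0) q) p" unfolding csum_mult
    proof (intro csum_cong)
      fix u w assume "u \<in> keys p" "w \<in> keys q"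
      then have "u @ w \<in> lists S" using assms by (metis append_in_lists_conv subsetD)
      then show "g (u @ w) = 0" using n by (auto simp: g_def)
    qed
    also have "\<dots> = 0" by (simp add: csum_def)
    finally show False using z by (simp add: in_keys_iff)
  qed
qed

lemma vspace_free_alg: "vspace (free_alg S)"
  by (rule vspace_free_gen[of _ "lists S"]) (simp_all add: free_alg_def)

lemma ring_free_alg: "ring (free_alg S)"
proof (rule ringI)
  interpret vspace "free_alg S" by (rule vspace_free_alg)
  show "abelian_group (free_alg S)" by (rule abelian_group_axioms)
  show "Group.monoid (free_alg S)"
    by (rule monoidI) (auto simp: free_alg_simps(1,5) free_alg_mult_closed csum_mult intro!: pm_eqI simp del: subset_eq)
qed (auto simp: free_alg_simps(3) csum_mult csum_add csum_plus intro!: pm_eqI)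

section \<open>Enveloping algebras\<close>

context lie_algebra
begin

abbreviation FA where "FA \<equiv> free_alg (carrier L)"
abbreviation UL where "UL \<equiv> uea L"
definition UJ where "UJ = genideal FA (uea_rels L)"
definition uq where "uq p = UJ +>\<^bsub>FA\<^esub> p"

sublocale FR: ring FA by (rule ring_free_alg)
sublocale FV: vspace FA by (rule vspace_free_alg)

lemma keys_rel: "x \<in> carrier L \<Longrightarrow> single [x] (c::complex) \<in> carrier FA"
  "\<lbrakk>x \<in> carrier L; y \<in> carrier L\<rbrakk> \<Longrightarrow> single [x, y] (c::complex) \<in> carrier FA"
  "single [] (c::complex) \<in> carrier FA"
  by (auto simp: free_alg_simps)

lemma FA_diff: "\<lbrakk>p \<in> carrier FA; q \<in> carrier FA\<rbrakk> \<Longrightarrow> p - q \<in> carrier FA"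
  using keys_diff[of p q] by (auto simp: free_alg_simps)

lemma rels_sub: "uea_rels L \<subseteq> carrier FA"
  unfolding uea_rels_def by (auto intro!: FA_diff keys_rel simp: brack_closed)

lemma UJ_ideal: "ideal UJ FA" unfolding UJ_def by (rule FR.genideal_ideal[OF rels_sub])
lemma UJ_rels: "uea_rels L \<subseteq> UJ" unfolding UJ_def by (rule FR.genideal_self[OF rels_sub])

text \<open>A scalar multiple is a product with a multiple of the empty word, hence a ring ideal of
  the free algebra is automatically a subspace.\<close>

lemma smult_as_mult: "c \<odot>\<^bsub>FA\<^esub> p = single [] c \<otimes>\<^bsub>FA\<^esub> p"
  by (rule pm_eqI) (simp add: free_alg_simps csum_mult csum_scale)

lemma UJ_subsp: "subsp FA UJ"
proof -
  interpret ideal UJ FA by (rule UJ_ideal)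
  show ?thesis unfolding subsp_def smult_as_mult
    using Icarr additive_subgroup.zero_closed[OF is_additive_subgroup] additive_subgroup.a_closed[OF is_additive_subgroup] I_l_closed keys_rel(3)
    by (simp add: subset_iff)
qed

lemma ideal_of_subsp:
  assumes "subsp FA N" "\<And>p q. \<lbrakk>p \<in> carrier FA; q \<in> N\<rbrakk> \<Longrightarrow> p \<otimes>\<^bsub>FA\<^esub> q \<in> N" "\<And>p q. \<lbrakk>p \<in> carrier FA; q \<in> N\<rbrakk> \<Longrightarrow> q \<otimes>\<^bsub>FA\<^esub> p \<in> N"
  shows "ideal N FA"
proof (rule idealI)
  show "ring FA" by (rule ring_free_alg)
  show "subgroup N (add_monoid FA)" using assms(1) FV.submodule_iff by (auto simp: submodule_def)
qed (use assms in auto)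

lemma UJ_least: "\<lbrakk>ideal N FA; uea_rels L \<subseteq> N\<rbrakk> \<Longrightarrow> UJ \<subseteq> N"
  unfolding UJ_def by (rule FR.genideal_minimal)

lemma UL_eq: "UL = vquot FA UJ" by (simp add: uea_def UJ_def)

sublocale UV: vspace UL unfolding UL_eq by (rule FV.vspace_vquot[OF UJ_subsp])

lemma UL_carrier: "carrier UL = uq ` carrier FA" by (simp add: UL_eq FV.vq_carrier uq_def[abs_def])

lemma uq_lin: "lin_map FA UL uq"
  unfolding UL_eq uq_def[abs_def] by (rule FV.lin_map_coset[OF UJ_subsp])

lemmas uqD = lin_mapD[OF uq_lin]

lemma uq_mult: assumes "p \<in> carrier FA" "q \<in> carrier FA" shows "uq p \<otimes>\<^bsub>UL\<^esub> uq q = uq (p \<otimes>\<^bsub>FA\<^esub> q)"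
  using ideal.rcoset_mult_add[OF UJ_ideal assms] by (simp add: UL_eq vquot_def uq_def)

lemma uq_one: "\<one>\<^bsub>UL\<^esub> = uq (single [] 1)"
  by (simp add: UL_eq vquot_def uq_def free_alg_simps(5))

lemma uq_incl: "uea_incl L x = uq (single [x] 1)"
  by (simp add: uea_incl_def uq_def UJ_def)

lemma uq_cong: "\<lbrakk>p \<in> carrier FA; q \<in> carrier FA; p - q \<in> UJ\<rbrakk> \<Longrightarrow> uq p = uq q"
proof -
  assume p: "p \<in> carrier FA" and q: "q \<in> carrier FA" and d: "p - q \<in> UJ"
  have "p \<ominus>\<^bsub>FA\<^esub> q = p - q"
    unfolding FV.minus_eq'[OF p q] by (rule pm_eqI) (simp only: free_alg_simps csum_add csum_scale csum_diff, simp)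
  then show ?thesis unfolding uq_def using FV.coset_eq_iff[OF UJ_subsp p q] d by simp
qed

lemma incl_closed [simp]: "x \<in> carrier L \<Longrightarrow> uea_incl L x \<in> carrier UL"
  using uqD(1)[OF keys_rel(1)] by (simp add: uq_incl)

lemma one_closed_UL [simp]: "\<one>\<^bsub>UL\<^esub> \<in> carrier UL" using uqD(1)[OF keys_rel(3)] by (simp add: uq_one)

lemma mult_closed_UL [simp]: "\<lbrakk>u \<in> carrier UL; v \<in> carrier UL\<rbrakk> \<Longrightarrow> u \<otimes>\<^bsub>UL\<^esub> v \<in> carrier UL"
  by (auto simp: UL_carrier uq_mult intro!: imageI FR.m_closed)

lemma mult_assoc_UL: "\<lbrakk>u \<in> carrier UL; v \<in> carrier UL; w \<in> carrier UL\<rbrakk> \<Longrightarrow> u \<otimes>\<^bsub>UL\<^esub> v \<otimes>\<^bsub>UL\<^esub> w = u \<otimes>\<^bsub>UL\<^esub> (v \<otimes>\<^bsub>UL\<^esub> w)"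
  by (auto simp: UL_carrier uq_mult FR.m_assoc FR.m_closed)

lemma one_UL [simp]: "u \<in> carrier UL \<Longrightarrow> \<one>\<^bsub>UL\<^esub> \<otimes>\<^bsub>UL\<^esub> u = u" "u \<in> carrier UL \<Longrightarrow> u \<otimes>\<^bsub>UL\<^esub> \<one>\<^bsub>UL\<^esub> = u"
  using FR.one_closed by (auto simp: UL_carrier uq_mult uq_one FR.l_one[unfolded free_alg_simps(5)] FR.r_one[unfolded free_alg_simps(5)] keys_rel(3))

lemma mult_bilin_UL: "bilin UL UL UL (mult UL)"
proof (rule bilinI)
  fix x y c assume "x \<in> carrier UL" "y \<in> carrier UL"
  then obtain p q where p: "p \<in> carrier FA" "x = uq p" and q: "q \<in> carrier FA" "y = uq q" by (auto simp: UL_carrier)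
  have 1: "(c \<odot>\<^bsub>FA\<^esub> p) \<otimes>\<^bsub>FA\<^esub> q = c \<odot>\<^bsub>FA\<^esub> (p \<otimes>\<^bsub>FA\<^esub> q)" "p \<otimes>\<^bsub>FA\<^esub> (c \<odot>\<^bsub>FA\<^esub> q) = c \<odot>\<^bsub>FA\<^esub> (p \<otimes>\<^bsub>FA\<^esub> q)"
    by (auto intro!: pm_eqI simp: free_alg_simps(4) csum_mult csum_scale csum_const)
  show "(c \<odot>\<^bsub>UL\<^esub> x) \<otimes>\<^bsub>UL\<^esub> y = c \<odot>\<^bsub>UL\<^esub> (x \<otimes>\<^bsub>UL\<^esub> y)" "x \<otimes>\<^bsub>UL\<^esub> (c \<odot>\<^bsub>UL\<^esub> y) = c \<odot>\<^bsub>UL\<^esub> (x \<otimes>\<^bsub>UL\<^esub> y)"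
    using p q 1 by (simp_all add: uq_mult FR.m_closed flip: uqD(3))
qed (auto simp: UL_carrier uq_mult FR.m_closed FR.l_distr FR.r_distr simp flip: uqD(2))

lemmas multD_UL = bilinD[OF mult_bilin_UL]

lemma incl_lin: "lin_map L UL (uea_incl L)"
proof (rule lin_mapI)
  fix x y c assume x: "x \<in> carrier L"
  have "uq (single [c \<odot>\<^bsub>L\<^esub> x] 1) = uq (single [x] c)"
    by (rule uq_cong) (use x UJ_rels in \<open>auto intro!: keys_rel simp: uea_rels_def\<close>)
  also have "single [x] c = c \<odot>\<^bsub>FA\<^esub> single [x] 1"
    by (rule pm_eqI) (simp add: free_alg_simps csum_scale)
  finally show "uea_incl L (c \<odot>\<^bsub>L\<^esub> x) = c \<odot>\<^bsub>UL\<^esub> uea_incl L x" using uqD(3)[OF keys_rel(1)[OF x]] by (simp add: uq_incl)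
  assume y: "y \<in> carrier L"
  have "single [x \<oplus>\<^bsub>L\<^esub> y] 1 - single [x] 1 - single [y] (1::complex) \<in> uea_rels L"
    unfolding uea_rels_def using x y by blast
  then have "uq (single [x \<oplus>\<^bsub>L\<^esub> y] 1) = uq (single [x] 1 \<oplus>\<^bsub>FA\<^esub> single [y] 1)"
    using x y UJ_rels by (intro uq_cong keys_rel FR.a_closed) (auto simp: free_alg_simps(3) algebra_simps)
  then show "uea_incl L (x \<oplus>\<^bsub>L\<^esub> y) = uea_incl L x \<oplus>\<^bsub>UL\<^esub> uea_incl L y"
    using uqD(2)[OF keys_rel(1)[OF x] keys_rel(1)[OF y]] by (simp add: uq_incl)
qed simp

lemma incl_brack:
  assumes x: "x \<in> carrier L" and y: "y \<in> carrier L"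
  shows "uea_incl L (brack L x y) \<oplus>\<^bsub>UL\<^esub> uea_incl L y \<otimes>\<^bsub>UL\<^esub> uea_incl L x = uea_incl L x \<otimes>\<^bsub>UL\<^esub> uea_incl L y"
proof -
  have m: "single [x] 1 \<otimes>\<^bsub>FA\<^esub> single [y] 1 = single [x, y] 1" for x y
    by (rule pm_eqI) (simp add: csum_mult)
  have "single [x, y] 1 - single [y, x] 1 - single [brack L x y] (1::complex) \<in> uea_rels L"
    unfolding uea_rels_def using x y by blast
  then have "uq (single [x, y] 1) = uq (single [brack L x y] 1 \<oplus>\<^bsub>FA\<^esub> single [y, x] 1)"
    using x y brack_closed UJ_rels by (intro uq_cong keys_rel FR.a_closed) (auto simp: free_alg_simps(3) algebra_simps)
  then show ?thesis using x y
    by (simp add: uq_incl uq_mult keys_rel m brack_closed flip: uqD(2))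
qed

lemma uq_lsum: "p \<in> carrier FA \<Longrightarrow> uq p = lsum UL (\<lambda>w. uq (single w 1)) p"
proof (rule UV.vs_eqI)
  assume p: "p \<in> carrier FA"
  then have k: "\<And>w. w \<in> keys p \<Longrightarrow> single w 1 \<in> carrier FA" by (auto simp: free_alg_simps)
  then have k': "\<And>w. w \<in> keys p \<Longrightarrow> uq (single w 1) \<in> carrier UL" using uqD(1) by blast
  show "uq p \<in> carrier UL" using uqD(1) p .
  show "lsum UL (\<lambda>w. uq (single w 1)) p \<in> carrier UL" using k' by (rule UV.lsum_closed)
  fix \<phi> assume \<phi>: "lf UL \<phi>"
  have "lf (free_vs (lists (carrier L))) (\<lambda>p. \<phi> (uq p))"
    using lf_comp[OF uq_lin \<phi>] by (simp add: lin_form_def free_vs_simps free_alg_simps)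
  from lf_free[OF this, of p] show "\<phi> (uq p) = \<phi> (lsum UL (\<lambda>w. uq (single w 1)) p)"
    using p by (subst UV.lf_lsum[OF \<phi> k']) (auto simp: free_alg_simps)
qed

lemma uq_word: "\<lbrakk>x \<in> carrier L; w \<in> lists (carrier L)\<rbrakk> \<Longrightarrow>
    uq (single (x # w) 1) = uea_incl L x \<otimes>\<^bsub>UL\<^esub> uq (single w 1)"
proof -
  assume xw: "x \<in> carrier L" "w \<in> lists (carrier L)"
  have "single (x # w) 1 = single [x] 1 \<otimes>\<^bsub>FA\<^esub> single w 1"
    by (rule pm_eqI) (simp add: csum_mult)
  then show ?thesis using xw by (simp add: uq_incl free_alg_simps(1) flip: uq_mult)
qed

lemma UL_induct:
  assumes P: "subsp UL P" "\<one>\<^bsub>UL\<^esub> \<in> P" "\<And>x u. \<lbrakk>x \<in> carrier L; u \<in> P\<rbrakk> \<Longrightarrow> uea_incl L x \<otimes>\<^bsub>UL\<^esub> u \<in> P"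
  shows "carrier UL \<subseteq> P"
proof
  fix u assume "u \<in> carrier UL"
  then obtain p where p: "p \<in> carrier FA" "u = uq p" by (auto simp: UL_carrier)
  have w: "uq (single w 1) \<in> P" if "w \<in> lists (carrier L)" for w using that
  proof (induct w)
    case Nil then show ?case using P(2) by (simp add: uq_one)
  next
    case (Cons x w)
    then show ?case using P(3) by (auto simp: uq_word)
  qed
  show "u \<in> P" unfolding p(2) uq_lsum[OF p(1)] lsum_def
    by (rule UV.subsp_finsum[OF P(1)], rule subspD(4)[OF P(1)]) (use w p in \<open>auto simp: free_alg_simps\<close>)
qed

end

section \<open>The action of the enveloping algebra on a module\<close>

context lie_module
begin

definition actw :: "'v \<Rightarrow> 'x list \<Rightarrow> 'v" where "actw z w = foldr (act V) w z"

lemma actw_append: "actw z (u @ w) = actw (actw z w) u" by (simp add: actw_def)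

lemma lin_map_actw: "w \<in> lists (carrier L) \<Longrightarrow> lin_map V V (\<lambda>z. actw z w)"
proof (induct w)
  case Nil then show ?case by (simp add: actw_def lin_map_def)
next
  case (Cons x w) then show ?case using lin_map_comp[of V V "\<lambda>z. actw z w" V "act V x"] lin_map_act by (auto simp: actw_def)
qed

lemma actw_closed: "w \<in> lists (carrier L) \<Longrightarrow> z \<in> carrier V \<Longrightarrow> actw z w \<in> carrier V"
  using lin_mapD(1)[OF lin_map_actw] .

lemma actp_lin: "z \<in> carrier V \<Longrightarrow> lin_map FA V (lsum V (actw z))"
  using lin_map_lsum[OF VV.vspace_axioms, of "lists (carrier L)" "actw z"] actw_closed
  by (simp add: lin_map_def free_vs_simps free_alg_simps)

lemma lf_actp: "\<lbrakk>lf V \<phi>; p \<in> carrier FA; z \<in> carrier V\<rbrakk> \<Longrightarrow> \<phi> (lsum V (actw z) p) = csum (\<lambda>w. \<phi> (actw z w)) p"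
  by (rule VV.lf_lsum) (auto intro!: actw_closed simp: free_alg_simps)

lemma lf_actp2: "\<lbrakk>lf V \<phi>; p \<in> carrier FA; z \<in> carrier V; u \<in> lists (carrier L)\<rbrakk> \<Longrightarrow>
    csum (\<lambda>w. \<phi> (actw (actw z w) u)) p = \<phi> (actw (lsum V (actw z) p) u)"
  using lf_actp[OF lf_comp[OF lin_map_actw]] by metis

lemma actp_mult:
  assumes p: "p \<in> carrier FA" and q: "q \<in> carrier FA" and z: "z \<in> carrier V"
  shows "lsum V (actw z) (p \<otimes>\<^bsub>FA\<^esub> q) = lsum V (actw (lsum V (actw z) q)) p"
proof (rule VV.vs_eqI)
  have qz: "lsum V (actw z) q \<in> carrier V" using lin_mapD(1)[OF actp_lin[OF z] q] .
  show "lsum V (actw z) (p \<otimes>\<^bsub>FA\<^esub> q) \<in> carrier V" using lin_mapD(1)[OF actp_lin[OF z]] p q FR.m_closed by blast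
  show "lsum V (actw (lsum V (actw z) q)) p \<in> carrier V" using lin_mapD(1)[OF actp_lin[OF qz] p] .
  fix \<phi> assume \<phi>: "lf V \<phi>"
  have "\<phi> (lsum V (actw z) (p \<otimes>\<^bsub>FA\<^esub> q)) = csum (\<lambda>u. csum (\<lambda>w. \<phi> (actw (actw z w) u)) q) p"
    using p q z by (simp add: lf_actp[OF \<phi>] FR.m_closed csum_mult actw_append)
  also have "\<dots> = csum (\<lambda>u. \<phi> (actw (lsum V (actw z) q) u)) p"
    by (rule csum_cong, rule lf_actp2[OF \<phi> q z]) (use p in \<open>auto simp: free_alg_simps(1)\<close>)
  finally show "\<phi> (lsum V (actw z) (p \<otimes>\<^bsub>FA\<^esub> q)) = \<phi> (lsum V (actw (lsum V (actw z) q)) p)"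
    using lf_actp[OF \<phi> p qz] by simp
qed

text \<open>The elements of the free algebra that act as zero form a two-sided ideal, and this ideal
  contains the defining relations because \<open>V\<close> is a module.\<close>

lemma actp_UJ: assumes "p \<in> UJ" "z \<in> carrier V" shows "lsum V (actw z) p = \<zero>\<^bsub>V\<^esub>"
proof -
  \<comment> \<open>Quantifying over all \<open>z\<close> is what makes \<open>?K\<close> closed
    under multiplication on the right: \<open>p q\<close> acts on \<open>z\<close> as
    \<open>p\<close> acts on \<open>q z\<close>.\<close>
  let ?K = "{p \<in> carrier FA. \<forall>z\<in>carrier V. lsum V (actw z) p = \<zero>\<^bsub>V\<^esub>}"
  have z0: "lsum V (actw \<zero>\<^bsub>V\<^esub>) p = \<zero>\<^bsub>V\<^esub>" if p: "p \<in> carrier FA" for p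
  proof -
    have "actw \<zero>\<^bsub>V\<^esub> w = \<zero>\<^bsub>V\<^esub>" if "w \<in> lists (carrier L)" for w
      using lin_map_zero[OF lin_map_actw[OF that] VV.vspace_axioms VV.vspace_axioms] .
    then have *: "\<phi> (lsum V (actw \<zero>\<^bsub>V\<^esub>) p) = \<phi> \<zero>\<^bsub>V\<^esub>" if \<phi>: "lf V \<phi>" for \<phi>
      unfolding lf_actp[OF \<phi> p VV.zc] csum_def VV.lf_zero[OF \<phi>]
      by (intro sum.neutral) (use p VV.lf_zero[OF \<phi>] in \<open>auto simp: free_alg_simps(1) subset_iff\<close>)
    show ?thesis by (rule VV.vs_eqI) (rule lin_mapD(1)[OF actp_lin[OF VV.zc] p] VV.zc * | assumption)+
  qed
  have "subsp FA ?K"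
    using lin_mapD[OF actp_lin] lin_map_zero[OF actp_lin FV.vspace_axioms VV.vspace_axioms] FV.zc
    by (auto simp: subsp_def)
  then have "ideal ?K FA"
    by (rule ideal_of_subsp) (use lin_mapD(1)[OF actp_lin] FR.m_closed z0 in \<open>auto simp: actp_mult\<close>)
  moreover have "uea_rels L \<subseteq> ?K"
  proof
    fix r assume r: "r \<in> uea_rels L"
    then have rF: "r \<in> carrier FA" using rels_sub by blast
    have "lsum V (actw z) r = \<zero>\<^bsub>V\<^esub>" if z: "z \<in> carrier V" for z
    proof (rule VV.vs_eqI)
      fix \<phi> assume \<phi>: "lf V \<phi>"
      show "\<phi> (lsum V (actw z) r) = \<phi> \<zero>\<^bsub>V\<^esub>" unfolding lf_actp[OF \<phi> rF z]
        using r z unfolding uea_rels_def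
        by (elim UnE CollectE exE conjE; hypsubst)
           (simp_all add: csum_diff actw_def VV.lf_simps[OF \<phi>] act_add_left act_smult_left act_closed act_brack)
    qed (use lin_mapD(1)[OF actp_lin[OF z] rF] in auto)
    then show "r \<in> ?K" using rF by blast
  qed
  ultimately have "UJ \<subseteq> ?K" by (rule UJ_least)
  then show ?thesis using assms by blast
qed

definition UA :: "'v \<Rightarrow> ('x list \<Rightarrow>\<^sub>0 complex) set \<Rightarrow> 'v" where "UA z X = lsum V (actw z) (SOME p. p \<in> X)"

lemma UA_uq: "\<lbrakk>z \<in> carrier V; p \<in> carrier FA\<rbrakk> \<Longrightarrow> UA z (uq p) = lsum V (actw z) p"
  unfolding UA_def uq_def by (rule FV.lin_map_lift(2)[OF UJ_subsp VV.vspace_axioms actp_lin]) (auto simp: actp_UJ)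

lemma UA_lin: "z \<in> carrier V \<Longrightarrow> lin_map UL V (UA z)"
  unfolding UL_eq UA_def[abs_def] by (rule FV.lin_map_lift(1)[OF UJ_subsp VV.vspace_axioms actp_lin]) (auto simp: actp_UJ)

lemma UA_one: "z \<in> carrier V \<Longrightarrow> UA z \<one>\<^bsub>UL\<^esub> = z"
  by (simp add: uq_one UA_uq keys_rel VV.lsum_single actw_def)

lemma UA_mult: "\<lbrakk>z \<in> carrier V; u \<in> carrier UL; v \<in> carrier UL\<rbrakk> \<Longrightarrow> UA z (u \<otimes>\<^bsub>UL\<^esub> v) = UA (UA z v) u"
  using lin_mapD(1)[OF actp_lin] by (auto simp: UL_carrier uq_mult UA_uq actp_mult FR.m_closed)

lemma UA_incl: "\<lbrakk>z \<in> carrier V; x \<in> carrier L\<rbrakk> \<Longrightarrow> UA z (uea_incl L x) = act V x z"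
  by (simp add: uq_incl UA_uq keys_rel VV.lsum_single actw_def act_closed)

end

section \<open>Modules induced from a character of a subalgebra\<close>

lemma vspace_sub: assumes "vspace V" "subsp V N" shows "vspace (V\<lparr>carrier := N\<rparr>)"
  using assms submodule.submodule_is_module module_iff_vspace vspace.submodule_iff by metis

lemma lie_subalgebra_lie_algebra:
  assumes "lie_algebra L" "lie_subalgebra L S" shows "lie_algebra (L\<lparr>carrier := S\<rparr>)"
proof -
  interpret lie_algebra L by fact
  have S: "subsp L S" "\<forall>x\<in>S. \<forall>y\<in>S. brack L x y \<in> S" using assms(2) lie_subalgebra_iff by auto
  have SC: "\<And>x. x \<in> S \<Longrightarrow> x \<in> carrier L" using subspD(1)[OF S(1)] .
  show ?thesis
    by (intro lie_algebra.intro lie_algebra_axioms.intro)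
       (use S SC vspace_sub[OF LV.vspace_axioms S(1)] in
         \<open>auto simp: module_iff_vspace brack_add_left brack_add_right brack_smult_left brack_smult_right brack_self jacobi\<close>)
qed

lemma lsum_cplx: "lsum cplx f p = csum f p"
proof -
  interpret vspace cplx by (rule vspace_cplx)
  have "lf cplx (\<lambda>x. x)" by (simp add: lin_form_def)
  from lf_lsum[OF this] show ?thesis by auto
qed

lemma lin_ext_lsum: "lin_ext E f X = lsum E f (SOME p. p \<in> X)"
  by (simp add: lin_ext_def lsum_def Let_def)

text \<open>The data of a one-dimensional module over a subalgebra \<open>B\<close>: on a line all
  operators commute, so brackets must act by zero. The Verma module is the case of the Borel
  subalgebra.\<close>

locale induced = lie_algebra L for L :: "('x, 'm) lie_scheme" +
  fixes B :: "'x set" and ch :: "'x \<Rightarrow> complex"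
  assumes B: "lie_subalgebra L B" and ch: "lin_form L B ch"
    and ch_brack: "\<lbrakk>x \<in> B; y \<in> B\<rbrakk> \<Longrightarrow> ch (brack L x y) = 0"
begin

abbreviation b where "b \<equiv> L\<lparr>carrier := B\<rparr>"

lemma BD: "subsp L B" "\<lbrakk>x \<in> B; y \<in> B\<rbrakk> \<Longrightarrow> brack L x y \<in> B" "x \<in> B \<Longrightarrow> x \<in> carrier L"
  using B unfolding lie_subalgebra_iff by (blast, blast, auto simp: subsp_def)

sublocale b: lie_algebra b by (rule lie_subalgebra_lie_algebra[OF lie_algebra_axioms B])

definition ir where "ir u r = u \<otimes>\<^bsub>uea L\<^esub> uea_ext (uea L) (uea_incl L) r"
definition il where "il r z = uea_ext cplx ch r * z"
text \<open>The representative at which \<open>lin_ext\<close> evaluates. Naming it allows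
  \<open>uea_ext\<close> to be computed on both sides of the tensor product with one and the same
  word expansion.\<close>

definition rep where "rep X = (SOME p. p \<in> X)"
definition chw where "chw w = foldr (\<lambda>x r. ch x * r) w 1"

lemma chw_append: "chw (u @ w) = chw u * chw w" by (induct u) (auto simp: chw_def)

lemma FAb_sub: "p \<in> carrier (free_alg B) \<Longrightarrow> p \<in> carrier FA"
  using BD(3) by (auto simp: free_alg_simps)

lemma rep_props:
  assumes "X \<in> carrier (uea b)"
  shows "rep X \<in> carrier (free_alg B)" "b.uq (rep X) = X"
proof -
  obtain p where p: "p \<in> carrier b.FA" "X = b.uq p" using assms b.UL_carrier by auto
  have "p \<in> X" unfolding p(2) b.uq_def using b.FV.coset_self[OF b.UJ_subsp p(1)] .
  then have "rep X \<in> X" unfolding rep_def by (rule someI)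
  then have r: "rep X \<in> carrier b.FA" "rep X \<ominus>\<^bsub>b.FA\<^esub> p \<in> b.UJ"
    unfolding p(2) b.uq_def using b.FV.coset_iff[OF b.UJ_subsp p(1)] by blast+
  show "rep X \<in> carrier (free_alg B)" using r(1) by simp
  show "b.uq (rep X) = X" using b.FV.coset_eq_iff[OF b.UJ_subsp r(1) p(1)] r(2) unfolding p(2) b.uq_def by blast
qed

lemma foldr_incl: "w \<in> lists (carrier L) \<Longrightarrow> foldr (\<lambda>x r. uea_incl L x \<otimes>\<^bsub>UL\<^esub> r) w \<one>\<^bsub>UL\<^esub> = uq (single w 1)"
  by (induct w) (auto simp: uq_one uq_word)

lemma ext_incl: assumes X: "X \<in> carrier (uea b)" shows "uea_ext (uea L) (uea_incl L) X = uq (rep X)"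
proof -
  have p: "rep X \<in> carrier FA" using FAb_sub rep_props(1)[OF X] .
  have c: "w \<in> lists (carrier L)" "uq (single w 1) \<in> carrier UL" if "w \<in> keys (rep X)" for w
    using p that uqD(1)[of "single w 1"] by (auto simp: free_alg_simps)
  have "uea_ext (uea L) (uea_incl L) X = lsum UL (\<lambda>w. uq (single w 1)) (rep X)"
    unfolding uea_ext_def lin_ext_lsum rep_def[symmetric] unfolding lsum_def
    by (rule UV.finsum_cong') (use c foldr_incl in auto)
  then show ?thesis using uq_lsum[OF p] by simp
qed

lemma ext_ch: "uea_ext cplx ch X = csum chw (rep X)"
  unfolding uea_ext_def lin_ext_lsum rep_def[symmetric] lsum_cplx by (simp add: chw_def[abs_def])

text \<open>The functional is multiplicative since \<open>chw\<close> is multiplicative on words, so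
  its kernel is an ideal. It contains the relations because \<open>ch\<close> is linear and vanishes
  on brackets.\<close>

lemma chw_UJ: assumes "p \<in> b.UJ" shows "csum chw p = 0"
proof -
  let ?K = "{p \<in> carrier b.FA. csum chw p = 0}"
  have m: "csum chw (p \<otimes>\<^bsub>b.FA\<^esub> q) = csum chw p * csum chw q" for p q
    by (simp add: csum_mult chw_append csum_const)
  have "subsp b.FA ?K" using b.FV.zc b.FV.sm_closed b.FR.a_closed
    by (auto simp: subsp_def) (auto simp: free_alg_simps csum_add csum_scale)
  then have "ideal ?K b.FA" by (rule b.ideal_of_subsp) (use b.FR.m_closed m in auto)
  moreover have "uea_rels b \<subseteq> ?K"
  proof
    fix r assume r: "r \<in> uea_rels b"
    then have "csum chw r = 0" unfolding uea_rels_def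
      by (elim UnE CollectE exE conjE; hypsubst) (auto simp: csum_diff chw_def lin_formD[OF ch] ch_brack)
    then show "r \<in> ?K" using r b.rels_sub by auto
  qed
  ultimately have "b.UJ \<subseteq> ?K" by (rule b.UJ_least)
  then show ?thesis using assms by blast
qed

text \<open>The relations of \<open>B\<close> are relations of \<open>L\<close>, and
  \<open>UJ\<close> cuts out an ideal in the smaller free algebra. Hence the map of enveloping
  algebras induced by the inclusion is well defined.\<close>

lemma UJ_sub: "b.UJ \<subseteq> UJ"
proof -
  have bm: "p \<otimes>\<^bsub>b.FA\<^esub> q = p \<otimes>\<^bsub>FA\<^esub> q" for p q by (simp add: free_alg_def)
  interpret I: ideal UJ FA by (rule UJ_ideal)
  have s: "subsp b.FA {p \<in> carrier b.FA. p \<in> UJ}"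
    using subspD[OF UJ_subsp] b.FV.zc b.FV.sm_closed b.FR.a_closed unfolding subsp_def
    by (auto simp: free_alg_simps(2-4))
  have "ideal {p \<in> carrier b.FA. p \<in> UJ} b.FA"
    by (rule b.ideal_of_subsp[OF s]) (use b.FR.m_closed I.I_l_closed I.I_r_closed FAb_sub bm in auto)
  moreover have "uea_rels b \<subseteq> {p \<in> carrier b.FA. p \<in> UJ}"
  proof
    fix r assume r: "r \<in> uea_rels b"
    have "uea_rels b \<subseteq> uea_rels L" unfolding uea_rels_def using BD(3)
      by (intro Un_mono; simp; blast)
    then have "r \<in> uea_rels L" using r by blast
    then show "r \<in> {p \<in> carrier b.FA. p \<in> UJ}" using UJ_rels r b.rels_sub by auto
  qed
  ultimately have "b.UJ \<subseteq> {p \<in> carrier b.FA. p \<in> UJ}" by (rule b.UJ_least)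
  then show ?thesis by blast
qed

lemma rep_incl:
  assumes x: "x \<in> B"
  shows "uea_incl b x \<in> carrier (uea b)" "uq (rep (uea_incl b x)) = uea_incl L x" "csum chw (rep (uea_incl b x)) = ch x"
proof -
  show X: "uea_incl b x \<in> carrier (uea b)" using x b.incl_closed by simp
  let ?p = "rep (uea_incl b x)" and ?q = "single [x] (1::complex)"
  have q: "?q \<in> carrier b.FA" using x b.keys_rel(1) by simp
  have p: "?p \<in> carrier b.FA" using rep_props(1)[OF X] by simp
  have "b.uq ?p = b.uq ?q" using rep_props(2)[OF X] b.uq_incl by simp
  then have d: "?p \<ominus>\<^bsub>b.FA\<^esub> ?q \<in> b.UJ" unfolding b.uq_def using b.FV.coset_eq_iff[OF b.UJ_subsp p q] by blast
  have "?p \<ominus>\<^bsub>b.FA\<^esub> ?q = ?p - ?q"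
    unfolding b.FV.minus_eq'[OF p q] by (rule pm_eqI) (simp only: free_alg_simps csum_add csum_scale csum_diff, simp)
  with d have d: "?p - ?q \<in> b.UJ" by simp
  then show "uq ?p = uea_incl L x" unfolding uq_incl using UJ_sub p q FAb_sub by (intro uq_cong) auto
  show "csum chw ?p = ch x" using chw_UJ[OF d] by (simp add: csum_diff chw_def)
qed

sublocale tens UL cplx "carrier (uea b)" ir il
proof (intro tens.intro tens_axioms.intro)
  show "vspace UL" "vspace cplx" by (rule UV.vspace_axioms vspace_cplx)+
  fix v r assume "v \<in> carrier UL" "r \<in> carrier (uea b)"
  then show "ir v r \<in> carrier UL" unfolding ir_def using rep_props(1) FAb_sub uqD(1) by (simp add: ext_incl)
qed simp

definition IM where "IM = module.extend T (lmod.fields (\<lambda>x. lin_ext T (\<lambda>(u, z). tp (uea_incl L x \<otimes>\<^bsub>UL\<^esub> u) z)))"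
definition hw where "hw = tp \<one>\<^bsub>UL\<^esub> (1::complex)"

lemma IM_simps: "carrier IM = carrier T" "zero IM = zero T" "add IM = add T" "smult IM = smult T"
  "act IM x = lin_ext T (\<lambda>(u, z). tp (uea_incl L x \<otimes>\<^bsub>UL\<^esub> u) z)"
  by (simp_all add: IM_def)

lemma IM_vspace: "vspace IM" by (rule vspace_cong[OF TV.vspace_axioms]) (simp_all add: IM_simps)

lemma IM_lin: "lin_map T T f = lin_map IM IM f" by (simp add: lin_map_def IM_simps)

lemma IM_act:
  assumes x: "x \<in> carrier L"
  shows "lin_map T T (act IM x)" "\<lbrakk>u \<in> carrier UL\<rbrakk> \<Longrightarrow> act IM x (tp u z) = tp (uea_incl L x \<otimes>\<^bsub>UL\<^esub> u) z"
proof -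
  have bl: "bilin UL cplx T (\<lambda>u z. tp (uea_incl L x \<otimes>\<^bsub>UL\<^esub> u) z)"
    by (rule bilinI) (use x multD_UL[of "uea_incl L x"] tpD in auto)
  have bal: "tp (uea_incl L x \<otimes>\<^bsub>UL\<^esub> ir v r) w = tp (uea_incl L x \<otimes>\<^bsub>UL\<^esub> v) (il r w)"
    if "v \<in> carrier UL" "r \<in> carrier (uea b)" "w \<in> carrier cplx" for v r w
  proof -
    have "uq (rep r) \<in> carrier UL" using rep_props(1) FAb_sub uqD(1) that by blast
    then have "uea_incl L x \<otimes>\<^bsub>UL\<^esub> ir v r = ir (uea_incl L x \<otimes>\<^bsub>UL\<^esub> v) r"
      unfolding ir_def using that x by (simp add: ext_incl mult_assoc_UL)
    then show ?thesis using tp_bal[of "uea_incl L x \<otimes>\<^bsub>UL\<^esub> v" r w] that x by simp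
  qed
  show "lin_map T T (act IM x)" unfolding IM_simps by (rule T_lift(1)[OF TV.vspace_axioms bl]) (rule bal)
  assume u: "u \<in> carrier UL"
  show "act IM x (tp u z) = tp (uea_incl L x \<otimes>\<^bsub>UL\<^esub> u) z" unfolding IM_simps
    by (rule T_lift(2)[OF TV.vspace_axioms bl]) (use bal u in auto)
qed

lemma IM_module: "lie_module L IM"
proof (rule lie_moduleI[OF lie_algebra_axioms IM_vspace])
  note A = lin_mapD[OF IM_act(1)]
  show "bilin L IM IM (act IM)"
  proof (rule bilinI; unfold IM_simps(1-4))
    fix x v assume x: "x \<in> carrier L" and v: "v \<in> carrier T"
    show "act IM x v \<in> carrier T" using A x v by simp
    show "act IM x (c \<odot>\<^bsub>T\<^esub> v) = c \<odot>\<^bsub>T\<^esub> act IM x v" for c using A x v by simp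
    show "act IM x (v \<oplus>\<^bsub>T\<^esub> w) = act IM x v \<oplus>\<^bsub>T\<^esub> act IM x w" if "w \<in> carrier T" for w using A x v that by simp
    show "act IM (c \<odot>\<^bsub>L\<^esub> x) v = c \<odot>\<^bsub>T\<^esub> act IM x v" for c
    proof (rule lin_map_eqT[OF TV.vspace_axioms _ _ v])
      show "lin_map T T (act IM (c \<odot>\<^bsub>L\<^esub> x))" using IM_act(1) x by simp
      show "lin_map T T (\<lambda>v. c \<odot>\<^bsub>T\<^esub> act IM x v)"
        by (rule lin_mapI) (use A x in \<open>auto simp: TV.sm_add_r TV.sm_assoc mult.commute\<close>)
      show "act IM (c \<odot>\<^bsub>L\<^esub> x) (tp u z) = c \<odot>\<^bsub>T\<^esub> act IM x (tp u z)" if "u \<in> carrier UL" "z \<in> carrier cplx" for u z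
        using x that by (simp add: IM_act(2) lin_mapD(3)[OF incl_lin] multD_UL tpD)
    qed
    show "act IM (x \<oplus>\<^bsub>L\<^esub> y) v = act IM x v \<oplus>\<^bsub>T\<^esub> act IM y v" if y: "y \<in> carrier L" for y
    proof (rule lin_map_eqT[OF TV.vspace_axioms _ _ v])
      show "lin_map T T (act IM (x \<oplus>\<^bsub>L\<^esub> y))" using IM_act(1) x y by simp
      show "lin_map T T (\<lambda>v. act IM x v \<oplus>\<^bsub>T\<^esub> act IM y v)"
        by (rule lin_mapI) (use A x y in \<open>auto simp: TV.sm_add_r TV.vac\<close>)
      show "act IM (x \<oplus>\<^bsub>L\<^esub> y) (tp u z) = act IM x (tp u z) \<oplus>\<^bsub>T\<^esub> act IM y (tp u z)" if "u \<in> carrier UL" "z \<in> carrier cplx" for u z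
        using x y that by (simp add: IM_act(2) lin_mapD(2)[OF incl_lin] multD_UL tpD)
    qed
  qed
  fix x y v assume x: "x \<in> carrier L" and y: "y \<in> carrier L" and v: "v \<in> carrier IM"
  interpret IV: vspace IM by (rule IM_vspace)
  note A' = lin_mapD[OF IM_act(1)[unfolded IM_lin]]
  show "act IM (brack L x y) v = act IM x (act IM y v) \<ominus>\<^bsub>IM\<^esub> act IM y (act IM x v)"
  proof (rule lin_map_eqT[OF IM_vspace _ _ v[unfolded IM_simps]])
    show "lin_map T IM (act IM (brack L x y))" using IM_act(1)[OF brack_closed[OF x y]] by (simp add: lin_map_def IM_simps(1-4))
    have "lin_map IM IM (\<lambda>v. act IM x (act IM y v) \<ominus>\<^bsub>IM\<^esub> act IM y (act IM x v))"
      by (rule lin_mapI) (use A' x y in \<open>auto simp: IV.minus_eq' IV.sm_add_r IV.vac IV.sm_assoc\<close>)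
    then show "lin_map T IM (\<lambda>v. act IM x (act IM y v) \<ominus>\<^bsub>IM\<^esub> act IM y (act IM x v))" by (simp add: lin_map_def IM_simps(1-4))
    fix u z assume u: "u \<in> carrier UL" and z: "z \<in> carrier cplx"
    have uz: "tp u z \<in> carrier IM" using u z by (simp add: IM_simps)
    have c: "act IM x (act IM y (tp u z)) \<in> carrier IM" "act IM y (act IM x (tp u z)) \<in> carrier IM" "act IM (brack L x y) (tp u z) \<in> carrier IM"
      using A' x y uz brack_closed by auto
    have "tp (uea_incl L x \<otimes>\<^bsub>UL\<^esub> (uea_incl L y \<otimes>\<^bsub>UL\<^esub> u)) z
      = tp (uea_incl L (brack L x y) \<otimes>\<^bsub>UL\<^esub> u) z \<oplus>\<^bsub>T\<^esub> tp (uea_incl L y \<otimes>\<^bsub>UL\<^esub> (uea_incl L x \<otimes>\<^bsub>UL\<^esub> u)) z"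
      using incl_brack[OF x y, symmetric] x y u z brack_closed by (simp add: multD_UL tpD flip: mult_assoc_UL)
    then have "act IM x (act IM y (tp u z)) = act IM (brack L x y) (tp u z) \<oplus>\<^bsub>IM\<^esub> act IM y (act IM x (tp u z))"
      using x y u brack_closed by (simp add: IM_act(2) IM_simps(3))
    then show "act IM (brack L x y) (tp u z) = act IM x (act IM y (tp u z)) \<ominus>\<^bsub>IM\<^esub> act IM y (act IM x (tp u z))"
      by (intro IV.vs_eqI) (use c in \<open>simp_all add: IV.lf_simps\<close>)
  qed
qed

lemma hw_closed: "hw \<in> carrier IM" by (simp add: hw_def IM_simps)

lemma hw_eigen: assumes x: "x \<in> B" shows "act IM x hw = ch x \<odot>\<^bsub>IM\<^esub> hw"
proof -
  note r = rep_incl[OF x]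
  have "act IM x hw = tp (uea_incl L x) 1" using BD(3)[OF x] by (simp add: hw_def IM_act(2))
  also have "uea_incl L x = ir \<one>\<^bsub>UL\<^esub> (uea_incl b x)" using r BD(3)[OF x] by (simp add: ir_def ext_incl)
  also have "tp \<dots> 1 = tp \<one>\<^bsub>UL\<^esub> (ch x)" using tp_bal[of "\<one>\<^bsub>UL\<^esub>" "uea_incl b x" 1] r by (simp add: il_def ext_ch)
  also have "\<dots> = ch x \<odot>\<^bsub>IM\<^esub> hw" using tpD(5)[of "\<one>\<^bsub>UL\<^esub>" 1 "ch x"] by (simp add: hw_def IM_simps)
  finally show ?thesis .
qed

lemma IM_generated: assumes N: "lie_submodule L IM N" and h: "hw \<in> N" shows "N = carrier IM"
proof -
  interpret I: lie_module L IM by (rule IM_module)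
  have S: "subsp IM N" and A: "\<And>x v. \<lbrakk>x \<in> carrier L; v \<in> N\<rbrakk> \<Longrightarrow> act IM x v \<in> N" using N I.lie_submodule_iff by auto
  have "carrier UL \<subseteq> {u \<in> carrier UL. tp u 1 \<in> N}"
  proof (rule UL_induct)
    have "tp \<zero>\<^bsub>UL\<^esub> 1 = \<zero>\<^bsub>T\<^esub>" using tpD(4)[of "\<zero>\<^bsub>UL\<^esub>" 1 0] by simp
    then show "subsp UL {u \<in> carrier UL. tp u 1 \<in> N}"
      using subspD[OF S] by (auto simp: subsp_def tpD IM_simps(1-4))
    show "\<one>\<^bsub>UL\<^esub> \<in> {u \<in> carrier UL. tp u 1 \<in> N}" using h by (simp add: hw_def)
    show "uea_incl L x \<otimes>\<^bsub>UL\<^esub> u \<in> {u \<in> carrier UL. tp u 1 \<in> N}" if "x \<in> carrier L" "u \<in> {u \<in> carrier UL. tp u 1 \<in> N}" for x u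
      using that A[of x "tp u 1"] by (auto simp: IM_act(2))
  qed
  then have p: "tp u z \<in> N" if "u \<in> carrier UL" for u z
    using that subspD(4)[OF S, of "tp u 1" z] tpD(5)[of u 1 z] by (auto simp: IM_simps)
  have "t \<in> N" if "t \<in> carrier T" for t using that
    by (induct t rule: T_induct) (use p subspD[OF S] in \<open>auto simp: IM_simps(1-4)\<close>)
  then show ?thesis using subspD(1)[OF S] by (auto simp: IM_simps)
qed

text \<open>The homomorphism sends \<open>u \<otimes> c\<close> to \<open>c (u z0)\<close>. It is
  balanced because \<open>U(B)\<close> acts on the line through \<open>z0\<close> by the
  multiplicative extension of \<open>ch\<close>.\<close>

lemma IM_universal:
  assumes Z: "lie_module L Z" and z: "z0 \<in> carrier Z" and e: "\<And>x. x \<in> B \<Longrightarrow> act Z x z0 = ch x \<odot>\<^bsub>Z\<^esub> z0"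
  shows "\<exists>f. lhom L IM Z f \<and> f hw = z0"
proof -
  interpret Z: lie_module L Z by fact
  note U = lin_mapD[OF Z.UA_lin]
  let ?f = "\<lambda>u c. c \<odot>\<^bsub>Z\<^esub> Z.UA z0 u"
  have bl: "bilin UL cplx Z ?f"
    by (rule bilinI) (use z U in \<open>auto simp: Z.VV.sm_add_l Z.VV.sm_add_r Z.VV.sm_assoc mult.commute\<close>)
  have aw: "Z.actw z0 w = chw w \<odot>\<^bsub>Z\<^esub> z0" if "w \<in> lists B" for w using that
  proof (induct w)
    case Nil then show ?case using z by (simp add: Z.actw_def chw_def)
  next
    case (Cons x w)
    then have "Z.actw z0 (x # w) = act Z x (chw w \<odot>\<^bsub>Z\<^esub> z0)" by (simp add: Z.actw_def)
    also have "\<dots> = chw (x # w) \<odot>\<^bsub>Z\<^esub> z0" using Cons BD(3) z e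
      by (simp add: Z.act_smult_right Z.VV.sm_assoc chw_def mult.commute)
    finally show ?case .
  qed
  have ext: "Z.UA z0 (uq (rep r)) = csum chw (rep r) \<odot>\<^bsub>Z\<^esub> z0" if r: "r \<in> carrier (uea b)" for r
  proof -
    have p: "rep r \<in> carrier FA" "keys (rep r) \<subseteq> lists B" using rep_props(1)[OF r] FAb_sub by (auto simp: free_alg_simps)
    have "lsum Z (Z.actw z0) (rep r) = csum chw (rep r) \<odot>\<^bsub>Z\<^esub> z0"
    proof (rule Z.VV.vs_eqI)
      show "lsum Z (Z.actw z0) (rep r) \<in> carrier Z" using lin_mapD(1)[OF Z.actp_lin[OF z] p(1)] .
      fix \<phi> assume \<phi>: "lf Z \<phi>"
      have "csum (\<lambda>w. \<phi> (Z.actw z0 w)) (rep r) = csum (\<lambda>w. chw w * \<phi> z0) (rep r)"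
        by (rule csum_cong) (use p aw z in \<open>auto simp: Z.VV.lf_smult[OF \<phi>] subset_iff\<close>)
      then show "\<phi> (lsum Z (Z.actw z0) (rep r)) = \<phi> (csum chw (rep r) \<odot>\<^bsub>Z\<^esub> z0)"
        using z by (simp add: Z.lf_actp[OF \<phi> p(1) z] csum_const Z.VV.lf_smult[OF \<phi>])
    qed (use z in auto)
    then show ?thesis using Z.UA_uq[OF z p(1)] by simp
  qed
  have bal: "?f (ir v r) w = ?f v (il r w)" if "v \<in> carrier UL" "r \<in> carrier (uea b)" "w \<in> carrier cplx" for v r w
  proof -
    have ru: "uq (rep r) \<in> carrier UL" using rep_props(1) FAb_sub uqD(1) that by blast
    have vU: "v \<in> carrier UL" using that by simp
    \<comment> \<open>\<open>UA_lin\<close> gives linearity in the algebra element; homogeneity in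
      the vector is obtained here by expanding \<open>v\<close> into words.\<close>
    have lz: "Z.UA (c \<odot>\<^bsub>Z\<^esub> z0) v = c \<odot>\<^bsub>Z\<^esub> Z.UA z0 v" for c
    proof -
      obtain p where p: "p \<in> carrier FA" "v = uq p" using vU unfolding UL_carrier by auto
      show ?thesis unfolding p(2)
      proof (rule Z.VV.vs_eqI)
        fix \<phi> assume \<phi>: "lf Z \<phi>"
        have cz: "c \<odot>\<^bsub>Z\<^esub> z0 \<in> carrier Z" using z by simp
        have "csum (\<lambda>w. \<phi> (Z.actw (c \<odot>\<^bsub>Z\<^esub> z0) w)) p = csum (\<lambda>w. c * \<phi> (Z.actw z0 w)) p"
          by (rule csum_cong) (use p z lin_mapD(3)[OF Z.lin_map_actw] Z.actw_closed in \<open>auto simp: Z.VV.lf_smult[OF \<phi>] free_alg_simps subset_iff\<close>)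
        then show "\<phi> (Z.UA (c \<odot>\<^bsub>Z\<^esub> z0) (uq p)) = \<phi> (c \<odot>\<^bsub>Z\<^esub> Z.UA z0 (uq p))"
          using p z cz lin_mapD(1)[OF Z.actp_lin[OF z] p(1)]
          by (simp add: Z.UA_uq Z.lf_actp[OF \<phi>] Z.VV.lf_smult[OF \<phi>] csum_const)
      qed (use p z U(1) uqD(1) in auto)
    qed
    have "?f (ir v r) w = w \<odot>\<^bsub>Z\<^esub> Z.UA (Z.UA z0 (uq (rep r))) v"
      using that ru z by (simp add: ir_def ext_incl Z.UA_mult)
    also have "\<dots> = ?f v (il r w)" using that z U(1) by (simp add: ext lz il_def ext_ch Z.VV.sm_assoc mult.commute)
    finally show ?thesis .
  qed
  let ?g = "lin_ext Z (\<lambda>(u, c). ?f u c)"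
  have g: "lin_map T Z ?g" by (rule T_lift(1)[OF Z.VV.vspace_axioms bl]) (rule bal)
  have gv: "?g (tp u c) = ?f u c" if "u \<in> carrier UL" for u c
    by (rule T_lift(2)[OF Z.VV.vspace_axioms bl]) (use bal that in auto)
  have "?g (act IM x t) = act Z x (?g t)" if x: "x \<in> carrier L" and t: "t \<in> carrier T" for x t
  proof (rule lin_map_eqT[OF Z.VV.vspace_axioms _ _ t])
    show "lin_map T Z (\<lambda>t. ?g (act IM x t))" by (rule lin_map_comp[OF IM_act(1)[OF x] g])
    show "lin_map T Z (\<lambda>t. act Z x (?g t))" by (rule lin_map_comp[OF g Z.lin_map_act[OF x]])
    show "?g (act IM x (tp u c)) = act Z x (?g (tp u c))" if "u \<in> carrier UL" for u c
      using x that z U(1) by (simp add: IM_act(2) gv Z.UA_mult Z.UA_incl Z.act_smult_right)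
  qed
  then have "lhom L IM Z ?g" using g by (simp add: lhom_def lin_map_def IM_simps(1-4))
  moreover have "?g hw = z0" using gv[of "\<one>\<^bsub>UL\<^esub>" 1] z by (simp add: hw_def Z.UA_one)
  ultimately show ?thesis by blast
qed

end

section \<open>Kac-Moody algebras\<close>

lemma (in vspace) vspan_base: "x \<in> S \<Longrightarrow> x \<in> vspan V S"
  using vspan_superset by auto

context lie_module
begin

lemma sl2_pow:
  assumes e: "e \<in> carrier L" and f: "f \<in> carrier L" and ef: "brack L e f = h"
    and hf: "brack L h f = (-2) \<odot>\<^bsub>L\<^esub> f"
    and v: "v \<in> carrier V" and ev: "act V e v = \<zero>\<^bsub>V\<^esub>" and hv: "act V h v = l \<odot>\<^bsub>V\<^esub> v"
  shows "act V h ((act V f ^^ n) v) = (l - 2 * of_nat n) \<odot>\<^bsub>V\<^esub> (act V f ^^ n) v"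
    "act V e ((act V f ^^ Suc n) v) = (of_nat (Suc n) * (l - of_nat n)) \<odot>\<^bsub>V\<^esub> (act V f ^^ n) v"
proof -
  have h: "h \<in> carrier L" using e f ef brack_closed by blast
  note c = act_pow_closed[OF f v]
  have 1: "act V h ((act V f ^^ n) v) = (l - 2 * of_nat n) \<odot>\<^bsub>V\<^esub> (act V f ^^ n) v" for n
  proof (induct n)
    case 0 then show ?case using hv by simp
  next
    case (Suc n)
    show ?case
      using h f c Suc
      by (simp add: act_comm[OF h f c] hf act_smult_left act_smult_right act_closed VV.sm_assoc algebra_simps flip: VV.sm_add_l)
  qed
  show "act V h ((act V f ^^ n) v) = (l - 2 * of_nat n) \<odot>\<^bsub>V\<^esub> (act V f ^^ n) v" by (rule 1)
  show "act V e ((act V f ^^ Suc n) v) = (of_nat (Suc n) * (l - of_nat n)) \<odot>\<^bsub>V\<^esub> (act V f ^^ n) v"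
  proof (induct n)
    case 0 then show ?case using act_comm[OF e f v] ev hv f h v by (simp add: ef act_zero act_closed)
  next
    case (Suc n)
    have "act V e ((act V f ^^ Suc (Suc n)) v) = act V h ((act V f ^^ Suc n) v) \<oplus>\<^bsub>V\<^esub> act V f (act V e ((act V f ^^ Suc n) v))"
      using act_comm[OF e f c[of "Suc n"]] ef by simp
    also have "\<dots> = (l - 2 * of_nat (Suc n)) \<odot>\<^bsub>V\<^esub> (act V f ^^ Suc n) v \<oplus>\<^bsub>V\<^esub> (of_nat (Suc n) * (l - of_nat n)) \<odot>\<^bsub>V\<^esub> (act V f ^^ Suc n) v"
      unfolding 1 Suc using f c by (simp add: act_smult_right)
    also have "\<dots> = (of_nat (Suc (Suc n)) * (l - of_nat (Suc n))) \<odot>\<^bsub>V\<^esub> (act V f ^^ Suc n) v"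
      unfolding VV.sm_add_l[OF c, symmetric] by (rule arg_cong2[of _ _ _ _ "smult V"]) (auto simp: algebra_simps)
    finally show ?case .
  qed
qed

text \<open>Applying \<open>e\<close> to \<open>f^(n+1) v = 0\<close> gives
  \<open>(n + 1)(l - n) f^n v = 0\<close>. The factor is nonzero for \<open>n > l\<close>, so the
  exponent can be lowered step by step until it reaches \<open>l + 1\<close>.\<close>

lemma sl2_hw_nilp:
  assumes "e \<in> carrier L" "f \<in> carrier L" "brack L e f = h" "brack L h f = (-2) \<odot>\<^bsub>L\<^esub> f"
    "v \<in> carrier V" "act V e v = \<zero>\<^bsub>V\<^esub>" "act V h v = of_nat l \<odot>\<^bsub>V\<^esub> v" "(act V f ^^ n) v = \<zero>\<^bsub>V\<^esub>"
  shows "(act V f ^^ Suc l) v = \<zero>\<^bsub>V\<^esub>"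
  using assms(8)
proof (induct n)
  case 0 then show ?case using assms act_pow_mono[of f 0 v "Suc l"] by simp
next
  case (Suc n)
  show ?case
  proof (cases "n \<le> l")
    case True then show ?thesis using act_pow_mono[OF assms(2) Suc.prems, of "Suc l"] by simp
  next
    case False
    have c: "(act V f ^^ n) v \<in> carrier V" using act_pow_closed assms by blast
    let ?c = "of_nat (Suc n) * (of_nat l - of_nat n) :: complex"
    have "?c \<odot>\<^bsub>V\<^esub> (act V f ^^ n) v = \<zero>\<^bsub>V\<^esub>"
      using sl2_pow(2)[OF assms(1-7), of n] Suc.prems act_zero(1)[OF assms(1)] by simp
    moreover have "?c \<noteq> 0" using False by (auto simp del: of_nat_Suc)
    ultimately have "(act V f ^^ n) v = \<zero>\<^bsub>V\<^esub>"
      using VV.sm_assoc[OF c, of "1 / ?c" ?c] c by simp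
    then show ?thesis by (rule Suc.hyps)
  qed
qed

end

text \<open>The part of the axioms that is symmetric under exchanging the Chevalley generators.\<close>

locale km_core = lie_algebra G
  for C :: "int^'n^'n" and G :: "('g, 'n::finite) km" (structure) +
  assumes gcm: "gcm C"
    and cartan_sub: "subsp G (cartan G)"
    and sroot_linear: "lin_form G (cartan G) (sroot G i)"
    and sroot_indep: "(\<forall>h\<in>cartan G. (\<Sum>i\<in>UNIV. c i * sroot G i h) = 0) \<Longrightarrow> c i = 0"
    and coroot_cartan: "coroot G i \<in> cartan G"
    and sroot_coroot: "sroot G j (coroot G i) = of_int (C $ i $ j)"
    and chev_carrier: "chev_e G i \<in> carrier G" "chev_f G i \<in> carrier G"
    and brack_cartan: "\<lbrakk>h \<in> cartan G; h' \<in> cartan G\<rbrakk> \<Longrightarrow> brack G h h' = \<zero>"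
    and brack_cartan_e: "h \<in> cartan G \<Longrightarrow> brack G h (chev_e G i) = sroot G i h \<odot> chev_e G i"
    and brack_cartan_f: "h \<in> cartan G \<Longrightarrow> brack G h (chev_f G i) = (- sroot G i h) \<odot> chev_f G i"
    and brack_e_f: "brack G (chev_e G i) (chev_f G j) = (if i = j then coroot G i else \<zero>)"
    and generated: "\<lbrakk>lie_subalgebra G S; cartan G \<subseteq> S;
        \<And>i. chev_e G i \<in> S; \<And>i. chev_f G i \<in> S\<rbrakk> \<Longrightarrow> S = carrier G"
    and no_ideal: "\<lbrakk>lie_ideal G S; S \<inter> cartan G = {\<zero>}\<rbrakk> \<Longrightarrow> S = {\<zero>}"

lemma kac_moody_core: assumes "kac_moody C G" shows "km_core C G"
proof -
  interpret kac_moody C G by fact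
  show ?thesis
    by (intro km_core.intro km_core_axioms.intro lie_algebra_axioms)
       (fact gcm cartan_sub[unfolded LV.submodule_iff] sroot_linear sroot_indep coroot_cartan sroot_coroot chev_carrier
         brack_cartan brack_cartan_e brack_cartan_f brack_e_f generated no_ideal)+
qed

text \<open>The Chevalley involution on the level of data. The roots change sign because the
  lowering generators become raising ones, and the coroots change sign because
  \<open>[f_i, e_i] = - [e_i, f_i]\<close>.\<close>

definition km_swap :: "('g, 'n) km \<Rightarrow> ('g, 'n) km" where
  "km_swap G = G\<lparr>sroot := \<lambda>i h. - sroot G i h, coroot := \<lambda>i. (-1) \<odot>\<^bsub>G\<^esub> coroot G i,
     chev_e := chev_f G, chev_f := chev_e G\<rparr>"

lemma km_swap_simps:
  "carrier (km_swap G) = carrier G" "zero (km_swap G) = zero G" "add (km_swap G) = add G" "smult (km_swap G) = smult G"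
  "brack (km_swap G) = brack G" "cartan (km_swap G) = cartan G" "sroot (km_swap G) i h = - sroot G i h"
  "coroot (km_swap G) i = (-1) \<odot>\<^bsub>G\<^esub> coroot G i" "chev_e (km_swap G) = chev_f G" "chev_f (km_swap G) = chev_e G"
  by (simp_all add: km_swap_def)

lemma subsp_swap: "subsp (km_swap G) = subsp G" by (simp add: subsp_def km_swap_simps fun_eq_iff)

lemma (in lie_algebra) lie_algebra_cong:
  assumes "carrier K = carrier L" "zero K = zero L" "add K = add L" "smult K = smult L" "brack K = brack L"
  shows "lie_algebra K"
  by (intro lie_algebra.intro lie_algebra_axioms.intro)
     (use vspace_cong[OF LV.vspace_axioms assms(1-4)] in
       \<open>simp_all add: assms module_iff_vspace brack_closed brack_add_left brack_add_right brack_smult_left brack_smult_right brack_self jacobi\<close>)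

text \<open>The simple root with index \<open>i\<close> as a coefficient vector.\<close>

definition unit_vec :: "'n \<Rightarrow> 'n \<Rightarrow> nat" where "unit_vec i j = (if j = i then 1 else 0)"

text \<open>
  \<open>ew G m x\<close>: \<open>x\<close> is a right-normed bracket of the \<open>e\<^sub>i\<close> of weight \<open>\<Sum> m\<^sub>i \<alpha>\<^sub>i\<close>. Statements on the lowering
  counterpart \<open>fw\<close> are obtained from the symmetry \<open>km_swap\<close>.
\<close>

inductive ew :: "('g, 'n) km \<Rightarrow> ('n \<Rightarrow> nat) \<Rightarrow> 'g \<Rightarrow> bool" for G where
  base: "ew G (unit_vec i) (chev_e G i)"
| step: "ew G m x \<Longrightarrow> ew G (\<lambda>j. m j + unit_vec i j) (brack G (chev_e G i) x)"

definition fw where "fw G = ew (km_swap G)"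

lemma root_of_unit: "root_of G (unit_vec i) h = sroot G i h"
  by (simp add: root_of_def unit_vec_def if_distrib[of of_nat] if_distrib[of "\<lambda>x. x * _"] cong: if_cong)

lemma root_of_add: "root_of G (\<lambda>j. m j + n j) h = root_of G m h + root_of G n h"
  by (simp add: root_of_def algebra_simps sum.distrib)

lemma root_of_swap: "root_of (km_swap G) m h = - root_of G m h"
  by (simp add: root_of_def km_swap_simps sum_negf)

lemma ew_nonzero: "ew G m x \<Longrightarrow> m \<noteq> (\<lambda>_. 0)"
  by (induct rule: ew.induct) (auto simp: unit_vec_def fun_eq_iff)

section \<open>Weights, the triangular decomposition and the Serre relations\<close>

context km_core
begin

lemma cartan_carrier: "h \<in> cartan G \<Longrightarrow> h \<in> carrier G" using subspD(1)[OF cartan_sub] .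
lemma coroot_carrier: "coroot G i \<in> carrier G" using cartan_carrier coroot_cartan by blast

lemma km_swap_core: "km_core C (km_swap G)"
proof (intro km_core.intro km_core_axioms.intro)
  show L: "lie_algebra (km_swap G)" by (rule lie_algebra_cong) (simp_all add: km_swap_simps)
  interpret K: lie_algebra "km_swap G" by (rule L)
  show "gcm C" by (rule gcm)
  show "subsp (km_swap G) (cartan (km_swap G))" by (simp add: subsp_swap km_swap_simps cartan_sub)
  show "lin_form (km_swap G) (cartan (km_swap G)) (sroot (km_swap G) i)" for i
    using sroot_linear[of i] by (simp add: lin_form_def km_swap_simps)
  show "c i = 0" if "\<forall>h\<in>cartan (km_swap G). (\<Sum>i\<in>UNIV. c i * sroot (km_swap G) i h) = 0" for c i
    by (rule sroot_indep[of c i]) (use that in \<open>simp add: km_swap_simps sum_negf\<close>)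
  show "coroot (km_swap G) i \<in> cartan (km_swap G)" for i
    using subspD(4)[OF cartan_sub coroot_cartan] by (simp add: km_swap_simps)
  show "sroot (km_swap G) j (coroot (km_swap G) i) = of_int (C $ i $ j)" for i j
    using lin_formD(2)[OF sroot_linear coroot_cartan] sroot_coroot by (simp add: km_swap_simps)
  show "chev_e (km_swap G) i \<in> carrier (km_swap G)" "chev_f (km_swap G) i \<in> carrier (km_swap G)" for i
    using chev_carrier by (simp_all add: km_swap_simps)
  show "brack (km_swap G) h h' = \<zero>\<^bsub>km_swap G\<^esub>" if "h \<in> cartan (km_swap G)" "h' \<in> cartan (km_swap G)" for h h'
    using that brack_cartan by (simp add: km_swap_simps)
  show "brack (km_swap G) h (chev_e (km_swap G) i) = sroot (km_swap G) i h \<odot>\<^bsub>km_swap G\<^esub> chev_e (km_swap G) i"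
    if "h \<in> cartan (km_swap G)" for h i using that brack_cartan_f by (simp add: km_swap_simps)
  show "brack (km_swap G) h (chev_f (km_swap G) i) = (- sroot (km_swap G) i h) \<odot>\<^bsub>km_swap G\<^esub> chev_f (km_swap G) i"
    if "h \<in> cartan (km_swap G)" for h i using that brack_cartan_e by (simp add: km_swap_simps)
  show "brack (km_swap G) (chev_e (km_swap G) i) (chev_f (km_swap G) j) = (if i = j then coroot (km_swap G) i else \<zero>\<^bsub>km_swap G\<^esub>)" for i j
    using brack_anti[of "chev_f G i" "chev_e G j"] brack_e_f[of j i] chev_carrier by (simp add: km_swap_simps)
  show "S = carrier (km_swap G)" if "lie_subalgebra (km_swap G) S" "cartan (km_swap G) \<subseteq> S"
    "\<And>i. chev_e (km_swap G) i \<in> S" "\<And>i. chev_f (km_swap G) i \<in> S" for S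
    using that generated[of S] by (simp add: km_swap_simps K.lie_subalgebra_iff lie_subalgebra_iff subsp_swap)
  show "S = {\<zero>\<^bsub>km_swap G\<^esub>}" if "lie_ideal (km_swap G) S" "S \<inter> cartan (km_swap G) = {\<zero>\<^bsub>km_swap G\<^esub>}" for S
    using that no_ideal[of S] by (simp add: km_swap_simps K.lie_ideal_iff lie_ideal_iff subsp_swap)
qed

lemma ew_carrier: "ew G m x \<Longrightarrow> x \<in> carrier G"
  by (induct rule: ew.induct) (auto simp: chev_carrier brack_closed)

lemma weight_brack:
  assumes "x \<in> carrier G" "y \<in> carrier G" "h \<in> cartan G" "brack G h x = a \<odot> x" "brack G h y = b \<odot> y"
  shows "brack G h (brack G x y) = (a + b) \<odot> brack G x y"
  using assms cartan_carrier
  by (simp add: jacobi_ad[of h x y] brack_smult_left brack_smult_right brack_closed LV.sm_add_l)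

lemma ew_weight: "ew G m x \<Longrightarrow> h \<in> cartan G \<Longrightarrow> brack G h x = root_of G m h \<odot> x"
proof (induct rule: ew.induct)
  case (base i) then show ?case by (simp add: root_of_unit brack_cartan_e)
next
  case (step m x i)
  then show ?case using weight_brack[OF chev_carrier(1) ew_carrier[OF step(1)] step(3) brack_cartan_e step(2), of i]
    by (simp add: root_of_unit root_of_add add.commute)
qed

lemma fw_base: "fw G (unit_vec i) (chev_f G i)"
  using ew.base[of "km_swap G" i] by (simp add: fw_def km_swap_simps)

lemma fw_step: "fw G m x \<Longrightarrow> fw G (\<lambda>j. m j + unit_vec i j) (brack G (chev_f G i) x)"
  using ew.step[of "km_swap G" m x i] by (simp add: fw_def km_swap_simps)

lemma fw_induct [consumes 1, case_names base step]:
  assumes "fw G m x" "\<And>i. P (unit_vec i) (chev_f G i)"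
    "\<And>m x i. \<lbrakk>fw G m x; P m x\<rbrakk> \<Longrightarrow> P (\<lambda>j. m j + unit_vec i j) (brack G (chev_f G i) x)"
  shows "P m x"
  using assms(1) unfolding fw_def
  by (induct rule: ew.induct) (use assms(2,3) in \<open>auto simp: km_swap_simps fw_def\<close>)

lemma fw_carrier: "fw G m x \<Longrightarrow> x \<in> carrier G"
  using km_core.ew_carrier[OF km_swap_core] by (simp add: fw_def km_swap_simps)

lemma fw_weight: "fw G m x \<Longrightarrow> h \<in> cartan G \<Longrightarrow> brack G h x = (- root_of G m h) \<odot> x"
  using km_core.ew_weight[OF km_swap_core] by (simp add: fw_def km_swap_simps root_of_swap)

text \<open>The spanning set behind the triangular decomposition. Once its span is known to be
  stable under the generators, \<open>carrier_words\<close> shows that it is everything.\<close>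

definition words where "words = {x. \<exists>m. ew G m x} \<union> cartan G \<union> {x. \<exists>m. fw G m x}"

lemma words_sub: "words \<subseteq> carrier G"
  using ew_carrier fw_carrier cartan_carrier by (auto simp: words_def)

lemma span_stable:
  assumes "S \<subseteq> carrier G" "subsp G N" "x \<in> carrier G" "\<And>y. y \<in> S \<Longrightarrow> brack G x y \<in> N" "y \<in> vspan G S"
  shows "brack G x y \<in> N"
  using assms(5,1)
proof (induct rule: LV.vspan_induct)
  case (smult c y) then show ?case using assms(3) subspD(4)[OF assms(2)] by (simp add: brack_smult_right)
next
  case (add y z) then show ?case using assms(3) subspD(3)[OF assms(2)] by (simp add: brack_add_right)
qed (use assms brack_zero subspD(2) in auto)

text \<open>The substantial case is a lowering word: \<open>[e_i, [f_j, x]]\<close> equals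
  \<open>[[e_i, f_j], x] + [f_j, [e_i, x]]\<close>, where the first bracket contains at most a
  coroot and the second is covered by induction.\<close>

lemma e_stable: assumes "y \<in> vspan G words" shows "brack G (chev_e G i) y \<in> vspan G words"
proof (rule span_stable[OF words_sub LV.subsp_vspan[OF words_sub] chev_carrier(1) _ assms])
  note W = LV.subsp_vspan[OF words_sub] note WD = subspD[OF W]
  have ws: "\<And>x. x \<in> words \<Longrightarrow> x \<in> vspan G words" by (rule LV.vspan_base)
  \<comment> \<open>The induction on lowering words needs a span that is stable under the
    \<open>f_j\<close>. For the Cartan part plus the lowering words this can be checked directly,
    whereas for the span of all words \<open>f_stable\<close> is derived only later, from the
    present lemma.\<close>
  let ?C = "vspan G (cartan G \<union> {x. \<exists>m. fw G m x})"
  have Cs: "cartan G \<union> {x. \<exists>m. fw G m x} \<subseteq> carrier G" using words_sub by (auto simp: words_def)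
  note CS = LV.subsp_vspan[OF Cs] note CD = subspD[OF CS]
  have cs: "\<And>x. x \<in> cartan G \<union> {x. \<exists>m. fw G m x} \<Longrightarrow> x \<in> ?C" by (rule LV.vspan_base)
  have fC: "brack G (chev_f G j) y \<in> ?C" if "y \<in> ?C" for j y
  proof (rule span_stable[OF Cs CS chev_carrier(2) _ that])
    fix y assume "y \<in> cartan G \<union> {x. \<exists>m. fw G m x}"
    then consider "y \<in> cartan G" | m where "fw G m y" by auto
    then show "brack G (chev_f G j) y \<in> ?C"
    proof cases
      case 1
      then have "brack G (chev_f G j) y = sroot G j y \<odot> chev_f G j"
        using brack_anti[of "chev_f G j" y] chev_carrier cartan_carrier by (simp add: brack_cartan_f LV.sm_assoc)
      then show ?thesis using cs fw_base CD(4) by auto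
    next
      case 2 then show ?thesis using cs fw_step by blast
    qed
  qed
  have eC: "brack G (chev_e G i) y \<in> ?C" if "fw G m y" for m y using that
  proof (induct rule: fw_induct)
    case (base j) then show ?case using cs coroot_cartan CD(2) by (auto simp: brack_e_f)
  next
    case (step m x j)
    have x: "x \<in> carrier G" using fw_carrier step by blast
    have "brack G (coroot G i) x = (- root_of G m (coroot G i)) \<odot> x" using fw_weight[OF step(1) coroot_cartan] .
    moreover have "x \<in> ?C" using cs step(1) by blast
    ultimately have "brack G (brack G (chev_e G i) (chev_f G j)) x \<in> ?C"
      using CD(2,4) x by (auto simp: brack_e_f brack_zero)
    then show ?case using fC[OF step(2)] CD(3) chev_carrier x by (simp add: jacobi_ad[of "chev_e G i" "chev_f G j" x])
  qed
  have CW: "?C \<subseteq> vspan G words" by (rule LV.vspan_mono[OF _ words_sub]) (auto simp: words_def)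
  fix y assume "y \<in> words"
  then consider m where "ew G m y" | "y \<in> cartan G" | m where "fw G m y" by (auto simp: words_def)
  then show "brack G (chev_e G i) y \<in> vspan G words"
  proof cases
    case 1 then have "brack G (chev_e G i) y \<in> words" unfolding words_def using ew.step[of G m y i] by blast
    then show ?thesis by (rule ws)
  next
    case 2
    then have "brack G (chev_e G i) y = (- sroot G i y) \<odot> chev_e G i"
      using brack_anti[of "chev_e G i" y] chev_carrier cartan_carrier by (simp add: brack_cartan_e LV.sm_assoc)
    moreover have "chev_e G i \<in> words" unfolding words_def using ew.base[of G i] by blast
    ultimately show ?thesis using ws WD(4) by auto
  next
    case 3 then show ?thesis using eC CW by blast
  qed
qed

lemma ew_swap: "ew (km_swap (km_swap G)) = ew G"
proof -
  have "km_swap (km_swap G) = G"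
    using coroot_carrier by (simp add: km_swap_def LV.sm_assoc)
  then show ?thesis by simp
qed

lemma words_swap: "km_core.words (km_swap G) = words"
  unfolding km_core.words_def[OF km_swap_core] words_def by (auto simp: fw_def ew_swap km_swap_simps)

lemma vspan_swap: "vspan (km_swap G) = vspan G"
proof -
  interpret K: km_core C "km_swap G" by (rule km_swap_core)
  show ?thesis unfolding vspan_def[abs_def] K.LV.submodule_iff LV.submodule_iff subsp_swap ..
qed

lemma f_stable: "y \<in> vspan G words \<Longrightarrow> brack G (chev_f G i) y \<in> vspan G words"
  using km_core.e_stable[OF km_swap_core, of y i] by (simp add: km_swap_simps words_swap vspan_swap)

lemma generated_stable:
  assumes S: "subsp G S" and h: "\<And>h y. h \<in> cartan G \<Longrightarrow> y \<in> S \<Longrightarrow> brack G h y \<in> S"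
    and e: "\<And>i y. y \<in> S \<Longrightarrow> brack G (chev_e G i) y \<in> S" and f: "\<And>i y. y \<in> S \<Longrightarrow> brack G (chev_f G i) y \<in> S"
  shows "lie_ideal G S"
proof -
  have "{x \<in> carrier G. \<forall>y\<in>S. brack G x y \<in> S} = carrier G"
    by (rule generated[OF normalizer_subalgebra[OF S]]) (use h e f chev_carrier cartan_carrier in auto)
  then show ?thesis using S unfolding lie_ideal_iff by blast
qed

lemma h_stable: assumes h: "h \<in> cartan G" and y: "y \<in> vspan G words" shows "brack G h y \<in> vspan G words"
proof (rule span_stable[OF words_sub LV.subsp_vspan[OF words_sub] cartan_carrier[OF h] _ y])
  note WD = subspD[OF LV.subsp_vspan[OF words_sub]]
  fix y assume y: "y \<in> words"
  then have w: "y \<in> vspan G words" by (rule LV.vspan_base)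
  from y consider m where "ew G m y" | "y \<in> cartan G" | m where "fw G m y" by (auto simp: words_def)
  then show "brack G h y \<in> vspan G words"
    by cases (use w WD h ew_weight fw_weight brack_cartan in auto)
qed

text \<open>The span is stable under all generators, hence an ideal because normalizers are
  subalgebras, and in particular a subalgebra that contains the generators.\<close>

lemma carrier_words: "carrier G = vspan G words"
proof -
  have W: "subsp G (vspan G words)" by (rule LV.subsp_vspan[OF words_sub])
  have "lie_ideal G (vspan G words)" by (rule generated_stable[OF W]) (auto intro: h_stable e_stable f_stable)
  then have "lie_subalgebra G (vspan G words)" using subspD(1)[OF W] unfolding lie_ideal_iff lie_subalgebra_iff by blast
  then have "vspan G words = carrier G"
  proof (rule generated)
    have "words \<subseteq> vspan G words" by (rule LV.vspan_superset)
    moreover have "cartan G \<subseteq> words" "chev_e G i \<in> words" "chev_f G i \<in> words" for i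
      unfolding words_def using ew.base[of G i] fw_base[of i] by auto
    ultimately show "cartan G \<subseteq> vspan G words" "chev_e G i \<in> vspan G words" "chev_f G i \<in> vspan G words" for i by blast+
  qed
  then show ?thesis ..
qed

lemma root_inj: assumes "\<forall>h\<in>cartan G. (\<Sum>i\<in>UNIV. c i * sroot G i h) = (\<Sum>i\<in>UNIV. d i * sroot G i h)" shows "c = d"
proof
  fix i
  have "c i - d i = 0" by (rule sroot_indep[of "\<lambda>i. c i - d i"]) (use assms in \<open>simp add: algebra_simps sum_subtractf\<close>)
  then show "c i = d i" by simp
qed

text \<open>Words are graded by the root lattice, whose elements are integer vectors
  \<open>z\<close>: raising words have degree \<open>m\<close>, Cartan elements degree 0, lowering
  words degree \<open>- m\<close>. Linear independence of the simple roots makes different degrees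
  different weights, so \<open>eigen_separation\<close> applies.\<close>

lemma weight_space_words:
  assumes x: "x \<in> carrier G" and w: "\<And>h. h \<in> cartan G \<Longrightarrow> brack G h x = (\<Sum>i\<in>UNIV. of_int (z i) * sroot G i h) \<odot> x"
  shows "x \<in> vspan G ({h \<in> cartan G. z = (\<lambda>_. 0)} \<union> {x. \<exists>m. z = (\<lambda>i. int (m i)) \<and> ew G m x}
    \<union> {x. \<exists>m. z = (\<lambda>i. - int (m i)) \<and> fw G m x})"
proof -
  let ?g = "\<lambda>z. {h \<in> cartan G. z = (\<lambda>_. 0)} \<union> {x. \<exists>m. z = (\<lambda>i. int (m i)) \<and> ew G m x} \<union> {x. \<exists>m. z = (\<lambda>i. - int (m i)) \<and> fw G m x}"
  have gs: "?g z \<subseteq> carrier G" for z :: "'n \<Rightarrow> int" using words_sub by (auto simp: words_def)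
  show ?thesis
  proof (rule LV.eigen_separation[where J = UNIV and S = "\<lambda>z. vspan G (?g z)" and H = "cartan G" and B = "brack G"
        and ch = "\<lambda>z h. \<Sum>i\<in>UNIV. of_int (z i) * sroot G i h"])
    show "subsp G (vspan G (?g z))" for z :: "'n \<Rightarrow> int" by (rule LV.subsp_vspan[OF gs])
    show "lin_map G G (brack G h)" if "h \<in> cartan G" for h using lin_map_ad cartan_carrier that by blast
    show "brack G h x = (\<Sum>i\<in>UNIV. of_int (z i) * sroot G i h) \<odot> x" if "x \<in> vspan G (?g z)" "h \<in> cartan G" for z h x
      using that(1) gs[of z]
    proof (induct rule: LV.vspan_induct)
      case (base x)
      have h: "h \<in> cartan G" by fact
      from base consider "x \<in> cartan G" "z = (\<lambda>_. 0)" | m where "z = (\<lambda>i. int (m i))" "ew G m x" | m where "z = (\<lambda>i. - int (m i))" "fw G m x"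
        by auto
      then show ?case
      proof cases
        case 1 then show ?thesis using brack_cartan[OF h] cartan_carrier by simp
      next
        case 2 then show ?thesis using ew_weight[OF 2(2) h] by (simp add: root_of_def)
      next
        case 3 then show ?thesis using fw_weight[OF 3(2) h] by (simp add: root_of_def sum_negf)
      qed
    qed (use cartan_carrier[OF that(2)] in \<open>auto simp: brack_zero brack_add_right brack_smult_right LV.sm_add_r LV.sm_assoc mult.commute\<close>)
    show "\<exists>h\<in>cartan G. (\<Sum>i\<in>UNIV. of_int (z i) * sroot G i h) \<noteq> (\<Sum>i\<in>UNIV. of_int (z' i) * sroot G i h)" if "z \<noteq> z'" for z z' :: "'n \<Rightarrow> int"
    proof (rule ccontr)
      assume "\<not> ?thesis"
      then have "(\<lambda>i. of_int (z i)) = (\<lambda>i. of_int (z' i) :: complex)" by (intro root_inj) auto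
      then show False using that by (auto simp: fun_eq_iff)
    qed
    have ew_z: "\<exists>z. x \<in> ?g z" if "x \<in> words" for x
      using that unfolding words_def by auto
    have "words \<subseteq> (\<Union>z\<in>UNIV. vspan G (?g z))"
    proof
      fix x assume "x \<in> words"
      then obtain z where "x \<in> ?g z" using ew_z by blast
      then have "x \<in> vspan G (?g z)" by (rule LV.vspan_base)
      then show "x \<in> (\<Union>z\<in>UNIV. vspan G (?g z))" by blast
    qed
    then have "vspan G words \<subseteq> vspan G (\<Union>z\<in>UNIV. vspan G (?g z))"
      by (rule LV.vspan_mono) (intro UN_least LV.vspan_subset_carrier gs)
    then show "x \<in> vspan G (\<Union>z\<in>UNIV. vspan G (?g z))" using x carrier_words by blast
  qed (use w in auto)
qed

text \<open>As \<open>m\<close> is nonnegative and not zero, the only words of degree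
  \<open>- m\<close> are the lowering words of that degree.\<close>

lemma root_space_neg:
  assumes x: "x \<in> root_space G (\<lambda>h. - root_of G m h)" and m: "m \<noteq> (\<lambda>_. 0)"
  shows "x \<in> vspan G {x. fw G m x}"
proof -
  have nn: "\<And>m' :: 'n \<Rightarrow> nat. (\<lambda>i. - int (m i)) = (\<lambda>i. int (m' i)) \<Longrightarrow> m = (\<lambda>_. 0)" "(\<lambda>i. - int (m i)) = (\<lambda>_. 0) \<Longrightarrow> m = (\<lambda>_. 0)"
    "\<And>m' :: 'n \<Rightarrow> nat. (\<lambda>i. - int (m i)) = (\<lambda>i. - int (m' i)) \<Longrightarrow> m' = m"
    by (auto simp: fun_eq_iff)
  have "x \<in> vspan G ({h \<in> cartan G. (\<lambda>i. - int (m i)) = (\<lambda>_. 0)} \<union> {x. \<exists>m'. (\<lambda>i. - int (m i)) = (\<lambda>i. int (m' i)) \<and> ew G m' x}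
    \<union> {x. \<exists>m'. (\<lambda>i. - int (m i)) = (\<lambda>i. - int (m' i)) \<and> fw G m' x})"
    by (rule weight_space_words) (use x in \<open>auto simp: root_space_def root_of_def sum_negf\<close>)
  also have "({h \<in> cartan G. (\<lambda>i. - int (m i)) = (\<lambda>_. 0)} \<union> {x. \<exists>m'. (\<lambda>i. - int (m i)) = (\<lambda>i. int (m' i)) \<and> ew G m' x}
    \<union> {x. \<exists>m'. (\<lambda>i. - int (m i)) = (\<lambda>i. - int (m' i)) \<and> fw G m' x}) = {x. fw G m x}"
    using nn m by blast
  finally show ?thesis .
qed

lemma root_space_pos:
  assumes x: "x \<in> root_space G (root_of G m)" and m: "m \<noteq> (\<lambda>_. 0)"
  shows "x \<in> vspan G {x. ew G m x}"
proof -
  have "x \<in> root_space (km_swap G) (\<lambda>h. - root_of (km_swap G) m h)"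
    using x by (simp add: root_space_def root_of_swap km_swap_simps)
  from km_core.root_space_neg[OF km_swap_core this m] show ?thesis
    by (simp add: fw_def ew_swap vspan_swap)
qed

lemma ew_root_space: "ew G m x \<Longrightarrow> x \<in> root_space G (root_of G m)"
  by (simp add: root_space_def ew_carrier ew_weight)

lemma nil_plus_sub: "(\<Union>m\<in>pos_roots G. root_space G (root_of G m)) \<subseteq> carrier G" by (auto simp: root_space_def)

lemma ew_nil_plus: "ew G m x \<Longrightarrow> x \<in> nil_plus G"
proof (cases "x = \<zero>")
  case True
  then show ?thesis unfolding nil_plus_def using subspD(2)[OF LV.subsp_vspan[OF nil_plus_sub]] by simp
next
  case False
  assume "ew G m x"
  then have "x \<in> (\<Union>m\<in>pos_roots G. root_space G (root_of G m))"
    using ew_root_space[of m x] ew_nonzero[of G m x] False by (auto simp: pos_roots_def)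
  then show ?thesis unfolding nil_plus_def by (rule LV.vspan_base)
qed

lemma derived_props:
  "subsp G (derived G)" "\<lbrakk>x \<in> carrier G; y \<in> carrier G\<rbrakk> \<Longrightarrow> brack G x y \<in> derived G"
proof -
  have s: "{brack G x y |x y. x \<in> carrier G \<and> y \<in> carrier G} \<subseteq> carrier G" using brack_closed by auto
  show "subsp G (derived G)" unfolding derived_def by (rule LV.subsp_vspan[OF s])
  show "\<lbrakk>x \<in> carrier G; y \<in> carrier G\<rbrakk> \<Longrightarrow> brack G x y \<in> derived G"
    unfolding derived_def by (rule subsetD[OF LV.vspan_superset]) blast
qed

lemma derived_carrier: "x \<in> derived G \<Longrightarrow> x \<in> carrier G" using subspD(1)[OF derived_props(1)] .

lemma chev_e_derived: "chev_e G i \<in> derived G"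
proof -
  have "brack G (coroot G i) (chev_e G i) = 2 \<odot> chev_e G i"
    using brack_cartan_e[OF coroot_cartan, of i i] sroot_coroot[of i i] gcm by (simp add: gcm_def)
  then have "(1/2) \<odot> (2 \<odot> chev_e G i) \<in> derived G"
    using derived_props(2)[OF coroot_carrier chev_carrier(1), of i i] subspD(4)[OF derived_props(1)] by metis
  then show ?thesis using chev_carrier by (simp add: LV.sm_assoc)
qed

lemma ew_derived: "ew G m x \<Longrightarrow> x \<in> derived G"
  by (induct rule: ew.induct) (auto intro: chev_e_derived derived_props(2) chev_carrier ew_carrier)

lemma derived_swap: "derived (km_swap G) = derived G"
  by (simp add: derived_def vspan_swap km_swap_simps)

lemma fw_derived: "fw G m x \<Longrightarrow> x \<in> derived G"
  using km_core.ew_derived[OF km_swap_core] by (simp add: fw_def derived_swap)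

lemma chev_f_derived: "chev_f G i \<in> derived G" using fw_derived[OF fw_base] .

lemma coroot_derived: "coroot G i \<in> derived G" using brack_e_f[of i i] derived_props(2)[OF chev_carrier, of i i] by simp

lemma nil_plus_derived: "nil_plus G \<subseteq> derived G"
  unfolding nil_plus_def
proof (rule LV.vspan_least[OF derived_props(1)], rule UN_least)
  fix m assume m: "m \<in> pos_roots G"
  have "vspan G {x. ew G m x} \<subseteq> derived G"
    by (rule LV.vspan_least[OF derived_props(1)]) (use ew_derived in blast)
  then show "root_space G (root_of G m) \<subseteq> derived G" using root_space_pos m by (auto simp: pos_roots_def)
qed

lemma nil_plus_subsp: "subsp G (nil_plus G)" unfolding nil_plus_def by (rule LV.subsp_vspan[OF nil_plus_sub])

definition nil_minus where "nil_minus = vspan G {x. \<exists>m. fw G m x}"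

lemma nil_minus_subsp: "subsp G nil_minus" unfolding nil_minus_def using fw_carrier by (intro LV.subsp_vspan) blast

lemma nil_minus_derived: "nil_minus \<subseteq> derived G"
  unfolding nil_minus_def by (rule LV.vspan_least[OF derived_props(1)]) (use fw_derived in blast)

lemma triangular: assumes "x \<in> carrier G" shows "\<exists>p\<in>nil_plus G. \<exists>h\<in>cartan G. \<exists>q\<in>nil_minus. x = p \<oplus> h \<oplus> q"
  using assms[unfolded carrier_words] words_sub
proof (induct rule: LV.vspan_induct)
  have z: "\<zero> \<in> nil_plus G" "\<zero> \<in> cartan G" "\<zero> \<in> nil_minus"
    using subspD(2)[OF nil_plus_subsp] subspD(2)[OF cartan_sub] subspD(2)[OF nil_minus_subsp] by auto
  have c: "p \<in> carrier G" if "p \<in> nil_plus G \<or> p \<in> cartan G \<or> p \<in> nil_minus" for p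
    using that subspD(1)[OF nil_plus_subsp] subspD(1)[OF cartan_sub] subspD(1)[OF nil_minus_subsp] by blast
  {
    case (base x)
    then consider m where "ew G m x" | "x \<in> cartan G" | m where "fw G m x" by (auto simp: words_def)
    then show ?case
    proof cases
      case 1
      have "x = x \<oplus> \<zero> \<oplus> \<zero>" using ew_carrier[OF 1] by simp
      then show ?thesis using ew_nil_plus[OF 1] z by blast
    next
      case 2
      have "x = \<zero> \<oplus> x \<oplus> \<zero>" using cartan_carrier[OF 2] by simp
      then show ?thesis using 2 z by blast
    next
      case 3
      then have "x \<in> nil_minus" unfolding nil_minus_def by (intro subsetD[OF LV.vspan_superset]) blast
      moreover have "x = \<zero> \<oplus> \<zero> \<oplus> x" using fw_carrier[OF 3] by simp
      ultimately show ?thesis using z by blast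
    qed
  next
    case zero
    have "\<zero> = \<zero> \<oplus> \<zero> \<oplus> \<zero>" by simp
    then show ?case using z by blast
  next
    case (add x y)
    then obtain p h q p' h' q' where *: "p \<in> nil_plus G" "h \<in> cartan G" "q \<in> nil_minus" "x = p \<oplus> h \<oplus> q"
      "p' \<in> nil_plus G" "h' \<in> cartan G" "q' \<in> nil_minus" "y = p' \<oplus> h' \<oplus> q'" by blast
    have "x \<oplus> y = (p \<oplus> p') \<oplus> (h \<oplus> h') \<oplus> (q \<oplus> q')" using * c by (simp add: LV.vac)
    then show ?case using * subspD(3)[OF nil_plus_subsp] subspD(3)[OF cartan_sub] subspD(3)[OF nil_minus_subsp] by blast
  next
    case (smult a x)
    then obtain p h q where *: "p \<in> nil_plus G" "h \<in> cartan G" "q \<in> nil_minus" "x = p \<oplus> h \<oplus> q" by blast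
    have "a \<odot> x = a \<odot> p \<oplus> a \<odot> h \<oplus> a \<odot> q" using * c by (simp add: LV.sm_add_r)
    then show ?case using * subspD(4)[OF nil_plus_subsp] subspD(4)[OF cartan_sub] subspD(4)[OF nil_minus_subsp] by blast
  }
qed

text \<open>Both nilpotent parts consist of commutators, so for an element of the derived algebra
  the Cartan component is a commutator as well.\<close>

lemma triangular_derived:
  assumes "x \<in> derived G" shows "\<exists>p\<in>nil_plus G. \<exists>h\<in>cartan' G. \<exists>q\<in>nil_minus. x = p \<oplus> h \<oplus> q"
proof -
  obtain p h q where *: "p \<in> nil_plus G" "h \<in> cartan G" "q \<in> nil_minus" "x = p \<oplus> h \<oplus> q"
    using triangular[OF derived_carrier[OF assms]] by blast
  have d: "p \<in> derived G" "q \<in> derived G" using * nil_plus_derived nil_minus_derived by auto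
  have c: "p \<in> carrier G" "h \<in> carrier G" "q \<in> carrier G" using d derived_carrier cartan_carrier * by auto
  have "h = x \<ominus> p \<ominus> q" unfolding *(4) by (rule LV.vs_eqI) (use c in \<open>auto simp: LV.lf_simps\<close>)
  then have "h \<in> derived G" using assms d LV.subsp_minus(1)[OF derived_props(1)] by simp
  then show ?thesis using * by (auto simp: cartan'_def)
qed

text \<open>Lowering words applied to a start vector \<open>x0\<close> of weight
  \<open>- m0\<close>; the index records the negative of the weight reached.\<close>

inductive xw :: "('n \<Rightarrow> nat) \<Rightarrow> 'g \<Rightarrow> ('n \<Rightarrow> nat) \<Rightarrow> 'g \<Rightarrow> bool" for m0 x0 where
  base: "xw m0 x0 m0 x0"
| step: "xw m0 x0 m x \<Longrightarrow> xw m0 x0 (\<lambda>j. m j + unit_vec i j) (brack G (chev_f G i) x)"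

text \<open>A singular vector of negative weight generates an ideal that meets the Cartan subalgebra trivially.\<close>

lemma singular_zero:
  assumes x0: "x0 \<in> carrier G" and m0: "m0 \<noteq> (\<lambda>_. 0)"
    and w: "\<And>h. h \<in> cartan G \<Longrightarrow> brack G h x0 = (- root_of G m0 h) \<odot> x0"
    and e: "\<And>i. brack G (chev_e G i) x0 = \<zero>"
  shows "x0 = \<zero>"
proof -
  have xc: "x \<in> carrier G" if "xw m0 x0 m x" for m x using that by induct (auto simp: x0 chev_carrier brack_closed)
  have xm: "m \<noteq> (\<lambda>_. 0)" if "xw m0 x0 m x" for m x using that m0 by induct (auto simp: fun_eq_iff)
  have xwt: "brack G h x = (- root_of G m h) \<odot> x" if "xw m0 x0 m x" "h \<in> cartan G" for m x h using that
  proof induct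
    case base then show ?case using w by simp
  next
    case (step m x i)
    then show ?case using weight_brack[OF chev_carrier(2) xc[OF step(1)] step(3) brack_cartan_f step(2), of i]
      by (simp add: root_of_unit root_of_add algebra_simps)
  qed
  let ?X = "vspan G {x. \<exists>m. xw m0 x0 m x}"
  have Xs: "{x. \<exists>m. xw m0 x0 m x} \<subseteq> carrier G" using xc by blast
  note XS = LV.subsp_vspan[OF Xs] note XD = subspD[OF XS]
  have xX: "xw m0 x0 m x \<Longrightarrow> x \<in> ?X" for m x by (rule subsetD[OF LV.vspan_superset]) blast
  have fX: "brack G (chev_f G i) y \<in> ?X" if "y \<in> ?X" for i y
    by (rule span_stable[OF Xs XS chev_carrier(2) _ that]) (use xw.step xX in blast)
  have hX: "brack G h y \<in> ?X" if h: "h \<in> cartan G" and y: "y \<in> ?X" for h y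
    by (rule span_stable[OF Xs XS cartan_carrier[OF h] _ y]) (use xwt h xX XD(4) in auto)
  have ex: "brack G (chev_e G i) x \<in> ?X" if "xw m0 x0 m x" for i m x using that
  proof induct
    case base then show ?case using e XD(2) by simp
  next
    case (step m x j)
    have x: "x \<in> carrier G" using xc step by blast
    have "brack G (brack G (chev_e G i) (chev_f G j)) x \<in> ?X"
      using hX[OF coroot_cartan xX[OF step(1)]] XD(2) x by (auto simp: brack_e_f brack_zero)
    then show ?case using fX[OF step(2)] XD(3) chev_carrier x by (simp add: jacobi_ad[of "chev_e G i" "chev_f G j" x])
  qed
  have eX: "brack G (chev_e G i) y \<in> ?X" if "y \<in> ?X" for i y
    by (rule span_stable[OF Xs XS chev_carrier(1) _ that]) (use ex in blast)
  have ideal: "lie_ideal G ?X" by (rule generated_stable[OF XS hX eX fX])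
  \<comment> \<open>A Cartan element has weight 0, whereas \<open>?X\<close> is spanned by vectors
    of weights \<open>- m\<close> with \<open>m \<noteq> 0\<close>. Separation of weights leaves
    only zero in the intersection.\<close>
  have "y = \<zero>" if y: "y \<in> ?X" "y \<in> cartan G" for y
  proof -
    have Ss: "{x. xw m0 x0 m x} \<subseteq> carrier G" for m using Xs by blast
    have "y \<in> vspan G {x. xw m0 x0 (\<lambda>_. 0) x}"
    proof (rule LV.eigen_separation[where J = UNIV and S = "\<lambda>m. vspan G {x. xw m0 x0 m x}" and H = "cartan G" and B = "brack G"
          and ch = "\<lambda>m h. - root_of G m h"])
      show "subsp G (vspan G {x. xw m0 x0 m x})" for m by (rule LV.subsp_vspan[OF Ss])
      show "lin_map G G (brack G h)" if "h \<in> cartan G" for h using lin_map_ad cartan_carrier that by blast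
      show "brack G h x = (- root_of G m h) \<odot> x" if "x \<in> vspan G {x. xw m0 x0 m x}" "h \<in> cartan G" for m h x
        using that(1) Ss[of m]
        by (induct rule: LV.vspan_induct) (use xwt that cartan_carrier[OF that(2)] in
            \<open>auto simp: brack_zero brack_add_right brack_smult_right LV.sm_add_r LV.sm_assoc mult.commute\<close>)
      show "\<exists>h\<in>cartan G. - root_of G m h \<noteq> - root_of G m' h" if "m \<noteq> m'" for m m' :: "'n \<Rightarrow> nat"
      proof (rule ccontr)
        assume "\<not> ?thesis"
        then have "(\<lambda>i. of_nat (m i)) = (\<lambda>i. of_nat (m' i) :: complex)" by (intro root_inj) (auto simp: root_of_def)
        then show False using that by (auto simp: fun_eq_iff)
      qed
      show "y \<in> vspan G (\<Union>m\<in>UNIV. vspan G {x. xw m0 x0 m x})"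
      proof (rule subsetD[OF LV.vspan_mono y(1)])
        show "{x. \<exists>m. xw m0 x0 m x} \<subseteq> (\<Union>m\<in>UNIV. vspan G {x. xw m0 x0 m x})" by (auto intro: LV.vspan_base)
        show "(\<Union>m\<in>UNIV. vspan G {x. xw m0 x0 m x}) \<subseteq> carrier G" by (intro UN_least LV.vspan_subset_carrier Ss)
      qed
      show "brack G h y = (- root_of G (\<lambda>_. 0) h) \<odot> y" if "h \<in> cartan G" for h
        using y that brack_cartan cartan_carrier by (simp add: root_of_def)
    qed simp
    also have "{x. xw m0 x0 (\<lambda>_. 0) x} = {}" using xm by blast
    also have "vspan G {} \<subseteq> {\<zero>}" by (rule LV.vspan_least[OF LV.subsp_zero]) simp
    finally show ?thesis by simp
  qed
  then have "?X \<inter> cartan G = {\<zero>}" using XD(2) subspD(2)[OF cartan_sub] by blast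
  then have "?X = {\<zero>}" using no_ideal ideal by blast
  then show ?thesis using xX[OF xw.base] by blast
qed

lemma ad_pow_closed: "f \<in> carrier G \<Longrightarrow> y \<in> carrier G \<Longrightarrow> (brack G f ^^ n) y \<in> carrier G"
  by (induct n) (auto simp: brack_closed)

lemma ad_pow_zero: "f \<in> carrier G \<Longrightarrow> (brack G f ^^ n) \<zero> = \<zero>"
  by (induct n) (auto simp: brack_zero)

text \<open>The left side is killed by every \<open>e_k\<close> and has nonzero negative weight, so
  \<open>singular_zero\<close> applies. For \<open>k = i\<close> this is the sl2 formula for a
  vector of coroot weight \<open>- C $ i $ j\<close>; for other \<open>k\<close> the element
  \<open>e_k\<close> commutes with \<open>f_i\<close>, so only its bracket with \<open>f_j\<close>
  matters.\<close>

lemma serre: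
  assumes ij: "i \<noteq> j" shows "(brack G (chev_f G i) ^^ Suc (nat (- C $ i $ j))) (chev_f G j) = \<zero>"
proof -
  let ?f = "chev_f G i" and ?N = "nat (- C $ i $ j)"
  let ?x = "(brack G ?f ^^ Suc ?N) (chev_f G j)"
  have f: "?f \<in> carrier G" by (rule chev_carrier)
  have xc: "(brack G ?f ^^ n) (chev_f G j) \<in> carrier G" for n using ad_pow_closed chev_carrier by blast
  interpret A: lie_module G adj by (rule adjoint_module)
  have neg: "C $ i $ j \<le> 0" using gcm ij by (auto simp: gcm_def)
  \<comment> \<open>The iterated bracket with \<open>n\<close> factors \<open>f_i\<close> has weight
    \<open>- (n \<alpha>_i + \<alpha>_j)\<close>.\<close>
  define mm where "mm n = (\<lambda>l. n * unit_vec i l + unit_vec j l)" for n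
  have "brack G h ((brack G ?f ^^ n) (chev_f G j)) = (- root_of G (mm n) h) \<odot> (brack G ?f ^^ n) (chev_f G j)" if h: "h \<in> cartan G" for n h
  proof (induct n)
    case 0 then show ?case using h by (simp add: mm_def root_of_unit brack_cartan_f)
  next
    case (Suc n)
    have m: "mm (Suc n) = (\<lambda>l. mm n l + unit_vec i l)" by (auto simp: mm_def)
    show ?case using weight_brack[OF f xc h brack_cartan_f[OF h] Suc]
      by (simp add: m root_of_unit root_of_add algebra_simps)
  qed
  moreover have "brack G (chev_e G k) ?x = \<zero>" for k
  proof (cases "k = i")
    case True
    have "act adj (chev_e G i) ((act adj ?f ^^ Suc ?N) (chev_f G j)) = (of_nat (Suc ?N) * (of_int (- C $ i $ j) - of_nat ?N)) \<odot>\<^bsub>adj\<^esub> (act adj ?f ^^ ?N) (chev_f G j)"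
    proof (rule A.sl2_pow(2))
      show "brack G (chev_e G i) ?f = coroot G i" by (simp add: brack_e_f)
      show "brack G (coroot G i) ?f = (- 2) \<odot> ?f"
        using brack_cartan_f[OF coroot_cartan, of i i] sroot_coroot[of i i] gcm by (simp add: gcm_def)
      show "act adj (chev_e G i) (chev_f G j) = \<zero>\<^bsub>adj\<^esub>" using ij by (simp add: adj_simps brack_e_f)
      show "act adj (coroot G i) (chev_f G j) = of_int (- C $ i $ j) \<odot>\<^bsub>adj\<^esub> chev_f G j"
        using brack_cartan_f[OF coroot_cartan, of i j] sroot_coroot[of j i] by (simp add: adj_simps)
    qed (auto simp: chev_carrier adj_simps)
    \<comment> \<open>The exponent in the Serre relation is one more than
      \<open>- C $ i $ j\<close>, which is where the sl2 coefficient has its zero.\<close>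
    moreover have "(of_int (- C $ i $ j) - of_nat ?N :: complex) = 0" using neg by simp
    ultimately show ?thesis using True xc[of ?N] by (simp add: adj_simps del: funpow.simps)
  next
    case False
    have "brack G (chev_e G k) ((brack G ?f ^^ n) (chev_f G j)) = (brack G ?f ^^ n) (brack G (chev_e G k) (chev_f G j))" for n
    proof (induct n)
      case (Suc n)
      then show ?case using jacobi_ad[of "chev_e G k" ?f "(brack G ?f ^^ n) (chev_f G j)"] False xc chev_carrier brack_closed ad_pow_closed
        by (simp add: brack_e_f brack_zero coroot_carrier)
    qed simp
    then have *: "brack G (chev_e G k) ?x = (brack G ?f ^^ Suc ?N) (brack G (chev_e G k) (chev_f G j))" .
    show ?thesis
    proof (cases "k = j")
      case False then show ?thesis unfolding * using ad_pow_zero[OF f] by (simp add: brack_e_f del: funpow.simps)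
    next
      case True
      have 1: "brack G ?f (coroot G j) = of_int (C $ j $ i) \<odot> ?f"
        using brack_anti[OF f coroot_carrier] brack_cartan_f[OF coroot_cartan, of j i] sroot_coroot[of i j] f by (simp add: LV.sm_assoc)
      have "(brack G ?f ^^ Suc ?N) (coroot G j) = (brack G ?f ^^ ?N) (of_int (C $ j $ i) \<odot> ?f)"
        unfolding funpow_Suc_right o_def 1 ..
      also have "\<dots> = \<zero>"
      \<comment> \<open>If an operator \<open>ad f_i\<close> is left, it meets \<open>f_i\<close>
        itself. Otherwise \<open>C $ i $ j = 0\<close>, and the coefficient vanishes because the
        zeros of a generalised Cartan matrix are symmetric.\<close>
      proof (cases ?N)
        case 0
        then have "C $ i $ j = 0" using neg by simp
        then have "C $ j $ i = 0" using gcm by (auto simp: gcm_def)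
        then show ?thesis using f 0 by simp
      next
        case (Suc n)
        then show ?thesis using f ad_pow_zero[OF f, of n] unfolding Suc funpow_Suc_right o_def
          by (simp add: brack_smult_right brack_self)
      qed
      finally show ?thesis unfolding * using True by (simp add: brack_e_f del: funpow.simps)
    qed
  qed
  moreover have "mm (Suc ?N) \<noteq> (\<lambda>_. 0)" by (auto simp: mm_def fun_eq_iff unit_vec_def)
  ultimately show ?thesis using singular_zero[OF xc] by blast
qed

text \<open>The elements on which \<open>ad f_i\<close> is nilpotent form a subalgebra by the
  Leibniz rule, so the generators decide: Cartan elements need two steps, the \<open>e_j\<close> at
  most three, \<open>f_i\<close> one, and the other \<open>f_j\<close> are covered by the Serre
  relations.\<close>

lemma ad_f_nilp: assumes "y \<in> carrier G" shows "\<exists>n. (brack G (chev_f G i) ^^ n) y = \<zero>"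
proof -
  let ?f = "chev_f G i"
  interpret A: lie_module G adj by (rule adjoint_module)
  have f: "?f \<in> carrier G" by (rule chev_carrier)
  let ?S = "{y \<in> carrier G. \<exists>n. (brack G ?f ^^ n) y = \<zero>}"
  have pl: "lin_map G G (brack G ?f ^^ n)" for n using A.lin_map_act_pow[OF f, of n] by (simp add: lin_map_def adj_simps)
  have mono: "(brack G ?f ^^ m) y = \<zero>" if "(brack G ?f ^^ n) y = \<zero>" "n \<le> m" for n m y
    using A.act_pow_mono[OF f, of n y m] that by (simp add: adj_simps)
  have "?S = carrier G"
  proof (rule generated)
    have "subsp G ?S" unfolding subsp_def
    proof (intro conjI ballI allI)
      fix x y assume x: "x \<in> ?S" and y: "y \<in> ?S"
      then obtain n n' where "(brack G ?f ^^ n) x = \<zero>" "(brack G ?f ^^ n') y = \<zero>" by auto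
      then have "(brack G ?f ^^ max n n') x = \<zero>" "(brack G ?f ^^ max n n') y = \<zero>" using mono by auto
      then have "(brack G ?f ^^ max n n') (x \<oplus> y) = \<zero>" using lin_mapD(2)[OF pl] x y by simp
      then show "x \<oplus> y \<in> ?S" using x y by auto
    next
      fix c x assume x: "x \<in> ?S"
      then obtain n where "(brack G ?f ^^ n) x = \<zero>" by auto
      then have "(brack G ?f ^^ n) (c \<odot> x) = \<zero>" using lin_mapD(3)[OF pl] x by simp
      then show "c \<odot> x \<in> ?S" using x by auto
    qed (auto intro: exI[of _ 0])
    moreover have "brack G x y \<in> ?S" if "x \<in> ?S" "y \<in> ?S" for x y
    proof -
      from that obtain n n' where "(brack G ?f ^^ n) x = \<zero>" "(brack G ?f ^^ n') y = \<zero>" by auto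
      then have "(brack G ?f ^^ (n + n')) (brack G x y) = \<zero>"
        using A.ad_nilp_step[OF f, of x y n n'] that by (simp add: adj_simps)
      then show ?thesis using that brack_closed by blast
    qed
    ultimately show "lie_subalgebra G ?S" unfolding lie_subalgebra_iff by blast
    have fh: "brack G ?f h = sroot G i h \<odot> ?f" if "h \<in> cartan G" for h
      using brack_anti[OF f cartan_carrier[OF that]] brack_cartan_f[OF that, of i] f by (simp add: LV.sm_assoc)
    have fh2: "(brack G ?f ^^ 2) h = \<zero>" if "h \<in> cartan G" for h
      using fh[OF that] f by (simp add: numeral_2_eq_2 brack_smult_right brack_self)
    then show "cartan G \<subseteq> ?S" using cartan_carrier by blast
    have fe: "brack G ?f (chev_e G j) = (-1) \<odot> (if i = j then coroot G j else \<zero>)" for j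
      using brack_anti[OF f chev_carrier(1)[of j]] brack_e_f[of j i] by auto
    have "(brack G ?f ^^ Suc 2) (chev_e G j) = \<zero>" for j
    proof -
      have "(brack G ?f ^^ Suc 2) (chev_e G j) = (brack G ?f ^^ 2) ((-1) \<odot> (if i = j then coroot G j else \<zero>))"
        unfolding funpow_Suc_right o_def fe ..
      then show ?thesis using fh2[OF subspD(4)[OF cartan_sub coroot_cartan], of "-1" j] ad_pow_zero[OF f, of 2] by auto
    qed
    then show "chev_e G j \<in> ?S" for j using chev_carrier by blast
    show "chev_f G j \<in> ?S" for j
    proof (cases "i = j")
      case True
      have "(brack G ?f ^^ 1) ?f = \<zero>" using f by (simp add: brack_self)
      then show ?thesis using True f by blast
    next
      case False then show ?thesis using serre[OF False] chev_carrier by blast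
    qed
  qed
  then show ?thesis using assms by blast
qed

lemma ad_e_nilp: "y \<in> carrier G \<Longrightarrow> \<exists>n. (brack G (chev_e G i) ^^ n) y = \<zero>"
  using km_core.ad_f_nilp[OF km_swap_core, of y i] by (simp add: km_swap_simps)

end

section \<open>The current algebra\<close>

lemma (in vspace) lin_map_plus: "lin_map W V f \<Longrightarrow> lin_map W V g \<Longrightarrow> lin_map W V (\<lambda>x. f x \<oplus> g x)"
  by (auto simp: lin_map_def sm_add_r a_ac)
lemma (in vspace) lin_map_scale: "lin_map W V f \<Longrightarrow> lin_map W V (\<lambda>x. c \<odot> f x)"
  by (auto simp: lin_map_def sm_add_r sm_assoc mult.commute)
lemma (in vspace) lin_map_id: "lin_map V V (\<lambda>x. x)" by (simp add: lin_map_def)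

lemma bilin_lin1: "bilin V W E f \<Longrightarrow> y \<in> carrier W \<Longrightarrow> lin_map V E (\<lambda>x. f x y)"
  and bilin_lin2: "bilin V W E f \<Longrightarrow> x \<in> carrier V \<Longrightarrow> lin_map W E (f x)"
  by (auto simp: bilin_def)

locale cur = km_core C G
  for C :: "int^'n^'n" and G :: "('g, 'n::finite) km" +
  fixes H2 :: "'g set" and A :: "(complex, 'a) module"
  assumes H2: "cartan_complement G H2" and A: "Module.algebra cplx A"
begin

abbreviation mult_A (infixl "\<cdot>" 70) where "a \<cdot> b \<equiv> a \<otimes>\<^bsub>A\<^esub> b"
abbreviation one_A ("\<one>\<^sub>A") where "\<one>\<^sub>A \<equiv> \<one>\<^bsub>A\<^esub>"
abbreviation "ipow \<equiv> ideal_power A"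

abbreviation "G' \<equiv> G\<lparr>carrier := derived G\<rparr>"
abbreviation "Lc \<equiv> current G A H2"

sublocale A: cring A using A by (simp add: algebra_def)
sublocale AV: vspace A
  using A unfolding algebra_def by (simp add: module_iff_vspace)
sublocale GV: vspace G' by (rule vspace_sub[OF LV.vspace_axioms derived_props(1)])

lemma A_bilin: "bilin A A A (mult A)"
proof -
  interpret AA: Module.algebra cplx A by (rule A)
  have l: "(c \<odot>\<^bsub>A\<^esub> x) \<cdot> y = c \<odot>\<^bsub>A\<^esub> (x \<cdot> y)" if "x \<in> carrier A" "y \<in> carrier A" for c x y
    using AA.smult_assoc2[of c x y] that by simp
  have r: "x \<cdot> (c \<odot>\<^bsub>A\<^esub> y) = c \<odot>\<^bsub>A\<^esub> (x \<cdot> y)" if "x \<in> carrier A" "y \<in> carrier A" for c x y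
    using l[OF that(2,1), of c] A.m_comm[of x "c \<odot>\<^bsub>A\<^esub> y"] A.m_comm[of y x] that AV.sm_closed by simp
  show ?thesis by (rule bilinI) (simp_all add: A.l_distr A.r_distr l r)
qed

sublocale Tn: tens G' A "{}" "\<lambda>v r. v" "\<lambda>r w. w"
  rewrites "tensor_over {} G' (\<lambda>v r. v) A (\<lambda>r w. w) = tensor G' A"
    and "tensor_over_pure {} G' (\<lambda>v r. v) A (\<lambda>r w. w) = tensor_pure G' A"
proof -
  show "tens G' A {} (\<lambda>v r. v) (\<lambda>r w. w)"
    by (intro tens.intro tens_axioms.intro GV.vspace_axioms AV.vspace_axioms) auto
qed (simp_all add: tensor_over_empty)

abbreviation "TT \<equiv> tensor G' A"
abbreviation "pt \<equiv> tensor_pure G' A"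

text \<open>
  On \<open>g' \<otimes> A\<close>: \<open>bt X a\<close> brackets with the pure tensor \<open>X \<otimes> a\<close>, \<open>tt\<close> is the bracket, \<open>ht h\<close> the derivation
  \<open>ad h \<otimes> id\<close>, and \<open>mu c\<close> the multiplication by \<open>c \<in> A\<close>.
\<close>

definition bt where "bt X a = lin_ext TT (\<lambda>(Y, b). pt (brack G X Y) (a \<cdot> b))"
definition tt where "tt s t = lin_ext TT (\<lambda>(X, a). bt X a t) s"
definition ht where "ht h = lin_ext TT (\<lambda>(X, a). pt (brack G h X) a)"
definition mu where "mu c = lin_ext TT (\<lambda>(X, a). pt X (c \<cdot> a))"

lemma dG: "X \<in> derived G \<Longrightarrow> X \<in> carrier G" by (rule derived_carrier)
lemma db: "X \<in> carrier G \<Longrightarrow> Y \<in> derived G \<Longrightarrow> brack G X Y \<in> derived G" using derived_props(2) dG by blast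

lemma pt_simps:
  "\<lbrakk>X \<in> derived G; a \<in> carrier A\<rbrakk> \<Longrightarrow> pt X a \<in> carrier TT"
  "\<lbrakk>X \<in> derived G; X' \<in> derived G; a \<in> carrier A\<rbrakk> \<Longrightarrow> pt (X \<oplus>\<^bsub>G\<^esub> X') a = pt X a \<oplus>\<^bsub>TT\<^esub> pt X' a"
  "\<lbrakk>X \<in> derived G; a \<in> carrier A; a' \<in> carrier A\<rbrakk> \<Longrightarrow> pt X (a \<oplus>\<^bsub>A\<^esub> a') = pt X a \<oplus>\<^bsub>TT\<^esub> pt X a'"
  "\<lbrakk>X \<in> derived G; a \<in> carrier A\<rbrakk> \<Longrightarrow> pt (c \<odot>\<^bsub>G\<^esub> X) a = c \<odot>\<^bsub>TT\<^esub> pt X a"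
  "\<lbrakk>X \<in> derived G; a \<in> carrier A\<rbrakk> \<Longrightarrow> pt X (c \<odot>\<^bsub>A\<^esub> a) = c \<odot>\<^bsub>TT\<^esub> pt X a"
  using Tn.tpD by simp_all

lemma T_eqI:
  assumes "lin_map TT TT f" "lin_map TT TT g" "t \<in> carrier TT"
    "\<And>X a. X \<in> derived G \<Longrightarrow> a \<in> carrier A \<Longrightarrow> f (pt X a) = g (pt X a)"
  shows "f t = g t"
  by (rule Tn.lin_map_eqT[OF Tn.TV.vspace_axioms assms(1-3)]) (use assms(4) in auto)

lemma T_liftI:
  assumes "bilin G' A TT f"
  shows "lin_map TT TT (lin_ext TT (\<lambda>(x, y). f x y))"
    "\<lbrakk>X \<in> derived G; a \<in> carrier A\<rbrakk> \<Longrightarrow> lin_ext TT (\<lambda>(x, y). f x y) (pt X a) = f X a"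
  using Tn.T_lift[OF Tn.TV.vspace_axioms assms] by simp_all

lemma bt:
  assumes X: "X \<in> carrier G" and a: "a \<in> carrier A"
  shows "lin_map TT TT (bt X a)" "\<lbrakk>Y \<in> derived G; b \<in> carrier A\<rbrakk> \<Longrightarrow> bt X a (pt Y b) = pt (brack G X Y) (a \<cdot> b)"
proof -
  have "bilin G' A TT (\<lambda>Y b. pt (brack G X Y) (a \<cdot> b))"
    by (rule bilinI) (use X a dG db in \<open>auto simp: pt_simps brack_add_right brack_smult_right bilinD[OF A_bilin]\<close>)
  from T_liftI[OF this] show "lin_map TT TT (bt X a)" "\<lbrakk>Y \<in> derived G; b \<in> carrier A\<rbrakk> \<Longrightarrow> bt X a (pt Y b) = pt (brack G X Y) (a \<cdot> b)"
    by (simp_all add: bt_def)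
qed

lemma ht:
  assumes h: "h \<in> carrier G"
  shows "lin_map TT TT (ht h)" "\<lbrakk>Y \<in> derived G; b \<in> carrier A\<rbrakk> \<Longrightarrow> ht h (pt Y b) = pt (brack G h Y) b"
proof -
  have "bilin G' A TT (\<lambda>Y b. pt (brack G h Y) b)"
    by (rule bilinI) (use h dG db in \<open>auto simp: pt_simps brack_add_right brack_smult_right\<close>)
  from T_liftI[OF this] show "lin_map TT TT (ht h)" "\<lbrakk>Y \<in> derived G; b \<in> carrier A\<rbrakk> \<Longrightarrow> ht h (pt Y b) = pt (brack G h Y) b"
    by (simp_all add: ht_def)
qed

lemma mu:
  assumes c: "c \<in> carrier A"
  shows "lin_map TT TT (mu c)" "\<lbrakk>Y \<in> derived G; b \<in> carrier A\<rbrakk> \<Longrightarrow> mu c (pt Y b) = pt Y (c \<cdot> b)"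
proof -
  have "bilin G' A TT (\<lambda>Y b. pt Y (c \<cdot> b))"
    by (rule bilinI) (use c dG db in \<open>auto simp: pt_simps bilinD[OF A_bilin]\<close>)
  from T_liftI[OF this] show "lin_map TT TT (mu c)" "\<lbrakk>Y \<in> derived G; b \<in> carrier A\<rbrakk> \<Longrightarrow> mu c (pt Y b) = pt Y (c \<cdot> b)"
    by (simp_all add: mu_def)
qed

lemmas btD = lin_mapD[OF bt(1)] and htD = lin_mapD[OF ht(1)] and muD = lin_mapD[OF mu(1)]
lemmas lmap = Tn.TV.lin_map_plus Tn.TV.lin_map_scale Tn.TV.lin_map_id bt(1) ht(1) mu(1)

lemma bt_bilin: assumes t: "t \<in> carrier TT" shows "bilin G' A TT (\<lambda>X a. bt X a t)"
proof (rule bilinI; simp)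
  fix X a assume X: "X \<in> derived G" and a: "a \<in> carrier A"
  show "bt X a t \<in> carrier TT" using btD(1) dG X a t by blast
  show "bt (X \<oplus>\<^bsub>G\<^esub> X') a t = bt X a t \<oplus>\<^bsub>TT\<^esub> bt X' a t" if X': "X' \<in> derived G" for X'
    by (rule T_eqI[OF _ _ t]) (use X X' a dG db in \<open>auto intro!: lmap simp: bt(2) pt_simps brack_add_left\<close>)
  show "bt X (a \<oplus>\<^bsub>A\<^esub> a') t = bt X a t \<oplus>\<^bsub>TT\<^esub> bt X a' t" if a': "a' \<in> carrier A" for a'
    by (rule T_eqI[OF _ _ t]) (use X a a' dG db in \<open>auto intro!: lmap simp: bt(2) pt_simps bilinD[OF A_bilin]\<close>)
  show "bt (c \<odot>\<^bsub>G\<^esub> X) a t = c \<odot>\<^bsub>TT\<^esub> bt X a t" for c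
    by (rule T_eqI[OF _ _ t]) (use X a dG db in \<open>auto intro!: lmap simp: bt(2) pt_simps brack_smult_left\<close>)
  show "bt X (c \<odot>\<^bsub>A\<^esub> a) t = c \<odot>\<^bsub>TT\<^esub> bt X a t" for c
    by (rule T_eqI[OF _ _ t]) (use X a dG db in \<open>auto intro!: lmap simp: bt(2) pt_simps bilinD[OF A_bilin]\<close>)
qed

lemma tt_left:
  assumes t: "t \<in> carrier TT"
  shows "lin_map TT TT (\<lambda>s. tt s t)" "\<lbrakk>X \<in> derived G; a \<in> carrier A\<rbrakk> \<Longrightarrow> tt (pt X a) t = bt X a t"
  using T_liftI[OF bt_bilin[OF t]] by (simp_all add: tt_def)

lemma tt_closed: "s \<in> carrier TT \<Longrightarrow> t \<in> carrier TT \<Longrightarrow> tt s t \<in> carrier TT"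
  using lin_mapD(1)[OF tt_left(1)] by blast

lemma tt_bilin: "bilin TT TT TT tt"
  unfolding bilin_def
proof (intro conjI ballI)
  show "lin_map TT TT (\<lambda>s. tt s t)" if "t \<in> carrier TT" for t using tt_left(1)[OF that] .
  fix s assume s: "s \<in> carrier TT"
  show "lin_map TT TT (tt s)"
  proof (rule lin_mapI)
    fix t c assume t: "t \<in> carrier TT"
    show "tt s t \<in> carrier TT" using tt_closed s t .
    show "tt s (c \<odot>\<^bsub>TT\<^esub> t) = c \<odot>\<^bsub>TT\<^esub> tt s t"
      by (rule T_eqI[OF _ _ s]) (use t dG in \<open>auto intro!: lmap tt_left simp: tt_left(2) btD\<close>)
    show "tt s (t \<oplus>\<^bsub>TT\<^esub> t') = tt s t \<oplus>\<^bsub>TT\<^esub> tt s t'" if t': "t' \<in> carrier TT" for t'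
      by (rule T_eqI[OF _ _ s]) (use t t' dG in \<open>auto intro!: lmap tt_left simp: tt_left(2) btD\<close>)
  qed
qed

lemmas ttD = bilinD[OF tt_bilin]
lemmas tt_lin1 = bilin_lin1[OF tt_bilin] and tt_lin2 = bilin_lin2[OF tt_bilin]

lemma tt_pure: "\<lbrakk>X \<in> derived G; a \<in> carrier A; Y \<in> derived G; b \<in> carrier A\<rbrakk> \<Longrightarrow> tt (pt X a) (pt Y b) = pt (brack G X Y) (a \<cdot> b)"
  by (simp add: tt_left(2) bt(2) dG pt_simps)

text \<open>The identities for \<open>tt\<close> and \<open>ht\<close> are linear in every argument.
  They are checked by fixing all arguments but one and passing to pure tensors, one argument after
  the other.\<close>

lemma tt_anti: assumes s: "s \<in> carrier TT" and t: "t \<in> carrier TT" shows "tt s t = (-1) \<odot>\<^bsub>TT\<^esub> tt t s"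
proof (rule T_eqI[OF tt_lin1[OF t] Tn.TV.lin_map_scale[OF tt_lin2[OF t]] s])
  fix X a assume X: "X \<in> derived G" and a: "a \<in> carrier A"
  have x: "pt X a \<in> carrier TT" using X a pt_simps by blast
  show "tt (pt X a) t = (-1) \<odot>\<^bsub>TT\<^esub> tt t (pt X a)"
  proof (rule T_eqI[OF tt_lin2[OF x] Tn.TV.lin_map_scale[OF tt_lin1[OF x]] t])
    fix Y b assume Y: "Y \<in> derived G" and b: "b \<in> carrier A"
    show "tt (pt X a) (pt Y b) = (-1) \<odot>\<^bsub>TT\<^esub> tt (pt Y b) (pt X a)"
      using X Y a b brack_anti[OF dG[OF X] dG[OF Y]] db dG A.m_comm by (simp add: tt_pure pt_simps)
  qed
qed

lemma lin_map_ht_ht: "h \<in> carrier G \<Longrightarrow> k \<in> carrier G \<Longrightarrow> lin_map TT TT (\<lambda>t. ht h (ht k t))"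
  using lin_map_comp ht(1) by blast

lemma ht_brack: assumes h: "h \<in> carrier G" and k: "k \<in> carrier G" and t: "t \<in> carrier TT"
  shows "ht h (ht k t) = ht (brack G h k) t \<oplus>\<^bsub>TT\<^esub> ht k (ht h t)"
proof (rule T_eqI[OF lin_map_ht_ht[OF h k] Tn.TV.lin_map_plus[OF ht(1)[OF brack_closed[OF h k]] lin_map_ht_ht[OF k h]] t])
  fix X a assume X: "X \<in> derived G" and a: "a \<in> carrier A"
  show "ht h (ht k (pt X a)) = ht (brack G h k) (pt X a) \<oplus>\<^bsub>TT\<^esub> ht k (ht h (pt X a))"
    using h k X a db dG brack_closed by (simp add: ht(2) jacobi_ad[of h k X] pt_simps)
qed

lemma ht_der: assumes h: "h \<in> carrier G" and s: "s \<in> carrier TT" and t: "t \<in> carrier TT"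
  shows "ht h (tt s t) = tt (ht h s) t \<oplus>\<^bsub>TT\<^esub> tt s (ht h t)"
proof (rule T_eqI[OF _ _ s])
  have htt: "ht h t \<in> carrier TT" using htD(1) h t by blast
  show "lin_map TT TT (\<lambda>s. ht h (tt s t))" by (rule lin_map_comp[OF tt_lin1[OF t] ht(1)[OF h]])
  show "lin_map TT TT (\<lambda>s. tt (ht h s) t \<oplus>\<^bsub>TT\<^esub> tt s (ht h t))"
    by (rule Tn.TV.lin_map_plus[OF lin_map_comp[OF ht(1)[OF h] tt_lin1[OF t]] tt_lin1[OF htt]])
  fix X a assume X: "X \<in> derived G" and a: "a \<in> carrier A"
  have x: "pt X a \<in> carrier TT" using X a pt_simps by blast
  have hx: "ht h (pt X a) \<in> carrier TT" using htD(1) h x by blast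
  show "ht h (tt (pt X a) t) = tt (ht h (pt X a)) t \<oplus>\<^bsub>TT\<^esub> tt (pt X a) (ht h t)"
  proof (rule T_eqI[OF _ _ t])
    show "lin_map TT TT (\<lambda>t. ht h (tt (pt X a) t))" by (rule lin_map_comp[OF tt_lin2[OF x] ht(1)[OF h]])
    show "lin_map TT TT (\<lambda>t. tt (ht h (pt X a)) t \<oplus>\<^bsub>TT\<^esub> tt (pt X a) (ht h t))"
      by (rule Tn.TV.lin_map_plus[OF tt_lin2[OF hx] lin_map_comp[OF ht(1)[OF h] tt_lin2[OF x]]])
    show "ht h (tt (pt X a) (pt Y b)) = tt (ht h (pt X a)) (pt Y b) \<oplus>\<^bsub>TT\<^esub> tt (pt X a) (ht h (pt Y b))"
      if "Y \<in> derived G" "b \<in> carrier A" for Y b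
      using h X a that db dG brack_closed by (simp add: tt_pure ht(2) pt_simps jacobi_ad[of h X Y])
  qed
qed

lemma tt_der: assumes r: "r \<in> carrier TT" and s: "s \<in> carrier TT" and t: "t \<in> carrier TT"
  shows "tt r (tt s t) = tt (tt r s) t \<oplus>\<^bsub>TT\<^esub> tt s (tt r t)"
proof (rule T_eqI[OF _ _ r])
  show "lin_map TT TT (\<lambda>r. tt r (tt s t))" by (rule tt_lin1[OF tt_closed[OF s t]])
  show "lin_map TT TT (\<lambda>r. tt (tt r s) t \<oplus>\<^bsub>TT\<^esub> tt s (tt r t))"
    by (rule Tn.TV.lin_map_plus[OF lin_map_comp[OF tt_lin1[OF s] tt_lin1[OF t]] lin_map_comp[OF tt_lin1[OF t] tt_lin2[OF s]]])
  fix Z c assume Z: "Z \<in> derived G" and c: "c \<in> carrier A"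
  have z: "pt Z c \<in> carrier TT" using Z c pt_simps by blast
  show "tt (pt Z c) (tt s t) = tt (tt (pt Z c) s) t \<oplus>\<^bsub>TT\<^esub> tt s (tt (pt Z c) t)"
  proof (rule T_eqI[OF _ _ s])
    show "lin_map TT TT (\<lambda>s. tt (pt Z c) (tt s t))" by (rule lin_map_comp[OF tt_lin1[OF t] tt_lin2[OF z]])
    show "lin_map TT TT (\<lambda>s. tt (tt (pt Z c) s) t \<oplus>\<^bsub>TT\<^esub> tt s (tt (pt Z c) t))"
      by (rule Tn.TV.lin_map_plus[OF lin_map_comp[OF tt_lin2[OF z] tt_lin1[OF t]] tt_lin1[OF tt_closed[OF z t]]])
    fix X a assume X: "X \<in> derived G" and a: "a \<in> carrier A"
    have x: "pt X a \<in> carrier TT" using X a pt_simps by blast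
    show "tt (pt Z c) (tt (pt X a) t) = tt (tt (pt Z c) (pt X a)) t \<oplus>\<^bsub>TT\<^esub> tt (pt X a) (tt (pt Z c) t)"
    proof (rule T_eqI[OF _ _ t])
      show "lin_map TT TT (\<lambda>t. tt (pt Z c) (tt (pt X a) t))" by (rule lin_map_comp[OF tt_lin2[OF x] tt_lin2[OF z]])
      show "lin_map TT TT (\<lambda>t. tt (tt (pt Z c) (pt X a)) t \<oplus>\<^bsub>TT\<^esub> tt (pt X a) (tt (pt Z c) t))"
        by (rule Tn.TV.lin_map_plus[OF tt_lin2[OF tt_closed[OF z x]] lin_map_comp[OF tt_lin2[OF z] tt_lin2[OF x]]])
      fix Y b assume Y: "Y \<in> derived G" and b: "b \<in> carrier A"
      have "a \<cdot> (c \<cdot> b) = c \<cdot> (a \<cdot> b)" using a b c by (simp add: A.m_lcomm)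
      then show "tt (pt Z c) (tt (pt X a) (pt Y b)) = tt (tt (pt Z c) (pt X a)) (pt Y b) \<oplus>\<^bsub>TT\<^esub> tt (pt X a) (tt (pt Z c) (pt Y b))"
        using X Y Z a b c db dG by (simp add: tt_pure pt_simps jacobi_ad[of Z X Y] A.m_assoc)
    qed
  qed
qed

lemma H2D: "subsp G H2" "h \<in> H2 \<Longrightarrow> h \<in> cartan G" "h \<in> H2 \<Longrightarrow> h \<in> carrier G"
  "h \<in> derived G \<Longrightarrow> h \<in> H2 \<Longrightarrow> h = \<zero>\<^bsub>G\<^esub>" "cartan' G <+>\<^bsub>G\<^esub> H2 = cartan G"
  using H2 cartan_carrier unfolding cartan_complement_def LV.submodule_iff cartan'_def by blast+

lemma cur_simps:
  "carrier Lc = carrier TT \<times> H2" "\<zero>\<^bsub>Lc\<^esub> = (\<zero>\<^bsub>TT\<^esub>, \<zero>\<^bsub>G\<^esub>)"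
  "(s, h) \<oplus>\<^bsub>Lc\<^esub> (t, k) = (s \<oplus>\<^bsub>TT\<^esub> t, h \<oplus>\<^bsub>G\<^esub> k)"
  "c \<odot>\<^bsub>Lc\<^esub> (t, h) = (c \<odot>\<^bsub>TT\<^esub> t, c \<odot>\<^bsub>G\<^esub> h)"
  "brack Lc (s, h) (t, k) = ((tt s t \<oplus>\<^bsub>TT\<^esub> ht h t) \<ominus>\<^bsub>TT\<^esub> ht k s, \<zero>\<^bsub>G\<^esub>)"
  by (simp_all add: current_def Let_def tt_def bt_def ht_def)

lemma H2_zero [simp]: "\<zero>\<^bsub>G\<^esub> \<in> H2" using subspD(2)[OF H2D(1)] .

lemma vspace_cur: "vspace Lc"
proof -
  note h = subspD[OF H2D(1)] H2D(3)
  have "abelian_group Lc"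
  proof (rule abelian_groupI)
    show "\<exists>y\<in>carrier Lc. y \<oplus>\<^bsub>Lc\<^esub> x = \<zero>\<^bsub>Lc\<^esub>" if "x \<in> carrier Lc" for x
    proof -
      obtain s k where x: "x = (s, k)" "s \<in> carrier TT" "k \<in> H2" using \<open>x \<in> carrier Lc\<close> by (auto simp: cur_simps)
      have "(-1) \<odot>\<^bsub>TT\<^esub> s \<oplus>\<^bsub>TT\<^esub> s = \<zero>\<^bsub>TT\<^esub>" "(-1) \<odot>\<^bsub>G\<^esub> k \<oplus>\<^bsub>G\<^esub> k = \<zero>\<^bsub>G\<^esub>"
        using Tn.TV.sm_add_l[OF x(2), of "-1" 1] LV.sm_add_l[OF h(5)[OF x(3)], of "-1" 1] x h by simp_all
      then show ?thesis using x h by (intro bexI[of _ "((-1) \<odot>\<^bsub>TT\<^esub> s, (-1) \<odot>\<^bsub>G\<^esub> k)"]) (auto simp: cur_simps)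
    qed
  qed (use h in \<open>auto simp: cur_simps Tn.TV.vac LV.vac\<close>)
  then show ?thesis
    by (intro vspace.intro vspace_axioms.intro)
       (use h in \<open>auto simp: cur_simps Tn.TV.sm_add_l Tn.TV.sm_add_r Tn.TV.sm_assoc LV.sm_add_l LV.sm_add_r LV.sm_assoc\<close>)
qed

lemma ht_lin_h:
  assumes t: "t \<in> carrier TT" and h: "h \<in> carrier G"
  shows "k \<in> carrier G \<Longrightarrow> ht (h \<oplus>\<^bsub>G\<^esub> k) t = ht h t \<oplus>\<^bsub>TT\<^esub> ht k t" "ht (c \<odot>\<^bsub>G\<^esub> h) t = c \<odot>\<^bsub>TT\<^esub> ht h t"
proof -
  show "ht (h \<oplus>\<^bsub>G\<^esub> k) t = ht h t \<oplus>\<^bsub>TT\<^esub> ht k t" if "k \<in> carrier G"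
    by (rule T_eqI[OF _ _ t]) (use h that db dG in \<open>auto intro!: lmap simp: ht(2) pt_simps brack_add_left\<close>)
  show "ht (c \<odot>\<^bsub>G\<^esub> h) t = c \<odot>\<^bsub>TT\<^esub> ht h t"
    by (rule T_eqI[OF _ _ t]) (use h db dG in \<open>auto intro!: lmap simp: ht(2) pt_simps brack_smult_left\<close>)
qed

lemma ht_zero: "t \<in> carrier TT \<Longrightarrow> ht \<zero>\<^bsub>G\<^esub> t = \<zero>\<^bsub>TT\<^esub>"
  using ht_lin_h(2)[OF _ LV.zc, of t 0] htD(1)[OF LV.zc, of t] by simp

text \<open>The Jacobi identity splits into the one for \<open>tt\<close> alone and mixed terms. The
  latter cancel because the \<open>ht h\<close> are derivations of \<open>tt\<close> that commute
  with each other for \<open>h\<close> in \<open>H2\<close>.\<close>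

lemma lie_cur: "lie_algebra Lc"
proof -
  interpret VC: vspace Lc by (rule vspace_cur)
  note h = subspD[OF H2D(1)] H2D(3)
  have cl: "brack Lc x y \<in> carrier Lc" if "x \<in> carrier Lc" "y \<in> carrier Lc" for x y
    using that h by (auto simp: cur_simps ttD htD)
  have TL: "lf TT \<phi> \<Longrightarrow> \<phi> (x \<ominus>\<^bsub>TT\<^esub> y) = \<phi> x - \<phi> y" if "x \<in> carrier TT" "y \<in> carrier TT" for \<phi> x y
    using Tn.TV.lf_minus that by blast
  show ?thesis
  proof (intro lie_algebra.intro lie_algebra_axioms.intro)
    show "Module.module cplx Lc" by (simp add: module_iff_vspace vspace_cur)
    fix x y z c assume x: "x \<in> carrier Lc" and y: "y \<in> carrier Lc"
    obtain s k where xs: "x = (s, k)" "s \<in> carrier TT" "k \<in> H2" "k \<in> carrier G" using x h by (auto simp: cur_simps)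
    obtain t l where yt: "y = (t, l)" "t \<in> carrier TT" "l \<in> H2" "l \<in> carrier G" using y h by (auto simp: cur_simps)
    show "brack Lc x y \<in> carrier Lc" using cl x y .
    show "brack Lc (c \<odot>\<^bsub>Lc\<^esub> x) y = c \<odot>\<^bsub>Lc\<^esub> brack Lc x y"
      unfolding xs yt cur_simps prod.inject
      by (intro conjI Tn.TV.vs_eqI) (use xs yt h in \<open>simp_all add: ttD htD ht_lin_h Tn.TV.lf_simps algebra_simps\<close>)
    show "brack Lc x (c \<odot>\<^bsub>Lc\<^esub> y) = c \<odot>\<^bsub>Lc\<^esub> brack Lc x y"
      unfolding xs yt cur_simps prod.inject
      by (intro conjI Tn.TV.vs_eqI) (use xs yt h in \<open>simp_all add: ttD htD ht_lin_h Tn.TV.lf_simps algebra_simps\<close>)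
    have "tt s s = \<zero>\<^bsub>TT\<^esub>"
    proof (rule Tn.TV.vs_eqI)
      fix \<phi> assume \<phi>: "lf TT \<phi>"
      have "\<phi> (tt s s) = - \<phi> (tt s s)" using arg_cong[OF tt_anti[OF xs(2) xs(2)], of \<phi>] Tn.TV.lf_smult[OF \<phi> tt_closed[OF xs(2) xs(2)]] by simp
      then show "\<phi> (tt s s) = \<phi> \<zero>\<^bsub>TT\<^esub>" using Tn.TV.lf_zero[OF \<phi>] by simp
    qed (use xs tt_closed in auto)
    then show "brack Lc x x = \<zero>\<^bsub>Lc\<^esub>"
      unfolding xs cur_simps prod.inject by (intro conjI Tn.TV.vs_eqI) (use xs h in \<open>simp_all add: ttD htD Tn.TV.lf_simps\<close>)
    assume z: "z \<in> carrier Lc"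
    obtain r m where zr: "z = (r, m)" "r \<in> carrier TT" "m \<in> H2" "m \<in> carrier G" using z h by (auto simp: cur_simps)
    show "brack Lc (x \<oplus>\<^bsub>Lc\<^esub> y) z = brack Lc x z \<oplus>\<^bsub>Lc\<^esub> brack Lc y z"
      unfolding xs yt zr cur_simps prod.inject
      by (intro conjI Tn.TV.vs_eqI) (use xs yt zr h in \<open>simp_all add: ttD htD ht_lin_h Tn.TV.lf_simps\<close>)
    show "brack Lc x (y \<oplus>\<^bsub>Lc\<^esub> z) = brack Lc x y \<oplus>\<^bsub>Lc\<^esub> brack Lc x z"
      unfolding xs yt zr cur_simps prod.inject
      by (intro conjI Tn.TV.vs_eqI) (use xs yt zr h in \<open>simp_all add: ttD htD ht_lin_h Tn.TV.lf_simps\<close>)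
    have hc: "ht a (ht b u) = ht b (ht a u)" if "a \<in> H2" "b \<in> H2" "u \<in> carrier TT" for a b u
      using ht_brack[of a b u] that h brack_cartan H2D(2) ht_zero htD by simp
    have J1: "tt s (tt t r) = tt (tt s t) r \<oplus>\<^bsub>TT\<^esub> tt t (tt s r)" using tt_der xs yt zr by blast
    have J2: "tt t (tt r s) = (-1) \<odot>\<^bsub>TT\<^esub> tt t (tt s r)" using tt_anti[of r s] xs yt zr tt_closed by (simp add: ttD)
    have J3: "tt r (tt s t) = (-1) \<odot>\<^bsub>TT\<^esub> tt (tt s t) r" using tt_anti xs yt zr tt_closed by blast
    have J: "\<phi> (tt s (tt t r)) + \<phi> (tt t (tt r s)) + \<phi> (tt r (tt s t)) = 0" if "lf TT \<phi>" for \<phi>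
      unfolding J1 J2 J3 using xs yt zr by (simp add: Tn.TV.lf_simps[OF that] tt_closed)
    have an: "\<phi> (tt (ht a u) w) = - \<phi> (tt w (ht a u))" if "lf TT \<phi>" "a \<in> H2" "u \<in> carrier TT" "w \<in> carrier TT" for \<phi> a u w
      using tt_anti[of "ht a u" w] that h htD(1)[of a u] by (simp add: tt_closed Tn.TV.lf_smult)
    have mm: "x \<ominus>\<^bsub>TT\<^esub> y = x \<oplus>\<^bsub>TT\<^esub> (-1) \<odot>\<^bsub>TT\<^esub> y" if "x \<in> carrier TT" "y \<in> carrier TT" for x y using Tn.TV.minus_eq' that .
    show "brack Lc x (brack Lc y z) \<oplus>\<^bsub>Lc\<^esub> brack Lc y (brack Lc z x) \<oplus>\<^bsub>Lc\<^esub> brack Lc z (brack Lc x y) = \<zero>\<^bsub>Lc\<^esub>"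
      unfolding xs yt zr cur_simps prod.inject
    proof (intro conjI)
      show "\<zero>\<^bsub>G\<^esub> \<oplus>\<^bsub>G\<^esub> \<zero>\<^bsub>G\<^esub> \<oplus>\<^bsub>G\<^esub> \<zero>\<^bsub>G\<^esub> = \<zero>\<^bsub>G\<^esub>" by simp
    qed (rule Tn.TV.vs_eqI; use xs yt zr h J in \<open>simp add: mm ttD htD ht_der ht_zero Tn.TV.lf_simps an hc[of l k] hc[of m k] hc[of m l] algebra_simps\<close>)
  qed
qed

sublocale Lie: lie_algebra Lc by (rule lie_cur)

end

lemma (in lie_module) nilp_subsp:
  assumes x: "x \<in> carrier L" shows "subsp V {v \<in> carrier V. \<exists>n. (act V x ^^ n) v = \<zero>\<^bsub>V\<^esub>}"
  unfolding subsp_def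
proof (intro conjI ballI allI)
  let ?S = "{v \<in> carrier V. \<exists>n. (act V x ^^ n) v = \<zero>\<^bsub>V\<^esub>}"
  note pl = lin_map_act_pow[OF x]
  show "\<zero>\<^bsub>V\<^esub> \<in> ?S" by (auto intro: exI[of _ 0])
  fix u assume u: "u \<in> ?S"
  then obtain n where n: "(act V x ^^ n) u = \<zero>\<^bsub>V\<^esub>" by auto
  then have "(act V x ^^ n) (c \<odot>\<^bsub>V\<^esub> u) = \<zero>\<^bsub>V\<^esub>" for c using lin_mapD(3)[OF pl] u by simp
  then show "c \<odot>\<^bsub>V\<^esub> u \<in> ?S" for c using u by auto
  fix v assume v: "v \<in> ?S"
  then obtain n' where n': "(act V x ^^ n') v = \<zero>\<^bsub>V\<^esub>" by auto
  have "(act V x ^^ max n n') u = \<zero>\<^bsub>V\<^esub>" "(act V x ^^ max n n') v = \<zero>\<^bsub>V\<^esub>"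
    using act_pow_mono[OF x n, of "max n n'"] act_pow_mono[OF x n', of "max n n'"] by auto
  then have "(act V x ^^ max n n') (u \<oplus>\<^bsub>V\<^esub> v) = \<zero>\<^bsub>V\<^esub>" using lin_mapD(2)[OF pl] u v by simp
  then show "u \<oplus>\<^bsub>V\<^esub> v \<in> ?S" using u v by auto
qed auto

lemma (in lie_algebra) span_brack:
  assumes "S \<subseteq> carrier L" "S' \<subseteq> carrier L" "subsp L N" "\<And>x y. \<lbrakk>x \<in> S; y \<in> S'\<rbrakk> \<Longrightarrow> brack L x y \<in> N"
    "x \<in> vspan L S" "y \<in> vspan L S'"
  shows "brack L x y \<in> N"
proof -
  note ND = subspD[OF assms(3)]
  have *: "brack L x y \<in> N" if x: "x \<in> S" for x using assms(6,2)
  proof (induct rule: LV.vspan_induct)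
    case (base y) then show ?case using assms(4) x by blast
  qed (use x assms(1) ND in \<open>auto simp: brack_zero brack_add_right brack_smult_right subset_iff\<close>)
  have y: "y \<in> carrier L" using LV.vspan_subset_carrier[OF assms(2)] assms(6) by blast
  show ?thesis using assms(5,1)
    by (induct rule: LV.vspan_induct) (use * y ND in \<open>auto simp: brack_zero brack_add_left brack_smult_left\<close>)
qed

lemma (in lie_module) span_act:
  assumes "S \<subseteq> carrier L" "S' \<subseteq> carrier V" "subsp V N" "\<And>x v. \<lbrakk>x \<in> S; v \<in> S'\<rbrakk> \<Longrightarrow> act V x v \<in> N"
    "x \<in> vspan L S" "v \<in> vspan V S'"
  shows "act V x v \<in> N"
proof -
  note ND = subspD[OF assms(3)]
  have *: "act V x v \<in> N" if x: "x \<in> S" for x using assms(6,2)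
  proof (induct rule: VV.vspan_induct)
    case (base y) then show ?case using assms(4) x by blast
  qed (use x assms(1) ND in \<open>auto simp: act_zero act_add_right act_smult_right subset_iff\<close>)
  have v: "v \<in> carrier V" using VV.vspan_subset_carrier[OF assms(2)] assms(6) by blast
  show ?thesis using assms(5,1)
    by (induct rule: LV.vspan_induct) (use * v ND in \<open>auto simp: act_zero act_add_left act_smult_left\<close>)
qed

context km_core
begin

lemma nil_plus_brack: assumes "X \<in> nil_plus G" "Y \<in> nil_plus G" shows "brack G X Y \<in> nil_plus G"
proof (rule span_brack[OF nil_plus_sub nil_plus_sub nil_plus_subsp _ assms[unfolded nil_plus_def]])
  fix x y assume "x \<in> (\<Union>m\<in>pos_roots G. root_space G (root_of G m))" "y \<in> (\<Union>m\<in>pos_roots G. root_space G (root_of G m))"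
  then obtain m n where m: "m \<in> pos_roots G" "x \<in> root_space G (root_of G m)" and n: "n \<in> pos_roots G" "y \<in> root_space G (root_of G n)" by blast
  have xy: "x \<in> carrier G" "y \<in> carrier G" using m n by (auto simp: root_space_def)
  let ?p = "\<lambda>j. m j + n j"
  have "brack G x y \<in> root_space G (root_of G ?p)"
    using m n weight_brack[of x y] xy brack_closed by (auto simp: root_space_def root_of_add)
  moreover have "?p \<noteq> (\<lambda>_. 0)" using m by (auto simp: pos_roots_def fun_eq_iff)
  \<comment> \<open>A zero bracket is treated separately, because \<open>m + n\<close> need not be a
    root.\<close>
  ultimately have "brack G x y = \<zero> \<or> brack G x y \<in> (\<Union>m\<in>pos_roots G. root_space G (root_of G m))"
    by (cases "brack G x y = \<zero>") (auto simp: pos_roots_def)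
  then show "brack G x y \<in> nil_plus G"
  proof
    assume "brack G x y = \<zero>" then show ?thesis using subspD(2)[OF nil_plus_subsp] by simp
  next
    assume "brack G x y \<in> (\<Union>m\<in>pos_roots G. root_space G (root_of G m))"
    then show ?thesis unfolding nil_plus_def by (rule LV.vspan_base)
  qed
qed

lemma nil_plus_cartan: assumes h: "h \<in> cartan G" and Y: "Y \<in> nil_plus G" shows "brack G h Y \<in> nil_plus G"
proof (rule span_stable[OF nil_plus_sub nil_plus_subsp cartan_carrier[OF h] _ Y[unfolded nil_plus_def]])
  fix y assume y: "y \<in> (\<Union>m\<in>pos_roots G. root_space G (root_of G m))"
  then obtain m where "y \<in> root_space G (root_of G m)" by blast
  then have "brack G h y = root_of G m h \<odot> y" using h by (simp add: root_space_def)
  moreover have "y \<in> nil_plus G" unfolding nil_plus_def using y by (rule LV.vspan_base)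
  ultimately show "brack G h y \<in> nil_plus G" using subspD(4)[OF nil_plus_subsp] by simp
qed

end

section \<open>The triangular decomposition and the Verma modules of the current algebra\<close>

context cur
begin

abbreviation "ct \<equiv> cur_tensor G A"
abbreviation "chh \<equiv> cur_h G A"
abbreviation "emb \<equiv> cur_emb G A H2"

lemma ct_eq: "ct X a = (pt X a, \<zero>\<^bsub>G\<^esub>)" by (simp add: cur_tensor_def)
lemma chh_eq: "chh h = (\<zero>\<^bsub>TT\<^esub>, h)" by (simp add: cur_h_def)

lemma ct_closed [simp]: "\<lbrakk>X \<in> derived G; a \<in> carrier A\<rbrakk> \<Longrightarrow> ct X a \<in> carrier Lc"
  by (simp add: ct_eq cur_simps pt_simps)
lemma chh_closed [simp]: "h \<in> H2 \<Longrightarrow> chh h \<in> carrier Lc" by (simp add: chh_eq cur_simps)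

lemma ct_simps:
  "\<lbrakk>X \<in> derived G; X' \<in> derived G; a \<in> carrier A\<rbrakk> \<Longrightarrow> ct (X \<oplus>\<^bsub>G\<^esub> X') a = ct X a \<oplus>\<^bsub>Lc\<^esub> ct X' a"
  "\<lbrakk>X \<in> derived G; a \<in> carrier A; a' \<in> carrier A\<rbrakk> \<Longrightarrow> ct X (a \<oplus>\<^bsub>A\<^esub> a') = ct X a \<oplus>\<^bsub>Lc\<^esub> ct X a'"
  "\<lbrakk>X \<in> derived G; a \<in> carrier A\<rbrakk> \<Longrightarrow> ct (c \<odot>\<^bsub>G\<^esub> X) a = c \<odot>\<^bsub>Lc\<^esub> ct X a"
  "\<lbrakk>X \<in> derived G; a \<in> carrier A\<rbrakk> \<Longrightarrow> ct X (c \<odot>\<^bsub>A\<^esub> a) = c \<odot>\<^bsub>Lc\<^esub> ct X a"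
  by (simp_all add: ct_eq cur_simps pt_simps)

lemma ct_zero: "a \<in> carrier A \<Longrightarrow> ct \<zero>\<^bsub>G\<^esub> a = \<zero>\<^bsub>Lc\<^esub>" "X \<in> derived G \<Longrightarrow> ct X \<zero>\<^bsub>A\<^esub> = \<zero>\<^bsub>Lc\<^esub>"
  using ct_simps(3)[of "\<zero>\<^bsub>G\<^esub>" a 0] ct_simps(4)[of X "\<zero>\<^bsub>A\<^esub>" 0] subspD(2)[OF derived_props(1)]
  by simp_all

lemma minus_zz: "x \<in> carrier TT \<Longrightarrow> x \<ominus>\<^bsub>TT\<^esub> \<zero>\<^bsub>TT\<^esub> = x" "x \<in> carrier TT \<Longrightarrow> \<zero>\<^bsub>TT\<^esub> \<ominus>\<^bsub>TT\<^esub> x = (-1) \<odot>\<^bsub>TT\<^esub> x"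
  by (simp_all add: Tn.TV.minus_eq')

lemma tt_ht_zero: "t \<in> carrier TT \<Longrightarrow> tt \<zero>\<^bsub>TT\<^esub> t = \<zero>\<^bsub>TT\<^esub>" "t \<in> carrier TT \<Longrightarrow> tt t \<zero>\<^bsub>TT\<^esub> = \<zero>\<^bsub>TT\<^esub>"
    "h \<in> carrier G \<Longrightarrow> ht h \<zero>\<^bsub>TT\<^esub> = \<zero>\<^bsub>TT\<^esub>"
  using lin_map_zero[OF tt_lin1 Tn.TV.vspace_axioms Tn.TV.vspace_axioms] lin_map_zero[OF tt_lin2 Tn.TV.vspace_axioms Tn.TV.vspace_axioms]
    lin_map_zero[OF ht(1) Tn.TV.vspace_axioms Tn.TV.vspace_axioms] by auto

lemma brack_ct: 
  "\<lbrakk>X \<in> derived G; a \<in> carrier A; Y \<in> derived G; b \<in> carrier A\<rbrakk> \<Longrightarrow> brack Lc (ct X a) (ct Y b) = ct (brack G X Y) (a \<cdot> b)"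
  "\<lbrakk>h \<in> H2; X \<in> derived G; a \<in> carrier A\<rbrakk> \<Longrightarrow> brack Lc (chh h) (ct X a) = ct (brack G h X) a"
  "\<lbrakk>h \<in> H2; X \<in> derived G; a \<in> carrier A\<rbrakk> \<Longrightarrow> brack Lc (ct X a) (chh h) = ct (brack G X h) a"
  "\<lbrakk>h \<in> H2; k \<in> H2\<rbrakk> \<Longrightarrow> brack Lc (chh h) (chh k) = \<zero>\<^bsub>Lc\<^esub>"
proof -
  show "\<lbrakk>X \<in> derived G; a \<in> carrier A; Y \<in> derived G; b \<in> carrier A\<rbrakk> \<Longrightarrow> brack Lc (ct X a) (ct Y b) = ct (brack G X Y) (a \<cdot> b)"
    using db dG by (simp add: ct_eq cur_simps tt_pure ht_zero pt_simps minus_zz)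
  show "\<lbrakk>h \<in> H2; X \<in> derived G; a \<in> carrier A\<rbrakk> \<Longrightarrow> brack Lc (chh h) (ct X a) = ct (brack G h X) a"
    using db dG H2D(3) by (simp add: ct_eq chh_eq cur_simps tt_ht_zero ht_zero pt_simps minus_zz ht(2))
  show "\<lbrakk>h \<in> H2; X \<in> derived G; a \<in> carrier A\<rbrakk> \<Longrightarrow> brack Lc (ct X a) (chh h) = ct (brack G X h) a"
    using db dG H2D(3) by (simp add: ct_eq chh_eq cur_simps tt_ht_zero ht_zero pt_simps minus_zz ht(2) brack_anti[of X h])
  show "\<lbrakk>h \<in> H2; k \<in> H2\<rbrakk> \<Longrightarrow> brack Lc (chh h) (chh k) = \<zero>\<^bsub>Lc\<^esub>"
    using H2D(3) by (simp add: chh_eq cur_simps tt_ht_zero minus_zz)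
qed

text \<open>For a fixed coefficient \<open>a\<close> the condition on \<open>X\<close> is linear, so
  assertions on all \<open>X \<otimes> a\<close> can be checked on vectors \<open>X\<close> that
  span.\<close>

lemma subsp_ct: assumes N: "subsp Lc N" and a: "a \<in> carrier A" shows "subsp G {X \<in> derived G. ct X a \<in> N}"
  using subspD[OF N] a subspD[OF derived_props(1)] by (auto simp: subsp_def ct_simps ct_zero derived_carrier)

lemma Lc_induct:
  assumes N: "subsp Lc N" and c: "\<And>X a. \<lbrakk>X \<in> derived G; a \<in> carrier A\<rbrakk> \<Longrightarrow> ct X a \<in> N" and h: "\<And>h. h \<in> H2 \<Longrightarrow> chh h \<in> N"
  shows "carrier Lc \<subseteq> N"
proof
  fix x assume "x \<in> carrier Lc"
  then obtain t k where x: "x = (t, k)" "t \<in> carrier TT" "k \<in> H2" by (auto simp: cur_simps)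
  note ND = subspD[OF N]
  have z: "(\<zero>\<^bsub>TT\<^esub>, \<zero>\<^bsub>G\<^esub>) \<in> N" using ND(2) by (simp add: cur_simps)
  have "(t, \<zero>\<^bsub>G\<^esub>) \<in> N" using x(2)
  proof (induct t rule: Tn.T_induct)
    case (pure X a) then show ?case using c by (simp add: ct_eq)
  next
    case (add s t) then show ?case using ND(3)[of "(s, \<zero>\<^bsub>G\<^esub>)" "(t, \<zero>\<^bsub>G\<^esub>)"] by (simp add: cur_simps)
  next
    case (smult d s) then show ?case using ND(4)[of "(s, \<zero>\<^bsub>G\<^esub>)" d] by (simp add: cur_simps)
  qed (rule z)
  from ND(3)[OF this h[OF x(3)]] show "x \<in> N" using x H2D(3) by (simp add: cur_simps chh_eq)
qed

lemma emb_eq: assumes X: "X \<in> derived G" and h: "h \<in> H2" shows "emb (X \<oplus>\<^bsub>G\<^esub> h) = ct X \<one>\<^sub>A \<oplus>\<^bsub>Lc\<^esub> chh h"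
  unfolding cur_emb_def
proof (rule the_equality)
  show "\<exists>X'\<in>derived G. \<exists>h'\<in>H2. X \<oplus>\<^bsub>G\<^esub> h = X' \<oplus>\<^bsub>G\<^esub> h' \<and> ct X \<one>\<^sub>A \<oplus>\<^bsub>Lc\<^esub> chh h = ct X' \<one>\<^sub>A \<oplus>\<^bsub>Lc\<^esub> chh h'"
    using X h by blast
  fix y assume "\<exists>X'\<in>derived G. \<exists>h'\<in>H2. X \<oplus>\<^bsub>G\<^esub> h = X' \<oplus>\<^bsub>G\<^esub> h' \<and> y = ct X' \<one>\<^sub>A \<oplus>\<^bsub>Lc\<^esub> chh h'"
  then obtain X' h' where *: "X' \<in> derived G" "h' \<in> H2" "X \<oplus>\<^bsub>G\<^esub> h = X' \<oplus>\<^bsub>G\<^esub> h'" "y = ct X' \<one>\<^sub>A \<oplus>\<^bsub>Lc\<^esub> chh h'" by blast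
  have cc: "X \<in> carrier G" "X' \<in> carrier G" "h \<in> carrier G" "h' \<in> carrier G" using X h * dG H2D(3) by auto
  have eq: "X \<ominus>\<^bsub>G\<^esub> X' = h' \<ominus>\<^bsub>G\<^esub> h"
  proof (rule LV.vs_eqI)
    fix \<phi> assume \<phi>: "lf G \<phi>"
    have "\<phi> X + \<phi> h = \<phi> X' + \<phi> h'" using arg_cong[OF *(3), of \<phi>] cc by (simp add: LV.lf_simps[OF \<phi>])
    then show "\<phi> (X \<ominus>\<^bsub>G\<^esub> X') = \<phi> (h' \<ominus>\<^bsub>G\<^esub> h)" using cc by (simp add: LV.lf_simps[OF \<phi>] algebra_simps)
  qed (use cc in auto)
  have "h' \<ominus>\<^bsub>G\<^esub> h \<in> derived G" using LV.subsp_minus(1)[OF derived_props(1) X *(1)] eq by simp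
  \<comment> \<open>Two decompositions differ by an element of the derived algebra that also lies in
    \<open>H2\<close>. Since \<open>H2\<close> is contained in the Cartan subalgebra and complements
    its derived part, that element is zero.\<close>
  then have z: "h' \<ominus>\<^bsub>G\<^esub> h = \<zero>\<^bsub>G\<^esub>" using H2D(4) LV.subsp_minus(1)[OF H2D(1) *(2) h] by blast
  have "a = b" if "a \<ominus>\<^bsub>G\<^esub> b = \<zero>\<^bsub>G\<^esub>" "a \<in> carrier G" "b \<in> carrier G" for a b
  proof (rule LV.vs_eqI[OF that(2,3)])
    fix \<phi> assume \<phi>: "lf G \<phi>"
    show "\<phi> a = \<phi> b" using arg_cong[OF that(1), of \<phi>] that(2,3) by (simp add: LV.lf_simps[OF \<phi>])
  qed
  then have "X = X'" "h' = h" using z eq cc by auto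
  then show "y = ct X \<one>\<^sub>A \<oplus>\<^bsub>Lc\<^esub> chh h" using * by simp
qed

lemma emb_derived: "X \<in> derived G \<Longrightarrow> emb X = ct X \<one>\<^sub>A"
  using emb_eq[of X "\<zero>\<^bsub>G\<^esub>"] dG by (simp add: ct_eq chh_eq cur_simps pt_simps)

lemma cartan_decomp: "h \<in> cartan G \<Longrightarrow> \<exists>h'\<in>cartan' G. \<exists>k\<in>H2. h = h' \<oplus>\<^bsub>G\<^esub> k"
  using H2D(5) unfolding set_add_def' by blast

lemma cartan'D: "h \<in> cartan' G \<Longrightarrow> h \<in> derived G" "h \<in> cartan' G \<Longrightarrow> h \<in> cartan G" by (auto simp: cartan'_def)

lemma emb_cartan:
  assumes "h \<in> cartan G"
  obtains h' k where "h' \<in> cartan' G" "k \<in> H2" "h = h' \<oplus>\<^bsub>G\<^esub> k" "emb h = ct h' \<one>\<^sub>A \<oplus>\<^bsub>Lc\<^esub> chh k"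
  using cartan_decomp[OF assms] emb_eq cartan'D by metis

lemma emb_cartan_closed: "h \<in> cartan G \<Longrightarrow> emb h \<in> carrier Lc"
  by (erule emb_cartan) (simp add: cartan'D)

lemma emb_brack: 
  assumes h: "h \<in> cartan G"
  shows "\<lbrakk>X \<in> derived G; a \<in> carrier A\<rbrakk> \<Longrightarrow> brack Lc (emb h) (ct X a) = ct (brack G h X) a"
    "k \<in> H2 \<Longrightarrow> brack Lc (emb h) (chh k) = \<zero>\<^bsub>Lc\<^esub>"
proof -
  obtain h' l where *: "h' \<in> cartan' G" "l \<in> H2" "h = h' \<oplus>\<^bsub>G\<^esub> l" "emb h = ct h' \<one>\<^sub>A \<oplus>\<^bsub>Lc\<^esub> chh l" by (rule emb_cartan[OF h])
  note h' = cartan'D[OF *(1)] dG[OF cartan'D(1)[OF *(1)]]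
  show "\<lbrakk>X \<in> derived G; a \<in> carrier A\<rbrakk> \<Longrightarrow> brack Lc (emb h) (ct X a) = ct (brack G h X) a"
    using h' * H2D(3) db dG by (simp add: Lie.brack_add_left brack_ct brack_add_left ct_simps)
  show "k \<in> H2 \<Longrightarrow> brack Lc (emb h) (chh k) = \<zero>\<^bsub>Lc\<^esub>"
    using h' * H2D brack_cartan by (simp add: Lie.brack_add_left brack_ct ct_zero)
qed

text \<open>On \<open>Y \<otimes> b\<close> the operator acts as \<open>ad X\<close> on
  \<open>Y\<close> and leaves \<open>b\<close> alone. A bracket with \<open>h''\<close> lands in
  \<open>g' \<otimes> A\<close>, so there one more power suffices.\<close>

lemma ad_nilp_cur:
  assumes X: "X \<in> derived G" and nil: "\<And>y. y \<in> carrier G \<Longrightarrow> \<exists>n. (brack G X ^^ n) y = \<zero>\<^bsub>G\<^esub>" and y: "y \<in> carrier Lc"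
  shows "\<exists>n. (brack Lc (ct X \<one>\<^sub>A) ^^ n) y = \<zero>\<^bsub>Lc\<^esub>"
proof -
  interpret AM: lie_module Lc Lie.adj by (rule Lie.adjoint_module)
  have x: "ct X \<one>\<^sub>A \<in> carrier Lc" using X by simp
  let ?N = "{y \<in> carrier Lc. \<exists>n. (brack Lc (ct X \<one>\<^sub>A) ^^ n) y = \<zero>\<^bsub>Lc\<^esub>}"
  have N: "subsp Lc ?N" using AM.nilp_subsp[OF x] by (simp add: Lie.adj_simps subsp_def)
  have pw: "(brack Lc (ct X \<one>\<^sub>A) ^^ n) (ct Y b) = ct ((brack G X ^^ n) Y) b \<and> (brack G X ^^ n) Y \<in> derived G"
    if "Y \<in> derived G" "b \<in> carrier A" for n Y b
    by (induct n) (use that X dG db in \<open>auto simp: brack_ct\<close>)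
  have c: "ct Y b \<in> ?N" if Yb: "Y \<in> derived G" "b \<in> carrier A" for Y b
  proof -
    obtain n where "(brack G X ^^ n) Y = \<zero>\<^bsub>G\<^esub>" using nil dG Yb by blast
    then have "(brack Lc (ct X \<one>\<^sub>A) ^^ n) (ct Y b) = \<zero>\<^bsub>Lc\<^esub>" using pw[OF Yb, of n] ct_zero(1)[OF Yb(2)] by simp
    then show ?thesis using Yb by auto
  qed
  have "chh h \<in> ?N" if h: "h \<in> H2" for h
  proof -
    have "brack G X h \<in> derived G" using derived_props(2) dG[OF X] H2D(3)[OF h] by blast
    then obtain n where "(brack Lc (ct X \<one>\<^sub>A) ^^ n) (brack Lc (ct X \<one>\<^sub>A) (chh h)) = \<zero>\<^bsub>Lc\<^esub>"
      using c[of "brack G X h" "\<one>\<^sub>A"] brack_ct(3)[OF h X A.one_closed] by auto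
    then have "(brack Lc (ct X \<one>\<^sub>A) ^^ Suc n) (chh h) = \<zero>\<^bsub>Lc\<^esub>" by (simp add: funpow_swap1)
    then show ?thesis using chh_closed[OF h] by blast
  qed
  then show ?thesis using Lc_induct[OF N c] y by blast
qed

definition gplus where "gplus = {ct X a | X a. X \<in> nil_plus G \<and> a \<in> carrier A}"
definition gcart where "gcart = {ct X a | X a. X \<in> cartan' G \<and> a \<in> carrier A}"

lemma nilD: "X \<in> nil_plus G \<Longrightarrow> X \<in> derived G" using nil_plus_derived by blast

lemma g_sub: "gplus \<subseteq> carrier Lc" "gcart \<subseteq> carrier Lc" "chh ` H2 \<subseteq> carrier Lc"
  by (auto simp: gplus_def gcart_def nilD cartan'D)

lemma cur_plus_eq: "cur_plus G A H2 = vspan Lc gplus" by (simp add: cur_plus_def cur_sub_def gplus_def)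

lemma chh_subsp: "subsp Lc (chh ` H2)"
  unfolding subsp_def
proof (intro conjI ballI allI)
  show "chh ` H2 \<subseteq> carrier Lc" by (rule g_sub)
  show "\<zero>\<^bsub>Lc\<^esub> \<in> chh ` H2" by (auto simp: cur_simps chh_eq intro!: image_eqI[of _ _ "\<zero>\<^bsub>G\<^esub>"])
  fix x c assume x: "x \<in> chh ` H2"
  then show "c \<odot>\<^bsub>Lc\<^esub> x \<in> chh ` H2" using subspD(4)[OF H2D(1)] by (auto simp: cur_simps chh_eq)
  fix y assume "y \<in> chh ` H2"
  then show "x \<oplus>\<^bsub>Lc\<^esub> y \<in> chh ` H2" using x subspD(3)[OF H2D(1)] by (auto simp: cur_simps chh_eq)
qed

lemma subsp_sum:
  assumes "vspace V" "subsp V M" "subsp V N" shows "subsp V (M <+>\<^bsub>V\<^esub> N)" "M \<subseteq> M <+>\<^bsub>V\<^esub> N" "N \<subseteq> M <+>\<^bsub>V\<^esub> N"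
proof -
  interpret vspace V by fact
  note M = subspD[OF assms(2)] and N = subspD[OF assms(3)]
  show "subsp V (M <+>\<^bsub>V\<^esub> N)"
    unfolding subsp_def set_add_def'
  proof (intro conjI ballI allI)
    show "(\<Union>h\<in>M. \<Union>k\<in>N. {h \<oplus>\<^bsub>V\<^esub> k}) \<subseteq> carrier V" using M(1) N(1) by auto
    show "\<zero>\<^bsub>V\<^esub> \<in> (\<Union>h\<in>M. \<Union>k\<in>N. {h \<oplus>\<^bsub>V\<^esub> k})" using M(2) N(2) by (auto intro!: bexI[of _ "\<zero>\<^bsub>V\<^esub>"])
    fix x assume "x \<in> (\<Union>h\<in>M. \<Union>k\<in>N. {h \<oplus>\<^bsub>V\<^esub> k})"
    then obtain m n where x: "m \<in> M" "n \<in> N" "x = m \<oplus>\<^bsub>V\<^esub> n" by auto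
    have "c \<odot>\<^bsub>V\<^esub> x = c \<odot>\<^bsub>V\<^esub> m \<oplus>\<^bsub>V\<^esub> c \<odot>\<^bsub>V\<^esub> n" for c using x M(1) N(1) by (simp add: sm_add_r)
    then show "c \<odot>\<^bsub>V\<^esub> x \<in> (\<Union>h\<in>M. \<Union>k\<in>N. {h \<oplus>\<^bsub>V\<^esub> k})" for c using M(4)[OF x(1), of c] N(4)[OF x(2), of c] by blast
    fix y assume "y \<in> (\<Union>h\<in>M. \<Union>k\<in>N. {h \<oplus>\<^bsub>V\<^esub> k})"
    then obtain m' n' where y: "m' \<in> M" "n' \<in> N" "y = m' \<oplus>\<^bsub>V\<^esub> n'" by auto
    have "x \<oplus>\<^bsub>V\<^esub> y = (m \<oplus>\<^bsub>V\<^esub> m') \<oplus>\<^bsub>V\<^esub> (n \<oplus>\<^bsub>V\<^esub> n')" using x y M(1) N(1) by (simp add: vac)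
    then show "x \<oplus>\<^bsub>V\<^esub> y \<in> (\<Union>h\<in>M. \<Union>k\<in>N. {h \<oplus>\<^bsub>V\<^esub> k})" using M(3)[OF x(1) y(1)] N(3)[OF x(2) y(2)] by blast
  qed
  show "M \<subseteq> M <+>\<^bsub>V\<^esub> N"
  proof
    fix m assume m: "m \<in> M"
    have "m = m \<oplus>\<^bsub>V\<^esub> \<zero>\<^bsub>V\<^esub>" using m M(1) by simp
    then show "m \<in> M <+>\<^bsub>V\<^esub> N" using m N(2) unfolding set_add_def' by blast
  qed
  show "N \<subseteq> M <+>\<^bsub>V\<^esub> N"
  proof
    fix m assume m: "m \<in> N"
    have "m = \<zero>\<^bsub>V\<^esub> \<oplus>\<^bsub>V\<^esub> m" using m N(1) by simp
    then show "m \<in> M <+>\<^bsub>V\<^esub> N" using m M(2) unfolding set_add_def' by blast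
  qed
qed

lemma cur_cartan_eq: "cur_cartan G A H2 = vspan Lc gcart <+>\<^bsub>Lc\<^esub> chh ` H2"
  by (simp add: cur_cartan_def cur_sub_def gcart_def)

lemma cur_plus_subsp: "subsp Lc (cur_plus G A H2)" unfolding cur_plus_eq by (rule Lie.LV.subsp_vspan[OF g_sub(1)])
lemma cur_cartan_subsp: "subsp Lc (cur_cartan G A H2)"
  unfolding cur_cartan_eq by (rule subsp_sum(1)[OF vspace_cur Lie.LV.subsp_vspan[OF g_sub(2)] chh_subsp])

lemma cur_mem:
  "\<lbrakk>X \<in> nil_plus G; a \<in> carrier A\<rbrakk> \<Longrightarrow> ct X a \<in> cur_plus G A H2"
  "\<lbrakk>X \<in> cartan' G; a \<in> carrier A\<rbrakk> \<Longrightarrow> ct X a \<in> cur_cartan G A H2"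
  "h \<in> H2 \<Longrightarrow> chh h \<in> cur_cartan G A H2"
  "h \<in> cartan G \<Longrightarrow> emb h \<in> cur_cartan G A H2"
proof -
  show "\<lbrakk>X \<in> nil_plus G; a \<in> carrier A\<rbrakk> \<Longrightarrow> ct X a \<in> cur_plus G A H2"
    unfolding cur_plus_eq gplus_def by (rule Lie.LV.vspan_base) blast
  show 1: "\<lbrakk>X \<in> cartan' G; a \<in> carrier A\<rbrakk> \<Longrightarrow> ct X a \<in> cur_cartan G A H2" for X a
    unfolding cur_cartan_eq
    by (rule subsetD[OF subsp_sum(2)[OF vspace_cur Lie.LV.subsp_vspan[OF g_sub(2)] chh_subsp]], rule Lie.LV.vspan_base)
       (auto simp: gcart_def)
  show 2: "h \<in> H2 \<Longrightarrow> chh h \<in> cur_cartan G A H2" for h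
    unfolding cur_cartan_eq
    by (rule subsetD[OF subsp_sum(3)[OF vspace_cur Lie.LV.subsp_vspan[OF g_sub(2)] chh_subsp]]) blast
  show "h \<in> cartan G \<Longrightarrow> emb h \<in> cur_cartan G A H2"
    by (erule emb_cartan) (auto intro!: subspD(3)[OF cur_cartan_subsp] 1 2)
qed

lemma cur_plus_induct:
  assumes "subsp Lc N" "\<And>X a. \<lbrakk>X \<in> nil_plus G; a \<in> carrier A\<rbrakk> \<Longrightarrow> ct X a \<in> N" shows "cur_plus G A H2 \<subseteq> N"
  unfolding cur_plus_eq by (rule Lie.LV.vspan_least[OF assms(1)]) (use assms(2) in \<open>auto simp: gplus_def\<close>)

lemma cur_cartan_induct:
  assumes N: "subsp Lc N" and "\<And>X a. \<lbrakk>X \<in> cartan' G; a \<in> carrier A\<rbrakk> \<Longrightarrow> ct X a \<in> N" "\<And>h. h \<in> H2 \<Longrightarrow> chh h \<in> N"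
  shows "cur_cartan G A H2 \<subseteq> N"
proof -
  have "vspan Lc gcart \<subseteq> N" by (rule Lie.LV.vspan_least[OF assms(1)]) (use assms(2) in \<open>auto simp: gcart_def\<close>)
  then have "a \<oplus>\<^bsub>Lc\<^esub> b \<in> N" if "a \<in> vspan Lc gcart" "b \<in> chh ` H2" for a b
    using subspD(3)[OF N, of a b] assms(3) that by blast
  then show ?thesis unfolding cur_cartan_eq set_add_def' by blast
qed

definition borel_set where "borel_set = cur_plus G A H2 <+>\<^bsub>Lc\<^esub> cur_cartan G A H2"

lemma borel_eq: "borel G A H2 = Lc\<lparr>carrier := borel_set\<rparr>" by (simp add: borel_def borel_set_def)

lemma borel_subsp: "subsp Lc borel_set" "cur_plus G A H2 \<subseteq> borel_set" "cur_cartan G A H2 \<subseteq> borel_set"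
  unfolding borel_set_def using subsp_sum[OF vspace_cur cur_plus_subsp cur_cartan_subsp] by auto

text \<open>Elements of \<open>cartan' G\<close> and of \<open>H2\<close> commute in
  \<open>G\<close>, so every bracket involving them either vanishes or has a nilpotent factor. This
  is the reason why a linear form on the Cartan part extends by zero to a character of the Borel
  subalgebra.\<close>

lemma borel_brack:
  assumes "x \<in> borel_set" "y \<in> borel_set" shows "brack Lc x y \<in> cur_plus G A H2"
proof -
  let ?g = "gplus \<union> gcart \<union> chh ` H2"
  have gs: "?g \<subseteq> carrier Lc" using g_sub by blast
  have sub: "borel_set \<subseteq> vspan Lc ?g"
  proof -
    have V: "subsp Lc (vspan Lc ?g)" by (rule Lie.LV.subsp_vspan[OF gs])
    have "cur_plus G A H2 \<subseteq> vspan Lc ?g"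
      by (rule cur_plus_induct[OF V], rule Lie.LV.vspan_base) (auto simp: gplus_def)
    moreover have "cur_cartan G A H2 \<subseteq> vspan Lc ?g"
      by (rule cur_cartan_induct[OF V]; rule Lie.LV.vspan_base) (auto simp: gcart_def)
    ultimately have "a \<oplus>\<^bsub>Lc\<^esub> b \<in> vspan Lc ?g" if "a \<in> cur_plus G A H2" "b \<in> cur_cartan G A H2" for a b
      using subspD(3)[OF V, of a b] that by blast
    then show ?thesis unfolding borel_set_def set_add_def' by blast
  qed
  have z: "\<zero>\<^bsub>Lc\<^esub> \<in> cur_plus G A H2" using subspD(2)[OF cur_plus_subsp] .
  have nd: "X \<in> carrier G" if "X \<in> nil_plus G" for X using nilD[of X] dG[of X] that by blast
  have cz: "brack G X Y = \<zero>\<^bsub>G\<^esub>" if "X \<in> cartan' G \<or> X \<in> H2" "Y \<in> cartan' G \<or> Y \<in> H2" for X Y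
    using that brack_cartan[of X Y] cartan'D(2)[of X] H2D(2)[of X] cartan'D(2)[of Y] H2D(2)[of Y] by auto
  have n1: "brack G X Y \<in> nil_plus G" if "X \<in> cartan' G \<or> X \<in> H2" "Y \<in> nil_plus G" for X Y
    using that nil_plus_cartan[of X Y] cartan'D(2)[of X] H2D(2)[of X] by auto
  have n2: "brack G X Y \<in> nil_plus G" if "Y \<in> cartan' G \<or> Y \<in> H2" "X \<in> nil_plus G" for X Y
  proof -
    have "Y \<in> carrier G" using that cartan'D(2)[of Y] H2D(3)[of Y] cartan_carrier[of Y] by auto
    then show ?thesis using brack_anti[of X Y] subspD(4)[OF nil_plus_subsp n1[OF that]] nd that by simp
  qed
  show ?thesis
  proof (rule Lie.span_brack[OF gs gs cur_plus_subsp])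
    show "x \<in> vspan Lc ?g" "y \<in> vspan Lc ?g" using assms sub by auto
    have c1: "brack Lc (ct X a) (ct Y b) \<in> cur_plus G A H2"
      if X: "X \<in> nil_plus G \<or> X \<in> cartan' G" and Y: "Y \<in> nil_plus G \<or> Y \<in> cartan' G" and ab: "a \<in> carrier A" "b \<in> carrier A" for X Y a b
    proof -
      have d: "X \<in> derived G" "Y \<in> derived G" using X Y nilD cartan'D(1) by blast+
      have "brack G X Y \<in> nil_plus G"
        using X Y nil_plus_brack[of X Y] n1[of X Y] n2[of Y X] cz[of X Y] subspD(2)[OF nil_plus_subsp] by metis
      then show ?thesis using d ab by (simp add: brack_ct(1) cur_mem(1))
    qed
    have c2: "brack Lc (ct X a) (chh h) \<in> cur_plus G A H2" "brack Lc (chh h) (ct X a) \<in> cur_plus G A H2"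
      if X: "X \<in> nil_plus G \<or> X \<in> cartan' G" and h: "h \<in> H2" and a: "a \<in> carrier A" for X a h
    proof -
      have d: "X \<in> derived G" using X nilD cartan'D(1) by blast
      have "brack G X h \<in> nil_plus G" "brack G h X \<in> nil_plus G"
        using X h n1[of h X] n2[of h X] cz[of X h] cz[of h X] subspD(2)[OF nil_plus_subsp] by metis+
      then show "brack Lc (ct X a) (chh h) \<in> cur_plus G A H2" "brack Lc (chh h) (ct X a) \<in> cur_plus G A H2"
        using d h a by (simp_all add: brack_ct(2,3) cur_mem(1))
    qed
    fix x y assume "x \<in> ?g" "y \<in> ?g"
    then show "brack Lc x y \<in> cur_plus G A H2" unfolding gplus_def gcart_def
      by (elim UnE CollectE exE conjE imageE; hypsubst) (simp_all add: c1 c2 brack_ct(4) z)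
  qed
qed

lemma borel_lie: "lie_subalgebra Lc borel_set"
  unfolding Lie.lie_subalgebra_iff using borel_subsp borel_brack by blast

text \<open>Under the original Cartan subalgebra the Cartan part of the current algebra has weight
  0, and the positive part has only weights \<open>m \<noteq> 0\<close>. It makes the description in
  \<open>borel_char\<close> unambiguous.\<close>

lemma plus_cartan_disjoint:
  assumes y: "y \<in> cur_plus G A H2" and y': "y \<in> cur_cartan G A H2" shows "y = \<zero>\<^bsub>Lc\<^esub>"
proof -
  \<comment> \<open>The component of degree 0 is declared to be zero, so that membership in it is
    the conclusion \<open>y = 0\<close> itself.\<close>
  define S where "S m = (if m = (\<lambda>_. 0) then {\<zero>\<^bsub>Lc\<^esub>} else vspan Lc {ct X a | X a. X \<in> root_space G (root_of G m) \<inter> nil_plus G \<and> a \<in> carrier A})" for m :: "'n \<Rightarrow> nat"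
  have g: "{ct X a | X a. X \<in> root_space G (root_of G m) \<inter> nil_plus G \<and> a \<in> carrier A} \<subseteq> carrier Lc" for m :: "'n \<Rightarrow> nat"
    using nilD by auto
  have sS: "subsp Lc (S m)" for m using Lie.LV.subsp_vspan[OF g] Lie.LV.subsp_zero by (simp add: S_def)
  have "y \<in> S (\<lambda>_. 0)"
  proof (rule Lie.LV.eigen_separation[where J = UNIV and S = S and H = "cartan G" and B = "\<lambda>h. brack Lc (emb h)"
        and ch = "\<lambda>m h. root_of G m h"])
    show "subsp Lc (S m)" for m by (rule sS)
    show "lin_map Lc Lc (brack Lc (emb h))" if "h \<in> cartan G" for h using Lie.lin_map_ad[OF emb_cartan_closed[OF that]] .
    show "brack Lc (emb h) x = root_of G m h \<odot>\<^bsub>Lc\<^esub> x" if "x \<in> S m" "h \<in> cartan G" for m h x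
    proof (cases "m = (\<lambda>_. 0)")
      case True then show ?thesis using that emb_cartan_closed Lie.brack_zero by (simp add: S_def)
    next
      case False
      have x: "x \<in> vspan Lc {ct X a | X a. X \<in> root_space G (root_of G m) \<inter> nil_plus G \<and> a \<in> carrier A}"
        using that False by (simp add: S_def)
      from x g show ?thesis
      proof (induct rule: Lie.LV.vspan_induct)
        case (base x)
        then show ?case using that(2) by (auto simp: emb_brack nilD root_space_def ct_simps)
      qed (use emb_cartan_closed[OF that(2)] in \<open>auto simp: Lie.brack_zero Lie.brack_add_right Lie.brack_smult_right Lie.LV.sm_add_r Lie.LV.sm_assoc mult.commute\<close>)
    qed
    show "\<exists>h\<in>cartan G. root_of G m h \<noteq> root_of G m' h" if "m \<noteq> m'" for m m' :: "'n \<Rightarrow> nat"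
    proof (rule ccontr)
      assume "\<not> ?thesis"
      then have "(\<lambda>i. of_nat (m i)) = (\<lambda>i. of_nat (m' i) :: complex)" by (intro root_inj) (auto simp: root_of_def)
      then show False using that by (auto simp: fun_eq_iff)
    qed
    show "brack Lc (emb h) y = root_of G (\<lambda>_. 0) h \<odot>\<^bsub>Lc\<^esub> y" if h: "h \<in> cartan G" for h
    proof -
      have "cur_cartan G A H2 \<subseteq> {y \<in> carrier Lc. brack Lc (emb h) y = \<zero>\<^bsub>Lc\<^esub>}"
      proof (rule cur_cartan_induct)
        show "subsp Lc {y \<in> carrier Lc. brack Lc (emb h) y = \<zero>\<^bsub>Lc\<^esub>}"
          using emb_cartan_closed[OF h] by (auto simp: subsp_def Lie.brack_zero Lie.brack_add_right Lie.brack_smult_right)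
        show "ct X a \<in> {y \<in> carrier Lc. brack Lc (emb h) y = \<zero>\<^bsub>Lc\<^esub>}" if "X \<in> cartan' G" "a \<in> carrier A" for X a
          using that cartan'D by (simp add: emb_brack[OF h] brack_cartan[OF h] ct_zero)
        show "chh k \<in> {y \<in> carrier Lc. brack Lc (emb h) y = \<zero>\<^bsub>Lc\<^esub>}" if "k \<in> H2" for k
          using that by (simp add: emb_brack[OF h])
      qed
      then show ?thesis using y' by (auto simp: root_of_def)
    qed
    have U: "(\<Union>m\<in>UNIV. S m) \<subseteq> carrier Lc" using subspD(1)[OF sS] by auto
    have "cur_plus G A H2 \<subseteq> vspan Lc (\<Union>m\<in>UNIV. S m)"
    proof (rule cur_plus_induct[OF Lie.LV.subsp_vspan[OF U]])
      fix X a assume X: "X \<in> nil_plus G" and a: "a \<in> carrier A"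
      have "nil_plus G \<subseteq> {X \<in> derived G. ct X a \<in> vspan Lc (\<Union>m\<in>UNIV. S m)}"
        unfolding nil_plus_def
      proof (rule LV.vspan_least[OF subsp_ct[OF Lie.LV.subsp_vspan[OF U] a]], rule subsetI)
        fix X assume X: "X \<in> (\<Union>m\<in>pos_roots G. root_space G (root_of G m))"
        then obtain m where m: "m \<in> pos_roots G" "X \<in> root_space G (root_of G m)" by blast
        have Xn: "X \<in> nil_plus G" unfolding nil_plus_def using X by (rule LV.vspan_base)
        have "m \<noteq> (\<lambda>_. 0)" using m by (simp add: pos_roots_def)
        then have "ct X a \<in> S m" unfolding S_def using m Xn a by (auto intro!: Lie.LV.vspan_base)
        then have "ct X a \<in> vspan Lc (\<Union>m\<in>UNIV. S m)" by (intro Lie.LV.vspan_base) blast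
        then show "X \<in> {X \<in> derived G. ct X a \<in> vspan Lc (\<Union>m\<in>UNIV. S m)}" using nilD[OF Xn] by blast
      qed
      then show "ct X a \<in> vspan Lc (\<Union>m\<in>UNIV. S m)" using X by blast
    qed
    then show "y \<in> vspan Lc (\<Union>m\<in>UNIV. S m)" using y by blast
  qed simp
  then show ?thesis by (simp add: S_def)
qed

lemma borel_char_eq:
  assumes n: "n \<in> cur_plus G A H2" and h: "h \<in> cur_cartan G A H2"
  shows "borel_char G A H2 \<psi> (n \<oplus>\<^bsub>Lc\<^esub> h) = \<psi> h"
  unfolding borel_char_def
proof (rule the_equality)
  show "\<exists>n'\<in>cur_plus G A H2. \<exists>h'\<in>cur_cartan G A H2. n \<oplus>\<^bsub>Lc\<^esub> h = n' \<oplus>\<^bsub>Lc\<^esub> h' \<and> \<psi> h = \<psi> h'" using n h by blast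
  fix z assume "\<exists>n'\<in>cur_plus G A H2. \<exists>h'\<in>cur_cartan G A H2. n \<oplus>\<^bsub>Lc\<^esub> h = n' \<oplus>\<^bsub>Lc\<^esub> h' \<and> z = \<psi> h'"
  then obtain n' h' where *: "n' \<in> cur_plus G A H2" "h' \<in> cur_cartan G A H2" "n \<oplus>\<^bsub>Lc\<^esub> h = n' \<oplus>\<^bsub>Lc\<^esub> h'" "z = \<psi> h'" by blast
  have cc: "n \<in> carrier Lc" "n' \<in> carrier Lc" "h \<in> carrier Lc" "h' \<in> carrier Lc"
    using n h * subspD(1)[OF cur_plus_subsp] subspD(1)[OF cur_cartan_subsp] by auto
  have eq: "n \<ominus>\<^bsub>Lc\<^esub> n' = h' \<ominus>\<^bsub>Lc\<^esub> h"
  proof (rule Lie.LV.vs_eqI)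
    fix \<phi> assume \<phi>: "lf Lc \<phi>"
    have "\<phi> n + \<phi> h = \<phi> n' + \<phi> h'" using arg_cong[OF *(3), of \<phi>] cc by (simp add: Lie.LV.lf_simps[OF \<phi>])
    then show "\<phi> (n \<ominus>\<^bsub>Lc\<^esub> n') = \<phi> (h' \<ominus>\<^bsub>Lc\<^esub> h)" using cc by (simp add: Lie.LV.lf_simps[OF \<phi>] algebra_simps)
  qed (use cc in auto)
  have z: "h' \<ominus>\<^bsub>Lc\<^esub> h = \<zero>\<^bsub>Lc\<^esub>"
    by (rule plus_cartan_disjoint)
       (use Lie.LV.subsp_minus(1)[OF cur_plus_subsp n *(1)] eq Lie.LV.subsp_minus(1)[OF cur_cartan_subsp *(2) h] in auto)
  have "h' = h"
  proof (rule Lie.LV.vs_eqI)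
    fix \<phi> assume \<phi>: "lf Lc \<phi>"
    show "\<phi> h' = \<phi> h" using arg_cong[OF z, of \<phi>] cc by (simp add: Lie.LV.lf_simps[OF \<phi>])
  qed (use cc in auto)
  then show "z = \<psi> h" using * by simp
qed

definition wform where "wform \<psi> \<longleftrightarrow> lin_form Lc (cur_cartan G A H2) \<psi>"

lemma wformD:
  assumes "wform \<psi>"
  shows "\<psi> \<zero>\<^bsub>Lc\<^esub> = 0" "\<lbrakk>x \<in> cur_cartan G A H2; y \<in> cur_cartan G A H2\<rbrakk> \<Longrightarrow> \<psi> (x \<oplus>\<^bsub>Lc\<^esub> y) = \<psi> x + \<psi> y"
    "x \<in> cur_cartan G A H2 \<Longrightarrow> \<psi> (c \<odot>\<^bsub>Lc\<^esub> x) = c * \<psi> x"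
proof -
  note l = lin_formD[OF assms[unfolded wform_def]]
  show "\<lbrakk>x \<in> cur_cartan G A H2; y \<in> cur_cartan G A H2\<rbrakk> \<Longrightarrow> \<psi> (x \<oplus>\<^bsub>Lc\<^esub> y) = \<psi> x + \<psi> y"
    "x \<in> cur_cartan G A H2 \<Longrightarrow> \<psi> (c \<odot>\<^bsub>Lc\<^esub> x) = c * \<psi> x" using l by auto
  show "\<psi> \<zero>\<^bsub>Lc\<^esub> = 0" using l(2)[of "\<zero>\<^bsub>Lc\<^esub>" 0] subspD(2)[OF cur_cartan_subsp] by simp
qed

lemma borel_char_props:
  assumes "wform \<psi>"
  shows "x \<in> cur_plus G A H2 \<Longrightarrow> borel_char G A H2 \<psi> x = 0" "x \<in> cur_cartan G A H2 \<Longrightarrow> borel_char G A H2 \<psi> x = \<psi> x"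
    "lin_form Lc borel_set (borel_char G A H2 \<psi>)"
proof -
  note w = wformD[OF assms] and p = subspD[OF cur_plus_subsp] and c = subspD[OF cur_cartan_subsp]
  show "x \<in> cur_plus G A H2 \<Longrightarrow> borel_char G A H2 \<psi> x = 0" using borel_char_eq[of x "\<zero>\<^bsub>Lc\<^esub>" \<psi>] p(1) c(2) w(1) by simp
  show "x \<in> cur_cartan G A H2 \<Longrightarrow> borel_char G A H2 \<psi> x = \<psi> x" using borel_char_eq[of "\<zero>\<^bsub>Lc\<^esub>" x \<psi>] p(2) c(1) by simp
  show "lin_form Lc borel_set (borel_char G A H2 \<psi>)"
    unfolding lin_form_def
  proof (intro conjI ballI allI)
    fix x d assume "x \<in> borel_set"
    then obtain n h where x: "n \<in> cur_plus G A H2" "h \<in> cur_cartan G A H2" "x = n \<oplus>\<^bsub>Lc\<^esub> h" by (auto simp: borel_set_def set_add_def')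
    have "d \<odot>\<^bsub>Lc\<^esub> x = d \<odot>\<^bsub>Lc\<^esub> n \<oplus>\<^bsub>Lc\<^esub> d \<odot>\<^bsub>Lc\<^esub> h" using x p(1) c(1) by (simp add: Lie.LV.sm_add_r)
    then show "borel_char G A H2 \<psi> (d \<odot>\<^bsub>Lc\<^esub> x) = d * borel_char G A H2 \<psi> x"
      using x p(4) c(4) w by (simp add: borel_char_eq)
    fix y assume "y \<in> borel_set"
    then obtain n' h' where y: "n' \<in> cur_plus G A H2" "h' \<in> cur_cartan G A H2" "y = n' \<oplus>\<^bsub>Lc\<^esub> h'" by (auto simp: borel_set_def set_add_def')
    have "x \<oplus>\<^bsub>Lc\<^esub> y = (n \<oplus>\<^bsub>Lc\<^esub> n') \<oplus>\<^bsub>Lc\<^esub> (h \<oplus>\<^bsub>Lc\<^esub> h')" using x y p(1) c(1) by (simp add: Lie.LV.vac)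
    then show "borel_char G A H2 \<psi> (x \<oplus>\<^bsub>Lc\<^esub> y) = borel_char G A H2 \<psi> x + borel_char G A H2 \<psi> y"
      using x y p(3) c(3) w by (simp add: borel_char_eq)
  qed
qed

definition hwv where "hwv V \<psi> z \<longleftrightarrow> z \<in> carrier V \<and> (\<forall>x\<in>cur_plus G A H2. act V x z = \<zero>\<^bsub>V\<^esub>)
    \<and> (\<forall>x\<in>cur_cartan G A H2. act V x z = \<psi> x \<odot>\<^bsub>V\<^esub> z)"

lemma induced_borel: "wform \<psi> \<Longrightarrow> induced Lc borel_set (borel_char G A H2 \<psi>)"
  by (intro induced.intro induced_axioms.intro lie_cur borel_lie borel_char_props(3))
     (auto simp: borel_char_props(1) borel_brack)

text \<open>All four properties are those of the induced module. The definitions of the Verma module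
  coincide with it once the map \<open>U(b) \<rightarrow> U(g~)\<close>, the left action and the
  pure tensors are identified.\<close>

lemma verma_props:
  assumes w: "wform \<psi>"
  shows "lie_module Lc (verma G A H2 \<psi>)" "hwv (verma G A H2 \<psi>) \<psi> (verma_hw G A H2 \<psi>)"
    "\<lbrakk>lie_submodule Lc (verma G A H2 \<psi>) N; verma_hw G A H2 \<psi> \<in> N\<rbrakk> \<Longrightarrow> N = carrier (verma G A H2 \<psi>)"
    "\<lbrakk>lie_module Lc Z; hwv Z \<psi> z\<rbrakk> \<Longrightarrow> \<exists>f. lhom Lc (verma G A H2 \<psi>) Z f \<and> f (verma_hw G A H2 \<psi>) = z"
proof -
  interpret I: induced Lc borel_set "borel_char G A H2 \<psi>" by (rule induced_borel[OF w])
  have r: "verma_right G A H2 = I.ir" by (simp add: fun_eq_iff verma_right_def I.ir_def Let_def)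
  have l: "verma_left G A H2 \<psi> = I.il" by (simp add: fun_eq_iff verma_left_def I.il_def)
  have p: "verma_pure G A H2 \<psi> = I.tp" by (simp add: verma_pure_def r l borel_eq)
  have V: "verma G A H2 \<psi> = I.IM" by (simp add: verma_def I.IM_def r l p borel_eq Let_def)
  have h: "verma_hw G A H2 \<psi> = I.hw" by (simp add: verma_hw_def I.hw_def p)
  interpret IM: lie_module Lc I.IM by (rule I.IM_module)
  show "lie_module Lc (verma G A H2 \<psi>)" unfolding V by (rule I.IM_module)
  show "hwv (verma G A H2 \<psi>) \<psi> (verma_hw G A H2 \<psi>)"
    unfolding hwv_def V h using I.hw_closed I.hw_eigen borel_subsp(2,3) borel_char_props[OF w] by (auto simp: subset_iff)
  show "\<lbrakk>lie_submodule Lc (verma G A H2 \<psi>) N; verma_hw G A H2 \<psi> \<in> N\<rbrakk> \<Longrightarrow> N = carrier (verma G A H2 \<psi>)"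
    unfolding V h by (rule I.IM_generated)
  show "\<exists>f. lhom Lc (verma G A H2 \<psi>) Z f \<and> f (verma_hw G A H2 \<psi>) = z" if Z: "lie_module Lc Z" and z: "hwv Z \<psi> z"
    unfolding V h
  proof (rule I.IM_universal[OF Z])
    interpret Z: lie_module Lc Z by (rule Z)
    show zc: "z \<in> carrier Z" using z by (simp add: hwv_def)
    fix x assume "x \<in> borel_set"
    then obtain n k where x: "n \<in> cur_plus G A H2" "k \<in> cur_cartan G A H2" "x = n \<oplus>\<^bsub>Lc\<^esub> k" by (auto simp: borel_set_def set_add_def')
    then show "act Z x z = borel_char G A H2 \<psi> x \<odot>\<^bsub>Z\<^esub> z"
      using z zc subspD(1)[OF cur_plus_subsp] subspD(1)[OF cur_cartan_subsp]
      by (simp add: borel_char_eq Z.act_add_left hwv_def)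
  qed
qed

end

section \<open>Highest weight modules\<close>

context km_core
begin

text \<open>By the triangular decomposition the derived algebra is spanned by raising words, its
  Cartan part and lowering words, so a linear property of its elements can be tested on these three
  kinds.\<close>

lemma derived_least:
  assumes P: "subsp G P" and "\<And>m X. ew G m X \<Longrightarrow> X \<in> P" "\<And>X. X \<in> cartan' G \<Longrightarrow> X \<in> P" "\<And>m X. fw G m X \<Longrightarrow> X \<in> P"
  shows "derived G \<subseteq> P"
proof
  fix x assume "x \<in> derived G"
  then obtain p h q where x: "p \<in> nil_plus G" "h \<in> cartan' G" "q \<in> nil_minus" "x = p \<oplus> h \<oplus> q" using triangular_derived by blast
  have "vspan G {x. ew G m x} \<subseteq> P" for m by (rule LV.vspan_least[OF P]) (use assms(2) in auto)
  then have "root_space G (root_of G m) \<subseteq> P" if "m \<in> pos_roots G" for m using root_space_pos that by (auto simp: pos_roots_def)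
  then have "nil_plus G \<subseteq> P" unfolding nil_plus_def by (intro LV.vspan_least[OF P] UN_least)
  moreover have "nil_minus \<subseteq> P" unfolding nil_minus_def by (rule LV.vspan_least[OF P]) (use assms(4) in auto)
  ultimately show "x \<in> P" using x assms(3)[of h] subspD(3)[OF P] by (simp add: subset_iff)
qed

end

context cur
begin

abbreviation fA where "fA i \<equiv> ct (chev_f G i)"
abbreviation eA where "eA i \<equiv> ct (chev_e G i)"
abbreviation hA where "hA i \<equiv> ct (coroot G i)"

lemma coroot_cartan': "coroot G i \<in> cartan' G" by (simp add: cartan'_def coroot_cartan coroot_derived)
lemma chev_e_nil: "chev_e G i \<in> nil_plus G" by (rule ew_nil_plus[OF ew.base])

definition wkill where "wkill \<psi> I \<longleftrightarrow> (\<forall>X\<in>cartan' G. \<forall>a\<in>I. \<psi> (ct X a) = 0)"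
definition dom where "dom \<psi> \<longleftrightarrow> wform \<psi> \<and> (\<forall>i. \<psi> (hA i \<one>\<^sub>A) \<in> \<nat>)"
definition wn where "wn \<psi> i = (SOME n. \<psi> (hA i \<one>\<^sub>A) = of_nat n)"

lemma domD: assumes "dom \<psi>" shows "wform \<psi>" "\<psi> (hA i \<one>\<^sub>A) = of_nat (wn \<psi> i)"
proof -
  show "wform \<psi>" using assms by (simp add: dom_def)
  have "\<exists>n. \<psi> (hA i \<one>\<^sub>A) = of_nat n" using assms unfolding dom_def Nats_def by auto
  then show "\<psi> (hA i \<one>\<^sub>A) = of_nat (wn \<psi> i)" unfolding wn_def by (rule someI_ex)
qed

lemma N_wt_eq: assumes "dom \<psi>" shows "N_wt G (cur_weight G A H2 \<psi>) m = (\<Sum>i\<in>UNIV. m i * wn \<psi> i)"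
proof -
  have "cur_weight G A H2 \<psi> (coroot G i) = of_nat (wn \<psi> i)" for i
    using domD(2)[OF assms, of i] emb_derived[OF coroot_derived] by (simp add: cur_weight_def)
  then show ?thesis unfolding N_wt_def by (simp flip: of_nat_mult of_nat_sum)
qed

lemma hwvD:
  assumes "hwv Z \<psi> z"
  shows "z \<in> carrier Z" "\<lbrakk>X \<in> nil_plus G; a \<in> carrier A\<rbrakk> \<Longrightarrow> act Z (ct X a) z = \<zero>\<^bsub>Z\<^esub>"
    "\<lbrakk>X \<in> cartan' G; a \<in> carrier A\<rbrakk> \<Longrightarrow> act Z (ct X a) z = \<psi> (ct X a) \<odot>\<^bsub>Z\<^esub> z"
    "h \<in> H2 \<Longrightarrow> act Z (chh h) z = \<psi> (chh h) \<odot>\<^bsub>Z\<^esub> z"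
    "h \<in> cartan G \<Longrightarrow> act Z (emb h) z = \<psi> (emb h) \<odot>\<^bsub>Z\<^esub> z"
  using assms cur_mem unfolding hwv_def by blast+

lemma hwvI:
  assumes Z: "lie_module Lc Z" and w: "wform \<psi>" and z: "z \<in> carrier Z"
    and p: "\<And>X a. \<lbrakk>X \<in> nil_plus G; a \<in> carrier A\<rbrakk> \<Longrightarrow> act Z (ct X a) z = \<zero>\<^bsub>Z\<^esub>"
    and c: "\<And>X a. \<lbrakk>X \<in> cartan' G; a \<in> carrier A\<rbrakk> \<Longrightarrow> act Z (ct X a) z = \<psi> (ct X a) \<odot>\<^bsub>Z\<^esub> z"
    and h: "\<And>h. h \<in> H2 \<Longrightarrow> act Z (chh h) z = \<psi> (chh h) \<odot>\<^bsub>Z\<^esub> z"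
  shows "hwv Z \<psi> z"
proof -
  interpret Z: lie_module Lc Z by (rule Z)
  have "cur_plus G A H2 \<subseteq> {x \<in> carrier Lc. act Z x z = \<zero>\<^bsub>Z\<^esub>}"
    by (rule cur_plus_induct) (use z p nilD in \<open>auto simp: subsp_def Z.act_zero Z.act_add_left Z.act_smult_left\<close>)
  moreover have "cur_cartan G A H2 \<subseteq> {x \<in> cur_cartan G A H2. act Z x z = \<psi> x \<odot>\<^bsub>Z\<^esub> z}"
  proof (rule cur_cartan_induct)
    show "subsp Lc {x \<in> cur_cartan G A H2. act Z x z = \<psi> x \<odot>\<^bsub>Z\<^esub> z}"
      using subspD[OF cur_cartan_subsp] z wformD[OF w]
      by (auto simp: subsp_def Z.act_zero Z.act_add_left Z.act_smult_left Z.VV.sm_add_l Z.VV.sm_assoc)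
  qed (use c h cur_mem in auto)
  ultimately show ?thesis using z unfolding hwv_def by blast
qed

lemma sl2_rels:
  assumes "a \<in> carrier A" "b \<in> carrier A"
  shows "brack Lc (eA i a) (fA i b) = hA i (a \<cdot> b)" "brack Lc (hA i a) (fA i b) = (-2) \<odot>\<^bsub>Lc\<^esub> fA i (a \<cdot> b)"
    "brack Lc (fA i a) (fA i b) = \<zero>\<^bsub>Lc\<^esub>"
proof -
  have 1: "brack G (coroot G i) (chev_f G i) = (-2) \<odot>\<^bsub>G\<^esub> chev_f G i"
    using brack_cartan_f[OF coroot_cartan, of i i] sroot_coroot[of i i] gcm by (simp add: gcm_def)
  show "brack Lc (eA i a) (fA i b) = hA i (a \<cdot> b)" "brack Lc (hA i a) (fA i b) = (-2) \<odot>\<^bsub>Lc\<^esub> fA i (a \<cdot> b)"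
    "brack Lc (fA i a) (fA i b) = \<zero>\<^bsub>Lc\<^esub>"
    using assms 1 chev_e_derived chev_f_derived coroot_derived chev_carrier
    by (simp_all add: brack_ct brack_e_f ct_simps brack_self ct_zero)
qed

lemma A_closed [simp]: "a \<in> carrier A \<Longrightarrow> eA i a \<in> carrier Lc" "a \<in> carrier A \<Longrightarrow> fA i a \<in> carrier Lc" "a \<in> carrier A \<Longrightarrow> hA i a \<in> carrier Lc"
  using chev_e_derived chev_f_derived coroot_derived by simp_all

text \<open>sl2 theory replaces an unknown exponent by one that depends on \<open>\<psi>\<close>
  alone. This bound is uniform over all integrable quotients, and it is also the exponent from which
  Garland's argument starts.\<close>

lemma hw_nilp:
  assumes Z: "lie_module Lc Z" and z: "hwv Z \<psi> z" and d: "dom \<psi>" and n: "(act Z (fA i \<one>\<^sub>A) ^^ n) z = \<zero>\<^bsub>Z\<^esub>"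
  shows "(act Z (fA i \<one>\<^sub>A) ^^ Suc (wn \<psi> i)) z = \<zero>\<^bsub>Z\<^esub>"
proof -
  interpret Z: lie_module Lc Z by (rule Z)
  show ?thesis
  proof (rule Z.sl2_hw_nilp[where e = "eA i \<one>\<^sub>A" and h = "hA i \<one>\<^sub>A"])
    show "act Z (eA i \<one>\<^sub>A) z = \<zero>\<^bsub>Z\<^esub>" using hwvD(2)[OF z chev_e_nil] by simp
    show "act Z (hA i \<one>\<^sub>A) z = of_nat (wn \<psi> i) \<odot>\<^bsub>Z\<^esub> z" using hwvD(3)[OF z coroot_cartan'] domD(2)[OF d] by simp
    show "z \<in> carrier Z" using hwvD(1)[OF z] .
  qed (use n sl2_rels in auto)
qed

definition hwmod where "hwmod Z \<psi> z \<longleftrightarrow> lie_module Lc Z \<and> hwv Z \<psi> z \<and> (\<forall>N. lie_submodule Lc Z N \<and> z \<in> N \<longrightarrow> N = carrier Z)"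
definition fnilp where "fnilp Z z \<longleftrightarrow> (\<forall>i. \<exists>n. (act Z (fA i \<one>\<^sub>A) ^^ n) z = \<zero>\<^bsub>Z\<^esub>)"

text \<open>Both parts of integrability are checked on the generator: the vectors on which an
  operator is nilpotent, and the span of the weight vectors, are submodules that contain
  \<open>z\<close>.\<close>

lemma integrable_hwmod:
  assumes "hwmod Z \<psi> z" and f: "fnilp Z z"
  shows "integrable G A H2 Z"
proof -
  have Z: "lie_module Lc Z" and z: "hwv Z \<psi> z" and gen: "\<And>N. lie_submodule Lc Z N \<Longrightarrow> z \<in> N \<Longrightarrow> N = carrier Z"
    using assms by (auto simp: hwmod_def)
  interpret Z: lie_module Lc Z by (rule Z)
  note zc = hwvD(1)[OF z]
  have nil: "locally_nilpotent Z (emb X)"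
    if X: "X \<in> derived G" and ad: "\<And>y. y \<in> carrier G \<Longrightarrow> \<exists>n. (brack G X ^^ n) y = \<zero>\<^bsub>G\<^esub>"
      and n: "\<exists>n. (act Z (ct X \<one>\<^sub>A) ^^ n) z = \<zero>\<^bsub>Z\<^esub>" for X
  proof -
    have x: "ct X \<one>\<^sub>A \<in> carrier Lc" using X by simp
    let ?N = "{v \<in> carrier Z. \<exists>n. (act Z (ct X \<one>\<^sub>A) ^^ n) v = \<zero>\<^bsub>Z\<^esub>}"
    \<comment> \<open>Local nilpotency of the operator on the Lie algebra itself, together with its
      nilpotency on \<open>v\<close>, gives nilpotency on \<open>y v\<close>.\<close>
    have "lie_submodule Lc Z ?N" unfolding Z.lie_submodule_iff
    proof (intro conjI ballI)
      show "subsp Z ?N" by (rule Z.nilp_subsp[OF x])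
      fix y v assume y: "y \<in> carrier Lc" and v: "v \<in> ?N"
      obtain p where "(brack Lc (ct X \<one>\<^sub>A) ^^ p) y = \<zero>\<^bsub>Lc\<^esub>" using ad_nilp_cur[OF X ad y] by blast
      moreover obtain q where "(act Z (ct X \<one>\<^sub>A) ^^ q) v = \<zero>\<^bsub>Z\<^esub>" using v by blast
      ultimately have "(act Z (ct X \<one>\<^sub>A) ^^ (p + q)) (act Z y v) = \<zero>\<^bsub>Z\<^esub>" using Z.ad_nilp_step[OF x y] v by blast
      then show "act Z y v \<in> ?N" using Z.act_closed y v by blast
    qed
    then have "?N = carrier Z" by (rule gen) (use zc n in blast)
    then show ?thesis unfolding locally_nilpotent_def emb_derived[OF X] by blast
  qed
  let ?W = "{v \<in> carrier Z. \<exists>\<mu>. \<forall>h\<in>cartan G. act Z (emb h) v = \<mu> h \<odot>\<^bsub>Z\<^esub> v}"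
  let ?G = "{x \<in> carrier Lc. \<exists>\<beta>. \<forall>h\<in>cartan G. brack Lc (emb h) x = \<beta> h \<odot>\<^bsub>Lc\<^esub> x}"
  have Gs: "?G \<subseteq> carrier Lc" and Ws: "?W \<subseteq> carrier Z" by auto
  \<comment> \<open>The current algebra is itself spanned by weight vectors. A weight vector of the
    algebra applied to one of the module is again a weight vector, with the sum of the
    weights.\<close>
  have LG: "carrier Lc \<subseteq> vspan Lc ?G"
  proof (rule Lc_induct[OF Lie.LV.subsp_vspan[OF Gs]])
    show "chh h \<in> vspan Lc ?G" if "h \<in> H2" for h
      by (rule Lie.LV.vspan_base) (use that emb_brack(2) in \<open>auto intro!: exI[of _ "\<lambda>_. 0"]\<close>)
    fix X a assume X: "X \<in> derived G" and a: "a \<in> carrier A"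
    have b: "ct Y a \<in> vspan Lc ?G" if "Y \<in> derived G" "\<And>h. h \<in> cartan G \<Longrightarrow> brack G h Y = \<beta> h \<odot>\<^bsub>G\<^esub> Y" for Y \<beta>
      by (rule Lie.LV.vspan_base) (use that a emb_brack(1) in \<open>auto simp: ct_simps intro!: exI[of _ \<beta>]\<close>)
    have "derived G \<subseteq> {X \<in> derived G. ct X a \<in> vspan Lc ?G}"
    proof (rule derived_least[OF subsp_ct[OF Lie.LV.subsp_vspan[OF Gs] a]])
      show "Y \<in> {X \<in> derived G. ct X a \<in> vspan Lc ?G}" if "ew G m Y" for m Y
        using b[OF ew_derived[OF that] ew_weight[OF that]] ew_derived[OF that] by blast
      show "Y \<in> {X \<in> derived G. ct X a \<in> vspan Lc ?G}" if "fw G m Y" for m Y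
        using b[OF fw_derived[OF that] fw_weight[OF that]] fw_derived[OF that] by blast
      show "Y \<in> {X \<in> derived G. ct X a \<in> vspan Lc ?G}" if "Y \<in> cartan' G" for Y
        using b[of Y "\<lambda>_. 0"] brack_cartan[of _ Y] cartan'D[OF that] dG[of Y] by auto
    qed
    then show "ct X a \<in> vspan Lc ?G" using X by blast
  qed
  have "lie_submodule Lc Z (vspan Z ?W)" unfolding Z.lie_submodule_iff
  proof (intro conjI ballI)
    show S: "subsp Z (vspan Z ?W)" by (rule Z.VV.subsp_vspan[OF Ws])
    fix x v assume "x \<in> carrier Lc" and v: "v \<in> vspan Z ?W"
    then have x: "x \<in> vspan Lc ?G" using LG by blast
    show "act Z x v \<in> vspan Z ?W"
    proof (rule Z.span_act[OF Gs Ws S _ x v])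
      fix x v assume "x \<in> ?G" "v \<in> ?W"
      then obtain \<beta> \<mu> where xv: "x \<in> carrier Lc" "v \<in> carrier Z" "\<And>h. h \<in> cartan G \<Longrightarrow> brack Lc (emb h) x = \<beta> h \<odot>\<^bsub>Lc\<^esub> x"
        "\<And>h. h \<in> cartan G \<Longrightarrow> act Z (emb h) v = \<mu> h \<odot>\<^bsub>Z\<^esub> v" by blast
      have "act Z (emb h) (act Z x v) = (\<beta> h + \<mu> h) \<odot>\<^bsub>Z\<^esub> act Z x v" if "h \<in> cartan G" for h
        using xv that emb_cartan_closed[OF that]
        by (simp add: Z.act_comm[of "emb h" x v] Z.act_smult_left Z.act_smult_right Z.act_closed Z.VV.sm_add_l)
      then have "act Z x v \<in> ?W" using xv Z.act_closed by (auto intro!: exI[of _ "\<lambda>h. \<beta> h + \<mu> h"])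
      then show "act Z x v \<in> vspan Z ?W" by (rule Z.VV.vspan_base)
    qed
  qed
  then have "vspan Z ?W = carrier Z"
  proof (rule gen)
    show "z \<in> vspan Z ?W" by (rule Z.VV.vspan_base) (use zc hwvD(5)[OF z] in \<open>auto intro!: exI[of _ "\<lambda>h. \<psi> (emb h)"]\<close>)
  qed
  then have dg: "diagonalizable G A H2 Z" by (simp add: diagonalizable_def)
  have "(act Z (eA i \<one>\<^sub>A) ^^ 1) z = \<zero>\<^bsub>Z\<^esub>" for i using hwvD(2)[OF z chev_e_nil] by simp
  then have "locally_nilpotent Z (emb (chev_e G i))" for i by (intro nil chev_e_derived ad_e_nilp) blast+
  moreover have "locally_nilpotent Z (emb (chev_f G i))" for i
    by (intro nil chev_f_derived ad_f_nilp) (use f in \<open>auto simp: fnilp_def\<close>)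
  ultimately show ?thesis using dg by (simp add: integrable_def)
qed

lemma hwmod_quot:
  assumes "hwmod Z \<psi> z" and N: "lie_submodule Lc Z N"
  shows "hwmod (lmod_quot Z N) \<psi> (N +>\<^bsub>Z\<^esub> z)"
proof -
  have Z: "lie_module Lc Z" and z: "hwv Z \<psi> z" and gen: "\<And>N. lie_submodule Lc Z N \<Longrightarrow> z \<in> N \<Longrightarrow> N = carrier Z"
    using assms by (auto simp: hwmod_def)
  interpret Z: lie_module Lc Z by (rule Z)
  interpret Q: lie_module Lc "lmod_quot Z N" by (rule Z.quot_module[OF N])
  note zc = hwvD(1)[OF z]
  have "hwv (lmod_quot Z N) \<psi> (N +>\<^bsub>Z\<^esub> z)"
    using z zc subspD(1)[OF cur_plus_subsp] subspD(1)[OF cur_cartan_subsp]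
    by (auto simp: hwv_def Z.quot_simps Z.quot_ops[OF N])
  moreover have "N' = carrier (lmod_quot Z N)" if N': "lie_submodule Lc (lmod_quot Z N) N'" and zN: "N +>\<^bsub>Z\<^esub> z \<in> N'" for N'
  proof -
    have S: "subsp (lmod_quot Z N) N'" "\<And>x v. \<lbrakk>x \<in> carrier Lc; v \<in> N'\<rbrakk> \<Longrightarrow> act (lmod_quot Z N) x v \<in> N'"
      using N' Q.lie_submodule_iff by auto
    have "lie_submodule Lc Z {v \<in> carrier Z. N +>\<^bsub>Z\<^esub> v \<in> N'}" unfolding Z.lie_submodule_iff subsp_def
      using subspD(2-4)[OF S(1)] S(2) by (auto simp: Z.act_closed simp flip: Z.quot_ops[OF N])
    then have "{v \<in> carrier Z. N +>\<^bsub>Z\<^esub> v \<in> N'} = carrier Z" by (rule gen) (use zc zN in auto)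
    then have "carrier (lmod_quot Z N) \<subseteq> N'" by (auto simp: Z.quot_simps)
    then show ?thesis using subspD(1)[OF S(1)] by blast
  qed
  ultimately show ?thesis using Q.lie_module_axioms by (auto simp: hwmod_def)
qed

lemma quot_pow:
  assumes Z: "lie_module Lc Z" and N: "lie_submodule Lc Z N" and x: "x \<in> carrier Lc" and v: "v \<in> carrier Z"
  shows "(act (lmod_quot Z N) x ^^ n) (N +>\<^bsub>Z\<^esub> v) = N +>\<^bsub>Z\<^esub> (act Z x ^^ n) v"
proof -
  interpret Z: lie_module Lc Z by (rule Z)
  show ?thesis by (induct n) (use v x in \<open>auto simp: Z.quot_ops(4)[OF N] Z.act_pow_closed\<close>)
qed

section \<open>The relations of a Weyl module are consequences of integrability\<close>

context
  fixes Z :: "(('g, 'a) cur, 'v, 'k) lmod_scheme" and \<psi> :: "('g, 'a) cur \<Rightarrow> complex"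
    and z :: 'v and I :: "'a set" and i :: 'n
  assumes Z: "lie_module Lc Z" and z: "hwv Z \<psi> z" and I: "ideal I A" and k: "wkill \<psi> I" and d: "dom \<psi>"
begin

interpretation Z: lie_module Lc Z by (rule Z)
interpretation I: ideal I A by (rule I)

definition aprod where "aprod bs = foldr (mult A) bs \<one>\<^sub>A"
definition fwd where "fwd bs = foldr (\<lambda>b v. act Z (fA i b) v) bs z"

lemma aprod_closed: "set bs \<subseteq> carrier A \<Longrightarrow> aprod bs \<in> carrier A" by (induct bs) (auto simp: aprod_def)

text \<open>The invariant: \<open>y\<close> is a sum of \<open>K\<close> products of \<open>r\<close> lowering operators whose arguments multiply to \<open>c\<close>.\<close>

inductive comb :: "nat \<Rightarrow> 'a \<Rightarrow> nat \<Rightarrow> 'v \<Rightarrow> bool" where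
  word: "set bs \<subseteq> carrier A \<Longrightarrow> comb (length bs) (aprod bs) 1 (fwd bs)"
| zero: "c \<in> carrier A \<Longrightarrow> comb r c 0 \<zero>\<^bsub>Z\<^esub>"
| add: "comb r c K y \<Longrightarrow> comb r c K' y' \<Longrightarrow> comb r c (K + K') (y \<oplus>\<^bsub>Z\<^esub> y')"

lemma zc: "z \<in> carrier Z" by (rule hwvD(1)[OF z])

lemma fwd_closed: "set bs \<subseteq> carrier A \<Longrightarrow> fwd bs \<in> carrier Z" by (induct bs) (auto simp: fwd_def zc Z.act_closed)

lemma comb_closed: "comb r c K y \<Longrightarrow> c \<in> carrier A \<and> y \<in> carrier Z"
  by (induct rule: comb.induct) (auto simp: fwd_closed aprod_closed)

lemma comb_f: "comb r c K y \<Longrightarrow> b \<in> carrier A \<Longrightarrow> comb (Suc r) (b \<cdot> c) K (act Z (fA i b) y)"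
proof (induct rule: comb.induct)
  case (word bs)
  then show ?case using comb.word[of "b # bs"] by (simp add: fwd_def aprod_def)
next
  case (zero c r)
  then show ?case using comb.zero[of "b \<cdot> c" "Suc r"] by (simp add: Z.act_zero)
next
  case (add r c K y K' y')
  then show ?case using comb.add[of "Suc r"] comb_closed by (simp add: Z.act_add_right)
qed

lemma kill_hA: "a \<in> I \<Longrightarrow> \<psi> (hA i a) = 0" using k coroot_cartan' by (simp add: wkill_def)

text \<open>Moving \<open>h_i \<otimes> a\<close> through a word replaces, for each factor in turn,
  its argument \<open>b\<close> by \<open>a b\<close> with coefficient \<open>-2\<close>. The term
  in which it reaches \<open>z\<close> vanishes because \<open>a\<close> lies in \<open>I\<close>.
  One word per factor remains.\<close>

lemma comb_h:
  assumes a: "a \<in> I" and bs: "set bs \<subseteq> carrier A"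
  shows "\<exists>y. act Z (hA i a) (fwd bs) = (-2) \<odot>\<^bsub>Z\<^esub> y \<and> comb (length bs) (a \<cdot> aprod bs) (length bs) y"
  using bs
proof (induct bs)
  case Nil
  have ac: "a \<in> carrier A" using a by simp
  then have "act Z (hA i a) z = \<zero>\<^bsub>Z\<^esub>" using hwvD(3)[OF z coroot_cartan' ac] kill_hA[OF a] zc by simp
  then show ?case using comb.zero[of "a \<cdot> aprod []" 0] ac by (intro exI[of _ "\<zero>\<^bsub>Z\<^esub>"]) (auto simp: fwd_def aprod_def)
next
  case (Cons b bs)
  have ac: "a \<in> carrier A" using a by simp
  have bc: "b \<in> carrier A" and bsc: "set bs \<subseteq> carrier A" using Cons.prems by auto
  obtain y where y: "act Z (hA i a) (fwd bs) = (-2) \<odot>\<^bsub>Z\<^esub> y" "comb (length bs) (a \<cdot> aprod bs) (length bs) y" using Cons by auto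
  have yc: "y \<in> carrier Z" using comb_closed[OF y(2)] by simp
  have p: "aprod bs \<in> carrier A" using aprod_closed[OF bsc] .
  have 1: "comb (Suc (length bs)) (a \<cdot> aprod (b # bs)) 1 (fwd ((a \<cdot> b) # bs))"
    using comb.word[of "(a \<cdot> b) # bs"] ac bc bsc p by (simp add: aprod_def A.m_assoc)
  have "b \<cdot> (a \<cdot> aprod bs) = a \<cdot> aprod (b # bs)" using ac bc p by (simp add: aprod_def A.m_lcomm)
  then have 2: "comb (Suc (length bs)) (a \<cdot> aprod (b # bs)) (length bs) (act Z (fA i b) y)" using comb_f[OF y(2) bc] by simp
  have "act Z (hA i a) (fwd (b # bs)) = act Z (brack Lc (hA i a) (fA i b)) (fwd bs) \<oplus>\<^bsub>Z\<^esub> act Z (fA i b) (act Z (hA i a) (fwd bs))"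
    using Z.act_comm[of "hA i a" "fA i b" "fwd bs"] ac bc fwd_closed[OF bsc] by (simp add: fwd_def)
  also have "\<dots> = (-2) \<odot>\<^bsub>Z\<^esub> (fwd ((a \<cdot> b) # bs) \<oplus>\<^bsub>Z\<^esub> act Z (fA i b) y)"
    using ac bc yc fwd_closed[OF bsc] unfolding y(1)
    by (simp add: sl2_rels Z.act_smult_left Z.act_smult_right Z.act_closed Z.VV.sm_add_r fwd_def)
  finally show ?case using comb.add[OF 1 2] by (intro exI[of _ "fwd ((a \<cdot> b) # bs) \<oplus>\<^bsub>Z\<^esub> act Z (fA i b) y"]) simp
qed

text \<open>\<open>tri n = n (n - 1) / 2\<close> counts pairs of positions:
  \<open>e_i \<otimes> a\<close> turns one factor into a coroot element, which then meets one of the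
  factors to its right.\<close>

fun tri :: "nat \<Rightarrow> nat" where "tri 0 = 0" | "tri (Suc n) = n + tri n"

lemma comb_e:
  assumes a: "a \<in> I" and bs: "set bs \<subseteq> carrier A" "bs \<noteq> []"
  shows "\<exists>y. act Z (eA i a) (fwd bs) = (-2) \<odot>\<^bsub>Z\<^esub> y \<and> comb (length bs - 1) (a \<cdot> aprod bs) (tri (length bs)) y"
  using bs
proof (induct bs)
  case (Cons b bs)
  have ac: "a \<in> carrier A" using a by simp
  have bc: "b \<in> carrier A" and bsc: "set bs \<subseteq> carrier A" using Cons.prems by auto
  have ab: "a \<cdot> b \<in> I" using I.I_r_closed[OF a bc] .
  have p: "aprod bs \<in> carrier A" using aprod_closed[OF bsc] .
  obtain y where y: "act Z (hA i (a \<cdot> b)) (fwd bs) = (-2) \<odot>\<^bsub>Z\<^esub> y" "comb (length bs) (a \<cdot> b \<cdot> aprod bs) (length bs) y"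
    using comb_h[OF ab bsc] by blast
  have yc: "y \<in> carrier Z" using comb_closed[OF y(2)] by simp
  have e: "act Z (eA i a) (fwd (b # bs)) = act Z (hA i (a \<cdot> b)) (fwd bs) \<oplus>\<^bsub>Z\<^esub> act Z (fA i b) (act Z (eA i a) (fwd bs))"
    using Z.act_comm[of "eA i a" "fA i b" "fwd bs"] ac bc fwd_closed[OF bsc] by (simp add: fwd_def sl2_rels)
  have 1: "comb (length bs) (a \<cdot> aprod (b # bs)) (length bs) y" using y(2) ac bc p by (simp add: aprod_def A.m_assoc)
  show ?case
  proof (cases "bs = []")
    case True
    have "act Z (eA i a) (fwd []) = \<zero>\<^bsub>Z\<^esub>" using hwvD(2)[OF z chev_e_nil ac] by (simp add: fwd_def)
    then have "act Z (eA i a) (fwd (b # bs)) = (-2) \<odot>\<^bsub>Z\<^esub> y" using e y yc True bc by (simp add: Z.act_zero)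
    then show ?thesis using 1 True by (intro exI[of _ y]) simp
  next
    case False
    obtain y' where y': "act Z (eA i a) (fwd bs) = (-2) \<odot>\<^bsub>Z\<^esub> y'" "comb (length bs - 1) (a \<cdot> aprod bs) (tri (length bs)) y'"
      using Cons.hyps[OF bsc False] by blast
    have yc': "y' \<in> carrier Z" using comb_closed[OF y'(2)] by simp
    have "b \<cdot> (a \<cdot> aprod bs) = a \<cdot> aprod (b # bs)" using ac bc p by (simp add: aprod_def A.m_lcomm)
    then have 2: "comb (length bs) (a \<cdot> aprod (b # bs)) (tri (length bs)) (act Z (fA i b) y')"
      using comb_f[OF y'(2) bc] False by simp
    have "act Z (eA i a) (fwd (b # bs)) = (-2) \<odot>\<^bsub>Z\<^esub> (y \<oplus>\<^bsub>Z\<^esub> act Z (fA i b) y')"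
      using e yc yc' bc unfolding y(1) y'(1) by (simp add: Z.act_smult_right Z.act_closed Z.VV.sm_add_r)
    then show ?thesis using comb.add[OF 1 2] by (intro exI[of _ "y \<oplus>\<^bsub>Z\<^esub> act Z (fA i b) y'"]) simp
  qed
qed simp

text \<open>All terms produced by \<open>comb_e\<close> share the coefficient \<open>-2\<close>.
  Pulling it out keeps the multiplicities nonnegative integers, so the terms cannot cancel.\<close>

lemma comb_step:
  assumes a: "a \<in> I" and "comb r c K y" "r = Suc r'"
  shows "\<exists>y'. act Z (eA i a) y = (-2) \<odot>\<^bsub>Z\<^esub> y' \<and> comb r' (a \<cdot> c) (K * tri r) y'"
  using assms(2,3)
proof (induct rule: comb.induct)
  case (word bs)
  then show ?case using comb_e[OF a, of bs] by (cases bs) auto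
next
  case (zero c r)
  have "a \<in> carrier A" using a by simp
  then show ?case using comb.zero[of "a \<cdot> c" r'] zero by (intro exI[of _ "\<zero>\<^bsub>Z\<^esub>"]) (auto simp: Z.act_zero)
next
  case (add r c K y K' y')
  then obtain u u' where u: "act Z (eA i a) y = (-2) \<odot>\<^bsub>Z\<^esub> u" "comb r' (a \<cdot> c) (K * tri r) u"
    "act Z (eA i a) y' = (-2) \<odot>\<^bsub>Z\<^esub> u'" "comb r' (a \<cdot> c) (K' * tri r) u'" by blast
  have ac: "a \<in> carrier A" using a by simp
  have "act Z (eA i a) (y \<oplus>\<^bsub>Z\<^esub> y') = (-2) \<odot>\<^bsub>Z\<^esub> (u \<oplus>\<^bsub>Z\<^esub> u')"
    using u comb_closed[OF u(2)] comb_closed[OF u(4)] comb_closed[OF add(1)] comb_closed[OF add(3)] ac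
    by (simp add: Z.act_add_right Z.VV.sm_add_r)
  then show ?case using comb.add[OF u(2,4)] by (intro exI[of _ "u \<oplus>\<^bsub>Z\<^esub> u'"]) (simp add: algebra_simps)
qed

lemma comb_one: "comb r c K y \<Longrightarrow> r = 1 \<Longrightarrow> y = of_nat K \<odot>\<^bsub>Z\<^esub> act Z (fA i c) z"
proof (induct rule: comb.induct)
  case (word bs)
  then obtain b where "bs = [b]" "b \<in> carrier A" by (cases bs) auto
  then show ?case using Z.act_closed zc by (simp add: fwd_def aprod_def)
next
  case (zero c r)
  then show ?case using Z.act_closed zc by simp
next
  case (add r c K y K' y')
  then show ?case using Z.act_closed zc comb_closed[OF add(1)] by (simp add: Z.VV.sm_add_l)
qed

text \<open>The zero vector is regarded as a sum of \<open>K\<close> words with one factor more than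
  there are elements in \<open>as\<close>. Each \<open>e_i \<otimes> a\<close> shortens the words by
  one factor and multiplies their argument product by \<open>a\<close>; in the end one factor is
  left, with positive multiplicity.\<close>

lemma comb_kill:
  assumes "set as \<subseteq> I" "comb (Suc (length as)) c K \<zero>\<^bsub>Z\<^esub>" "K > 0"
  shows "act Z (fA i (aprod as \<cdot> c)) z = \<zero>\<^bsub>Z\<^esub>"
  using assms
proof (induct as arbitrary: c K)
  case Nil
  then have c: "c \<in> carrier A" using comb_closed by blast
  then have fz: "act Z (fA i c) z \<in> carrier Z" using Z.act_closed zc by simp
  have "\<zero>\<^bsub>Z\<^esub> = of_nat K \<odot>\<^bsub>Z\<^esub> act Z (fA i c) z" using comb_one[OF Nil(2)] by simp
  then have "(1 / of_nat K) \<odot>\<^bsub>Z\<^esub> (of_nat K \<odot>\<^bsub>Z\<^esub> act Z (fA i c) z) = \<zero>\<^bsub>Z\<^esub>" by (metis Z.VV.sm_zero_r)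
  then show ?case using fz Nil(3) c by (simp add: Z.VV.sm_assoc aprod_def)
next
  case (Cons a as)
  have a: "a \<in> I" "a \<in> carrier A" and as: "set as \<subseteq> I" using Cons.prems by auto
  have p: "aprod as \<in> carrier A" using aprod_closed[of as] as I.Icarr by blast
  have c: "c \<in> carrier A" using comb_closed[OF Cons.prems(2)] by blast
  obtain y where y: "act Z (eA i a) \<zero>\<^bsub>Z\<^esub> = (-2) \<odot>\<^bsub>Z\<^esub> y" "comb (Suc (length as)) (a \<cdot> c) (K * tri (Suc (Suc (length as)))) y"
    using comb_step[OF a(1) Cons.prems(2)] by auto
  have yc: "y \<in> carrier Z" using comb_closed[OF y(2)] by blast
  have "(-1/2) \<odot>\<^bsub>Z\<^esub> ((-2) \<odot>\<^bsub>Z\<^esub> y) = \<zero>\<^bsub>Z\<^esub>" unfolding y(1)[symmetric] using a by (simp add: Z.act_zero)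
  then have "y = \<zero>\<^bsub>Z\<^esub>" using yc by (simp add: Z.VV.sm_assoc)
  \<comment> \<open>The multiplicity stays positive because the words still have at least two
    factors and \<open>tri r > 0\<close> for \<open>r \<ge> 2\<close>.\<close>
  then have "act Z (fA i (aprod as \<cdot> (a \<cdot> c))) z = \<zero>\<^bsub>Z\<^esub>"
    using Cons.hyps[OF as, of "a \<cdot> c"] y(2) Cons.prems(3) by (metis nat_0_less_mult_iff tri.simps(2) zero_less_Suc add_gr_0)
  moreover have "aprod as \<cdot> (a \<cdot> c) = aprod (a # as) \<cdot> c" using a p c by (simp add: aprod_def A.m_ac)
  ultimately show ?case by simp
qed

lemma garland_list:
  assumes nil: "(act Z (fA i \<one>\<^sub>A) ^^ Suc n) z = \<zero>\<^bsub>Z\<^esub>" and as: "set as \<subseteq> I" "length as = n"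
  shows "act Z (fA i (aprod as)) z = \<zero>\<^bsub>Z\<^esub>"
proof -
  have 1: "fwd (replicate n \<one>\<^sub>A) = (act Z (fA i \<one>\<^sub>A) ^^ n) z" for n by (induct n) (auto simp: fwd_def)
  have 2: "aprod (replicate n \<one>\<^sub>A) = \<one>\<^sub>A" for n by (induct n) (auto simp: aprod_def)
  \<comment> \<open>A vector may satisfy \<open>comb\<close> with several counts. Here the zero
    vector is counted as one word, namely \<open>f_i \<otimes> 1\<close> applied
    \<open>n + 1\<close> times to \<open>z\<close>.\<close>
  have "comb (Suc (length as)) \<one>\<^sub>A 1 \<zero>\<^bsub>Z\<^esub>"
  proof -
    have "comb (Suc n) (aprod (replicate (Suc n) \<one>\<^sub>A)) 1 (fwd (replicate (Suc n) \<one>\<^sub>A))"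
      using comb.word[of "replicate (Suc n) \<one>\<^sub>A"] by (simp del: replicate.simps add: set_replicate_Suc)
    then show ?thesis unfolding 1 2 nil as(2) .
  qed
  from comb_kill[OF as(1) this] show ?thesis using aprod_closed[of as] as I.Icarr by (simp add: subset_iff)
qed

lemma ideal_power_closed: "c \<in> ipow I q \<Longrightarrow> c \<in> carrier A"
proof -
  have "ideal (ipow I q) A"
    by (induct q) (simp_all add: A.oneideal A.ideal_prod_is_ideal[OF I])
  from ideal.Icarr[OF this] show "c \<in> ipow I q \<Longrightarrow> c \<in> carrier A" .
qed

text \<open>Elements of \<open>I^n\<close> are sums of nested products. The induction moves one
  factor after the other from the ideal power into the list, until only an arbitrary coefficient
  \<open>c\<close> in \<open>A\<close> is left.\<close>

lemma garland_pow:
  assumes nil: "(act Z (fA i \<one>\<^sub>A) ^^ Suc n) z = \<zero>\<^bsub>Z\<^esub>"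
  shows "\<lbrakk>c \<in> ipow I q; set as \<subseteq> I; q + length as = n\<rbrakk> \<Longrightarrow> act Z (fA i (c \<cdot> aprod as)) z = \<zero>\<^bsub>Z\<^esub>"
proof (induct q arbitrary: c as)
  case 0
  have "set as \<subseteq> carrier A" using 0(2) I.Icarr by (simp add: subset_iff)
  then have c: "c \<in> carrier A" and p: "aprod as \<in> carrier A" using 0 aprod_closed[of as] by auto
  have f0: "act Z (fA i (aprod as)) z = \<zero>\<^bsub>Z\<^esub>" by (rule garland_list[OF nil]) (use 0 in auto)
  \<comment> \<open>The leftover coefficient enters through
    \<open>[h_i \<otimes> c, f_i \<otimes> b] = -2 f_i \<otimes> c b\<close>, applied to the
    vanishing vector \<open>(f_i \<otimes> b) z\<close>.\<close>
  have "\<zero>\<^bsub>Z\<^esub> = act Z (hA i c) (act Z (fA i (aprod as)) z)" unfolding f0 using c by (simp add: Z.act_zero)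
  also have "\<dots> = act Z (brack Lc (hA i c) (fA i (aprod as))) z \<oplus>\<^bsub>Z\<^esub> act Z (fA i (aprod as)) (act Z (hA i c) z)"
    by (rule Z.act_comm) (use c p zc in auto)
  also have "\<dots> = (-2) \<odot>\<^bsub>Z\<^esub> act Z (fA i (c \<cdot> aprod as)) z"
    using c p zc f0 hwvD(3)[OF z coroot_cartan' c] by (simp add: sl2_rels Z.act_smult_left Z.act_smult_right Z.act_closed)
  finally have "(-1/2) \<odot>\<^bsub>Z\<^esub> ((-2) \<odot>\<^bsub>Z\<^esub> act Z (fA i (c \<cdot> aprod as)) z) = \<zero>\<^bsub>Z\<^esub>" by (metis Z.VV.sm_zero_r)
  then show ?case using c p zc by (simp add: Z.VV.sm_assoc Z.act_closed)
next
  case (Suc q)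
  have "set as \<subseteq> carrier A" using Suc.prems(2) I.Icarr by (simp add: subset_iff)
  then have p: "aprod as \<in> carrier A" using aprod_closed[of as] by simp
  have "c \<in> carrier A \<and> act Z (fA i (c \<cdot> aprod as)) z = \<zero>\<^bsub>Z\<^esub>" using Suc.prems(1) unfolding ideal_power.simps
  proof (induct rule: ideal_prod.induct)
    case (prod a b)
    have ab: "a \<in> carrier A" "b \<in> carrier A" using prod ideal_power_closed by auto
    have "act Z (fA i (b \<cdot> aprod (a # as))) z = \<zero>\<^bsub>Z\<^esub>" by (rule Suc.hyps) (use prod Suc.prems in auto)
    moreover have "b \<cdot> aprod (a # as) = a \<cdot> b \<cdot> aprod as" using ab p by (simp add: aprod_def A.m_ac)
    ultimately show ?case using ab by simp
  next
    case (sum a b)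
    have "fA i ((a \<oplus>\<^bsub>A\<^esub> b) \<cdot> aprod as) = fA i (a \<cdot> aprod as) \<oplus>\<^bsub>Lc\<^esub> fA i (b \<cdot> aprod as)"
      using sum p chev_f_derived by (simp add: A.l_distr ct_simps)
    then show ?case using sum p zc by (simp add: Z.act_add_left)
  qed
  then show ?case by blast
qed

lemma garland: "(act Z (fA i \<one>\<^sub>A) ^^ Suc n) z = \<zero>\<^bsub>Z\<^esub> \<Longrightarrow> c \<in> ipow I n \<Longrightarrow> act Z (fA i c) z = \<zero>\<^bsub>Z\<^esub>"
  using garland_pow[of n c n "[]"] ideal_power_closed[of c n] by (simp add: aprod_def)

end

end

section \<open>Annihilation of vectors by powers of the ideal\<close>

context cur
begin

lemma ideal_power_ideal: "ideal I A \<Longrightarrow> ideal (ipow I q) A"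
  by (induct q) (simp_all add: A.oneideal A.ideal_prod_is_ideal)

lemma ideal_power_carrier: "ideal I A \<Longrightarrow> c \<in> ipow I q \<Longrightarrow> c \<in> carrier A"
  using ideal.Icarr[OF ideal_power_ideal] .

lemma ideal_power_mult: "ideal I A \<Longrightarrow> c \<in> ipow I q \<Longrightarrow> a \<in> carrier A \<Longrightarrow> c \<cdot> a \<in> ipow I q"
  using ideal.I_r_closed[OF ideal_power_ideal] .

text \<open>Additively, \<open>I^(p + q)\<close> is spanned by products of elements of
  \<open>I^p\<close> and \<open>I^q\<close>. The predicate is generalised in the induction, because
  stripping one factor \<open>i\<close> replaces \<open>P\<close> by \<open>P\<close> of the
  multiple by \<open>i\<close>.\<close>

lemma ideal_power_split:
  assumes I: "ideal I A" and a: "a \<in> ipow I (p + q)"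
    and m: "\<And>b c. \<lbrakk>b \<in> ipow I p; c \<in> ipow I q\<rbrakk> \<Longrightarrow> P (b \<cdot> c)"
    and s: "\<And>x y. \<lbrakk>x \<in> carrier A; y \<in> carrier A; P x; P y\<rbrakk> \<Longrightarrow> P (x \<oplus>\<^bsub>A\<^esub> y)"
  shows "P a"
  using a m s
proof (induct p arbitrary: a P)
  case 0
  have "P (\<one>\<^sub>A \<cdot> a)" using 0 by simp
  then show ?case using ideal_power_carrier[OF I] 0 by simp
next
  case (Suc p)
  have "a \<in> carrier A \<and> P a" using Suc.prems(1) unfolding add_Suc ideal_power.simps
  proof (induct rule: ideal_prod.induct)
    case (prod i j)
    have i: "i \<in> carrier A" using prod ideal.Icarr[OF I] by blast
    have jc: "j \<in> carrier A" using ideal_power_carrier[OF I prod(2)] .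
    have "j \<in> carrier A \<and> P (i \<cdot> j)"
    proof (rule Suc.hyps[OF prod(2)])
      fix b c assume b: "b \<in> ipow I p" and c: "c \<in> ipow I q"
      have bc: "b \<in> carrier A" "c \<in> carrier A" using ideal_power_carrier[OF I] b c by auto
      have "i \<cdot> b \<in> ipow I (Suc p)" using prod(1) b by (auto intro: ideal_prod.prod)
      then have "P ((i \<cdot> b) \<cdot> c)" using Suc.prems(2) c by blast
      then show "b \<cdot> c \<in> carrier A \<and> P (i \<cdot> (b \<cdot> c))" using i bc by (simp add: A.m_assoc)
    next
      fix x y assume "x \<in> carrier A" "y \<in> carrier A" "x \<in> carrier A \<and> P (i \<cdot> x)" "y \<in> carrier A \<and> P (i \<cdot> y)"
      then show "x \<oplus>\<^bsub>A\<^esub> y \<in> carrier A \<and> P (i \<cdot> (x \<oplus>\<^bsub>A\<^esub> y))"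
        using Suc.prems(3)[of "i \<cdot> x" "i \<cdot> y"] i by (simp add: A.r_distr)
    qed
    then show ?case using i jc by simp
  next
    case (sum x y) then show ?case using Suc.prems(3)[of x y] by simp
  qed
  then show ?case by blast
qed

lemma ideal_power_mono: "ideal I A \<Longrightarrow> p \<le> q \<Longrightarrow> ipow I q \<subseteq> ipow I p"
proof
  fix a assume I: "ideal I A" and pq: "p \<le> q" and a: "a \<in> ipow I q"
  show "a \<in> ipow I p"
  proof (rule ideal_power_split[OF I, of a p "q - p"])
    show "b \<cdot> c \<in> ipow I p" if "b \<in> ipow I p" "c \<in> ipow I (q - p)" for b c
      using ideal_power_mult[OF I] ideal_power_carrier[OF I] that by blast
    show "x \<oplus>\<^bsub>A\<^esub> y \<in> ipow I p" if "x \<in> ipow I p" "y \<in> ipow I p" for x y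
      using additive_subgroup.a_closed[OF ideal.axioms(1)[OF ideal_power_ideal[OF I]] that] .
  qed (use a pq in simp)
qed

definition good where "good Z \<psi> z I \<longleftrightarrow> lie_module Lc Z \<and> hwv Z \<psi> z \<and> ideal I A \<and> wkill \<psi> I \<and> dom \<psi> \<and> fnilp Z z"

text \<open>The exponent is additive in the weight. For a coefficient \<open>b c\<close> split
  accordingly, \<open>[f_i, x] \<otimes> b c\<close> is the bracket of
  \<open>f_i \<otimes> b\<close> and \<open>x \<otimes> c\<close>, both of which kill
  \<open>z\<close>; the case of a single \<open>f_i\<close> is Garland's.\<close>

lemma fw_kill:
  assumes g: "good Z \<psi> z I" and "fw G m X" "a \<in> ipow I (\<Sum>j\<in>UNIV. m j * wn \<psi> j)"
  shows "act Z (ct X a) z = \<zero>\<^bsub>Z\<^esub>"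
proof -
  have Z: "lie_module Lc Z" and z: "hwv Z \<psi> z" and I: "ideal I A" and k: "wkill \<psi> I" and d: "dom \<psi>" and f: "fnilp Z z"
    using g by (auto simp: good_def)
  interpret Z: lie_module Lc Z by (rule Z)
  note zc = hwvD(1)[OF z]
  have fi: "act Z (fA i a) z = \<zero>\<^bsub>Z\<^esub>" if "a \<in> ipow I (wn \<psi> i)" for i a
  proof -
    obtain n where "(act Z (fA i \<one>\<^sub>A) ^^ n) z = \<zero>\<^bsub>Z\<^esub>" using f by (auto simp: fnilp_def)
    from garland[OF Z z I k d hw_nilp[OF Z z d this] that] show ?thesis .
  qed
  have ui: "(\<Sum>j\<in>UNIV. unit_vec i j * wn \<psi> j) = wn \<psi> i" for i
    by (simp add: unit_vec_def if_distrib[of "\<lambda>x. x * _"] cong: if_cong)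
  from assms(2,3) show ?thesis
  proof (induct arbitrary: a rule: fw_induct)
    case (base i) then show ?case using fi by (simp add: ui)
  next
    case (step m x i)
    have x: "x \<in> derived G" using fw_derived step by blast
    have "(\<Sum>j\<in>UNIV. (m j + unit_vec i j) * wn \<psi> j) = wn \<psi> i + (\<Sum>j\<in>UNIV. m j * wn \<psi> j)"
      using ui[of i] by (simp add: algebra_simps sum.distrib)
    then have a: "a \<in> ipow I (wn \<psi> i + (\<Sum>j\<in>UNIV. m j * wn \<psi> j))" using step.prems by simp
    have "brack G (chev_f G i) x \<in> derived G" using x chev_f_derived db dG by blast
    then have *: "ct (brack G (chev_f G i) x) (u \<oplus>\<^bsub>A\<^esub> w) = ct (brack G (chev_f G i) x) u \<oplus>\<^bsub>Lc\<^esub> ct (brack G (chev_f G i) x) w"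
      "ct (brack G (chev_f G i) x) u \<in> carrier Lc" "ct (brack G (chev_f G i) x) w \<in> carrier Lc"
      if "u \<in> carrier A" "w \<in> carrier A" for u w using that by (simp_all add: ct_simps)
    show ?case
    proof (rule ideal_power_split[OF I a])
      fix b c assume b: "b \<in> ipow I (wn \<psi> i)" and c: "c \<in> ipow I (\<Sum>j\<in>UNIV. m j * wn \<psi> j)"
      have bc: "b \<in> carrier A" "c \<in> carrier A" using ideal_power_carrier[OF I] b c by auto
      have "ct (brack G (chev_f G i) x) (b \<cdot> c) = brack Lc (fA i b) (ct x c)"
        using brack_ct(1)[OF chev_f_derived bc(1) x bc(2)] by simp
      then show "act Z (ct (brack G (chev_f G i) x) (b \<cdot> c)) z = \<zero>\<^bsub>Z\<^esub>"
        using bc x zc fi[OF b] step(2)[OF c] by (simp add: Z.act_brack Z.act_zero Z.VV.minus_eq')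
    qed (simp add: * Z.act_add_left zc)
  qed
qed

lemma rel_kill:
  assumes g: "good Z \<psi> z I" and m: "m \<in> pos_roots G" and X: "X \<in> root_space G (\<lambda>h. - root_of G m h)"
    and a: "a \<in> ipow I (N_wt G (cur_weight G A H2 \<psi>) m)"
  shows "act Z (ct X a) z = \<zero>\<^bsub>Z\<^esub>"
proof -
  have Z: "lie_module Lc Z" and z: "hwv Z \<psi> z" and I: "ideal I A" and d: "dom \<psi>" using g by (auto simp: good_def)
  interpret Z: lie_module Lc Z by (rule Z)
  note zc = hwvD(1)[OF z]
  have ac: "a \<in> carrier A" using ideal_power_carrier[OF I a] .
  have S: "subsp Lc {x \<in> carrier Lc. act Z x z = \<zero>\<^bsub>Z\<^esub>}"
    using zc by (auto simp: subsp_def Z.act_zero Z.act_add_left Z.act_smult_left)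
  have "X \<in> vspan G {x. fw G m x}" using root_space_neg[OF X] m by (simp add: pos_roots_def)
  also have "vspan G {x. fw G m x} \<subseteq> {X \<in> derived G. ct X a \<in> {x \<in> carrier Lc. act Z x z = \<zero>\<^bsub>Z\<^esub>}}"
    by (rule LV.vspan_least[OF subsp_ct[OF S ac]])
       (use fw_kill[OF g] a ac fw_derived in \<open>auto simp: N_wt_eq[OF d]\<close>)
  finally show ?thesis by blast
qed

definition j0 where "j0 t = (t, \<zero>\<^bsub>G\<^esub>)" for t :: "(('g \<times> 'a) \<Rightarrow>\<^sub>0 complex) set"

lemma j0_closed [simp]: "t \<in> carrier TT \<Longrightarrow> j0 t \<in> carrier Lc" by (simp add: j0_def cur_simps)
lemma j0_lin: "lin_map TT Lc j0" by (rule lin_mapI) (simp_all add: j0_def cur_simps)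
lemmas j0D = lin_mapD[OF j0_lin]
lemma j0_pt: "j0 (pt X a) = ct X a" by (simp add: j0_def ct_eq)
lemma Lc_cases: "x \<in> carrier Lc \<Longrightarrow> \<exists>t\<in>carrier TT. \<exists>h\<in>H2. x = j0 t \<oplus>\<^bsub>Lc\<^esub> chh h"
  using H2D(3) by (auto simp: cur_simps j0_def chh_eq)

lemma j0_brack:
  "\<lbrakk>s \<in> carrier TT; t \<in> carrier TT\<rbrakk> \<Longrightarrow> brack Lc (j0 s) (j0 t) = j0 (tt s t)"
  "\<lbrakk>h \<in> H2; t \<in> carrier TT\<rbrakk> \<Longrightarrow> brack Lc (chh h) (j0 t) = j0 (ht h t)"
  "\<lbrakk>h \<in> H2; t \<in> carrier TT\<rbrakk> \<Longrightarrow> brack Lc (j0 t) (chh h) = j0 ((-1) \<odot>\<^bsub>TT\<^esub> ht h t)"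
  using H2D(3) by (simp_all add: j0_def chh_eq cur_simps ht_zero tt_ht_zero minus_zz tt_closed htD)

lemma mu_tt:
  assumes c: "c \<in> carrier A" and s: "s \<in> carrier TT" and t: "t \<in> carrier TT"
  shows "tt (mu c s) t = mu c (tt s t)" "tt s (mu c t) = mu c (tt s t)"
proof -
  note ms = lin_map_comp[OF mu(1)[OF c]]
  have 1: "tt (mu c s) t = mu c (tt s t)" if s: "s \<in> carrier TT" and t: "t \<in> carrier TT" for s t
  proof (rule T_eqI[OF ms[OF tt_lin1[OF t]] lin_map_comp[OF tt_lin1[OF t] mu(1)[OF c]] s])
    fix X a assume X: "X \<in> derived G" "a \<in> carrier A"
    then have p: "pt X a \<in> carrier TT" "pt X (c \<cdot> a) \<in> carrier TT" using pt_simps c by auto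
    show "tt (mu c (pt X a)) t = mu c (tt (pt X a) t)"
      unfolding mu(2)[OF c X]
    proof (rule T_eqI[OF tt_lin2[OF p(2)] lin_map_comp[OF tt_lin2[OF p(1)] mu(1)[OF c]] t])
      show "tt (pt X (c \<cdot> a)) (pt Y b) = mu c (tt (pt X a) (pt Y b))" if "Y \<in> derived G" "b \<in> carrier A" for Y b
        using X that c db dG by (simp add: tt_pure mu A.m_assoc)
    qed
  qed
  show "tt (mu c s) t = mu c (tt s t)" by (rule 1[OF s t])
  have "tt s (mu c t) = (-1) \<odot>\<^bsub>TT\<^esub> tt (mu c t) s" using tt_anti s t muD(1)[OF c] by blast
  also have "\<dots> = mu c ((-1) \<odot>\<^bsub>TT\<^esub> tt t s)" using 1[OF t s] muD[OF c] tt_closed s t by simp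
  also have "(-1) \<odot>\<^bsub>TT\<^esub> tt t s = tt s t" using tt_anti[OF s t] ..
  finally show "tt s (mu c t) = mu c (tt s t)" .
qed

lemma mu_ht: assumes c: "c \<in> carrier A" and h: "h \<in> carrier G" and t: "t \<in> carrier TT" shows "ht h (mu c t) = mu c (ht h t)"
  by (rule T_eqI[OF lin_map_comp[OF mu(1)[OF c] ht(1)[OF h]] lin_map_comp[OF ht(1)[OF h] mu(1)[OF c]] t])
     (use c h db dG in \<open>simp add: mu ht(2)\<close>)

lemma mu_mu: assumes c: "c \<in> carrier A" and d: "d \<in> carrier A" and t: "t \<in> carrier TT" shows "mu c (mu d t) = mu (c \<cdot> d) t"
  by (rule T_eqI[OF lin_map_comp[OF mu(1)[OF d] mu(1)[OF c]] mu(1) t]) (use c d in \<open>simp_all add: mu A.m_assoc\<close>)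

lemma mu_one: assumes t: "t \<in> carrier TT" shows "mu \<one>\<^sub>A t = t"
  by (rule T_eqI[OF mu(1) Tn.TV.lin_map_id t]) (simp_all add: mu)

lemma mu_add: assumes c: "c \<in> carrier A" and d: "d \<in> carrier A" and t: "t \<in> carrier TT" shows "mu (c \<oplus>\<^bsub>A\<^esub> d) t = mu c t \<oplus>\<^bsub>TT\<^esub> mu d t"
  by (rule T_eqI[OF mu(1) Tn.TV.lin_map_plus[OF mu(1)[OF c] mu(1)[OF d]] t]) (use c d in \<open>simp_all add: mu A.l_distr pt_simps\<close>)

lemma ev_ideal_power:
  assumes "ideal I A" "\<forall>c\<in>ipow I n. Q c"
  shows "\<forall>\<^sub>F N in sequentially. \<forall>c\<in>ipow I N. Q c"
  unfolding eventually_sequentially using subsetD[OF ideal_power_mono[OF assms(1)]] assms(2) by blast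

text \<open>The exponent may depend on \<open>t\<close> and on \<open>w\<close>. Eventual statements
  allow finitely many such bounds to be combined without naming a maximum.\<close>

definition lann where "lann Z I w \<longleftrightarrow>
  (\<forall>t\<in>carrier TT. \<forall>\<^sub>F N in sequentially. \<forall>c\<in>ipow I N. act Z (j0 (mu c t)) w = \<zero>\<^bsub>Z\<^esub>)"

text \<open>The generator has the property, and the vectors with the property form a submodule:
  passing an algebra element across \<open>c t\<close> costs a bracket that is again
  \<open>c\<close> times an element of \<open>g' \<otimes> A\<close> chosen independently of
  \<open>c\<close>.\<close>

lemma lann_all:
  assumes g: "good Z \<psi> z I" and gen: "\<And>N. lie_submodule Lc Z N \<Longrightarrow> z \<in> N \<Longrightarrow> N = carrier Z" and w: "w \<in> carrier Z"
  shows "lann Z I w"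
proof -
  have Z: "lie_module Lc Z" and z: "hwv Z \<psi> z" and I: "ideal I A" and k: "wkill \<psi> I" and d: "dom \<psi>" using g by (auto simp: good_def)
  interpret Z: lie_module Lc Z by (rule Z)
  note zc = hwvD(1)[OF z] and IC = ideal_power_carrier[OF I] and ev = ev_ideal_power[OF I]
  have "lann Z I z" unfolding lann_def
  proof
    fix t assume "t \<in> carrier TT"
    then show "\<forall>\<^sub>F N in sequentially. \<forall>c\<in>ipow I N. act Z (j0 (mu c t)) z = \<zero>\<^bsub>Z\<^esub>"
    proof (induct t rule: Tn.T_induct)
      case (pure X a)
      \<comment> \<open>The coefficient of the pure tensor is absorbed: with \<open>c\<close> also
        \<open>c a\<close> lies in \<open>I^N\<close>, so only \<open>X\<close> matters.\<close>
      let ?ev = "\<lambda>X. \<forall>\<^sub>F N in sequentially. \<forall>a\<in>ipow I N. act Z (ct X a) z = \<zero>\<^bsub>Z\<^esub>"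
      let ?P = "{X \<in> derived G. ?ev X}"
      have "derived G \<subseteq> ?P"
      proof (rule derived_least)
        show "subsp G ?P" unfolding subsp_def
        proof (intro conjI ballI allI)
          show "?P \<subseteq> carrier G" using dG by blast
          show "\<zero>\<^bsub>G\<^esub> \<in> ?P" using subspD(2)[OF derived_props(1)] IC zc by (simp add: ct_zero Z.act_zero)
          fix X c assume X: "X \<in> ?P"
          then have "?ev (c \<odot>\<^bsub>G\<^esub> X)"
            by (auto elim!: eventually_mono) (use IC zc in \<open>simp add: ct_simps Z.act_smult_left\<close>)
          then show "c \<odot>\<^bsub>G\<^esub> X \<in> ?P" using X subspD(4)[OF derived_props(1)] by blast
          fix Y assume Y: "Y \<in> ?P"
          have "?ev X" "?ev Y" using X Y by auto
          then have "?ev (X \<oplus>\<^bsub>G\<^esub> Y)"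
            by eventually_elim (use X Y IC zc in \<open>simp add: ct_simps Z.act_add_left\<close>)
          then show "X \<oplus>\<^bsub>G\<^esub> Y \<in> ?P" using X Y subspD(3)[OF derived_props(1)] by blast
        qed
        show "X \<in> ?P" if "ew G m X" for m X
          using ew_derived[OF that] hwvD(2)[OF z ew_nil_plus[OF that]] IC by simp
        show "X \<in> ?P" if "fw G m X" for m X
          using fw_derived[OF that] ev[OF ballI[OF fw_kill[OF g that]]] by simp
        show "X \<in> ?P" if X: "X \<in> cartan' G" for X
        proof -
          \<comment> \<open>For Cartan elements the first power is enough: they act on
            \<open>z\<close> through \<open>\<psi>\<close>, which vanishes on
            \<open>X \<otimes> I\<close>.\<close>
          have kill: "act Z (ct X a) z = \<zero>\<^bsub>Z\<^esub>" if a: "a \<in> ipow I 1" for a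
          proof -
            have "a \<in> I" using a A.ideal_prod_inter[OF I A.oneideal] by auto
            then have "\<psi> (ct X a) = 0" using k X by (simp add: wkill_def)
            then show ?thesis using hwvD(3)[OF z X IC[OF a]] zc by simp
          qed
          have "?ev X" by (rule ev[where n = 1]) (use kill in blast)
          then show ?thesis using cartan'D(1)[OF X] by blast
        qed
      qed
      moreover have "X \<in> derived G" using pure by simp
      ultimately have "?ev X" by blast
      then show ?case
        by eventually_elim (use ideal_power_mult[OF I] IC pure in \<open>simp add: mu j0_pt\<close>)
    next
      case zero
      have "j0 (mu c \<zero>\<^bsub>TT\<^esub>) = \<zero>\<^bsub>Lc\<^esub>" if "c \<in> carrier A" for c
        using lin_map_zero[OF mu(1)[OF that] Tn.TV.vspace_axioms Tn.TV.vspace_axioms] by (simp add: j0_def cur_simps)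
      then show ?case using zc IC by (simp add: Z.act_zero)
    next
      case (add s t)
      show ?case using add(3,4) by eventually_elim (use add(1,2) IC zc in \<open>simp add: muD j0D Z.act_add_left\<close>)
    next
      case (smult r t)
      show ?case using smult(2) by eventually_elim (use smult(1) IC zc in \<open>simp add: muD j0D Z.act_smult_left\<close>)
    qed
  qed
  moreover have "lie_submodule Lc Z {w \<in> carrier Z. lann Z I w}" unfolding Z.lie_submodule_iff
  proof (intro conjI ballI)
    let ?L = "{w \<in> carrier Z. lann Z I w}"
    have mc: "j0 (mu c t) \<in> carrier Lc" if "c \<in> ipow I N" "t \<in> carrier TT" for c t N using muD(1) IC that by simp
    have L: "\<forall>\<^sub>F N in sequentially. \<forall>c\<in>ipow I N. act Z (j0 (mu c t)) u = \<zero>\<^bsub>Z\<^esub>" "u \<in> carrier Z"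
      if "u \<in> ?L" "t \<in> carrier TT" for u t using that by (auto simp: lann_def)
    have LI: "u \<in> ?L" if "u \<in> carrier Z" "\<And>t. t \<in> carrier TT \<Longrightarrow>
      \<forall>\<^sub>F N in sequentially. \<forall>c\<in>ipow I N. act Z (j0 (mu c t)) u = \<zero>\<^bsub>Z\<^esub>" for u using that by (simp add: lann_def)
    have Lc': "u \<in> carrier Z" if "u \<in> ?L" for u using that by blast
    show "subsp Z ?L" unfolding subsp_def
    proof (intro conjI ballI allI)
      show "\<zero>\<^bsub>Z\<^esub> \<in> ?L" by (rule LI) (use mc Z.act_zero(1) in auto)
      fix u r assume u: "u \<in> ?L"
      show "r \<odot>\<^bsub>Z\<^esub> u \<in> ?L"
      proof (rule LI)
        fix t assume t: "t \<in> carrier TT"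
        show "\<forall>\<^sub>F N in sequentially. \<forall>c\<in>ipow I N. act Z (j0 (mu c t)) (r \<odot>\<^bsub>Z\<^esub> u) = \<zero>\<^bsub>Z\<^esub>"
          using L(1)[OF u t] by eventually_elim (use Lc'[OF u] mc[OF _ t] in \<open>simp add: Z.act_smult_right\<close>)
      qed (use Lc'[OF u] in simp)
      fix v assume v: "v \<in> ?L"
      show "u \<oplus>\<^bsub>Z\<^esub> v \<in> ?L"
      proof (rule LI)
        fix t assume t: "t \<in> carrier TT"
        show "\<forall>\<^sub>F N in sequentially. \<forall>c\<in>ipow I N. act Z (j0 (mu c t)) (u \<oplus>\<^bsub>Z\<^esub> v) = \<zero>\<^bsub>Z\<^esub>"
          using L(1)[OF u t] L(1)[OF v t] by eventually_elim (use Lc'[OF u] Lc'[OF v] mc[OF _ t] in \<open>simp add: Z.act_add_right\<close>)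
      qed (use Lc'[OF u] Lc'[OF v] in simp)
    qed auto
    fix y w assume y: "y \<in> carrier Lc" and w: "w \<in> ?L"
    note wc = Lc'[OF w]
    obtain s h where sh: "s \<in> carrier TT" "h \<in> H2" "y = j0 s \<oplus>\<^bsub>Lc\<^esub> chh h" using Lc_cases y by blast
    show "act Z y w \<in> ?L"
    proof (rule LI[OF Z.act_closed[OF y wc]])
      fix t assume t: "t \<in> carrier TT"
      \<comment> \<open>The bracket of \<open>t\<close> with \<open>y = s + h\<close>. Both
        \<open>tt\<close> and \<open>ht\<close> are linear over \<open>A\<close>, hence the bracket
        of \<open>c t\<close> with \<open>y\<close> is \<open>c ?u\<close>.\<close>
      let ?u = "tt t s \<oplus>\<^bsub>TT\<^esub> (-1) \<odot>\<^bsub>TT\<^esub> ht h t"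
      have hc: "h \<in> carrier G" using sh H2D(3) by blast
      have uc: "?u \<in> carrier TT" using t sh tt_closed htD(1)[OF hc] by simp
      show "\<forall>\<^sub>F N in sequentially. \<forall>c\<in>ipow I N. act Z (j0 (mu c t)) (act Z y w) = \<zero>\<^bsub>Z\<^esub>"
        using L(1)[OF w t] L(1)[OF w uc]
      proof eventually_elim
        case (elim N)
        show ?case
        proof (rule ballI)
          fix c assume c: "c \<in> ipow I N"
          note cA = IC[OF c]
          have mt: "mu c t \<in> carrier TT" using muD(1)[OF cA t] .
          have tc: "mu c (tt t s) \<in> carrier TT" "mu c (ht h t) \<in> carrier TT" "tt t s \<in> carrier TT" "ht h t \<in> carrier TT"
            using cA t sh hc tt_closed htD(1)[OF hc] muD(1)[OF cA] by simp_all
          have "brack Lc (j0 (mu c t)) y = j0 (tt (mu c t) s) \<oplus>\<^bsub>Lc\<^esub> j0 ((-1) \<odot>\<^bsub>TT\<^esub> ht h (mu c t))"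
            unfolding sh(3) using mt sh by (simp add: Lie.brack_add_right j0_brack)
          also have "\<dots> = j0 (mu c ?u)"
            unfolding mu_tt(1)[OF cA t sh(1)] mu_ht[OF cA hc t] using muD(2,3)[OF cA] tc by (simp add: j0D)
          finally show "act Z (j0 (mu c t)) (act Z y w) = \<zero>\<^bsub>Z\<^esub>"
            using Z.act_comm[of "j0 (mu c t)" y w] mt y wc elim c Z.act_zero(1)[OF y] by simp
        qed
      qed
    qed
  qed
  ultimately have "{w \<in> carrier Z. lann Z I w} = carrier Z" using gen zc by blast
  then show ?thesis using w by blast
qed

lemma hwmod_ann:
  assumes "hwmod Z \<psi> z" "fnilp Z z" "ideal I A" "wkill \<psi> I" "dom \<psi>" "t \<in> carrier TT" "w \<in> carrier Z"
  shows "\<forall>\<^sub>F N in sequentially. \<forall>c\<in>ipow I N. act Z (j0 (mu c t)) w = \<zero>\<^bsub>Z\<^esub>"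
  using lann_all[of Z \<psi> z I w] assms by (simp add: good_def hwmod_def lann_def)

section \<open>The universal property of Weyl modules\<close>

text \<open>A submodule gives an integrable quotient exactly if it contains some power of each
  \<open>f_i\<close> applied to the generator. This criterion yields both the maximal quotient and
  its universal property; \<open>rel_kill\<close> makes the defining relations of
  \<open>M_mod\<close> hold in every target.\<close>

lemma weyl_props:
  fixes Z :: "(('g, 'a) cur, 'z, 'j) lmod_scheme"
  assumes I: "ideal I A" and k: "wkill \<psi> I" and d: "dom \<psi>"
  shows "\<exists>v. hwmod (weyl G A H2 \<psi> I) \<psi> v \<and> fnilp (weyl G A H2 \<psi> I) v \<and>
    (\<forall>z. lie_module Lc Z \<and> hwv Z \<psi> z \<and> fnilp Z z \<longrightarrow> (\<exists>f. lhom Lc (weyl G A H2 \<psi> I) Z f \<and> f v = z))"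
proof -
  note w = domD(1)[OF d]
  let ?V = "verma G A H2 \<psi>" and ?v = "verma_hw G A H2 \<psi>" and ?M = "M_mod G A H2 \<psi> I"
  interpret V: lie_module Lc ?V by (rule verma_props(1)[OF w])
  have Vh: "hwmod ?V \<psi> ?v" unfolding hwmod_def using verma_props(1-3)[OF w] by blast
  note vc = hwvD(1)[OF verma_props(2)[OF w]]
  let ?S = "{act ?V (ct X a) ?v | m X a. m \<in> pos_roots G \<and> X \<in> root_space G (\<lambda>h. - root_of G m h) \<and>
          a \<in> ipow I (N_wt G (cur_weight G A H2 \<psi>) m)}"
  have rd: "X \<in> derived G" if m: "m \<in> pos_roots G" and X: "X \<in> root_space G (\<lambda>h. - root_of G m h)" for m X
  proof -
    have "vspan G {x. fw G m x} \<subseteq> derived G" by (rule LV.vspan_least[OF derived_props(1)]) (use fw_derived in auto)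
    then show ?thesis using root_space_neg[OF X] m by (auto simp: pos_roots_def)
  qed
  have S: "?S \<subseteq> carrier ?V" using rd ideal_power_carrier[OF I] vc V.act_closed by (auto intro!: V.act_closed ct_closed)
  define R where "R = gen_submodule Lc ?V ?S"
  have M: "?M = lmod_quot ?V R" by (simp add: M_mod_def R_def)
  note Rp = V.gen_submodule_props[OF S, folded R_def]
  let ?m = "R +>\<^bsub>?V\<^esub> ?v"
  have Mh: "hwmod ?M \<psi> ?m" unfolding M by (rule hwmod_quot[OF Vh Rp(1)])
  then interpret M: lie_module Lc ?M by (simp add: hwmod_def)
  have mc: "?m \<in> carrier ?M" using Mh hwvD(1) by (auto simp: hwmod_def)
  define K where "K = {N. lie_submodule Lc ?M N \<and> integrable G A H2 (lmod_quot ?M N)}"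
  have fmem: "fnilp (lmod_quot ?M N) (N +>\<^bsub>?M\<^esub> ?m) \<longleftrightarrow> (\<forall>i. \<exists>n. (act ?M (fA i \<one>\<^sub>A) ^^ n) ?m \<in> N)" if N: "lie_submodule Lc ?M N" for N
  proof -
    have "(act (lmod_quot ?M N) (fA i \<one>\<^sub>A) ^^ n) (N +>\<^bsub>?M\<^esub> ?m) = \<zero>\<^bsub>lmod_quot ?M N\<^esub> \<longleftrightarrow> (act ?M (fA i \<one>\<^sub>A) ^^ n) ?m \<in> N" for i n
      using quot_pow[OF M.lie_module_axioms N, of "fA i \<one>\<^sub>A" ?m n] mc M.quot_ops(5)[OF N M.act_pow_closed[of "fA i \<one>\<^sub>A" ?m n]] by simp
    then show ?thesis by (simp add: fnilp_def)
  qed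
  have intK: "N \<in> K" if N: "lie_submodule Lc ?M N" "\<forall>i. \<exists>n. (act ?M (fA i \<one>\<^sub>A) ^^ n) ?m \<in> N" for N
    unfolding K_def using integrable_hwmod[OF hwmod_quot[OF Mh N(1)]] fmem[OF N(1)] N by blast
  \<comment> \<open>The exponent is the same for all members of \<open>K\<close>. Without this
    uniformity the intersection could fail to contain any power.\<close>
  have Kf: "(act ?M (fA i \<one>\<^sub>A) ^^ Suc (wn \<psi> i)) ?m \<in> N" if "N \<in> K" for N i
  proof -
    have N: "lie_submodule Lc ?M N" and int: "integrable G A H2 (lmod_quot ?M N)" using that by (auto simp: K_def)
    have q: "N +>\<^bsub>?M\<^esub> ?m \<in> carrier (lmod_quot ?M N)" using mc by (simp add: M.quot_simps)
    obtain n where nn: "(act (lmod_quot ?M N) (fA i \<one>\<^sub>A) ^^ n) (N +>\<^bsub>?M\<^esub> ?m) = \<zero>\<^bsub>lmod_quot ?M N\<^esub>"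
      using int q unfolding integrable_def locally_nilpotent_def emb_derived[OF chev_f_derived] by blast
    have "lie_module Lc (lmod_quot ?M N)" "hwv (lmod_quot ?M N) \<psi> (N +>\<^bsub>?M\<^esub> ?m)"
      using hwmod_quot[OF Mh N] by (auto simp: hwmod_def)
    from hw_nilp[OF this d nn]
    show ?thesis
      using quot_pow[OF M.lie_module_axioms N, of "fA i \<one>\<^sub>A" ?m "Suc (wn \<psi> i)"] mc M.quot_ops(5)[OF N M.act_pow_closed[of "fA i \<one>\<^sub>A" ?m "Suc (wn \<psi> i)"]] by simp
  qed
  have CK: "carrier ?M \<in> K" by (rule intK[OF M.lie_submodule_carrier]) (use M.act_pow_closed mc in auto)
  have IK: "\<Inter>K \<in> K"
  proof (rule intK)
    show "lie_submodule Lc ?M (\<Inter>K)" by (rule M.lie_submodule_Inter) (use CK in \<open>auto simp: K_def\<close>)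
    show "\<forall>i. \<exists>n. (act ?M (fA i \<one>\<^sub>A) ^^ n) ?m \<in> \<Inter>K" using Kf by blast
  qed
  have "(THE N. is_max_integrable_kernel G A H2 ?M N) = \<Inter>K"
  proof (rule the_equality)
    show "is_max_integrable_kernel G A H2 ?M (\<Inter>K)" using IK unfolding is_max_integrable_kernel_def K_def by blast
    fix N assume N: "is_max_integrable_kernel G A H2 ?M N"
    then have "N \<in> K" unfolding is_max_integrable_kernel_def K_def by blast
    moreover have "N \<subseteq> \<Inter>K" using N unfolding is_max_integrable_kernel_def K_def by blast
    ultimately show "N = \<Inter>K" by blast
  qed
  then have W: "weyl G A H2 \<psi> I = lmod_quot ?M (\<Inter>K)" by (simp add: weyl_def)
  have IKs: "lie_submodule Lc ?M (\<Inter>K)" using IK by (simp add: K_def)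
  let ?w = "\<Inter>K +>\<^bsub>?M\<^esub> ?m"
  have "hwmod (weyl G A H2 \<psi> I) \<psi> ?w" unfolding W by (rule hwmod_quot[OF Mh IKs])
  moreover have "fnilp (weyl G A H2 \<psi> I) ?w" unfolding W fmem[OF IKs] using Kf IK by blast
  moreover have "\<exists>f. lhom Lc (weyl G A H2 \<psi> I) Z f \<and> f ?w = z" if Z: "lie_module Lc Z" and z: "hwv Z \<psi> z" and f: "fnilp Z z"
    for z
  proof -
    interpret Z: lie_module Lc Z by (rule Z)
    have g: "good Z \<psi> z I" using Z z f I k d by (simp add: good_def)
    obtain f0 where f0: "lhom Lc ?V Z f0" "f0 ?v = z" using verma_props(4)[OF w Z z] by blast
    have "?S \<subseteq> {v \<in> carrier ?V. f0 v = \<zero>\<^bsub>Z\<^esub>}"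
    proof
      fix s assume "s \<in> ?S"
      then obtain m X a where s: "s = act ?V (ct X a) ?v" "m \<in> pos_roots G" "X \<in> root_space G (\<lambda>h. - root_of G m h)"
        "a \<in> ipow I (N_wt G (cur_weight G A H2 \<psi>) m)" by blast
      have c: "ct X a \<in> carrier Lc" using rd s ideal_power_carrier[OF I] by simp
      have "f0 s = act Z (ct X a) z" using lhomD(2)[OF f0(1) c vc] f0(2) s by simp
      then show "s \<in> {v \<in> carrier ?V. f0 v = \<zero>\<^bsub>Z\<^esub>}" using rel_kill[OF g s(2-4)] s(1) V.act_closed[OF c vc] by simp
    qed
    then have "R \<subseteq> {v \<in> carrier ?V. f0 v = \<zero>\<^bsub>Z\<^esub>}" by (rule Rp(3)[OF V.lhom_kernel[OF Z f0(1)]])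
    then obtain f1 where f1: "lhom Lc ?M Z f1" "\<forall>v\<in>carrier ?V. f1 (R +>\<^bsub>?V\<^esub> v) = f0 v"
      using V.quot_lift[OF Rp(1) Z f0(1)] unfolding M by blast
    have f1m: "f1 ?m = z" using f1(2) f0(2) vc by simp
    \<comment> \<open>\<open>f1\<close> factors through the Weyl module because its kernel belongs
      to \<open>K\<close>: nilpotency of the \<open>f_i\<close> on \<open>z\<close> puts a power of
      each, applied to the generator, into the kernel.\<close>
    let ?K = "{v \<in> carrier ?M. f1 v = \<zero>\<^bsub>Z\<^esub>}"
    have "?K \<in> K"
    proof (rule intK[OF M.lhom_kernel[OF Z f1(1)]], rule allI)
      fix i
      obtain n where n: "(act Z (fA i \<one>\<^sub>A) ^^ n) z = \<zero>\<^bsub>Z\<^esub>" using f by (auto simp: fnilp_def)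
      have "f1 ((act ?M (fA i \<one>\<^sub>A) ^^ n) ?m) = (act Z (fA i \<one>\<^sub>A) ^^ n) z" for n
        by (induct n) (use f1m lhomD(2)[OF f1(1)] M.act_pow_closed mc in auto)
      then have "(act ?M (fA i \<one>\<^sub>A) ^^ n) ?m \<in> ?K" using n M.act_pow_closed mc by simp
      then show "\<exists>n. (act ?M (fA i \<one>\<^sub>A) ^^ n) ?m \<in> ?K" by blast
    qed
    then have "\<And>v. v \<in> \<Inter>K \<Longrightarrow> f1 v = \<zero>\<^bsub>Z\<^esub>" by blast
    then obtain f2 where f2: "lhom Lc (lmod_quot ?M (\<Inter>K)) Z f2" "\<forall>v\<in>carrier ?M. f2 (\<Inter>K +>\<^bsub>?M\<^esub> v) = f1 v"
      using M.quot_lift[OF IKs Z f1(1)] by blast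
    then show ?thesis unfolding W using mc f1m by blast
  qed
  ultimately show ?thesis by blast
qed

end

section \<open>Tensor products of families of modules\<close>

lemmas (in vspace) acl = a_closed

text \<open>The summands commute, so one step of the sum lowers either \<open>a\<close> or
  \<open>b\<close>; induction on \<open>a + b\<close> avoids the binomial expansion.\<close>

lemma (in vspace) commuting_nilp_sum:
  assumes F: "lin_map V V F" and R: "lin_map V V R" and c: "\<And>v. v \<in> carrier V \<Longrightarrow> F (R v) = R (F v)"
    and z: "z \<in> carrier V" "(F ^^ a) z = \<zero>" "(R ^^ b) z = \<zero>"
  shows "((\<lambda>v. F v \<oplus> R v) ^^ (a + b)) z = \<zero>"
  using z
proof (induct "a + b" arbitrary: a b z)
  case 0 then show ?case by simp
next
  case (Suc n)
  let ?S = "\<lambda>v. F v \<oplus> R v"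
  note FD = lin_mapD[OF F] and RD = lin_mapD[OF R]
  have S: "lin_map V V ?S" by (rule lin_mapI) (use FD RD in \<open>auto simp: sm_add_r a_ac\<close>)
  have Sp: "lin_map V V (?S ^^ n)" for n
  proof (induct n)
    case 0 then show ?case by (simp add: lin_map_def)
  next
    case (Suc n) then show ?case using lin_map_comp[OF Suc S] by (simp add: o_def)
  qed
  have pc: "(F ^^ n) v \<in> carrier V" "(R ^^ n) v \<in> carrier V" if "v \<in> carrier V" for n v
    by (induct n) (use that FD RD in auto)
  have Fc: "(R ^^ n) (F v) = F ((R ^^ n) v)" "(F ^^ n) (R v) = R ((F ^^ n) v)" if "v \<in> carrier V" for n v
    by (induct n) (use that c pc in auto)
  show ?case
  proof (cases "a = 0 \<or> b = 0")
    case True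
    then have "z = \<zero>" using Suc.prems by auto
    then show ?thesis using lin_map_zero[OF Sp vspace_axioms vspace_axioms] by simp
  next
    case False
    then obtain a' b' where a: "a = Suc a'" and b: "b = Suc b'" by (metis not0_implies_Suc)
    have F0: "F \<zero> = \<zero>" "R \<zero> = \<zero>" using lin_map_zero[OF F vspace_axioms vspace_axioms] lin_map_zero[OF R vspace_axioms vspace_axioms] .
    have 1: "(?S ^^ (a' + b)) (F z) = \<zero>"
      by (rule Suc.hyps(1)) (use Suc.hyps(2) Suc.prems a FD F0 Fc in \<open>auto simp: funpow_swap1\<close>)
    have 2: "(?S ^^ (a + b')) (R z) = \<zero>"
      by (rule Suc.hyps(1)) (use Suc.hyps(2) Suc.prems b RD F0 Fc in \<open>auto simp: funpow_swap1\<close>)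
    have e: "a + b = Suc (a' + b)" "a + b' = a' + b" using a b by auto
    have "(?S ^^ (a + b)) z = (?S ^^ (a' + b)) (F z \<oplus> R z)" unfolding e by (simp only: funpow_Suc_right o_def)
    also have "\<dots> = (?S ^^ (a' + b)) (F z) \<oplus> (?S ^^ (a' + b)) (R z)" by (rule lin_mapD(2)[OF Sp]) (use Suc.prems FD RD in auto)
    also have "\<dots> = \<zero>" using 1 2 unfolding e by simp
    finally show ?thesis .
  qed
qed

lemma funpow_cong_on:
  assumes "\<And>t. t \<in> S \<Longrightarrow> f t = g t" "\<And>t. t \<in> S \<Longrightarrow> g t \<in> S" "z \<in> S"
  shows "(f ^^ n) z = (g ^^ n) z \<and> (g ^^ n) z \<in> S"
  by (induct n) (use assms in auto)

locale tfam = lie_algebra L for L :: "('x, 'm) lie_scheme" +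
  fixes J :: "'i set" and V :: "'i \<Rightarrow> ('x, 'v, 'k) lmod_scheme"
  assumes fin: "finite J" and mods: "i \<in> J \<Longrightarrow> lie_module L (V i)"
begin

abbreviation SS where "SS \<equiv> (\<Pi>\<^sub>E j\<in>J. carrier (V j))"
abbreviation RR where "RR \<equiv> multilin_rels J V"
abbreviation TF where "TF \<equiv> pres SS RR"
abbreviation gen where "gen \<equiv> pres_gen SS RR"

lemma Vvs: "i \<in> J \<Longrightarrow> vspace (V i)"
  using mods module_iff_vspace lie_module.axioms(2) by blast

lemma upd: "\<lbrakk>u \<in> SS; i \<in> J; x \<in> carrier (V i)\<rbrakk> \<Longrightarrow> u(i := x) \<in> SS"
  by (auto simp: PiE_def extensional_def Pi_def)

lemma SSD: "\<lbrakk>u \<in> SS; i \<in> J\<rbrakk> \<Longrightarrow> u i \<in> carrier (V i)" by auto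

lemma Vcl: "\<lbrakk>i \<in> J; x \<in> carrier (V i); y \<in> carrier (V i)\<rbrakk> \<Longrightarrow> x \<oplus>\<^bsub>V i\<^esub> y \<in> carrier (V i)"
  "\<lbrakk>i \<in> J; x \<in> carrier (V i)\<rbrakk> \<Longrightarrow> c \<odot>\<^bsub>V i\<^esub> x \<in> carrier (V i)"
  "i \<in> J \<Longrightarrow> \<zero>\<^bsub>V i\<^esub> \<in> carrier (V i)"
  "\<lbrakk>i \<in> J; l \<in> carrier L; y \<in> carrier (V i)\<rbrakk> \<Longrightarrow> act (V i) l y \<in> carrier (V i)"
proof -
  show "i \<in> J \<Longrightarrow> \<zero>\<^bsub>V i\<^esub> \<in> carrier (V i)" using vspace.zc[OF Vvs] .
  show "\<lbrakk>i \<in> J; x \<in> carrier (V i)\<rbrakk> \<Longrightarrow> c \<odot>\<^bsub>V i\<^esub> x \<in> carrier (V i)" using vspace.sm_closed[OF Vvs] .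
  show "\<lbrakk>i \<in> J; l \<in> carrier L; y \<in> carrier (V i)\<rbrakk> \<Longrightarrow> act (V i) l y \<in> carrier (V i)" using lie_module.act_closed[OF mods] .
  assume i: "i \<in> J" and x: "x \<in> carrier (V i)" and y: "y \<in> carrier (V i)"
  interpret vspace "V i" by (rule Vvs[OF i])
  show "x \<oplus>\<^bsub>V i\<^esub> y \<in> carrier (V i)" using x y by simp
qed

sublocale PF: presentation SS RR
proof
  fix r assume "r \<in> RR"
  moreover have "keys (p - single b c - single b' c') \<subseteq> keys p \<union> {b, b'}"
    "keys (p - single b c) \<subseteq> keys p \<union> {b}"
    for p and b b' :: "'i \<Rightarrow> 'v" and c c' :: complex
    using keys_diff[of "p - single b c" "single b' c'"] keys_diff[of p "single b c"]
    by (auto split: if_splits)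
  note * = this[of "single _ _"]
  ultimately show "keys r \<subseteq> SS"
    unfolding multilin_rels_def
    by (elim UnE CollectE exE conjE; hypsubst; intro order_trans[OF *(1)] order_trans[OF *(2)])
       (simp_all add: upd Vcl)
qed

lemma gen_add:
  assumes "u \<in> SS" "i \<in> J" "x \<in> carrier (V i)" "y \<in> carrier (V i)"
  shows "gen (u(i := x \<oplus>\<^bsub>V i\<^esub> y)) = gen (u(i := x)) \<oplus>\<^bsub>TF\<^esub> gen (u(i := y))"
proof (rule PF.P.vs_eqI)
  fix \<phi> assume \<phi>: "lf TF \<phi>"
  have "single (u(i := x \<oplus>\<^bsub>V i\<^esub> y)) 1 - single (u(i := x)) 1 - single (u(i := y)) 1 \<in> RR"
    unfolding multilin_rels_def using assms by blast
  from PF.gen_rel_lf[OF \<phi> this] show "\<phi> (gen (u(i := x \<oplus>\<^bsub>V i\<^esub> y))) = \<phi> (gen (u(i := x)) \<oplus>\<^bsub>TF\<^esub> gen (u(i := y)))"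
    using assms by (simp add: csum_diff csum_add upd PF.P.lf_add[OF \<phi>] algebra_simps)
qed (use assms in \<open>simp_all add: upd Vcl\<close>)

lemma gen_smult:
  assumes "u \<in> SS" "i \<in> J" "x \<in> carrier (V i)"
  shows "gen (u(i := c \<odot>\<^bsub>V i\<^esub> x)) = c \<odot>\<^bsub>TF\<^esub> gen (u(i := x))"
proof (rule PF.P.vs_eqI)
  fix \<phi> assume \<phi>: "lf TF \<phi>"
  have "single (u(i := c \<odot>\<^bsub>V i\<^esub> x)) 1 - single (u(i := x)) c \<in> RR"
    unfolding multilin_rels_def using assms by blast
  from PF.gen_rel_lf[OF \<phi> this] show "\<phi> (gen (u(i := c \<odot>\<^bsub>V i\<^esub> x))) = \<phi> (c \<odot>\<^bsub>TF\<^esub> gen (u(i := x)))"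
    using assms by (simp add: csum_diff upd PF.P.lf_smult[OF \<phi>])
qed (use assms in \<open>simp_all add: upd Vcl\<close>)

lemma gen_zero: "\<lbrakk>u \<in> SS; i \<in> J\<rbrakk> \<Longrightarrow> gen (u(i := \<zero>\<^bsub>V i\<^esub>)) = \<zero>\<^bsub>TF\<^esub>"
  using gen_smult[of u i "\<zero>\<^bsub>V i\<^esub>" 0] vspace.sm_zero_l[OF Vvs, of i "\<zero>\<^bsub>V i\<^esub>"] Vcl(3)[of i] upd[of u i "\<zero>\<^bsub>V i\<^esub>"] by simp

definition multilin where
  "multilin E f \<longleftrightarrow> (\<forall>u\<in>SS. f u \<in> carrier E) \<and>
    (\<forall>u\<in>SS. \<forall>i\<in>J. \<forall>x\<in>carrier (V i). \<forall>y\<in>carrier (V i). f (u(i := x \<oplus>\<^bsub>V i\<^esub> y)) = f (u(i := x)) \<oplus>\<^bsub>E\<^esub> f (u(i := y))) \<and>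
    (\<forall>u\<in>SS. \<forall>i\<in>J. \<forall>c. \<forall>x\<in>carrier (V i). f (u(i := c \<odot>\<^bsub>V i\<^esub> x)) = c \<odot>\<^bsub>E\<^esub> f (u(i := x)))"

lemma multilin_lift:
  assumes E: "vspace E" and f: "multilin E f"
  shows "\<exists>g. lin_map TF E g \<and> (\<forall>u\<in>SS. g (gen u) = f u)"
proof -
  interpret E: vspace E by (rule E)
  have c: "f u \<in> carrier E" if "u \<in> SS" for u using f that by (simp add: multilin_def)
  have r: "csum (\<lambda>x. \<phi> (f x)) r = 0" if "r \<in> RR" "lf E \<phi>" for r \<phi>
    using that(1) unfolding multilin_rels_def
  proof (elim UnE CollectE exE conjE)
    fix u i x y assume r: "r = single (u(i := x \<oplus>\<^bsub>V i\<^esub> y)) 1 - single (u(i := x)) 1 - single (u(i := y)) 1"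
      and *: "i \<in> J" "u \<in> SS" "x \<in> carrier (V i)" "y \<in> carrier (V i)"
    then have "f (u(i := x \<oplus>\<^bsub>V i\<^esub> y)) = f (u(i := x)) \<oplus>\<^bsub>E\<^esub> f (u(i := y))" using f by (simp add: multilin_def)
    then show ?thesis using * c upd unfolding r by (simp add: csum_diff E.lf_add[OF that(2)])
  next
    fix u i a x assume r: "r = single (u(i := a \<odot>\<^bsub>V i\<^esub> x)) 1 - single (u(i := x)) a"
      and *: "i \<in> J" "u \<in> SS" "x \<in> carrier (V i)"
    then have "f (u(i := a \<odot>\<^bsub>V i\<^esub> x)) = a \<odot>\<^bsub>E\<^esub> f (u(i := x))" using f by (simp add: multilin_def)
    then show ?thesis using * c upd unfolding r by (simp add: csum_diff E.lf_smult[OF that(2)])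
  qed
  have "lin_map TF E (lin_ext E f)" by (rule PF.lin_ext(1); (fact E | erule c | erule (1) r))
  moreover have "lin_ext E f (gen u) = f u" if "u \<in> SS" for u
    by (rule PF.lin_ext(2); (fact E | erule c | erule (1) r | fact that))
  ultimately show ?thesis by blast
qed

text \<open>The operator \<open>g\<close> in the factor \<open>i\<close> and the identity in the
  others. It exists as a linear map because the right side is multilinear in
  \<open>u\<close>.\<close>

definition slot where "slot i g = (SOME h. lin_map TF TF h \<and> (\<forall>u\<in>SS. h (gen u) = gen (u(i := g (u i)))))"

lemma slot:
  assumes i: "i \<in> J" and g: "lin_map (V i) (V i) g"
  shows "lin_map TF TF (slot i g)" "u \<in> SS \<Longrightarrow> slot i g (gen u) = gen (u(i := g (u i)))"
proof -
  note gD = lin_mapD[OF g]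
  have "multilin TF (\<lambda>u. gen (u(i := g (u i))))"
    unfolding multilin_def
  proof (intro conjI ballI allI)
    fix u assume u: "u \<in> SS"
    have gc: "g (u i) \<in> carrier (V i)" using gD(1) SSD u i by blast
    show "gen (u(i := g (u i))) \<in> carrier TF" using u i gc upd by simp
    fix j x c assume j: "j \<in> J" and x: "x \<in> carrier (V j)"
    have u': "u(i := g (u i)) \<in> SS" using upd u i gc by blast
    show "gen ((u(j := c \<odot>\<^bsub>V j\<^esub> x))(i := g ((u(j := c \<odot>\<^bsub>V j\<^esub> x)) i))) = c \<odot>\<^bsub>TF\<^esub> gen ((u(j := x))(i := g ((u(j := x)) i)))"
      using gen_smult[OF u' j x] gen_smult[OF u j, of "g x"] gD x j by (cases "i = j") (simp_all add: fun_upd_twist)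
    fix y assume y: "y \<in> carrier (V j)"
    show "gen ((u(j := x \<oplus>\<^bsub>V j\<^esub> y))(i := g ((u(j := x \<oplus>\<^bsub>V j\<^esub> y)) i))) =
      gen ((u(j := x))(i := g ((u(j := x)) i))) \<oplus>\<^bsub>TF\<^esub> gen ((u(j := y))(i := g ((u(j := y)) i)))"
      using gen_add[OF u' j x y] gen_add[OF u j, of "g x" "g y"] gD x y j by (cases "i = j") (simp_all add: fun_upd_twist)
  qed
  from someI_ex[OF multilin_lift[OF PF.P.vspace_axioms this]]
  show "lin_map TF TF (slot i g)" "u \<in> SS \<Longrightarrow> slot i g (gen u) = gen (u(i := g (u i)))" unfolding slot_def by blast+
qed

abbreviation sl where "sl i x \<equiv> slot i (act (V i) x)"

lemma Vlin: "i \<in> J \<Longrightarrow> x \<in> carrier L \<Longrightarrow> lin_map (V i) (V i) (act (V i) x)"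
  using lie_module.lin_map_act[OF mods] .

lemma sl:
  assumes "i \<in> J" "x \<in> carrier L"
  shows "lin_map TF TF (sl i x)" "u \<in> SS \<Longrightarrow> sl i x (gen u) = gen (u(i := act (V i) x (u i)))"
  using slot[OF assms(1) Vlin[OF assms]] by auto

lemmas slD = lin_mapD[OF sl(1)]

lemma sl_closed: "\<lbrakk>i \<in> J; x \<in> carrier L; t \<in> carrier TF\<rbrakk> \<Longrightarrow> sl i x t \<in> carrier TF" using slD(1) .

lemma TF_eqI:
  assumes "lin_map TF TF f" "lin_map TF TF g" "t \<in> carrier TF" "\<And>u. u \<in> SS \<Longrightarrow> f (gen u) = g (gen u)"
  shows "f t = g t"
  by (rule PF.lin_map_eq[OF PF.P.vspace_axioms assms])

lemma sl_add: assumes i: "i \<in> J" and x: "x \<in> carrier L" and y: "y \<in> carrier L" and t: "t \<in> carrier TF"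
  shows "sl i (x \<oplus>\<^bsub>L\<^esub> y) t = sl i x t \<oplus>\<^bsub>TF\<^esub> sl i y t"
proof (rule TF_eqI[OF sl(1)[OF i LV.acl[OF x y]] PF.P.lin_map_plus[OF sl(1)[OF i x] sl(1)[OF i y]] t])
  fix u assume u: "u \<in> SS"
  interpret Vi: lie_module L "V i" by (rule mods[OF i])
  show "sl i (x \<oplus>\<^bsub>L\<^esub> y) (gen u) = sl i x (gen u) \<oplus>\<^bsub>TF\<^esub> sl i y (gen u)"
    using i x y u SSD[OF u i] by (simp add: sl(2) Vi.act_add_left gen_add Vcl)
qed

lemma sl_smult: assumes i: "i \<in> J" and x: "x \<in> carrier L" and t: "t \<in> carrier TF"
  shows "sl i (c \<odot>\<^bsub>L\<^esub> x) t = c \<odot>\<^bsub>TF\<^esub> sl i x t"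
proof (rule TF_eqI[OF sl(1)[OF i LV.sm_closed[OF x]] PF.P.lin_map_scale[OF sl(1)[OF i x]] t])
  fix u assume u: "u \<in> SS"
  interpret Vi: lie_module L "V i" by (rule mods[OF i])
  show "sl i (c \<odot>\<^bsub>L\<^esub> x) (gen u) = c \<odot>\<^bsub>TF\<^esub> sl i x (gen u)"
    using i x u SSD[OF u i] by (simp add: sl(2) Vi.act_smult_left gen_smult Vcl)
qed

lemma sl_sl: "\<lbrakk>i \<in> J; j \<in> J; x \<in> carrier L; y \<in> carrier L\<rbrakk> \<Longrightarrow> lin_map TF TF (\<lambda>t. sl i x (sl j y t))"
  using lin_map_comp sl(1) by blast

lemma sl_brack: assumes i: "i \<in> J" and x: "x \<in> carrier L" and y: "y \<in> carrier L" and t: "t \<in> carrier TF"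
  shows "sl i x (sl i y t) = sl i (brack L x y) t \<oplus>\<^bsub>TF\<^esub> sl i y (sl i x t)"
proof (rule TF_eqI[OF sl_sl[OF i i x y] PF.P.lin_map_plus[OF sl(1)[OF i brack_closed[OF x y]] sl_sl[OF i i y x]] t])
  fix u assume u: "u \<in> SS"
  interpret Vi: lie_module L "V i" by (rule mods[OF i])
  have a: "act (V i) x (act (V i) y (u i)) = act (V i) (brack L x y) (u i) \<oplus>\<^bsub>V i\<^esub> act (V i) y (act (V i) x (u i))"
    using Vi.act_comm x y SSD[OF u i] by blast
  show "sl i x (sl i y (gen u)) = sl i (brack L x y) (gen u) \<oplus>\<^bsub>TF\<^esub> sl i y (sl i x (gen u))"
    using i x y u SSD[OF u i] brack_closed[OF x y] by (simp add: sl(2) upd a gen_add Vcl)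
qed

lemma sl_comm: assumes i: "i \<in> J" and j: "j \<in> J" and ij: "i \<noteq> j" and x: "x \<in> carrier L" and y: "y \<in> carrier L" and t: "t \<in> carrier TF"
  shows "sl i x (sl j y t) = sl j y (sl i x t)"
proof (rule TF_eqI[OF sl_sl[OF i j x y] sl_sl[OF j i y x] t])
  fix u assume u: "u \<in> SS"
  show "sl i x (sl j y (gen u)) = sl j y (sl i x (gen u))"
    using i j ij x y u SSD[OF u i] SSD[OF u j] by (simp add: sl(2) upd Vcl fun_upd_twist)
qed

abbreviation TM where "TM \<equiv> tensor_family J V"

lemma TM_simps: "carrier TM = carrier TF" "zero TM = zero TF" "add TM = add TF" "smult TM = smult TF"
  by (simp_all add: tensor_family_def Let_def)

lemma TM_vspace: "vspace TM" by (rule vspace_cong[OF PF.P.vspace_axioms]) (simp_all add: TM_simps)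

lemma sum_lin: assumes x: "x \<in> carrier L" and K: "K \<subseteq> J" shows "lin_map TF TF (\<lambda>t. \<Oplus>\<^bsub>TF\<^esub>i\<in>K. sl i x t)"
proof (rule lin_mapI)
  have i: "i \<in> J" if "i \<in> K" for i using K that by blast
  fix t c assume t: "t \<in> carrier TF"
  show c0: "(\<Oplus>\<^bsub>TF\<^esub>i\<in>K. sl i x t) \<in> carrier TF" by (rule PF.P.fsc) (use i x t sl_closed in auto)
  show "(\<Oplus>\<^bsub>TF\<^esub>i\<in>K. sl i x (c \<odot>\<^bsub>TF\<^esub> t)) = c \<odot>\<^bsub>TF\<^esub> (\<Oplus>\<^bsub>TF\<^esub>i\<in>K. sl i x t)"
    by (rule PF.P.vs_eqI) (use i x t c0 sl_closed in \<open>auto simp: PF.P.lf_simps slD(3) sum_distrib_left intro!: PF.P.fsc cong: sum.cong\<close>)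
  fix s assume s: "s \<in> carrier TF"
  have c1: "(\<Oplus>\<^bsub>TF\<^esub>i\<in>K. sl i x s) \<in> carrier TF" by (rule PF.P.fsc) (use i x s sl_closed in auto)
  show "(\<Oplus>\<^bsub>TF\<^esub>i\<in>K. sl i x (t \<oplus>\<^bsub>TF\<^esub> s)) = (\<Oplus>\<^bsub>TF\<^esub>i\<in>K. sl i x t) \<oplus>\<^bsub>TF\<^esub> (\<Oplus>\<^bsub>TF\<^esub>i\<in>K. sl i x s)"
    by (rule PF.P.vs_eqI) (use i x t s c0 c1 sl_closed in \<open>auto simp: PF.P.lf_simps slD(2) sum.distrib intro!: PF.P.fsc cong: sum.cong\<close>)
qed

text \<open>The Leibniz action becomes a sum of slot operators. These satisfy the module law within
  one slot and commute between different slots, which reduces the module axioms to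
  \<open>sl_brack\<close> and \<open>sl_comm\<close>.\<close>

lemma TM_act: assumes x: "x \<in> carrier L" and t: "t \<in> carrier TF" shows "act TM x t = (\<Oplus>\<^bsub>TF\<^esub>i\<in>J. sl i x t)"
proof -
  let ?f = "\<lambda>u. \<Oplus>\<^bsub>TF\<^esub>i\<in>J. gen (u(i := act (V i) x (u i)))"
  let ?h = "\<lambda>t. \<Oplus>\<^bsub>TF\<^esub>i\<in>J. sl i x t"
  have h: "lin_map TF TF ?h" by (rule sum_lin[OF x]) simp
  have fh: "?f u = ?h (gen u)" if u: "u \<in> SS" for u
    by (rule PF.P.finsum_cong') (use x u in \<open>auto simp: sl(2) intro!: sl_closed\<close>)
  have c: "?f u \<in> carrier TF" if "u \<in> SS" for u unfolding fh[OF that] using lin_mapD(1)[OF h] that by simp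
  have r: "csum (\<lambda>u. \<phi> (?f u)) r = 0" if "r \<in> RR" "lf TF \<phi>" for r \<phi>
  proof -
    have "csum (\<lambda>u. \<phi> (?f u)) r = csum (\<lambda>u. \<phi> (?h (gen u))) r"
      by (rule csum_cong) (use fh PF.rel[OF that(1)] in auto)
    also have "\<dots> = 0" by (rule PF.gen_rel_lf[OF lf_comp[OF h that(2)] that(1)])
    finally show ?thesis .
  qed
  have a: "act TM x = lin_ext TF ?f" by (simp add: tensor_family_def Let_def)
  have l: "lin_map TF TF (lin_ext TF ?f)" by (rule PF.lin_ext(1); (rule PF.P.vspace_axioms | erule c | erule (1) r))
  have v: "lin_ext TF ?f (gen u) = ?f u" if "u \<in> SS" for u
    by (rule PF.lin_ext(2); (rule PF.P.vspace_axioms | erule c | erule (1) r | fact that))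
  show ?thesis unfolding a by (rule TF_eqI[OF l h t]) (simp add: v fh)
qed

lemma TM_module: "lie_module L TM"
proof (rule lie_moduleI[OF lie_algebra_axioms TM_vspace])
  note T = TM_act
  have sc: "(\<Oplus>\<^bsub>TF\<^esub>i\<in>J. sl i x t) \<in> carrier TF" if "x \<in> carrier L" "t \<in> carrier TF" for x t
    using lin_mapD(1)[OF sum_lin[OF that(1) order_refl] that(2)] .
  show "bilin L TM TM (act TM)"
    unfolding bilin_def
  proof (intro conjI ballI)
    fix x assume x: "x \<in> carrier L"
    show "lin_map TM TM (act TM x)"
      using sum_lin[OF x order_refl] PF.P.sm_closed by (simp add: lin_map_def TM_simps T[OF x])
  next
    fix t assume "t \<in> carrier TM"
    then have t: "t \<in> carrier TF" by (simp add: TM_simps)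
    show "lin_map L TM (\<lambda>x. act TM x t)"
    proof (rule lin_mapI; unfold TM_simps)
      fix x c assume x: "x \<in> carrier L"
      show "act TM x t \<in> carrier TF" using sc x t by (simp add: T)
      show "act TM (c \<odot>\<^bsub>L\<^esub> x) t = c \<odot>\<^bsub>TF\<^esub> act TM x t"
        unfolding T[OF x t] T[OF LV.sm_closed[OF x] t]
        by (rule PF.P.vs_eqI) (use x t sc sl_closed in \<open>auto simp: PF.P.lf_simps sl_smult sum_distrib_left intro!: PF.P.fsc cong: sum.cong\<close>)
      fix y assume y: "y \<in> carrier L"
      show "act TM (x \<oplus>\<^bsub>L\<^esub> y) t = act TM x t \<oplus>\<^bsub>TF\<^esub> act TM y t"
        unfolding T[OF x t] T[OF y t] T[OF LV.acl[OF x y] t]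
        by (rule PF.P.vs_eqI) (use x y t sc sl_closed in \<open>auto simp: PF.P.lf_simps sl_add sum.distrib intro!: PF.P.fsc cong: sum.cong\<close>)
    qed
  qed
  fix x y t assume x: "x \<in> carrier L" and y: "y \<in> carrier L" and "t \<in> carrier TM"
  then have t: "t \<in> carrier TF" by (simp add: TM_simps)
  note b = brack_closed[OF x y]
  have ac: "act TM x t \<in> carrier TF" if "x \<in> carrier L" "t \<in> carrier TF" for x t using sc that by (simp add: T)
  have "act TM (brack L x y) t = act TM x (act TM y t) \<ominus>\<^bsub>TF\<^esub> act TM y (act TM x t)"
  proof (rule PF.P.vs_eqI)
    fix \<phi> assume \<phi>: "lf TF \<phi>"
    have dd: "\<phi> (act TM x (act TM y t)) = (\<Sum>i\<in>J. \<Sum>j\<in>J. \<phi> (sl i x (sl j y t)))" if x: "x \<in> carrier L" and y: "y \<in> carrier L" for x y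
    proof -
      have "\<phi> (act TM x (act TM y t)) = (\<Sum>i\<in>J. \<phi> (sl i x (act TM y t)))"
        unfolding T[OF x ac[OF y t]] by (rule PF.P.lf_finsum[OF \<phi>]) (use x ac[OF y t] sl_closed in auto)
      also have "\<dots> = (\<Sum>i\<in>J. \<Sum>j\<in>J. \<phi> (sl i x (sl j y t)))"
      proof (rule sum.cong[OF refl])
        fix i assume i: "i \<in> J"
        show "\<phi> (sl i x (act TM y t)) = (\<Sum>j\<in>J. \<phi> (sl i x (sl j y t)))"
          unfolding T[OF y t] by (rule PF.P.lf_finsum[OF lf_comp[OF sl(1)[OF i x] \<phi>]]) (use y t sl_closed in auto)
      qed
      finally show ?thesis .
    qed
    have "\<phi> (act TM x (act TM y t)) - \<phi> (act TM y (act TM x t)) = (\<Sum>i\<in>J. \<Sum>j\<in>J. \<phi> (sl i x (sl j y t)) - \<phi> (sl j y (sl i x t)))"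
      unfolding dd[OF x y] dd[OF y x] by (subst (2) sum.swap) (simp add: sum_subtractf)
    \<comment> \<open>Operators in different slots commute, so the double sum reduces to its
      diagonal, and each diagonal term is the action of the bracket.\<close>
    also have "\<dots> = (\<Sum>i\<in>J. \<Sum>j\<in>J. if i = j then \<phi> (sl i (brack L x y) t) else 0)"
    proof (intro sum.cong refl)
      fix i j assume i: "i \<in> J" and j: "j \<in> J"
      show "\<phi> (sl i x (sl j y t)) - \<phi> (sl j y (sl i x t)) = (if i = j then \<phi> (sl i (brack L x y) t) else 0)"
      proof (cases "i = j")
        case True
        have "sl i x (sl i y t) = sl i (brack L x y) t \<oplus>\<^bsub>TF\<^esub> sl i y (sl i x t)" by (rule sl_brack[OF i x y t])
        then show ?thesis using True i x y t b by (simp add: PF.P.lf_add[OF \<phi>] sl_closed)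
      next
        case False then show ?thesis using sl_comm[OF i j False x y t] by simp
      qed
    qed
    also have "\<dots> = (\<Sum>i\<in>J. \<phi> (sl i (brack L x y) t))" using fin by (intro sum.cong refl) simp
    also have "\<dots> = \<phi> (act TM (brack L x y) t)" unfolding T[OF b t]
      by (rule PF.P.lf_finsum[OF \<phi>, symmetric]) (use b t sl_closed in auto)
    finally show "\<phi> (act TM (brack L x y) t) = \<phi> (act TM x (act TM y t) \<ominus>\<^bsub>TF\<^esub> act TM y (act TM x t))"
      using ac x y t by (simp add: PF.P.lf_minus[OF \<phi>])
  qed (use ac x y t b in auto)
  then show "act TM (brack L x y) t = act TM x (act TM y t) \<ominus>\<^bsub>TM\<^esub> act TM y (act TM x t)"
    using vspace_cong_ops(1)[OF PF.P.vspace_axioms, of TM] TM_simps ac x y t by simp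
qed

lemma TM_act_gen:
  assumes x: "x \<in> carrier L" and u: "u \<in> SS"
  shows "act TM x (gen u) = (\<Oplus>\<^bsub>TF\<^esub>i\<in>J. gen (u(i := act (V i) x (u i))))"
  unfolding TM_act[OF x PF.gen_closed[OF u]]
  by (rule PF.P.finsum_cong') (use x u in \<open>auto simp: sl(2) intro!: PF.gen_closed upd Vcl\<close>)

text \<open>The slots are added one at a time: the operator in slot \<open>i\<close> commutes with
  the sum over the previous slots, and both are nilpotent on the pure tensor.\<close>

lemma TM_nilp:
  assumes x: "x \<in> carrier L" and u: "u \<in> SS" and n: "\<And>i. i \<in> J \<Longrightarrow> \<exists>n. (act (V i) x ^^ n) (u i) = \<zero>\<^bsub>V i\<^esub>"
  shows "\<exists>n. (act TM x ^^ n) (gen u) = \<zero>\<^bsub>TF\<^esub>"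
proof -
  have g: "gen u \<in> carrier TF" using u by simp
  have P: "\<exists>n. ((\<lambda>t. \<Oplus>\<^bsub>TF\<^esub>i\<in>K. sl i x t) ^^ n) (gen u) = \<zero>\<^bsub>TF\<^esub>" if "finite K" "K \<subseteq> J" for K using that
  proof (induct K rule: finite_induct)
    case empty then show ?case by (intro exI[of _ 1]) simp
  next
    case (insert i K)
    then have i: "i \<in> J" and K: "K \<subseteq> J" and iK: "i \<notin> K" by auto
    obtain b where b: "((\<lambda>t. \<Oplus>\<^bsub>TF\<^esub>i\<in>K. sl i x t) ^^ b) (gen u) = \<zero>\<^bsub>TF\<^esub>" using insert by blast
    obtain a where a: "(act (V i) x ^^ a) (u i) = \<zero>\<^bsub>V i\<^esub>" using n[OF i] by blast
    have c: "(act (V i) x ^^ n) (u i) \<in> carrier (V i)" for n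
      using lie_module.act_pow_closed[OF mods[OF i] x SSD[OF u i]] .
    have "(sl i x ^^ n) (gen u) = gen (u(i := (act (V i) x ^^ n) (u i)))" for n
    proof (induct n)
      case (Suc n)
      show ?case unfolding funpow.simps o_def Suc sl(2)[OF i x upd[OF u i c[of n]]] by (simp only: fun_upd_same fun_upd_upd)
    qed simp
    then have a: "(sl i x ^^ a) (gen u) = \<zero>\<^bsub>TF\<^esub>" using a gen_zero[OF u i] by simp
    have "((\<lambda>t. sl i x t \<oplus>\<^bsub>TF\<^esub> (\<Oplus>\<^bsub>TF\<^esub>i\<in>K. sl i x t)) ^^ (a + b)) (gen u) = \<zero>\<^bsub>TF\<^esub>"
    proof (rule PF.P.commuting_nilp_sum[OF sl(1)[OF i x] sum_lin[OF x K] _ g a b])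
      fix v assume v: "v \<in> carrier TF"
      have jJ: "j \<in> J" "j \<noteq> i" if "j \<in> K" for j using that K iK by auto
      have kc: "(\<Oplus>\<^bsub>TF\<^esub>j\<in>K. sl j x v) \<in> carrier TF" by (rule PF.P.fsc) (use jJ x v sl_closed in auto)
      show "sl i x (\<Oplus>\<^bsub>TF\<^esub>j\<in>K. sl j x v) = (\<Oplus>\<^bsub>TF\<^esub>j\<in>K. sl j x (sl i x v))"
      proof (rule PF.P.vs_eqI)
        fix \<phi> assume \<phi>: "lf TF \<phi>"
        have "\<phi> (sl i x (\<Oplus>\<^bsub>TF\<^esub>j\<in>K. sl j x v)) = (\<Sum>j\<in>K. \<phi> (sl i x (sl j x v)))"
          by (rule PF.P.lf_finsum[OF lf_comp[OF sl(1)[OF i x] \<phi>]]) (use jJ x v sl_closed in auto)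
        also have "\<dots> = (\<Sum>j\<in>K. \<phi> (sl j x (sl i x v)))"
        proof (rule sum.cong[OF refl])
          fix j assume "j \<in> K"
          then show "\<phi> (sl i x (sl j x v)) = \<phi> (sl j x (sl i x v))" using sl_comm[OF i jJ(1) _ x x v, of j] jJ(2)[of j] by auto
        qed
        also have "\<dots> = \<phi> (\<Oplus>\<^bsub>TF\<^esub>j\<in>K. sl j x (sl i x v))"
          by (rule PF.P.lf_finsum[OF \<phi>, symmetric]) (use jJ i x v sl_closed in auto)
        finally show "\<phi> (sl i x (\<Oplus>\<^bsub>TF\<^esub>j\<in>K. sl j x v)) = \<phi> (\<Oplus>\<^bsub>TF\<^esub>j\<in>K. sl j x (sl i x v))" .
      qed (use i x v kc jJ sl_closed in \<open>auto intro!: PF.P.fsc\<close>)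
    qed
    moreover have eq: "(\<Oplus>\<^bsub>TF\<^esub>i\<in>insert i K. sl i x t) = sl i x t \<oplus>\<^bsub>TF\<^esub> (\<Oplus>\<^bsub>TF\<^esub>i\<in>K. sl i x t)" if t: "t \<in> carrier TF" for t
      using insert(1,2) i K x t sl_closed by (simp add: Pi_def subset_iff)
    have "((\<lambda>t. \<Oplus>\<^bsub>TF\<^esub>i\<in>insert i K. sl i x t) ^^ n) (gen u) = ((\<lambda>t. sl i x t \<oplus>\<^bsub>TF\<^esub> (\<Oplus>\<^bsub>TF\<^esub>i\<in>K. sl i x t)) ^^ n) (gen u)
        \<and> ((\<lambda>t. sl i x t \<oplus>\<^bsub>TF\<^esub> (\<Oplus>\<^bsub>TF\<^esub>i\<in>K. sl i x t)) ^^ n) (gen u) \<in> carrier TF" for n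
      by (rule funpow_cong_on) (use g eq in \<open>simp_all add: sl_closed[OF i x] lin_mapD(1)[OF sum_lin[OF x K]]\<close>)
    ultimately show ?case by (intro exI[of _ "a + b"]) simp
  qed
  have "(act TM x ^^ n) (gen u) = ((\<lambda>t. \<Oplus>\<^bsub>TF\<^esub>i\<in>J. sl i x t) ^^ n) (gen u) \<and> ((\<lambda>t. \<Oplus>\<^bsub>TF\<^esub>i\<in>J. sl i x t) ^^ n) (gen u) \<in> carrier TF" for n
    by (rule funpow_cong_on[OF TM_act[OF x] lin_mapD(1)[OF sum_lin[OF x order_refl]] g])
  then show ?thesis using P[OF fin order_refl] by simp
qed

end

section \<open>Comaximal ideals\<close>

context cur
begin

text \<open>The ideals add up to the whole algebra, witnessed by an element congruent to 0 modulo
  \<open>P\<close> and to 1 modulo \<open>Q\<close>.\<close>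

definition comax where "comax P Q \<longleftrightarrow> (\<exists>a\<in>P. \<one>\<^sub>A \<ominus>\<^bsub>A\<^esub> a \<in> Q)"

lemma comax_prod_elt:
  assumes Q: "ideal Q A" and "a \<in> carrier A" "b \<in> carrier A" "\<one>\<^sub>A \<ominus>\<^bsub>A\<^esub> a \<in> Q" "\<one>\<^sub>A \<ominus>\<^bsub>A\<^esub> b \<in> Q"
  shows "\<one>\<^sub>A \<ominus>\<^bsub>A\<^esub> a \<cdot> b \<in> Q"
proof -
  have "\<one>\<^sub>A \<ominus>\<^bsub>A\<^esub> a \<cdot> b = (\<one>\<^sub>A \<ominus>\<^bsub>A\<^esub> a) \<oplus>\<^bsub>A\<^esub> a \<cdot> (\<one>\<^sub>A \<ominus>\<^bsub>A\<^esub> b)"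
    using assms(2,3) by algebra
  moreover have "a \<cdot> (\<one>\<^sub>A \<ominus>\<^bsub>A\<^esub> b) \<in> Q" using ideal.I_l_closed[OF Q assms(5,2)] .
  ultimately show ?thesis using additive_subgroup.a_closed[OF ideal.axioms(1)[OF Q] assms(4)] by simp
qed

lemma comax_sym: assumes "ideal P A" "comax P Q" shows "comax Q P"
proof -
  obtain a where a: "a \<in> P" "\<one>\<^sub>A \<ominus>\<^bsub>A\<^esub> a \<in> Q" using assms by (auto simp: comax_def)
  have ac: "a \<in> carrier A" using ideal.Icarr[OF assms(1) a(1)] .
  have "\<one>\<^sub>A \<ominus>\<^bsub>A\<^esub> (\<one>\<^sub>A \<ominus>\<^bsub>A\<^esub> a) = a" using ac by algebra
  then show ?thesis unfolding comax_def using a by metis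
qed

lemma comax_pow: assumes P: "ideal P A" and Q: "ideal Q A" and c: "comax P Q" shows "comax (ipow P N) Q"
proof -
  obtain e where e: "e \<in> P" "\<one>\<^sub>A \<ominus>\<^bsub>A\<^esub> e \<in> Q" using c by (auto simp: comax_def)
  have ec: "e \<in> carrier A" using ideal.Icarr[OF P e(1)] .
  show ?thesis
  proof (induct N)
    case 0
    have "\<one>\<^sub>A \<ominus>\<^bsub>A\<^esub> \<one>\<^sub>A \<in> Q" using additive_subgroup.zero_closed[OF ideal.axioms(1)[OF Q]] by (simp add: a_minus_def A.r_neg)
    then show ?case unfolding comax_def by (intro bexI[of _ "\<one>\<^sub>A"]) simp_all
  next
    case (Suc N)
    then obtain a where a: "a \<in> ipow P N" "\<one>\<^sub>A \<ominus>\<^bsub>A\<^esub> a \<in> Q" by (auto simp: comax_def)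
    have ac: "a \<in> carrier A" using ideal_power_carrier[OF P a(1)] .
    have "e \<cdot> a \<in> ipow P (Suc N)" using e a by (auto intro: ideal_prod.prod)
    then show ?case unfolding comax_def using comax_prod_elt[OF Q ec ac e(2) a(2)] by blast
  qed
qed

text \<open>One ideal is raised to a power while the other stays fixed; exchanging their roles and
  repeating treats both.\<close>

lemma comax_pow2: assumes P: "ideal P A" and Q: "ideal Q A" and c: "comax P Q" shows "comax (ipow P N) (ipow Q N)"
  using comax_sym[OF ideal_power_ideal[OF Q] comax_pow[OF Q ideal_power_ideal[OF P] comax_sym[OF ideal_power_ideal[OF P] comax_pow[OF P Q c]]]] .

lemma comax_maximal:
  assumes M: "maximalideal M A" and N: "maximalideal N A" and ne: "M \<noteq> N" shows "comax M N"
proof -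
  have Mi: "ideal M A" and Ni: "ideal N A" using M N by (auto intro: maximalideal.axioms)
  note MN = A.add_ideals[OF Mi Ni]
  have sub: "M \<subseteq> M <+>\<^bsub>A\<^esub> N" "N \<subseteq> M <+>\<^bsub>A\<^esub> N"
  proof -
    have z: "\<zero>\<^bsub>A\<^esub> \<in> M" "\<zero>\<^bsub>A\<^esub> \<in> N" using additive_subgroup.zero_closed[OF ideal.axioms(1)] Mi Ni by auto
    show "M \<subseteq> M <+>\<^bsub>A\<^esub> N"
    proof
      fix x assume x: "x \<in> M"
      then have "x = x \<oplus>\<^bsub>A\<^esub> \<zero>\<^bsub>A\<^esub>" using ideal.Icarr[OF Mi] by simp
      then show "x \<in> M <+>\<^bsub>A\<^esub> N" using x z unfolding set_add_def' by blast
    qed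
    show "N \<subseteq> M <+>\<^bsub>A\<^esub> N"
    proof
      fix x assume x: "x \<in> N"
      then have "x = \<zero>\<^bsub>A\<^esub> \<oplus>\<^bsub>A\<^esub> x" using ideal.Icarr[OF Ni] by simp
      then show "x \<in> M <+>\<^bsub>A\<^esub> N" using x z unfolding set_add_def' by blast
    qed
  qed
  have MNc: "M <+>\<^bsub>A\<^esub> N \<subseteq> carrier A" using ideal.Icarr[OF MN] by blast
  have "M <+>\<^bsub>A\<^esub> N = M \<or> M <+>\<^bsub>A\<^esub> N = carrier A" using maximalideal.I_maximal[OF M MN sub(1) MNc] .
  moreover have "M <+>\<^bsub>A\<^esub> N \<noteq> M"
  proof
    assume "M <+>\<^bsub>A\<^esub> N = M"
    then have "N \<subseteq> M" using sub(2) by simp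
    then have "M = N \<or> M = carrier A" using maximalideal.I_maximal[OF N Mi] ideal.Icarr[OF Mi] by blast
    then show False using ne maximalideal.I_notcarr[OF M] by auto
  qed
  ultimately have "\<one>\<^sub>A \<in> M <+>\<^bsub>A\<^esub> N" by simp
  then obtain a b where ab: "a \<in> M" "b \<in> N" "\<one>\<^sub>A = a \<oplus>\<^bsub>A\<^esub> b" unfolding set_add_def' by blast
  have "a \<in> carrier A" "b \<in> carrier A" using ab ideal.Icarr[OF Mi] ideal.Icarr[OF Ni] by auto
  then have "a \<oplus>\<^bsub>A\<^esub> b \<ominus>\<^bsub>A\<^esub> a = b" by algebra
  then show ?thesis unfolding comax_def using ab by (intro bexI[of _ a]) simp_all
qed

text \<open>The product of the witnesses for the single ideals lies in every \<open>P j\<close> and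
  is still congruent to 1 modulo \<open>Q\<close>, by
  \<open>1 - a b = (1 - a) + a (1 - b)\<close>.\<close>

lemma comax_Inter:
  assumes Q: "ideal Q A" and "finite K" "\<And>j. j \<in> K \<Longrightarrow> ideal (P j) A \<and> comax (P j) Q"
  shows "\<exists>a\<in>carrier A. (\<forall>j\<in>K. a \<in> P j) \<and> \<one>\<^sub>A \<ominus>\<^bsub>A\<^esub> a \<in> Q"
  using assms(2,3)
proof (induct K rule: finite_induct)
  case empty
  have "\<one>\<^sub>A \<ominus>\<^bsub>A\<^esub> \<one>\<^sub>A \<in> Q" using additive_subgroup.zero_closed[OF ideal.axioms(1)[OF Q]] by (simp add: a_minus_def A.r_neg)
  then show ?case by (intro bexI[of _ "\<one>\<^sub>A"]) simp_all
next
  case (insert n K)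
  then obtain a where a: "a \<in> carrier A" "\<forall>j\<in>K. a \<in> P j" "\<one>\<^sub>A \<ominus>\<^bsub>A\<^esub> a \<in> Q" by auto
  obtain b where b: "b \<in> P n" "\<one>\<^sub>A \<ominus>\<^bsub>A\<^esub> b \<in> Q" using insert.prems[of n] by (auto simp: comax_def)
  have Pn: "ideal (P n) A" using insert.prems by simp
  have bc: "b \<in> carrier A" using ideal.Icarr[OF Pn b(1)] .
  have "b \<cdot> a \<in> P n" using ideal.I_r_closed[OF Pn b(1) a(1)] .
  moreover have "b \<cdot> a \<in> P j" if "j \<in> K" for j using ideal.I_l_closed[of "P j" A a b] insert.prems[of j] a(2) bc that by simp
  ultimately show ?case using comax_prod_elt[OF Q bc a(1) b(2) a(3)] a(1) bc by (intro bexI[of _ "b \<cdot> a"]) auto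
qed

text \<open>In the product of a factor from \<open>P\<close> and a factor from \<open>Q\<close> one
  obtains an element of the intersection, so the \<open>N\<close> factors on each side are paired
  off.\<close>

lemma ideal_power_inter:
  assumes P: "ideal P A" and Q: "ideal Q A"
  shows "x \<in> ipow P N \<Longrightarrow> y \<in> ipow Q N \<Longrightarrow> x \<cdot> y \<in> ipow (P \<inter> Q) N"
proof (induct N arbitrary: x y)
  case 0 then show ?case by simp
next
  case (Suc N)
  have PQ: "ideal (P \<inter> Q) A" by (rule A.i_intersect[OF P Q])
  have pc: "p \<in> carrier A" if "p \<in> P" for p using ideal.Icarr[OF P that] .
  have qc: "q \<in> carrier A" if "q \<in> Q" for q using ideal.Icarr[OF Q that] .
  have add: "u \<oplus>\<^bsub>A\<^esub> v \<in> ipow (P \<inter> Q) (Suc N)" if "u \<in> ipow (P \<inter> Q) (Suc N)" "v \<in> ipow (P \<inter> Q) (Suc N)" for u v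
    using additive_subgroup.a_closed[OF ideal.axioms(1)[OF ideal_power_ideal[OF PQ]] that] .
  have *: "y \<in> carrier A \<and> (p \<cdot> x') \<cdot> y \<in> ipow (P \<inter> Q) (Suc N)" if p: "p \<in> P" and x': "x' \<in> ipow P N" for p x'
    using Suc.prems(2)[unfolded ideal_power.simps]
  proof (induct rule: ideal_prod.induct)
    case (prod q y')
    have c: "q \<in> carrier A" "y' \<in> carrier A" "p \<in> carrier A" "x' \<in> carrier A"
      using qc[OF prod(1)] ideal_power_carrier[OF Q prod(2)] pc[OF p] ideal_power_carrier[OF P x'] by auto
    have "p \<cdot> q \<in> P \<inter> Q" using ideal.I_r_closed[OF P p c(1)] ideal.I_l_closed[OF Q prod(1) c(3)] by blast
    moreover have "x' \<cdot> y' \<in> ipow (P \<inter> Q) N" by (rule Suc.hyps[OF x' prod(2)])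
    ultimately have "(p \<cdot> q) \<cdot> (x' \<cdot> y') \<in> ipow (P \<inter> Q) (Suc N)" by (auto intro: ideal_prod.prod)
    moreover have "(p \<cdot> q) \<cdot> (x' \<cdot> y') = (p \<cdot> x') \<cdot> (q \<cdot> y')" using c by (simp add: A.m_ac)
    ultimately show ?case using c by simp
  next
    case (sum u v)
    then show ?case using add pc[OF p] ideal_power_carrier[OF P x'] by (simp add: A.r_distr del: ideal_power.simps)
  qed
  have yc: "y \<in> carrier A" using ideal_power_carrier[OF Q Suc.prems(2)] .
  have "x \<in> carrier A \<and> x \<cdot> y \<in> ipow (P \<inter> Q) (Suc N)" using Suc.prems(1)[unfolded ideal_power.simps]
  proof (induct rule: ideal_prod.induct)
    case (prod p x') then show ?case using * pc ideal_power_carrier[OF P] by blast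
  next
    case (sum u v) then show ?case using add yc by (simp add: A.l_distr del: ideal_power.simps)
  qed
  then show ?case by blast
qed

text \<open>For comaximal ideals the intersection of the \<open>N\<close>-th powers lies in the
  \<open>N\<close>-th power of the intersection. In the induction step
  \<open>d = b d + d (1 - b)\<close> with a witness \<open>b\<close> for the powers; both summands
  are products to which \<open>ideal_power_inter\<close> applies.\<close>

lemma Inter_pow:
  assumes "finite K" "K \<noteq> {}" "\<And>j. j \<in> K \<Longrightarrow> ideal (P j) A" "\<And>i j. \<lbrakk>i \<in> K; j \<in> K; i \<noteq> j\<rbrakk> \<Longrightarrow> comax (P i) (P j)"
    "\<And>j. j \<in> K \<Longrightarrow> d \<in> ipow (P j) N"
  shows "ideal (\<Inter>j\<in>K. P j) A \<and> d \<in> ipow (\<Inter>j\<in>K. P j) N"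
  using assms
proof (induct K rule: finite_ne_induct)
  case (singleton x) then show ?case by simp
next
  case (insert n K)
  let ?P = "\<Inter>j\<in>K. P j"
  have IH: "ideal ?P A" "d \<in> ipow ?P N" using insert.hyps(4) insert.prems by auto
  have Q: "ideal (P n) A" using insert.prems by simp
  obtain a where a: "a \<in> carrier A" "\<forall>j\<in>K. a \<in> P j" "\<one>\<^sub>A \<ominus>\<^bsub>A\<^esub> a \<in> P n"
    using comax_Inter[OF Q insert.hyps(1), of P] insert.prems insert.hyps(3) by (metis insert_iff)
  then have "comax ?P (P n)" unfolding comax_def by blast
  from comax_pow2[OF IH(1) Q this] obtain b where b: "b \<in> ipow ?P N" "\<one>\<^sub>A \<ominus>\<^bsub>A\<^esub> b \<in> ipow (P n) N"
    by (auto simp: comax_def)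
  have dQ: "d \<in> ipow (P n) N" using insert.prems by simp
  have c: "d \<in> carrier A" "b \<in> carrier A" using ideal_power_carrier[OF IH(1)] IH(2) b(1) by auto
  have PQ: "ideal (?P \<inter> P n) A" by (rule A.i_intersect[OF IH(1) Q])
  have "b \<cdot> d \<in> ipow (?P \<inter> P n) N" by (rule ideal_power_inter[OF IH(1) Q b(1) dQ])
  moreover have "d \<cdot> (\<one>\<^sub>A \<ominus>\<^bsub>A\<^esub> b) \<in> ipow (?P \<inter> P n) N" by (rule ideal_power_inter[OF IH(1) Q IH(2) b(2)])
  ultimately have "b \<cdot> d \<oplus>\<^bsub>A\<^esub> d \<cdot> (\<one>\<^sub>A \<ominus>\<^bsub>A\<^esub> b) \<in> ipow (?P \<inter> P n) N"
    using additive_subgroup.a_closed[OF ideal.axioms(1)[OF ideal_power_ideal[OF PQ]]] by blast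
  moreover have "b \<cdot> d \<oplus>\<^bsub>A\<^esub> d \<cdot> (\<one>\<^sub>A \<ominus>\<^bsub>A\<^esub> b) = d" using c by algebra
  moreover have "(\<Inter>j\<in>insert n K. P j) = ?P \<inter> P n" by blast
  ultimately show ?case using PQ by simp
qed

end

section \<open>Splitting a highest weight module along the maximal ideals\<close>

text \<open>Expanding \<open>(P + Q)\<^sup>s v = 0\<close> by eigenvalues of \<open>B\<close>, the summand of weight \<open>\<lambda> - 2 s\<close> is \<open>P\<^sup>s v\<close>.\<close>

lemma (in vspace) extremal_power_zero:
  assumes P: "lin_map V V P" and Q: "lin_map V V Q" and B: "lin_map V V B"
    and BP: "\<And>w. w \<in> carrier V \<Longrightarrow> B (P w) = P (B w) \<oplus> (-2) \<odot> P w"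
    and BQ: "\<And>w. w \<in> carrier V \<Longrightarrow> B (Q w) = Q (B w)"
    and v: "v \<in> carrier V" "B v = l \<odot> v" and nil: "((\<lambda>w. P w \<oplus> Q w) ^^ s) v = \<zero>"
  shows "(P ^^ s) v = \<zero>"
proof -
  note PD = lin_mapD[OF P] and QD = lin_mapD[OF Q] and BD = lin_mapD[OF B]
  have z: "P \<zero> = \<zero>" "Q \<zero> = \<zero>" "B \<zero> = \<zero>" using lin_map_zero[OF _ vspace_axioms vspace_axioms] P Q B by auto
  have Pc: "(P ^^ n) v \<in> carrier V" for n by (induct n) (use v PD in auto)
  \<comment> \<open>\<open>x t\<close> collects the words of length \<open>n\<close> in
    \<open>P\<close> and \<open>Q\<close> with exactly \<open>t\<close> factors \<open>P\<close>;
    every factor \<open>P\<close> shifts the eigenvalue of \<open>B\<close> by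
    \<open>-2\<close>.\<close>
  have "\<exists>x. (\<forall>t. x t \<in> carrier V \<and> B (x t) = (l - 2 * of_nat t) \<odot> x t) \<and> (\<forall>t>n. x t = \<zero>) \<and> x n = (P ^^ n) v
      \<and> ((\<lambda>w. P w \<oplus> Q w) ^^ n) v = (\<Oplus>t\<in>{..n}. x t)" for n
  proof (induct n)
    case 0 then show ?case using v z by (intro exI[of _ "\<lambda>t. if t = 0 then v else \<zero>"]) simp
  next
    case (Suc n)
    then obtain x where x: "\<And>t. x t \<in> carrier V" "\<And>t. B (x t) = (l - 2 * of_nat t) \<odot> x t" "\<And>t. t > n \<Longrightarrow> x t = \<zero>"
      "x n = (P ^^ n) v" "((\<lambda>w. P w \<oplus> Q w) ^^ n) v = (\<Oplus>t\<in>{..n}. x t)" by blast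
    \<comment> \<open>A word with \<open>t\<close> factors \<open>P\<close> arises by prefixing
      \<open>P\<close> to one with \<open>t - 1\<close> such factors or \<open>Q\<close> to one with
      \<open>t\<close>; for \<open>t = 0\<close> only the second occurs.\<close>
    let ?y = "\<lambda>t. (case t of 0 \<Rightarrow> \<zero> | Suc t' \<Rightarrow> P (x t')) \<oplus> Q (x t)"
    have yc: "?y t \<in> carrier V" for t using x(1) PD(1) QD(1) by (cases t) auto
    have "B (?y t) = (l - 2 * of_nat t) \<odot> ?y t" for t
    proof (cases t)
      case 0 then show ?thesis using x(1,2) PD QD BD BQ z by (simp add: sm_add_r)
    next
      case (Suc t')
      have e: "l - 2 * of_nat t' + -2 = l - 2 * of_nat t" using Suc by (simp add: algebra_simps)
      have "B (P (x t')) = (l - 2 * of_nat t' + -2) \<odot> P (x t')"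
        using BP[OF x(1), of t'] x(1,2) PD sm_add_l[OF PD(1)[OF x(1)], of "l - 2 * of_nat t'" "-2" t'] by simp
      then have "B (P (x t')) = (l - 2 * of_nat t) \<odot> P (x t')" unfolding e .
      moreover have "?y t = P (x t') \<oplus> Q (x t)" using Suc by simp
      ultimately show ?thesis using x(1,2) PD QD BD BQ by (simp add: sm_add_r)
    qed
    moreover have "?y t = \<zero>" if "t > Suc n" for t using x(3) z that by (cases t) auto
    moreover have "?y (Suc n) = (P ^^ Suc n) v" using x(3,4) z Pc PD by simp
    moreover have "((\<lambda>w. P w \<oplus> Q w) ^^ Suc n) v = (\<Oplus>t\<in>{..Suc n}. ?y t)"
    proof (rule vs_eqI)
      have S: "(\<Oplus>t\<in>{..n}. x t) \<in> carrier V" using x(1) by (intro fsc) auto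
      then show "((\<lambda>w. P w \<oplus> Q w) ^^ Suc n) v \<in> carrier V" using x(5) PD QD by simp
      show "(\<Oplus>t\<in>{..Suc n}. ?y t) \<in> carrier V" using yc by (intro fsc) blast
      fix \<phi> assume \<phi>: "lf V \<phi>"
      have "\<phi> (((\<lambda>w. P w \<oplus> Q w) ^^ Suc n) v) = \<phi> (P (\<Oplus>t\<in>{..n}. x t)) + \<phi> (Q (\<Oplus>t\<in>{..n}. x t))"
        using x(5) PD(1)[OF S] QD(1)[OF S] lf_add[OF \<phi>] by simp
      also have "\<dots> = (\<Sum>t\<le>n. \<phi> (P (x t))) + (\<Sum>t\<le>n. \<phi> (Q (x t)))"
        using lf_finsum[OF lf_comp[OF P \<phi>], of "{..n}" x] lf_finsum[OF lf_comp[OF Q \<phi>], of "{..n}" x] x(1) by simp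
      also have "\<dots> = (\<Sum>t\<le>Suc n. \<phi> (case t of 0 \<Rightarrow> \<zero> | Suc t' \<Rightarrow> P (x t'))) + (\<Sum>t\<le>Suc n. \<phi> (Q (x t)))"
        using x(3)[of "Suc n"] z lf_zero[OF \<phi>] sum.atMost_Suc_shift[of "\<lambda>t. \<phi> (case t of 0 \<Rightarrow> \<zero> | Suc t' \<Rightarrow> P (x t'))" n]
          sum.atMost_Suc[of "\<lambda>t. \<phi> (Q (x t))" n] by (simp del: sum.atMost_Suc)
      also have "\<dots> = (\<Sum>t\<le>Suc n. \<phi> (?y t))" unfolding sum.distrib[symmetric]
        by (rule sum.cong[OF refl]) (use x(1) PD(1) QD(1) lf_add[OF \<phi>] in \<open>auto split: nat.split\<close>)
      also have "\<dots> = \<phi> (\<Oplus>t\<in>{..Suc n}. ?y t)" using lf_finsum[OF \<phi>, of "{..Suc n}" ?y] yc by simp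
      finally show "\<phi> (((\<lambda>w. P w \<oplus> Q w) ^^ Suc n) v) = \<phi> (\<Oplus>t\<in>{..Suc n}. ?y t)" .
    qed
    ultimately show ?case using yc by (intro exI[of _ ?y] conjI allI impI) simp_all
  qed
  from this[of s] obtain x where x: "\<And>t. x t \<in> carrier V" "\<And>t. B (x t) = (l - 2 * of_nat t) \<odot> x t"
    "x s = (P ^^ s) v" "((\<lambda>w. P w \<oplus> Q w) ^^ s) v = (\<Oplus>t\<in>{..s}. x t)" by blast
  have "\<forall>t\<in>{..s}. x t = \<zero>"
  proof (rule eigen_indep[where H = "{()}" and B = "\<lambda>_. B" and ch = "\<lambda>t _. l - 2 * of_nat t"])
    show "(\<Oplus>t\<in>{..s}. x t) = \<zero>" using x(4) nil by simp
  qed (use x(1,2) B in auto)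
  then show ?thesis using x(3) by simp
qed

locale cur_family = cur C G H2 A
  for C :: "int^'n^'n" and G :: "('g, 'n::finite) km" and H2 :: "'g set" and A :: "(complex, 'a) module" +
  fixes k :: nat and M :: "nat \<Rightarrow> 'a set" and ps :: "nat \<Rightarrow> ('g, 'a) cur \<Rightarrow> complex"
  assumes k1: "1 \<le> k" and maxi: "i \<in> {1..k} \<Longrightarrow> maximalideal (M i) A" and inj: "inj_on M {1..k}"
    and ps_kill: "i \<in> {1..k} \<Longrightarrow> wkill (ps i) (M i)" and ps_dom: "i \<in> {1..k} \<Longrightarrow> dom (ps i)"
begin

abbreviation "J \<equiv> {1..k}"
abbreviation "MI \<equiv> \<Inter>i\<in>J. M i"
abbreviation pss where "pss \<equiv> \<lambda>x. \<Sum>i\<in>J. ps i x"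

lemma Mi: "i \<in> J \<Longrightarrow> ideal (M i) A" using maxi maximalideal.axioms(1) by blast
lemma Mcx: "\<lbrakk>i \<in> J; j \<in> J; i \<noteq> j\<rbrakk> \<Longrightarrow> comax (M i) (M j)"
  by (rule comax_maximal[OF maxi maxi]) (use inj in \<open>simp_all add: inj_on_eq_iff\<close>)

text \<open>Congruences modulo a power of the intersection can be tested at each maximal ideal
  separately; this is used for all properties of the elements \<open>ee i N\<close>.\<close>

lemma MI_pow:
  assumes "\<And>j. j \<in> J \<Longrightarrow> d \<in> ipow (M j) N"
  shows "d \<in> ipow MI N"
proof -
  have ne: "J \<noteq> {}" using k1 by simp
  show ?thesis using Inter_pow[where P = M, OF finite_atLeastAtMost ne Mi Mcx assms] by blast
qed

lemma MI_ideal: "ideal MI A"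
proof -
  have ne: "J \<noteq> {}" using k1 by simp
  have "\<zero>\<^bsub>A\<^esub> \<in> ipow (M j) 0" for j by simp
  from Inter_pow[where P = M, OF finite_atLeastAtMost ne Mi Mcx this] show ?thesis by blast
qed

lemma ideal_ops:
  assumes Q: "ideal Q A"
  shows "\<lbrakk>a \<in> Q; b \<in> Q\<rbrakk> \<Longrightarrow> a \<oplus>\<^bsub>A\<^esub> b \<in> Q" "\<lbrakk>a \<in> Q; b \<in> Q\<rbrakk> \<Longrightarrow> a \<ominus>\<^bsub>A\<^esub> b \<in> Q"
proof -
  note c = ideal.Icarr[OF Q] and add = additive_subgroup.a_closed[OF ideal.axioms(1)[OF Q]]
  show "\<lbrakk>a \<in> Q; b \<in> Q\<rbrakk> \<Longrightarrow> a \<oplus>\<^bsub>A\<^esub> b \<in> Q" by (rule add)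
  assume a: "a \<in> Q" and b: "b \<in> Q"
  have "a \<oplus>\<^bsub>A\<^esub> (\<ominus>\<^bsub>A\<^esub> \<one>\<^sub>A) \<cdot> b \<in> Q" using add[OF a ideal.I_l_closed[OF Q b, of "\<ominus>\<^bsub>A\<^esub> \<one>\<^sub>A"]] by simp
  moreover have "a \<oplus>\<^bsub>A\<^esub> (\<ominus>\<^bsub>A\<^esub> \<one>\<^sub>A) \<cdot> b = a \<ominus>\<^bsub>A\<^esub> b" using c[OF a] c[OF b] by algebra
  ultimately show "a \<ominus>\<^bsub>A\<^esub> b \<in> Q" by simp
qed

text \<open>A representative, by the Chinese remainder theorem, of the idempotent that belongs to
  the factor \<open>i\<close> of \<open>A\<close> modulo the \<open>N\<close>-th power of
  \<open>MI\<close>.\<close>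

definition ee where "ee i N = (SOME e. e \<in> carrier A \<and> (\<forall>j\<in>J - {i}. e \<in> ipow (M j) N) \<and>
  \<one>\<^sub>A \<ominus>\<^bsub>A\<^esub> e \<in> ipow (M i) N)"

lemma ee:
  assumes i: "i \<in> J"
  shows "ee i N \<in> carrier A" "\<lbrakk>j \<in> J; j \<noteq> i\<rbrakk> \<Longrightarrow> ee i N \<in> ipow (M j) N"
    "\<one>\<^sub>A \<ominus>\<^bsub>A\<^esub> ee i N \<in> ipow (M i) N"
proof -
  have "\<exists>e\<in>carrier A. (\<forall>j\<in>J - {i}. e \<in> ipow (M j) N) \<and> \<one>\<^sub>A \<ominus>\<^bsub>A\<^esub> e \<in> ipow (M i) N"
    by (rule comax_Inter) (use i Mi Mcx in \<open>auto intro: ideal_power_ideal comax_pow2\<close>)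
  then have "\<exists>e. e \<in> carrier A \<and> (\<forall>j\<in>J - {i}. e \<in> ipow (M j) N) \<and> \<one>\<^sub>A \<ominus>\<^bsub>A\<^esub> e \<in> ipow (M i) N" by blast
  from someI_ex[OF this, folded ee_def]
  show "ee i N \<in> carrier A" "\<lbrakk>j \<in> J; j \<noteq> i\<rbrakk> \<Longrightarrow> ee i N \<in> ipow (M j) N"
    "\<one>\<^sub>A \<ominus>\<^bsub>A\<^esub> ee i N \<in> ipow (M i) N" by auto
qed

lemma ee_diff:
  assumes i: "i \<in> J" and NM: "N \<le> N'"
  shows "ee i N' \<ominus>\<^bsub>A\<^esub> ee i N \<in> ipow MI N"
proof (rule MI_pow)
  fix j assume j: "j \<in> J"
  note Q = ideal_power_ideal[OF Mi[OF j], of N] and mono = subsetD[OF ideal_power_mono[OF Mi[OF j] NM]]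
  note c = ee(1)[OF i]
  show "ee i N' \<ominus>\<^bsub>A\<^esub> ee i N \<in> ipow (M j) N"
  proof (cases "j = i")
    case True
    have "(\<one>\<^sub>A \<ominus>\<^bsub>A\<^esub> ee i N) \<ominus>\<^bsub>A\<^esub> (\<one>\<^sub>A \<ominus>\<^bsub>A\<^esub> ee i N') \<in> ipow (M j) N"
      using ideal_ops(2)[OF Q] mono ee(3)[OF i] True by simp
    moreover have "(\<one>\<^sub>A \<ominus>\<^bsub>A\<^esub> ee i N) \<ominus>\<^bsub>A\<^esub> (\<one>\<^sub>A \<ominus>\<^bsub>A\<^esub> ee i N') = ee i N' \<ominus>\<^bsub>A\<^esub> ee i N"
      using c[of N] c[of N'] by algebra
    ultimately show ?thesis by simp
  next
    case False then show ?thesis using ideal_ops(2)[OF Q] mono ee(2)[OF i j] by simp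
  qed
qed

lemma ee_orth:
  assumes i: "i \<in> J" and j: "j \<in> J" and ij: "i \<noteq> j"
  shows "ee i N \<cdot> ee j N \<in> ipow MI N"
proof (rule MI_pow)
  fix l assume l: "l \<in> J"
  note Q = ideal_power_ideal[OF Mi[OF l], of N]
  show "ee i N \<cdot> ee j N \<in> ipow (M l) N"
  proof (cases "l = i")
    case True then show ?thesis using ideal.I_l_closed[OF Q ee(2)[OF j l] ee(1)[OF i]] ij by simp
  next
    case False then show ?thesis using ideal.I_r_closed[OF Q ee(2)[OF i l] ee(1)[OF j]] by simp
  qed
qed

lemma ee_idem:
  assumes i: "i \<in> J"
  shows "ee i N \<cdot> ee i N \<ominus>\<^bsub>A\<^esub> ee i N \<in> ipow MI N"
proof (rule MI_pow)
  fix l assume l: "l \<in> J"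
  note Q = ideal_power_ideal[OF Mi[OF l], of N] and c = ee(1)[OF i]
  show "ee i N \<cdot> ee i N \<ominus>\<^bsub>A\<^esub> ee i N \<in> ipow (M l) N"
  proof (cases "l = i")
    case True
    have "(\<ominus>\<^bsub>A\<^esub> ee i N) \<cdot> (\<one>\<^sub>A \<ominus>\<^bsub>A\<^esub> ee i N) = ee i N \<cdot> ee i N \<ominus>\<^bsub>A\<^esub> ee i N" using c by algebra
    then show ?thesis using ideal.I_l_closed[OF Q, of "\<one>\<^sub>A \<ominus>\<^bsub>A\<^esub> ee i N" "\<ominus>\<^bsub>A\<^esub> ee i N"] True ee(3)[OF i, of N] c[of N] by simp
  next
    case False then show ?thesis using ideal_ops(2)[OF Q] ideal.I_r_closed[OF Q ee(2)[OF i l] c] ee(2)[OF i l] by simp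
  qed
qed

lemma ee_sum: "(\<Oplus>\<^bsub>A\<^esub>i\<in>J. ee i N) \<ominus>\<^bsub>A\<^esub> \<one>\<^sub>A \<in> ipow MI N"
proof (rule MI_pow)
  fix l assume l: "l \<in> J"
  note Q = ideal_power_ideal[OF Mi[OF l], of N]
  have S: "(\<Oplus>\<^bsub>A\<^esub>i\<in>K. ee i N) \<in> ipow (M l) N" if "finite K" "K \<subseteq> J - {l}" for K
    using that
  proof (induct K rule: finite_induct)
    case empty show ?case using additive_subgroup.zero_closed[OF ideal.axioms(1)[OF Q]] by simp
  next
    case (insert i K)
    have "i \<in> J" "i \<noteq> l" using insert by auto
    then show ?case using insert ideal_ops(1)[OF Q] ee(1) ee(2)[OF _ l]
      by (subst A.finsum_insert) (auto simp: subset_iff)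
  qed
  have "(\<Oplus>\<^bsub>A\<^esub>i\<in>J. ee i N) = ee l N \<oplus>\<^bsub>A\<^esub> (\<Oplus>\<^bsub>A\<^esub>i\<in>J - {l}. ee i N)"
    using A.finsum_insert[of "J - {l}" l "\<lambda>i. ee i N"] l ee(1) by (auto simp: insert_absorb Pi_def)
  moreover have c: "(\<Oplus>\<^bsub>A\<^esub>i\<in>J - {l}. ee i N) \<in> ipow (M l) N" by (rule S) auto
  moreover have "ee l N \<oplus>\<^bsub>A\<^esub> x \<ominus>\<^bsub>A\<^esub> \<one>\<^sub>A = x \<ominus>\<^bsub>A\<^esub> (\<one>\<^sub>A \<ominus>\<^bsub>A\<^esub> ee l N)" if "x \<in> carrier A" for x
    using that ee(1)[OF l, of N] by algebra
  ultimately show "(\<Oplus>\<^bsub>A\<^esub>i\<in>J. ee i N) \<ominus>\<^bsub>A\<^esub> \<one>\<^sub>A \<in> ipow (M l) N"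
    using ideal_ops(2)[OF Q c ee(3)[OF l]] ideal.Icarr[OF Q c] by simp
qed

lemma pss_wform: "wform pss"
  unfolding wform_def lin_form_def
  using domD(1)[OF ps_dom] wformD(2,3) by (auto simp: sum.distrib[symmetric] sum_distrib_left intro!: sum.cong)

lemma pss_dom: "dom pss"
proof -
  have "pss (hA i \<one>\<^sub>A) = of_nat (\<Sum>j\<in>J. wn (ps j) i)" for i
    unfolding of_nat_sum by (rule sum.cong[OF refl]) (use domD(2)[OF ps_dom] in blast)
  then show ?thesis unfolding dom_def using pss_wform of_nat_in_Nats by metis
qed

lemma pss_kill: "wkill pss MI"
  unfolding wkill_def using ps_kill by (auto simp: wkill_def)

text \<open>The form \<open>ps j\<close> sees coefficients only modulo \<open>M j\<close>, where
  \<open>ee i N\<close> is 1 for \<open>j = i\<close> and 0 otherwise. At least the first power is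
  required so that these congruences hold modulo \<open>M j\<close> itself.\<close>

lemma pss_ee:
  assumes i: "i \<in> J" and N: "1 \<le> N" and X: "X \<in> cartan' G" and a: "a \<in> carrier A"
  shows "pss (ct X (ee i N \<cdot> a)) = ps i (ct X a)"
proof -
  have Xd: "X \<in> derived G" using cartan'D X by blast
  have p1: "x \<in> M j" if "x \<in> ipow (M j) N" "j \<in> J" for x j
    using subsetD[OF ideal_power_mono[OF Mi[OF that(2)] N] that(1)] A.ideal_prod_inter[OF Mi[OF that(2)] A.oneideal] by auto
  note c = ee(1)[OF i, of N]
  have "ps j (ct X (ee i N \<cdot> a)) = (if j = i then ps i (ct X a) else 0)" if j: "j \<in> J" for j
  proof (cases "j = i")
    case True
    have 1: "(\<one>\<^sub>A \<ominus>\<^bsub>A\<^esub> ee i N) \<cdot> a \<in> M i" using ideal.I_r_closed[OF Mi[OF i] p1[OF ee(3)[OF i] i] a] .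
    then have k: "ps i (ct X ((\<one>\<^sub>A \<ominus>\<^bsub>A\<^esub> ee i N) \<cdot> a)) = 0" using ps_kill[OF i] X by (simp add: wkill_def)
    have "a = (\<one>\<^sub>A \<ominus>\<^bsub>A\<^esub> ee i N) \<cdot> a \<oplus>\<^bsub>A\<^esub> ee i N \<cdot> a" using c a by algebra
    then have "ct X a = ct X ((\<one>\<^sub>A \<ominus>\<^bsub>A\<^esub> ee i N) \<cdot> a) \<oplus>\<^bsub>Lc\<^esub> ct X (ee i N \<cdot> a)"
      using ct_simps(2)[OF Xd, of "(\<one>\<^sub>A \<ominus>\<^bsub>A\<^esub> ee i N) \<cdot> a" "ee i N \<cdot> a"] c a by simp
    then have "ps i (ct X a) = ps i (ct X ((\<one>\<^sub>A \<ominus>\<^bsub>A\<^esub> ee i N) \<cdot> a)) + ps i (ct X (ee i N \<cdot> a))"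
      using wformD(2)[OF domD(1)[OF ps_dom[OF i]] cur_mem(2)[OF X] cur_mem(2)[OF X], of "(\<one>\<^sub>A \<ominus>\<^bsub>A\<^esub> ee i N) \<cdot> a" "ee i N \<cdot> a"] c a by simp
    then show ?thesis using k True by simp
  next
    case False
    then have "ee i N \<cdot> a \<in> M j" using ideal.I_r_closed[OF Mi[OF j] p1[OF ee(2)[OF i j] j] a] by simp
    then show ?thesis using ps_kill[OF j] X False by (simp add: wkill_def)
  qed
  then have "pss (ct X (ee i N \<cdot> a)) = (\<Sum>j\<in>J. if j = i then ps i (ct X a) else 0)" by (intro sum.cong refl)
  then show ?thesis using i by simp
qed

end

section \<open>The commuting actions attached to the maximal ideals\<close>

locale fam_module = cur_family C G H2 A k M ps
  for C :: "int^'n^'n" and G :: "('g, 'n::finite) km" and H2 :: "'g set" and A :: "(complex, 'a) module"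
    and k :: nat and M :: "nat \<Rightarrow> 'a set" and ps :: "nat \<Rightarrow> ('g, 'a) cur \<Rightarrow> complex" +
  fixes V :: "(('g, 'a) cur, 'v, 'k) lmod_scheme" and v :: 'v
  assumes hwV: "hwmod V pss v" and fnV: "fnilp V v"
begin

sublocale V: lie_module Lc V using hwV by (simp add: hwmod_def)

lemma hv: "hwv V pss v" using hwV by (simp add: hwmod_def)
lemmas vc = hwvD(1)[OF hv]

lemmas ann_ev = hwmod_ann[OF hwV fnV MI_ideal pss_kill pss_dom]

text \<open>
  The values under \<open>THE\<close> are eventually constant in \<open>N\<close>, because \<open>ee i N\<close> is determined modulo the \<open>N\<close>-th power
  of the intersection of the ideals and a high power of it annihilates \<open>w\<close>.
\<close>

definition rho where "rho i t w = (THE x. \<forall>\<^sub>F N in sequentially. act V (j0 (mu (ee i N) t)) w = x)"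

lemma mu_e: "\<lbrakk>i \<in> J; t \<in> carrier TT\<rbrakk> \<Longrightarrow> mu (ee i N) t \<in> carrier TT" using muD(1)[OF ee(1)] .

lemma act_e: "\<lbrakk>i \<in> J; t \<in> carrier TT; w \<in> carrier V\<rbrakk> \<Longrightarrow> act V (j0 (mu (ee i N) t)) w \<in> carrier V"
  by (rule V.act_closed[OF j0_closed[OF mu_e]])

lemma act_mu_diff:
  assumes c: "c \<in> carrier A" "d \<in> carrier A" and t: "t \<in> carrier TT" and w: "w \<in> carrier V"
    and z: "act V (j0 (mu (c \<ominus>\<^bsub>A\<^esub> d) t)) w = \<zero>\<^bsub>V\<^esub>"
  shows "act V (j0 (mu c t)) w = act V (j0 (mu d t)) w"
proof -
  have "c = (c \<ominus>\<^bsub>A\<^esub> d) \<oplus>\<^bsub>A\<^esub> d" using c by algebra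
  then have "mu c t = mu (c \<ominus>\<^bsub>A\<^esub> d) t \<oplus>\<^bsub>TT\<^esub> mu d t" using mu_add[of "c \<ominus>\<^bsub>A\<^esub> d" d t] c t by simp
  then show ?thesis using z c t w muD(1) V.act_closed by (simp add: j0D V.act_add_left)
qed

text \<open>The filter is not trivial, so a fact that does not mention \<open>N\<close> may be
  proved for all large \<open>N\<close> only. This removes the auxiliary exponent at the end of each
  limit argument.\<close>

lemma ev_const: "(\<forall>\<^sub>F N in sequentially. P) \<Longrightarrow> P" by simp

lemma rho:
  assumes i: "i \<in> J" and t: "t \<in> carrier TT" and w: "w \<in> carrier V"
  shows "\<forall>\<^sub>F N in sequentially. act V (j0 (mu (ee i N) t)) w = rho i t w"
proof -
  obtain N0 where N0: "\<forall>c\<in>ipow MI N0. act V (j0 (mu c t)) w = \<zero>\<^bsub>V\<^esub>"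
    using eventually_happens'[OF sequentially_bot ann_ev[OF t w]] by blast
  have "act V (j0 (mu (ee i N) t)) w = act V (j0 (mu (ee i N0) t)) w" if "N0 \<le> N" for N
    by (rule act_mu_diff[OF ee(1)[OF i] ee(1)[OF i] t w]) (use N0 ee_diff[OF i that] in blast)
  then have ex: "\<forall>\<^sub>F N in sequentially. act V (j0 (mu (ee i N) t)) w = act V (j0 (mu (ee i N0) t)) w"
    unfolding eventually_sequentially by blast
  have "x = act V (j0 (mu (ee i N0) t)) w" if "\<forall>\<^sub>F N in sequentially. act V (j0 (mu (ee i N) t)) w = x" for x
    by (rule ev_const, use that ex in eventually_elim) simp
  then show ?thesis unfolding rho_def using ex theI[of "\<lambda>x. \<forall>\<^sub>F N in sequentially. act V (j0 (mu (ee i N) t)) w = x"] by blast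
qed

lemma rho_eqI:
  assumes "i \<in> J" "t \<in> carrier TT" "w \<in> carrier V" "\<forall>\<^sub>F N in sequentially. act V (j0 (mu (ee i N) t)) w = x"
  shows "rho i t w = x"
  by (rule ev_const, use rho[OF assms(1-3)] assms(4) in eventually_elim) simp

lemma rho_closed: assumes "i \<in> J" "t \<in> carrier TT" "w \<in> carrier V" shows "rho i t w \<in> carrier V"
  by (rule ev_const, use rho[OF assms] in eventually_elim) (use act_e[OF assms] in metis)

lemma rho_bilin: assumes i: "i \<in> J" shows "bilin TT V V (rho i)"
proof (rule bilinI)
  note e = ee(1)[OF i] and m = muD[OF ee(1)[OF i]]
  fix t w assume t: "t \<in> carrier TT" and w: "w \<in> carrier V"
  show "rho i t w \<in> carrier V" by (rule rho_closed[OF i t w])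
  show "rho i (c \<odot>\<^bsub>TT\<^esub> t) w = c \<odot>\<^bsub>V\<^esub> rho i t w" for c
    by (rule rho_eqI[OF i], use t w in simp_all, use rho[OF i t w] in eventually_elim) (use t w in \<open>simp add: m j0D V.act_smult_left\<close>)
  show "rho i t (c \<odot>\<^bsub>V\<^esub> w) = c \<odot>\<^bsub>V\<^esub> rho i t w" for c
    by (rule rho_eqI[OF i], use t w in simp_all, use rho[OF i t w] in eventually_elim) (use t w in \<open>simp add: m j0D V.act_smult_right\<close>)
  show "rho i (t \<oplus>\<^bsub>TT\<^esub> s) w = rho i t w \<oplus>\<^bsub>V\<^esub> rho i s w" if s: "s \<in> carrier TT" for s
    by (rule rho_eqI[OF i], use t s w in simp_all, use rho[OF i t w] rho[OF i s w] in eventually_elim) (use t s w in \<open>simp add: m j0D V.act_add_left\<close>)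
  show "rho i t (w \<oplus>\<^bsub>V\<^esub> u) = rho i t w \<oplus>\<^bsub>V\<^esub> rho i t u" if u: "u \<in> carrier V" for u
    by (rule rho_eqI[OF i], use t u w in simp_all, use rho[OF i t w] rho[OF i t u] in eventually_elim) (use t u w in \<open>simp add: m j0D V.act_add_right\<close>)
qed

lemmas rhoD = bilinD[OF rho_bilin]
lemmas rho_lin = bilin_lin2[OF rho_bilin]

text \<open>The bracket of \<open>e_i s\<close> and \<open>e_j t\<close> is
  \<open>e_i e_j [s, t]\<close>. The coefficient is congruent to \<open>e_i\<close> for
  \<open>i = j\<close> and to 0 otherwise, modulo a power of the ideal that kills \<open>w\<close>
  together with \<open>[s, t]\<close>.\<close>

lemma rho_comm:
  assumes i: "i \<in> J" and j: "j \<in> J" and s: "s \<in> carrier TT" and t: "t \<in> carrier TT" and w: "w \<in> carrier V"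
  shows "rho i s (rho j t w) = (if i = j then rho i (tt s t) w else \<zero>\<^bsub>V\<^esub>) \<oplus>\<^bsub>V\<^esub> rho j t (rho i s w)"
proof -
  note c = rho_closed[OF j t w] rho_closed[OF i s w]
  have tc: "tt s t \<in> carrier TT" using tt_closed s t .
  have prod: "\<forall>\<^sub>F N in sequentially. act V (j0 (mu (ee i N \<cdot> ee j N) (tt s t))) w = (if i = j then rho i (tt s t) w else \<zero>\<^bsub>V\<^esub>)"
    using ann_ev[OF tc w] rho[OF i tc w]
  proof eventually_elim
    case (elim N)
    show ?case
    proof (cases "i = j")
      case True
      have "act V (j0 (mu (ee i N \<cdot> ee i N) (tt s t))) w = act V (j0 (mu (ee i N) (tt s t))) w"
        by (rule act_mu_diff[OF _ _ tc w]) (use ee(1)[OF i] ee_idem[OF i, of N] elim(1) in auto)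
      then show ?thesis using True elim(2) by simp
    next
      case False then show ?thesis using elim(1) ee_orth[OF i j False] by simp
    qed
  qed
  \<comment> \<open>One exponent has to serve \<open>w\<close> as well as the inner values
    \<open>rho j t w\<close> and \<open>rho i s w\<close>; the inner values are fixed vectors, so a
    large \<open>N\<close> works for all of them.\<close>
  have "\<forall>\<^sub>F N in sequentially. ?thesis"
    using prod rho[OF i s c(1)] rho[OF j t w] rho[OF j t c(2)] rho[OF i s w]
  proof eventually_elim
    case (elim N)
    note es = mu_e[OF i s, of N] and et = mu_e[OF j t, of N]
    have "brack Lc (j0 (mu (ee i N) s)) (j0 (mu (ee j N) t)) = j0 (mu (ee i N \<cdot> ee j N) (tt s t))"
      using es et ee(1)[OF i, of N] ee(1)[OF j, of N] s t tc mu_tt[OF ee(1)[OF i, of N] s et] mu_tt[OF ee(1)[OF j, of N] s t]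
      by (simp add: j0_brack mu_mu)
    then have "act V (j0 (mu (ee i N) s)) (act V (j0 (mu (ee j N) t)) w)
      = act V (j0 (mu (ee i N \<cdot> ee j N) (tt s t))) w \<oplus>\<^bsub>V\<^esub> act V (j0 (mu (ee j N) t)) (act V (j0 (mu (ee i N) s)) w)"
      using V.act_comm[OF j0_closed[OF es] j0_closed[OF et] w] by simp
    then show ?case unfolding elim .
  qed
  then show ?thesis by (rule ev_const)
qed

text \<open>Bracketing with an algebra element commutes with multiplication by
  \<open>ee i N\<close>, so the Leibniz rule for the action passes to the eventual value.\<close>

lemma act_rho:
  assumes i: "i \<in> J" and t: "t \<in> carrier TT" and w: "w \<in> carrier V"
  shows "s \<in> carrier TT \<Longrightarrow> act V (j0 s) (rho i t w) = rho i (tt s t) w \<oplus>\<^bsub>V\<^esub> rho i t (act V (j0 s) w)"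
    "h \<in> H2 \<Longrightarrow> act V (chh h) (rho i t w) = rho i (ht h t) w \<oplus>\<^bsub>V\<^esub> rho i t (act V (chh h) w)"
proof -
  have *: "act V x (rho i t w) = rho i u w \<oplus>\<^bsub>V\<^esub> rho i t (act V x w)"
    if x: "x \<in> carrier Lc" and u: "u \<in> carrier TT" and b: "\<And>N. brack Lc x (j0 (mu (ee i N) t)) = j0 (mu (ee i N) u)" for x u
  proof (rule ev_const)
    show "\<forall>\<^sub>F N in sequentially. act V x (rho i t w) = rho i u w \<oplus>\<^bsub>V\<^esub> rho i t (act V x w)"
    using rho[OF i t w] rho[OF i u w] rho[OF i t V.act_closed[OF x w]]
  proof eventually_elim
    case (elim N)
    have "act V x (act V (j0 (mu (ee i N) t)) w) = act V (j0 (mu (ee i N) u)) w \<oplus>\<^bsub>V\<^esub> act V (j0 (mu (ee i N) t)) (act V x w)"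
      using V.act_comm[OF x j0_closed[OF mu_e[OF i t]] w] b by simp
    then show ?case unfolding elim .
  qed
  qed
  show "act V (j0 s) (rho i t w) = rho i (tt s t) w \<oplus>\<^bsub>V\<^esub> rho i t (act V (j0 s) w)" if s: "s \<in> carrier TT"
    by (rule *[OF j0_closed[OF s] tt_closed[OF s t]]) (simp only: j0_brack(1)[OF s mu_e[OF i t]] mu_tt(2)[OF ee(1)[OF i] s t])
  show "act V (chh h) (rho i t w) = rho i (ht h t) w \<oplus>\<^bsub>V\<^esub> rho i t (act V (chh h) w)" if h: "h \<in> H2"
    by (rule *[OF chh_closed[OF h] htD(1)[OF H2D(3)[OF h] t]]) (simp only: j0_brack(2)[OF h mu_e[OF i t]] mu_ht[OF ee(1)[OF i] H2D(3)[OF h] t])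
qed

lemma act_finsum:
  assumes "finite K" "\<And>i. i \<in> K \<Longrightarrow> c i \<in> carrier A" "t \<in> carrier TT" "w \<in> carrier V"
  shows "act V (j0 (mu (\<Oplus>\<^bsub>A\<^esub>i\<in>K. c i) t)) w = (\<Oplus>\<^bsub>V\<^esub>i\<in>K. act V (j0 (mu (c i) t)) w)"
  using assms(1,2)
proof (induct K rule: finite_induct)
  case empty
  have "mu \<zero>\<^bsub>A\<^esub> t \<oplus>\<^bsub>TT\<^esub> mu \<zero>\<^bsub>A\<^esub> t = mu \<zero>\<^bsub>A\<^esub> t" using mu_add[OF A.zero_closed A.zero_closed assms(3)] by simp
  moreover have mz: "mu \<zero>\<^bsub>A\<^esub> t \<in> carrier TT" using muD(1)[OF A.zero_closed assms(3)] .
  ultimately have "mu \<zero>\<^bsub>A\<^esub> t = \<zero>\<^bsub>TT\<^esub>"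
    by (intro Tn.TV.vs_eqI) (auto simp: Tn.TV.lf_simps dest!: arg_cong[of "mu \<zero>\<^bsub>A\<^esub> t \<oplus>\<^bsub>TT\<^esub> mu \<zero>\<^bsub>A\<^esub> t"])
  then show ?case using assms(4) by (simp add: j0_def cur_simps V.act_zero flip: cur_simps(2))
next
  case (insert i K)
  have "(\<Oplus>\<^bsub>A\<^esub>i\<in>K. c i) \<in> carrier A" using insert by (intro A.finsum_closed) auto
  then show ?case using insert assms(3,4) muD(1) V.act_closed
    by (subst A.finsum_insert, auto simp: Pi_def mu_add j0D V.act_add_left)
qed

text \<open>The sum of the \<open>ee i N\<close> is congruent to 1 modulo a power of the ideal that
  annihilates \<open>w\<close> together with \<open>t\<close>.\<close>

lemma act_sum:
  assumes t: "t \<in> carrier TT" and w: "w \<in> carrier V"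
  shows "act V (j0 t) w = (\<Oplus>\<^bsub>V\<^esub>i\<in>J. rho i t w)"
proof (rule ev_const)
  have "\<forall>\<^sub>F N in sequentially. \<forall>i\<in>J. act V (j0 (mu (ee i N) t)) w = rho i t w"
    by (rule eventually_ball_finite) (use rho[OF _ t w] in auto)
  then show "\<forall>\<^sub>F N in sequentially. act V (j0 t) w = (\<Oplus>\<^bsub>V\<^esub>i\<in>J. rho i t w)"
    using ann_ev[OF t w]
  proof eventually_elim
    case (elim N)
    have S: "(\<Oplus>\<^bsub>A\<^esub>i\<in>J. ee i N) \<in> carrier A" using ee(1) by (intro A.finsum_closed) auto
    have "act V (j0 t) w = act V (j0 (mu \<one>\<^sub>A t)) w" using mu_one[OF t] by simp
    also have "\<dots> = act V (j0 (mu (\<Oplus>\<^bsub>A\<^esub>i\<in>J. ee i N) t)) w"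
      by (rule act_mu_diff[OF S A.one_closed t w, symmetric]) (use elim(2) ee_sum in blast)
    also have "\<dots> = (\<Oplus>\<^bsub>V\<^esub>i\<in>J. act V (j0 (mu (ee i N) t)) w)" by (rule act_finsum[OF _ ee(1) t w]) auto
    also have "\<dots> = (\<Oplus>\<^bsub>V\<^esub>i\<in>J. rho i t w)" by (rule abelian_monoid.finsum_cong'[OF abelian_group.axioms(1)[OF vspace.axioms(1)[OF V.VV.vspace_axioms]]]) (use elim(1) rho_closed[OF _ t w] in auto)
    finally show ?case .
  qed
qed

lemma rho_hw:
  assumes i: "i \<in> J" and a: "a \<in> carrier A"
  shows "X \<in> nil_plus G \<Longrightarrow> rho i (pt X a) v = \<zero>\<^bsub>V\<^esub>" "X \<in> cartan' G \<Longrightarrow> rho i (pt X a) v = ps i (ct X a) \<odot>\<^bsub>V\<^esub> v"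
proof -
  show "rho i (pt X a) v = \<zero>\<^bsub>V\<^esub>" if X: "X \<in> nil_plus G"
  proof -
    have "act V (j0 (mu (ee i N) (pt X a))) v = \<zero>\<^bsub>V\<^esub>" for N
      using hwvD(2)[OF hv X, of "ee i N \<cdot> a"] ee(1)[OF i] a nilD[OF X] by (simp add: mu j0_pt)
    then show ?thesis by (intro rho_eqI[OF i pt_simps(1)[OF nilD[OF X] a] vc]) simp
  qed
  show "rho i (pt X a) v = ps i (ct X a) \<odot>\<^bsub>V\<^esub> v" if X: "X \<in> cartan' G"
  proof (rule rho_eqI[OF i pt_simps(1)[OF cartan'D(1)[OF X] a] vc])
    have "act V (j0 (mu (ee i N) (pt X a))) v = ps i (ct X a) \<odot>\<^bsub>V\<^esub> v" if "1 \<le> N" for N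
      using hwvD(3)[OF hv X, of "ee i N \<cdot> a"] ee(1)[OF i] a cartan'D(1)[OF X] pss_ee[OF i that X a] by (simp add: mu j0_pt)
    then show "\<forall>\<^sub>F N in sequentially. act V (j0 (mu (ee i N) (pt X a))) v = ps i (ct X a) \<odot>\<^bsub>V\<^esub> v"
      unfolding eventually_sequentially by blast
  qed
qed

end

lemma (in cur) chh_ops: "\<lbrakk>h \<in> H2; k \<in> H2\<rbrakk> \<Longrightarrow> chh (h \<oplus>\<^bsub>G\<^esub> k) = chh h \<oplus>\<^bsub>Lc\<^esub> chh k"
  "h \<in> H2 \<Longrightarrow> chh (c \<odot>\<^bsub>G\<^esub> h) = c \<odot>\<^bsub>Lc\<^esub> chh h" "chh \<zero>\<^bsub>G\<^esub> = \<zero>\<^bsub>Lc\<^esub>"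
  by (simp_all add: chh_eq cur_simps)

text \<open>The least subspace that contains \<open>z\<close> and is stable under
  \<open>g' \<otimes> A\<close> is stable under \<open>h''\<close> too, since \<open>h''\<close>
  scales \<open>z\<close> and normalizes \<open>g' \<otimes> A\<close>. It is therefore a
  submodule.\<close>

lemma (in cur) j0_generated:
  assumes Z: "hwmod Z \<psi> z" and S: "subsp Z S" and z: "z \<in> S"
    and st: "\<And>t w. \<lbrakk>t \<in> carrier TT; w \<in> S\<rbrakk> \<Longrightarrow> act Z (j0 t) w \<in> S"
  shows "S = carrier Z"
proof -
  interpret Z: lie_module Lc Z using Z by (simp add: hwmod_def)
  have hz: "hwv Z \<psi> z" using Z by (simp add: hwmod_def)
  define X where "X = {S. subsp Z S \<and> z \<in> S \<and> (\<forall>t\<in>carrier TT. \<forall>w\<in>S. act Z (j0 t) w \<in> S)}"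
  define S0 where "S0 = \<Inter>X"
  have SX: "S \<in> X" using S z st by (simp add: X_def)
  have S0: "subsp Z S0" "z \<in> S0" "\<And>t w. \<lbrakk>t \<in> carrier TT; w \<in> S0\<rbrakk> \<Longrightarrow> act Z (j0 t) w \<in> S0"
  proof -
    show "subsp Z S0" unfolding subsp_def S0_def
    proof (intro conjI ballI allI)
      show "\<Inter>X \<subseteq> carrier Z" using SX subspD(1)[OF S] by blast
    qed (auto simp: X_def subsp_def)
  qed (auto simp: S0_def X_def)
  have least: "S0 \<subseteq> T" if "subsp Z T" "z \<in> T" "\<And>t w. \<lbrakk>t \<in> carrier TT; w \<in> T\<rbrakk> \<Longrightarrow> act Z (j0 t) w \<in> T" for T
    using that unfolding S0_def X_def by blast
  note D = subspD[OF S0(1)]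
  \<comment> \<open>Minimality of \<open>S0\<close> serves as an induction principle:
    \<open>?T\<close> contains \<open>z\<close> and is stable, hence it is all of
    \<open>S0\<close>.\<close>
  let ?T = "{w \<in> S0. \<forall>h\<in>H2. act Z (chh h) w \<in> S0}"
  have "S0 \<subseteq> ?T"
  proof (rule least)
    show "subsp Z ?T" using D by (auto simp: subsp_def Z.act_zero Z.act_add_right Z.act_smult_right)
    show "z \<in> ?T" using hwvD(4)[OF hz] D(4)[OF S0(2)] S0(2) by simp
    fix t w assume t: "t \<in> carrier TT" and w: "w \<in> ?T"
    have "act Z (chh h) (act Z (j0 t) w) \<in> S0" if h: "h \<in> H2" for h
    proof -
      have ht: "ht h t \<in> carrier TT" using htD(1)[OF H2D(3)[OF h] t] .
      have "act Z (chh h) (act Z (j0 t) w) = act Z (j0 (ht h t)) w \<oplus>\<^bsub>Z\<^esub> act Z (j0 t) (act Z (chh h) w)"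
        using Z.act_comm[OF chh_closed[OF h] j0_closed[OF t], of w] j0_brack(2)[OF h t] w D(1) by simp
      then show ?thesis using S0(3)[OF ht, of w] S0(3)[OF t, of "act Z (chh h) w"] w h D(3) by simp
    qed
    then show "act Z (j0 t) w \<in> ?T" using S0(3)[OF t] w by blast
  qed
  then have hs: "act Z (chh h) w \<in> S0" if "h \<in> H2" "w \<in> S0" for h w using that by blast
  have "lie_submodule Lc Z S0" unfolding Z.lie_submodule_iff
  proof (intro conjI ballI)
    fix x w assume "x \<in> carrier Lc" and w: "w \<in> S0"
    then obtain t h where th: "t \<in> carrier TT" "h \<in> H2" "x = j0 t \<oplus>\<^bsub>Lc\<^esub> chh h" using Lc_cases by blast
    then show "act Z x w \<in> S0" using S0(3)[OF th(1) w] hs[OF th(2) w] D(3) D(1)[OF w] by (simp add: Z.act_add_left)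
  qed (rule S0(1))
  then have "S0 = carrier Z" using Z S0(2) by (simp add: hwmod_def)
  then show ?thesis using SX subspD(1)[OF S] by (auto simp: S0_def)
qed

context fam_module
begin

text \<open>The elements of \<open>h''\<close> act as before, shifted by a scalar so that the weight of \<open>v\<close> becomes \<open>ps i\<close>.\<close>

definition cc where "cc i h = pss (chh h) - ps i (chh h)"
definition tau where "tau i x w = (rho i (fst x) w \<oplus>\<^bsub>V\<^esub> act V (chh (snd x)) w) \<oplus>\<^bsub>V\<^esub> (- cc i (snd x)) \<odot>\<^bsub>V\<^esub> w"
abbreviation "Vt i \<equiv> V\<lparr>act := tau i\<rparr>"

lemma cc_lin: assumes "i \<in> J" shows "\<lbrakk>h \<in> H2; b \<in> H2\<rbrakk> \<Longrightarrow> cc i (h \<oplus>\<^bsub>G\<^esub> b) = cc i h + cc i b"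
  "h \<in> H2 \<Longrightarrow> cc i (c \<odot>\<^bsub>G\<^esub> h) = c * cc i h" "cc i \<zero>\<^bsub>G\<^esub> = 0"
  using wformD[OF domD(1)[OF ps_dom[OF assms]]] wformD[OF pss_wform] cur_mem(3)
  by (simp_all add: cc_def chh_ops algebra_simps)

lemma rho_zero: assumes "i \<in> J" "w \<in> carrier V" shows "rho i \<zero>\<^bsub>TT\<^esub> w = \<zero>\<^bsub>V\<^esub>"
  using rhoD(4)[OF assms(1) Tn.TV.zc assms(2), of 0] rho_closed[OF assms(1) Tn.TV.zc assms(2)] by simp

text \<open>Brackets have no component in \<open>h''\<close>, so the scalar shift is a character and
  does not disturb the module law. The remaining cases are \<open>rho_comm\<close> for
  \<open>i = j\<close>, \<open>act_rho\<close> and the commutativity of \<open>h''\<close>.\<close>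

lemma Vt_module: assumes i: "i \<in> J" shows "lie_module Lc (Vt i)"
proof (rule lie_moduleI[OF lie_cur])
  show Vv: "vspace (Vt i)" by (rule vspace_cong[OF V.VV.vspace_axioms]) simp_all
  note R = rhoD[OF i] and h = subspD[OF H2D(1)] H2D(3) and c = cc_lin[OF i]
  have tc: "tau i x w \<in> carrier V" if "x \<in> carrier Lc" "w \<in> carrier V" for x w
  proof -
    have "fst x \<in> carrier TT" "snd x \<in> H2" using that(1) by (auto simp: cur_simps)
    then show ?thesis using that(2) R(1) V.act_closed[OF chh_closed] by (simp add: tau_def)
  qed
  show "bilin Lc (Vt i) (Vt i) (act (Vt i))"
  proof (rule bilinI; simp)
    fix x w assume x: "x \<in> carrier Lc" and w: "w \<in> carrier V"
    obtain s a where xs: "x = (s, a)" "s \<in> carrier TT" "a \<in> H2" using x by (auto simp: cur_simps)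
    show "tau i x w \<in> carrier V" by (rule tc[OF x w])
    show "tau i (d \<odot>\<^bsub>Lc\<^esub> x) w = d \<odot>\<^bsub>V\<^esub> tau i x w" for d
      unfolding tau_def xs cur_simps fst_conv snd_conv
      using xs w R V.act_closed by (simp add: chh_ops c V.act_smult_left V.VV.sm_add_r V.VV.sm_assoc)
    show "tau i x (d \<odot>\<^bsub>V\<^esub> w) = d \<odot>\<^bsub>V\<^esub> tau i x w" for d
      using xs w R V.act_closed
      by (simp add: tau_def V.act_smult_right V.VV.sm_add_r V.VV.sm_assoc mult.commute)
    show "tau i (x \<oplus>\<^bsub>Lc\<^esub> y) w = tau i x w \<oplus>\<^bsub>V\<^esub> tau i y w" if y: "y \<in> carrier Lc" for y
    proof -
      obtain t b where yt: "y = (t, b)" "t \<in> carrier TT" "b \<in> H2" using y by (auto simp: cur_simps)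
      show ?thesis unfolding tau_def xs yt cur_simps fst_conv snd_conv
        by (rule V.VV.vs_eqI) (use xs yt w R V.act_closed h in \<open>simp_all add: chh_ops c V.act_add_left V.VV.lf_simps algebra_simps\<close>)
    qed
    show "tau i x (w \<oplus>\<^bsub>V\<^esub> u) = tau i x w \<oplus>\<^bsub>V\<^esub> tau i x u" if u: "u \<in> carrier V" for u
      unfolding tau_def
      by (rule V.VV.vs_eqI) (use xs u w R V.act_closed in \<open>simp_all add: V.act_add_right V.VV.lf_simps algebra_simps\<close>)
  qed
  fix x y w assume x: "x \<in> carrier Lc" and y: "y \<in> carrier Lc" and "w \<in> carrier (Vt i)"
  then have w: "w \<in> carrier V" by simp
  obtain s a where xs: "x = (s, a)" "s \<in> carrier TT" "a \<in> H2" using x by (auto simp: cur_simps)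
  obtain t b where yt: "y = (t, b)" "t \<in> carrier TT" "b \<in> H2" using y by (auto simp: cur_simps)
  have cl: "tt s t \<in> carrier TT" "ht a t \<in> carrier TT" "ht b s \<in> carrier TT" using xs yt h tt_closed htD(1) by auto
  have "tau i (brack Lc x y) w = tau i x (tau i y w) \<ominus>\<^bsub>V\<^esub> tau i y (tau i x w)"
  proof (rule V.VV.vs_eqI)
    fix \<phi> assume \<phi>: "lf V \<phi>"
    note lfs = V.VV.lf_simps[OF \<phi>]
    have 1: "\<phi> (rho i s (rho i t w)) = \<phi> (rho i (tt s t) w) + \<phi> (rho i t (rho i s w))"
      using rho_comm[OF i i xs(2) yt(2) w] xs yt w cl R(1) by (simp add: lfs)
    have 2: "\<phi> (act V (chh a) (rho i t w)) = \<phi> (rho i (ht a t) w) + \<phi> (rho i t (act V (chh a) w))"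
      "\<phi> (act V (chh b) (rho i s w)) = \<phi> (rho i (ht b s) w) + \<phi> (rho i s (act V (chh b) w))"
      using act_rho(2)[OF i yt(2) w xs(3)] act_rho(2)[OF i xs(2) w yt(3)] xs yt w cl R(1) V.act_closed by (simp_all add: lfs)
    have 3: "act V (chh a) (act V (chh b) w) = act V (chh b) (act V (chh a) w)"
      using V.act_comm[OF chh_closed[OF xs(3)] chh_closed[OF yt(3)] w] brack_ct(4)[OF xs(3) yt(3)] w xs yt V.act_closed
      by (simp add: V.act_zero)
    have mn: "rho i ((tt s t \<oplus>\<^bsub>TT\<^esub> ht a t) \<ominus>\<^bsub>TT\<^esub> ht b s) w = (rho i (tt s t) w \<oplus>\<^bsub>V\<^esub> rho i (ht a t) w) \<oplus>\<^bsub>V\<^esub> (-1) \<odot>\<^bsub>V\<^esub> rho i (ht b s) w"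
      using cl w R by (simp add: Tn.TV.minus_eq')
    show "\<phi> (tau i (brack Lc x y) w) = \<phi> (tau i x (tau i y w) \<ominus>\<^bsub>V\<^esub> tau i y (tau i x w))"
      unfolding tau_def xs yt cur_simps fst_conv snd_conv mn
      using xs yt w cl R V.act_closed
      by (simp add: chh_ops c V.act_zero V.act_add_right V.act_smult_right lfs 1 2 3 algebra_simps)
  qed (use x y w tc Lie.brack_closed in auto)
  then show "act (Vt i) (brack Lc x y) w = act (Vt i) x (act (Vt i) y w) \<ominus>\<^bsub>Vt i\<^esub> act (Vt i) y (act (Vt i) x w)"
    using vspace_cong_ops(1)[OF V.VV.vspace_axioms, of "Vt i"] tc x y w by simp
qed

lemma tau_j0: "\<lbrakk>i \<in> J; t \<in> carrier TT; w \<in> carrier V\<rbrakk> \<Longrightarrow> tau i (j0 t) w = rho i t w"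
  using rho_closed by (simp add: tau_def j0_def chh_ops V.act_zero cc_lin)

lemma Vt_hwv: assumes i: "i \<in> J" shows "hwv (Vt i) (ps i) v"
proof (rule hwvI[OF Vt_module[OF i] domD(1)[OF ps_dom[OF i]]])
  show "v \<in> carrier (Vt i)" using vc by simp
  fix X a assume a: "a \<in> carrier A"
  have *: "act (Vt i) (ct X a) v = rho i (pt X a) v" if "X \<in> derived G"
    using tau_j0[OF i pt_simps(1)[OF that a] vc] by (simp add: j0_pt)
  show "act (Vt i) (ct X a) v = \<zero>\<^bsub>Vt i\<^esub>" if "X \<in> nil_plus G" using *[OF nilD[OF that]] rho_hw(1)[OF i a that] by simp
  show "act (Vt i) (ct X a) v = ps i (ct X a) \<odot>\<^bsub>Vt i\<^esub> v" if "X \<in> cartan' G" using *[OF cartan'D(1)[OF that]] rho_hw(2)[OF i a that] by simp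
next
  fix h assume h: "h \<in> H2"
  have "tau i (chh h) v = pss (chh h) \<odot>\<^bsub>V\<^esub> v \<oplus>\<^bsub>V\<^esub> (- cc i h) \<odot>\<^bsub>V\<^esub> v"
    using hwvD(4)[OF hv h] rho_zero[OF i vc] vc by (simp add: tau_def chh_eq)
  also have "\<dots> = ps i (chh h) \<odot>\<^bsub>V\<^esub> v"
    using V.VV.sm_add_l[OF vc, of "pss (chh h)" "- cc i h"] by (simp add: cc_def)
  finally show "act (Vt i) (chh h) v = ps i (chh h) \<odot>\<^bsub>Vt i\<^esub> v" by simp
qed

text \<open>On \<open>V\<close> the generator \<open>f\<close> acts as \<open>P + Q\<close>, with
  \<open>P\<close> its action under \<open>rho i\<close> and \<open>Q\<close> the contribution of
  the other ideals. The coroot under \<open>rho i\<close> commutes with \<open>Q\<close> and shifts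
  weights under \<open>P\<close>, so \<open>extremal_power_zero\<close> carries nilpotency of
  \<open>P + Q\<close> on \<open>v\<close> over to \<open>P\<close>.\<close>

lemma Vt_fnilp: assumes i: "i \<in> J" shows "fnilp (Vt i) v"
  unfolding fnilp_def
proof
  fix l
  let ?f = "pt (chev_f G l) \<one>\<^sub>A" and ?h = "pt (coroot G l) \<one>\<^sub>A"
  have fc: "?f \<in> carrier TT" and hc: "?h \<in> carrier TT" using chev_f_derived coroot_derived pt_simps(1) by auto
  have b: "tt ?h ?f = (-2) \<odot>\<^bsub>TT\<^esub> ?f"
  proof -
    have "brack G (coroot G l) (chev_f G l) = (-2) \<odot>\<^bsub>G\<^esub> chev_f G l"
      using brack_cartan_f[OF coroot_cartan, of l l] sroot_coroot[of l l] gcm by (simp add: gcm_def)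
    then show ?thesis using chev_f_derived coroot_derived by (simp add: tt_pure pt_simps)
  qed
  obtain s where s: "(act V (fA l \<one>\<^sub>A) ^^ s) v = \<zero>\<^bsub>V\<^esub>" using fnV by (auto simp: fnilp_def)
  \<comment> \<open>\<open>?Q\<close> is written as a difference so that \<open>?P + ?Q\<close> is
    visibly the original action of \<open>f\<close>.\<close>
  let ?P = "rho i ?f" and ?Q = "\<lambda>w. act V (j0 ?f) w \<oplus>\<^bsub>V\<^esub> (-1) \<odot>\<^bsub>V\<^esub> rho i ?f w" and ?B = "rho i ?h"
  note R = rhoD[OF i] and fL = j0_closed[OF fc]
  have BP: "?B (?P w) = ?P (?B w) \<oplus>\<^bsub>V\<^esub> (-2) \<odot>\<^bsub>V\<^esub> ?P w" if w: "w \<in> carrier V" for w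
    using rho_comm[OF i i hc fc w] R(4)[OF fc w, of "-2"] R(1)[OF fc w] R(1)[OF fc R(1)[OF hc w]] b by (simp add: V.VV.vac)
  have "(?P ^^ s) v = \<zero>\<^bsub>V\<^esub>"
  proof (rule V.VV.extremal_power_zero[where Q = ?Q and B = ?B])
    show "lin_map V V ?P" "lin_map V V ?B" using rho_lin[OF i] fc hc by auto
    show "lin_map V V ?Q" by (rule V.VV.lin_map_plus[OF V.lin_map_act[OF fL] V.VV.lin_map_scale[OF rho_lin[OF i fc]]])
    show "v \<in> carrier V" by (rule vc)
    show "?B v = ps i (ct (coroot G l) \<one>\<^sub>A) \<odot>\<^bsub>V\<^esub> v" by (rule rho_hw(2)[OF i _ coroot_cartan']) simp
    fix w assume w: "w \<in> carrier V"
    show "?B (?P w) = ?P (?B w) \<oplus>\<^bsub>V\<^esub> (-2) \<odot>\<^bsub>V\<^esub> ?P w" by (rule BP[OF w])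
    have fw: "act V (j0 ?f) w \<in> carrier V" "?B w \<in> carrier V" "?P w \<in> carrier V" using V.act_closed[OF fL w] R(1) hc fc w by auto
    have "tt ?f ?h = (-1) \<odot>\<^bsub>TT\<^esub> ((-2) \<odot>\<^bsub>TT\<^esub> ?f)" using tt_anti[OF fc hc] b by simp
    then have 1: "act V (j0 ?f) (?B w) = 2 \<odot>\<^bsub>V\<^esub> ?P w \<oplus>\<^bsub>V\<^esub> ?B (act V (j0 ?f) w)"
      using act_rho(1)[OF i hc w fc] fc w R by (simp add: Tn.TV.sm_assoc)
    show "?B (?Q w) = ?Q (?B w)"
    proof (rule V.VV.vs_eqI)
      fix \<phi> assume \<phi>: "lf V \<phi>"
      show "\<phi> (?B (?Q w)) = \<phi> (?Q (?B w))"
        using w fc hc fw R V.act_closed[OF fL] by (simp add: 1 BP V.VV.lf_simps[OF \<phi>])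
    qed (use w fc hc fw R V.act_closed[OF fL] in auto)
  next
    have "((\<lambda>w. ?P w \<oplus>\<^bsub>V\<^esub> ?Q w) ^^ n) v = (act V (j0 ?f) ^^ n) v \<and> (act V (j0 ?f) ^^ n) v \<in> carrier V" for n
    proof (rule funpow_cong_on[OF _ _ vc])
      fix w assume w: "w \<in> carrier V"
      show "act V (j0 ?f) w \<in> carrier V" by (rule V.act_closed[OF fL w])
      show "?P w \<oplus>\<^bsub>V\<^esub> ?Q w = act V (j0 ?f) w"
        by (rule V.VV.vs_eqI) (use R(1)[OF fc w] V.act_closed[OF fL w] in \<open>simp_all add: V.VV.lf_simps\<close>)
    qed
    then show "((\<lambda>w. ?P w \<oplus>\<^bsub>V\<^esub> ?Q w) ^^ s) v = \<zero>\<^bsub>V\<^esub>" using s by (simp add: j0_pt)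
  qed
  moreover have "(act (Vt i) (fA l \<one>\<^sub>A) ^^ n) v = (?P ^^ n) v \<and> (?P ^^ n) v \<in> carrier V" for n
    by (rule funpow_cong_on[OF _ _ vc]) (use tau_j0[OF i fc] R(1)[OF fc] in \<open>simp_all add: j0_pt\<close>)
  ultimately show "\<exists>n. (act (Vt i) (fA l \<one>\<^sub>A) ^^ n) v = \<zero>\<^bsub>Vt i\<^esub>" by auto
qed

end

section \<open>The left inverse of the map to the tensor product\<close>

locale fam_hom = fam_module C G H2 A k M ps V v
  for C :: "int^'n^'n" and G :: "('g, 'n::finite) km" and H2 :: "'g set" and A :: "(complex, 'a) module"
    and k :: nat and M :: "nat \<Rightarrow> 'a set" and ps :: "nat \<Rightarrow> ('g, 'a) cur \<Rightarrow> complex"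
    and V :: "(('g, 'a) cur, 'v, 'k) lmod_scheme" and v :: 'v +
  fixes W :: "nat \<Rightarrow> (('g, 'a) cur, 'w, 'l) lmod_scheme" and u :: "nat \<Rightarrow> 'w"
  assumes hwW: "i \<in> J \<Longrightarrow> hwmod (W i) (ps i) (u i)"
    and fnW: "i \<in> J \<Longrightarrow> fnilp (W i) (u i)"
    and homW: "i \<in> J \<Longrightarrow> \<exists>f. lhom Lc (W i) (Vt i) f \<and> f (u i) = v"
begin

sublocale T: tfam Lc "{1..k}" W
  by (intro tfam.intro tfam_axioms.intro lie_cur) (use hwW in \<open>auto simp: hwmod_def\<close>)

lemma uc: "i \<in> J \<Longrightarrow> u i \<in> carrier (W i)" using hwvD(1)[of "W i" "ps i" "u i"] hwW[of i] by (simp add: hwmod_def)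

text \<open>\<open>Zs i\<close> consists of the vectors that are the image of the generator of \<open>W i\<close> under a \<open>rho i\<close>-equivariant map.\<close>

definition eqv where "eqv i p z \<longleftrightarrow> lin_map (W i) V p \<and> p (u i) = z \<and>
  (\<forall>t\<in>carrier TT. \<forall>w\<in>carrier (W i). p (act (W i) (j0 t) w) = rho i t (p w))"
definition Zs where "Zs i = {z \<in> carrier V. \<exists>p. eqv i p z}"
definition ph where "ph i z = (SOME p. eqv i p z)"

lemma W_gen:
  assumes "i \<in> J" "subsp (W i) S" "u i \<in> S" "\<And>t w. \<lbrakk>t \<in> carrier TT; w \<in> S\<rbrakk> \<Longrightarrow> act (W i) (j0 t) w \<in> S"
  shows "S = carrier (W i)"
  by (rule j0_generated[OF hwW[OF assms(1)] assms(2-4)])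

text \<open>An equivariant map is determined by the image of the generator, because
  \<open>W i\<close> is generated by \<open>g' \<otimes> A\<close>. Consequently
  \<open>ph i z\<close> depends linearly on \<open>z\<close>.\<close>

lemma eqv_unique:
  assumes i: "i \<in> J" and p: "eqv i p z" and q: "eqv i q z" and w: "w \<in> carrier (W i)"
  shows "p w = q w"
proof -
  have pl: "lin_map (W i) V p" and ql: "lin_map (W i) V q" using p q by (auto simp: eqv_def)
  have "{w \<in> carrier (W i). p w = q w} = carrier (W i)"
  proof (rule W_gen[OF i])
    show "subsp (W i) {w \<in> carrier (W i). p w = q w}"
      unfolding subsp_def using T.Vcl(1-3)[OF i] lin_mapD(2,3)[OF pl] lin_mapD(2,3)[OF ql]
        lin_map_zero[OF pl T.Vvs[OF i] V.VV.vspace_axioms] lin_map_zero[OF ql T.Vvs[OF i] V.VV.vspace_axioms] by auto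
    show "u i \<in> {w \<in> carrier (W i). p w = q w}" using p q uc[OF i] by (simp add: eqv_def)
    fix t w assume "t \<in> carrier TT" "w \<in> {w \<in> carrier (W i). p w = q w}"
    then show "act (W i) (j0 t) w \<in> {w \<in> carrier (W i). p w = q w}"
      using p q T.Vcl(4)[OF i] by (simp add: eqv_def)
  qed
  then show ?thesis using w by blast
qed

lemma ph: "z \<in> Zs i \<Longrightarrow> eqv i (ph i z) z"
  using someI_ex[of "\<lambda>p. eqv i p z"] by (auto simp: ph_def Zs_def)

lemma ph_eq: assumes i: "i \<in> J" and z: "z \<in> carrier V" and p: "eqv i p z" and w: "w \<in> carrier (W i)"
  shows "z \<in> Zs i" "ph i z w = p w"
proof -
  show "z \<in> Zs i" using z p by (auto simp: Zs_def)
  then show "ph i z w = p w" using eqv_unique[OF i ph p w] by blast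
qed

lemma phD:
  assumes z: "z \<in> Zs i"
  shows "lin_map (W i) V (ph i z)" "ph i z (u i) = z"
    "\<lbrakk>t \<in> carrier TT; w \<in> carrier (W i)\<rbrakk> \<Longrightarrow> ph i z (act (W i) (j0 t) w) = rho i t (ph i z w)"
  using ph[OF z] by (auto simp: eqv_def)

lemma ZsV: "z \<in> Zs i \<Longrightarrow> z \<in> carrier V" by (simp add: Zs_def)

lemma ph_closed: "\<lbrakk>z \<in> Zs i; w \<in> carrier (W i)\<rbrakk> \<Longrightarrow> ph i z w \<in> carrier V"
  using lin_mapD(1)[OF phD(1)] .

lemma Zs_v: assumes i: "i \<in> J" shows "v \<in> Zs i"
proof -
  obtain f where f: "lhom Lc (W i) (Vt i) f" "f (u i) = v" using homW[OF i] by blast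
  have l: "lin_map (W i) V f" using lhomD(1)[OF f(1)] by (simp add: lin_map_def)
  have "f (act (W i) (j0 t) w) = rho i t (f w)" if "t \<in> carrier TT" "w \<in> carrier (W i)" for t w
    using lhomD(2)[OF f(1) j0_closed[OF that(1)] that(2)] tau_j0[OF i that(1) lin_mapD(1)[OF l that(2)]] by simp
  then have "eqv i f v" using l f(2) by (simp add: eqv_def)
  then show ?thesis using vc by (auto simp: Zs_def)
qed

lemma Zs_add:
  assumes i: "i \<in> J" and z: "z \<in> Zs i" "z' \<in> Zs i"
  shows "z \<oplus>\<^bsub>V\<^esub> z' \<in> Zs i" "w \<in> carrier (W i) \<Longrightarrow> ph i (z \<oplus>\<^bsub>V\<^esub> z') w = ph i z w \<oplus>\<^bsub>V\<^esub> ph i z' w"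
proof -
  have "eqv i (\<lambda>w. ph i z w \<oplus>\<^bsub>V\<^esub> ph i z' w) (z \<oplus>\<^bsub>V\<^esub> z')"
    unfolding eqv_def using V.VV.lin_map_plus[OF phD(1)[OF z(1)] phD(1)[OF z(2)]] phD(2,3)[OF z(1)] phD(2,3)[OF z(2)]
      rhoD(3)[OF i] ph_closed[OF z(1)] ph_closed[OF z(2)] by simp
  note e = ph_eq[OF i _ this]
  show "z \<oplus>\<^bsub>V\<^esub> z' \<in> Zs i" using e(1)[OF _ uc[OF i]] ZsV z by simp
  show "w \<in> carrier (W i) \<Longrightarrow> ph i (z \<oplus>\<^bsub>V\<^esub> z') w = ph i z w \<oplus>\<^bsub>V\<^esub> ph i z' w" using e(2) ZsV z by simp
qed

lemma Zs_smult:
  assumes i: "i \<in> J" and z: "z \<in> Zs i"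
  shows "c \<odot>\<^bsub>V\<^esub> z \<in> Zs i" "w \<in> carrier (W i) \<Longrightarrow> ph i (c \<odot>\<^bsub>V\<^esub> z) w = c \<odot>\<^bsub>V\<^esub> ph i z w"
proof -
  have "eqv i (\<lambda>w. c \<odot>\<^bsub>V\<^esub> ph i z w) (c \<odot>\<^bsub>V\<^esub> z)"
    unfolding eqv_def using V.VV.lin_map_scale[OF phD(1)[OF z]] phD(2,3)[OF z] rhoD(5)[OF i] ph_closed[OF z] by simp
  note e = ph_eq[OF i _ this]
  show "c \<odot>\<^bsub>V\<^esub> z \<in> Zs i" using e(1)[OF _ uc[OF i]] ZsV z by simp
  show "w \<in> carrier (W i) \<Longrightarrow> ph i (c \<odot>\<^bsub>V\<^esub> z) w = c \<odot>\<^bsub>V\<^esub> ph i z w" using e(2) ZsV z by simp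
qed

text \<open>For \<open>j \<noteq> i\<close> the operator \<open>rho j s\<close> commutes with
  \<open>rho i\<close>, so composing an equivariant map with it gives another equivariant
  map.\<close>

lemma Zs_rho:
  assumes i: "i \<in> J" and j: "j \<in> J" and ij: "i \<noteq> j" and z: "z \<in> Zs i" and s: "s \<in> carrier TT"
  shows "rho j s z \<in> Zs i" "w \<in> carrier (W i) \<Longrightarrow> ph i (rho j s z) w = rho j s (ph i z w)"
proof -
  have "rho j s (rho i t x) = rho i t (rho j s x)" if "t \<in> carrier TT" "x \<in> carrier V" for t x
    using rho_comm[OF i j that(1) s that(2)] ij rho_closed[OF i that(1) rho_closed[OF j s that(2)]]
      rho_closed[OF j s rho_closed[OF i that]] by simp
  then have "eqv i (\<lambda>w. rho j s (ph i z w)) (rho j s z)"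
    unfolding eqv_def using lin_map_comp[OF phD(1)[OF z] rho_lin[OF j s]] phD(2,3)[OF z] ph_closed[OF z] by simp
  note e = ph_eq[OF i rho_closed[OF j s ZsV[OF z]] this]
  show "rho j s z \<in> Zs i" using e(1)[OF uc[OF i]] .
  show "w \<in> carrier (W i) \<Longrightarrow> ph i (rho j s z) w = rho j s (ph i z w)" by (rule e(2))
qed

lemma Zs_zero: assumes i: "i \<in> J" shows "\<zero>\<^bsub>V\<^esub> \<in> Zs i"
  using Zs_smult(1)[OF i Zs_v[OF i], of 0] vc by simp

text \<open>The generator is sent to \<open>z\<close>, which lies in \<open>Zs j\<close>, and the
  other values arise by applying \<open>rho i\<close>, which preserves \<open>Zs j\<close>. Thus the
  map for another factor can be applied to the result.\<close>

lemma Zs_ph: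
  assumes i: "i \<in> J" and j: "j \<in> J" and ij: "i \<noteq> j" and z: "z \<in> Zs i" and z': "z \<in> Zs j" and w: "w \<in> carrier (W i)"
  shows "ph i z w \<in> Zs j"
proof -
  note p = lin_mapD[OF phD(1)[OF z]]
  have "{w \<in> carrier (W i). ph i z w \<in> Zs j} = carrier (W i)"
  proof (rule W_gen[OF i])
    show "subsp (W i) {w \<in> carrier (W i). ph i z w \<in> Zs j}"
      unfolding subsp_def using T.Vcl(1-3)[OF i] p lin_map_zero[OF phD(1)[OF z] T.Vvs[OF i] V.VV.vspace_axioms]
        Zs_zero[OF j] Zs_add(1)[OF j] Zs_smult(1)[OF j] by auto
    show "u i \<in> {w \<in> carrier (W i). ph i z w \<in> Zs j}" using uc[OF i] phD(2)[OF z] z' by simp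
    fix t w assume t: "t \<in> carrier TT" and "w \<in> {w \<in> carrier (W i). ph i z w \<in> Zs j}"
    then have w: "w \<in> carrier (W i)" "ph i z w \<in> Zs j" by auto
    have "ph i z (act (W i) (j0 t) w) \<in> Zs j"
      unfolding phD(3)[OF z t w(1)] by (rule Zs_rho(1)[OF j i _ w(2) t]) (use ij in simp)
    then show "act (W i) (j0 t) w \<in> {w \<in> carrier (W i). ph i z w \<in> Zs j}" using T.Vcl(4)[OF i j0_closed[OF t] w(1)] by simp
  qed
  then show ?thesis using w by blast
qed

text \<open>The factors are numbered from 1; stage 0 is the vector before any factor has been used,
  and stage \<open>n\<close> reads only the coordinates 1 to \<open>n\<close> of
  \<open>x\<close>.\<close>

primrec F where
  "F 0 x = v"
| "F (Suc n) x = ph (Suc n) (F n x) (x (Suc n))"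

lemma F_closed: "n \<le> k \<Longrightarrow> x \<in> T.SS \<Longrightarrow> F n x \<in> carrier V \<and> (\<forall>j\<in>J. n < j \<longrightarrow> F n x \<in> Zs j)"
proof (induct n)
  case 0 then show ?case using vc Zs_v by simp
next
  case (Suc n)
  have i: "Suc n \<in> J" using Suc by simp
  have z: "F n x \<in> Zs (Suc n)" using Suc i by simp
  have w: "x (Suc n) \<in> carrier (W (Suc n))" using T.SSD[OF Suc.prems(2) i] .
  have "ph (Suc n) (F n x) (x (Suc n)) \<in> Zs j" if "j \<in> J" "Suc n < j" for j
    by (rule Zs_ph[OF i that(1) _ z _ w]) (use Suc that in auto)
  then show ?case using ph_closed[OF z w] by simp
qed

lemmas F_Zs = F_closed[THEN conjunct2, rule_format] 

lemma F_indep: "n < i \<Longrightarrow> F n (x(i := a)) = F n x" by (induct n) auto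

lemma F_step:
  assumes "Suc n \<le> k" "x \<in> T.SS"
  shows "Suc n \<in> J" "F n x \<in> Zs (Suc n)" "x (Suc n) \<in> carrier (W (Suc n))"
  using F_Zs[of n x "Suc n"] T.SSD[OF assms(2), of "Suc n"] assms by auto

text \<open>In the last coordinate used this is linearity of \<open>ph\<close> in its argument; in
  an earlier coordinate it passes through the later stages because \<open>ph\<close> is linear in
  the image of the generator.\<close>

lemma F_lin:
  assumes "n \<le> k" "i \<in> J" "i \<le> n" "x \<in> T.SS" "a \<in> carrier (W i)" "b \<in> carrier (W i)"
  shows "F n (x(i := a \<oplus>\<^bsub>W i\<^esub> b)) = F n (x(i := a)) \<oplus>\<^bsub>V\<^esub> F n (x(i := b)) \<and> F n (x(i := c \<odot>\<^bsub>W i\<^esub> a)) = c \<odot>\<^bsub>V\<^esub> F n (x(i := a))"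
  using assms(1,3)
proof (induct n)
  case 0 then show ?case using assms(2) by simp
next
  case (Suc n)
  have upd: "x(i := a) \<in> T.SS" "x(i := b) \<in> T.SS" using T.upd[OF assms(4,2)] assms(5,6) by auto
  note F = F_step[OF Suc.prems(1)]
  show ?case
  proof (cases "i = Suc n")
    case True
    note p = lin_mapD[OF phD(1)[OF F(2)[OF assms(4)]]]
    show ?thesis unfolding True F.simps F_indep[OF lessI] fun_upd_same using True assms(5,6) p by simp
  next
    case False
    then have le: "i \<le> n" using Suc.prems(2) by simp
    have IH: "F n (x(i := a \<oplus>\<^bsub>W i\<^esub> b)) = F n (x(i := a)) \<oplus>\<^bsub>V\<^esub> F n (x(i := b))" "F n (x(i := c \<odot>\<^bsub>W i\<^esub> a)) = c \<odot>\<^bsub>V\<^esub> F n (x(i := a))"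
      using Suc.hyps[OF Suc_leD[OF Suc.prems(1)] le] by blast+
    have ne: "Suc n \<noteq> i" using False by simp
    show ?thesis unfolding F.simps fun_upd_other[OF ne] IH
      by (intro conjI Zs_add(2)[OF F(1)[OF assms(4)] F(2)[OF upd(1)] F(2)[OF upd(2)] F(3)[OF assms(4)]]
        Zs_smult(2)[OF F(1)[OF assms(4)] F(2)[OF upd(1)] F(3)[OF assms(4)]])
  qed
qed

lemma F_act:
  assumes "n \<le> k" "i \<in> J" "i \<le> n" "x \<in> T.SS" "t \<in> carrier TT"
  shows "F n (x(i := act (W i) (j0 t) (x i))) = rho i t (F n x)"
  using assms(1,3)
proof (induct n)
  case 0 then show ?case using assms(2) by simp
next
  case (Suc n)
  note F = F_step[OF Suc.prems(1) assms(4)]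
  show ?case
  proof (cases "i = Suc n")
    case True
    show ?thesis unfolding True F.simps F_indep[OF lessI] fun_upd_same by (rule phD(3)[OF F(2) assms(5) F(3)])
  next
    case False
    then have le: "i \<le> n" using Suc.prems(2) by simp
    have IH: "F n (x(i := act (W i) (j0 t) (x i))) = rho i t (F n x)" by (rule Suc.hyps[OF Suc_leD[OF Suc.prems(1)] le])
    have ne: "Suc n \<noteq> i" using False by simp
    show ?thesis unfolding F.simps fun_upd_other[OF ne] IH by (rule Zs_rho(2)[OF F(1) assms(2) ne F(2) assms(5) F(3)])
  qed
qed

abbreviation "uu \<equiv> restrict u J"
lemma uuS: "uu \<in> T.SS" using uc by auto

lemma F_uu: "n \<le> k \<Longrightarrow> F n uu = v"
  by (induct n) (simp_all add: phD(2)[OF Zs_v])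

text \<open>The Leibniz sum over the slots is sent to the sum of the \<open>rho i\<close>, which by
  \<open>act_sum\<close> is the action of \<open>g' \<otimes> A\<close> on \<open>V\<close>.\<close>

lemma Psi_ex:
  "\<exists>\<Psi>. lin_map T.TF V \<Psi> \<and> \<Psi> (T.gen uu) = v \<and>
    (\<forall>t\<in>carrier TT. \<forall>x\<in>carrier T.TF. \<Psi> (act T.TM (j0 t) x) = act V (j0 t) (\<Psi> x))"
proof -
  have "T.multilin V (F k)"
    unfolding T.multilin_def using F_closed[of k] F_lin[of k] by simp
  then obtain \<Psi> where P: "lin_map T.TF V \<Psi>" "\<And>x. x \<in> T.SS \<Longrightarrow> \<Psi> (T.gen x) = F k x"
    using T.multilin_lift[OF V.VV.vspace_axioms] by blast
  interpret TM: lie_module Lc T.TM by (rule T.TM_module)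
  have "\<Psi> (act T.TM (j0 t) x) = act V (j0 t) (\<Psi> x)" if t: "t \<in> carrier TT" and x: "x \<in> carrier T.TF" for t x
  proof (rule T.PF.lin_map_eq[OF V.VV.vspace_axioms _ _ x])
    have "lin_map T.TF T.TF (act T.TM (j0 t))"
      using TM.lin_map_act[OF j0_closed[OF t]] unfolding lin_map_def T.TM_simps .
    then show "lin_map T.TF V (\<lambda>x. \<Psi> (act T.TM (j0 t) x))" by (rule lin_map_comp[OF _ P(1)])
    show "lin_map T.TF V (\<lambda>x. act V (j0 t) (\<Psi> x))" by (rule lin_map_comp[OF P(1) V.lin_map_act[OF j0_closed[OF t]]])
    fix x assume x: "x \<in> T.SS"
    have xu: "x(i := act (W i) (j0 t) (x i)) \<in> T.SS" if "i \<in> J" for i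
      using T.upd[OF x that T.Vcl(4)[OF that j0_closed[OF t] T.SSD[OF x that]]] .
    have Fx: "F k x \<in> carrier V" using F_closed[of k x] x by simp
    show "\<Psi> (act T.TM (j0 t) (T.gen x)) = act V (j0 t) (\<Psi> (T.gen x))"
    proof (rule V.VV.vs_eqI)
      fix \<phi> assume \<phi>: "lf V \<phi>"
      have "\<phi> (\<Psi> (act T.TM (j0 t) (T.gen x))) = (\<Sum>i\<in>J. \<phi> (\<Psi> (T.gen (x(i := act (W i) (j0 t) (x i))))))"
        unfolding T.TM_act_gen[OF j0_closed[OF t] x]
        by (rule T.PF.P.lf_finsum[OF lf_comp[OF P(1) \<phi>]]) (rule T.PF.gen_closed[OF xu])
      also have "\<dots> = (\<Sum>i\<in>J. \<phi> (rho i t (F k x)))"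
        by (rule sum.cong[OF refl]) (use P(2)[OF xu] F_act[OF _ _ _ x t] in simp)
      also have "\<dots> = \<phi> (act V (j0 t) (F k x))"
        unfolding act_sum[OF t Fx] by (rule V.VV.lf_finsum[OF \<phi>, symmetric]) (rule rho_closed[OF _ t Fx])
      finally show "\<phi> (\<Psi> (act T.TM (j0 t) (T.gen x))) = \<phi> (act V (j0 t) (\<Psi> (T.gen x)))" using P(2)[OF x] by simp
    next
      show "\<Psi> (act T.TM (j0 t) (T.gen x)) \<in> carrier V"
        by (rule lin_mapD(1)[OF P(1) TM.act_closed[OF j0_closed[OF t], of "T.gen x", unfolded T.TM_simps, OF T.PF.gen_closed[OF x]]])
      show "act V (j0 t) (\<Psi> (T.gen x)) \<in> carrier V" using V.act_closed[OF j0_closed[OF t] Fx] P(2)[OF x] by simp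
    qed
  qed
  then show ?thesis using P F_uu[of k] uuS by (intro exI[of _ \<Psi>]) simp
qed

end

section \<open>The tensor product as a highest weight module, and the isomorphism\<close>

context fam_hom
begin

lemma TM_eigen:
  assumes x: "x \<in> carrier Lc" and w: "w \<in> T.SS" and e: "\<And>i. i \<in> J \<Longrightarrow> act (W i) x (w i) = c i \<odot>\<^bsub>W i\<^esub> w i"
  shows "act T.TM x (T.gen w) = (\<Sum>i\<in>J. c i) \<odot>\<^bsub>T.TF\<^esub> T.gen w"
proof (rule T.PF.P.vs_eqI)
  note g = T.PF.gen_closed[OF w]
  have wu: "w(i := act (W i) x (w i)) \<in> T.SS" if "i \<in> J" for i using T.upd[OF w that T.Vcl(4)[OF that x T.SSD[OF w that]]] .
  fix \<phi> assume \<phi>: "lf T.TF \<phi>"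
  have "\<phi> (act T.TM x (T.gen w)) = (\<Sum>i\<in>J. \<phi> (T.gen (w(i := act (W i) x (w i)))))"
    unfolding T.TM_act_gen[OF x w] by (rule T.PF.P.lf_finsum[OF \<phi>]) (rule T.PF.gen_closed[OF wu])
  also have "\<dots> = (\<Sum>i\<in>J. c i * \<phi> (T.gen w))"
  proof (rule sum.cong[OF refl])
    fix i assume i: "i \<in> J"
    have "T.gen (w(i := act (W i) x (w i))) = c i \<odot>\<^bsub>T.TF\<^esub> T.gen w"
      unfolding e[OF i] using T.gen_smult[OF w i T.SSD[OF w i], of "c i"] by (simp only: fun_upd_triv)
    then show "\<phi> (T.gen (w(i := act (W i) x (w i)))) = c i * \<phi> (T.gen w)" using T.PF.P.lf_smult[OF \<phi> g] by simp
  qed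
  also have "\<dots> = \<phi> ((\<Sum>i\<in>J. c i) \<odot>\<^bsub>T.TF\<^esub> T.gen w)" unfolding T.PF.P.lf_smult[OF \<phi> g] by (simp only: sum_distrib_right)
  finally show "\<phi> (act T.TM x (T.gen w)) = \<phi> ((\<Sum>i\<in>J. c i) \<odot>\<^bsub>T.TF\<^esub> T.gen w)" .
next
  show "act T.TM x (T.gen w) \<in> carrier T.TF"
    using lie_module.act_closed[OF T.TM_module x, of "T.gen w", unfolded T.TM_simps, OF T.PF.gen_closed[OF w]] .
  show "(\<Sum>i\<in>J. c i) \<odot>\<^bsub>T.TF\<^esub> T.gen w \<in> carrier T.TF" by (rule T.PF.P.sm_closed[OF T.PF.gen_closed[OF w]])
qed

lemma hwu: "i \<in> J \<Longrightarrow> hwv (W i) (ps i) (u i)" using hwW by (simp add: hwmod_def)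

lemma TM_hwv: "hwv T.TM pss (T.gen uu)"
proof (rule hwvI[OF T.TM_module pss_wform], unfold T.TM_simps)
  show "T.gen uu \<in> carrier T.TF" by (rule T.PF.gen_closed[OF uuS])
  show "act T.TM (ct X a) (T.gen uu) = \<zero>\<^bsub>T.TF\<^esub>" if X: "X \<in> nil_plus G" and a: "a \<in> carrier A" for X a
  proof -
    have "act T.TM (ct X a) (T.gen uu) = (\<Sum>i\<in>J. 0) \<odot>\<^bsub>T.TF\<^esub> T.gen uu"
    proof (rule TM_eigen[OF ct_closed[OF nilD[OF X] a] uuS])
      fix i assume i: "i \<in> J"
      show "act (W i) (ct X a) (uu i) = 0 \<odot>\<^bsub>W i\<^esub> uu i"
        using hwvD(2)[OF hwu[OF i] X a] vspace.sm_zero_l[OF T.Vvs[OF i] uc[OF i]] i by simp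
    qed
    then show ?thesis using T.PF.P.sm_zero_l[OF T.PF.gen_closed[OF uuS]] by (simp only: sum.neutral_const)
  qed
  show "act T.TM (ct X a) (T.gen uu) = pss (ct X a) \<odot>\<^bsub>T.TF\<^esub> T.gen uu" if "X \<in> cartan' G" "a \<in> carrier A" for X a
    by (rule TM_eigen[OF ct_closed[OF cartan'D(1)[OF that(1)] that(2)] uuS]) (use hwvD(3)[OF hwu that] in simp)
  show "act T.TM (chh h) (T.gen uu) = pss (chh h) \<odot>\<^bsub>T.TF\<^esub> T.gen uu" if "h \<in> H2" for h
    by (rule TM_eigen[OF chh_closed[OF that] uuS]) (use hwvD(4)[OF hwu that] in simp)
qed

lemma TM_fnilp: "fnilp T.TM (T.gen uu)"
  unfolding fnilp_def T.TM_simps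
proof
  fix l
  show "\<exists>n. (act T.TM (fA l \<one>\<^sub>A) ^^ n) (T.gen uu) = \<zero>\<^bsub>T.TF\<^esub>"
    by (rule T.TM_nilp[OF _ uuS]) (use fnW in \<open>auto simp: fnilp_def\<close>)
qed

lemmas W_ann_ev = hwmod_ann[OF hwW fnW Mi ps_kill ps_dom]

text \<open>Acting with \<open>s \<otimes> e\<close>, where \<open>e \<equiv> 1\<close> modulo a high power of \<open>M i\<close> and \<open>e \<equiv> 0\<close> modulo high powers of
  the other ideals, moves only the \<open>i\<close>-th tensor factor.\<close>

lemma slot_act:
  assumes i: "i \<in> J" and w: "w \<in> T.SS" and s: "s \<in> carrier TT"
  shows "\<exists>t\<in>carrier TT. act T.TM (j0 t) (T.gen w) = T.gen (w(i := act (W i) (j0 s) (w i)))"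
proof -
  have "\<forall>\<^sub>F N in sequentially. \<forall>j\<in>J. \<forall>c\<in>ipow (M j) N. act (W j) (j0 (mu c s)) (w j) = \<zero>\<^bsub>W j\<^esub>"
    by (rule eventually_ball_finite) (use W_ann_ev[OF _ _ _ _ _ s T.SSD[OF w]] in auto)
  then obtain N where N: "\<And>j c. \<lbrakk>j \<in> J; c \<in> ipow (M j) N\<rbrakk> \<Longrightarrow> act (W j) (j0 (mu c s)) (w j) = \<zero>\<^bsub>W j\<^esub>"
    using eventually_happens'[OF sequentially_bot] by blast
  let ?e = "ee i N"
  note ec = ee(1)[OF i, of N] and x = j0_closed[OF mu_e[OF i s, of N]]
  have wc: "act (W j) y (w j) \<in> carrier (W j)" if "j \<in> J" "y \<in> carrier Lc" for j y using T.Vcl(4)[OF that T.SSD[OF w that(1)]] .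
  have other: "act (W j) (j0 (mu ?e s)) (w j) = \<zero>\<^bsub>W j\<^esub>" if "j \<in> J" "j \<noteq> i" for j using N[OF that(1) ee(2)[OF i that]] .
  have same: "act (W i) (j0 (mu ?e s)) (w i) = act (W i) (j0 s) (w i)"
  proof -
    interpret Wi: lie_module Lc "W i" by (rule T.mods[OF i])
    let ?d = "\<one>\<^sub>A \<ominus>\<^bsub>A\<^esub> ?e"
    have d: "?d \<in> carrier A" using ec by simp
    have "?d \<oplus>\<^bsub>A\<^esub> ?e = \<one>\<^sub>A" using ec by algebra
    then have "s = mu ?d s \<oplus>\<^bsub>TT\<^esub> mu ?e s" using mu_add[OF d ec s] mu_one[OF s] by simp
    then have "act (W i) (j0 s) (w i) = act (W i) (j0 (mu ?d s)) (w i) \<oplus>\<^bsub>W i\<^esub> act (W i) (j0 (mu ?e s)) (w i)"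
      using j0D(2)[OF muD(1)[OF d s] muD(1)[OF ec s]] Wi.act_add_left[OF j0_closed[OF muD(1)[OF d s]] x T.SSD[OF w i]] by metis
    then show ?thesis using N[OF i ee(3)[OF i]] wc[OF i x] by simp
  qed
  have "act T.TM (j0 (mu ?e s)) (T.gen w) = T.gen (w(i := act (W i) (j0 s) (w i)))"
  proof (rule T.PF.P.vs_eqI)
    fix \<phi> assume \<phi>: "lf T.TF \<phi>"
    have "\<phi> (act T.TM (j0 (mu ?e s)) (T.gen w)) = (\<Sum>j\<in>J. \<phi> (T.gen (w(j := act (W j) (j0 (mu ?e s)) (w j)))))"
      unfolding T.TM_act_gen[OF x w] by (rule T.PF.P.lf_finsum[OF \<phi>]) (rule T.PF.gen_closed[OF T.upd[OF w _ wc[OF _ x]]])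
    also have "\<dots> = (\<Sum>j\<in>J. if j = i then \<phi> (T.gen (w(i := act (W i) (j0 s) (w i)))) else 0)"
    proof (rule sum.cong[OF refl])
      fix j assume j: "j \<in> J"
      show "\<phi> (T.gen (w(j := act (W j) (j0 (mu ?e s)) (w j)))) = (if j = i then \<phi> (T.gen (w(i := act (W i) (j0 s) (w i)))) else 0)"
      proof (cases "j = i")
        case True then show ?thesis unfolding True same by (simp only: if_True simp_thms)
      next
        case False then show ?thesis by (simp only: other[OF j False] T.gen_zero[OF w j] T.PF.P.lf_zero[OF \<phi>] if_False)
      qed
    qed
    also have "\<dots> = \<phi> (T.gen (w(i := act (W i) (j0 s) (w i))))" using i by simp
    finally show "\<phi> (act T.TM (j0 (mu ?e s)) (T.gen w)) = \<phi> (T.gen (w(i := act (W i) (j0 s) (w i))))" .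
  next
    show "act T.TM (j0 (mu ?e s)) (T.gen w) \<in> carrier T.TF"
      using lie_module.act_closed[OF T.TM_module x, of "T.gen w", unfolded T.TM_simps, OF T.PF.gen_closed[OF w]] .
    show "T.gen (w(i := act (W i) (j0 s) (w i))) \<in> carrier T.TF" by (rule T.PF.gen_closed[OF T.upd[OF w i wc[OF i j0_closed[OF s]]]])
  qed
  then show ?thesis using mu_e[OF i s] by blast
qed

text \<open>Pure tensors are reached one coordinate at a time, starting from the tensor of the
  generators: by \<open>slot_act\<close> the values allowed in a single slot are stable under
  \<open>g' \<otimes> A\<close>, hence they exhaust that factor.\<close>

lemma TM_generated:
  assumes N: "lie_submodule Lc T.TM R" and u: "T.gen uu \<in> R"
  shows "R = carrier T.TM"
proof -
  interpret TM: lie_module Lc T.TM by (rule T.TM_module)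
  have R: "subsp T.TF R" using N unfolding TM.lie_submodule_iff subsp_def T.TM_simps by blast
  have RA: "act T.TM x r \<in> R" if "x \<in> carrier Lc" "r \<in> R" for x r using N that unfolding TM.lie_submodule_iff by blast
  note RD = subspD[OF R]
  \<comment> \<open>\<open>K\<close> is the set of coordinates in which \<open>w\<close> may differ
    from the generators.\<close>
  have P: "T.gen w \<in> R" if "finite K" "K \<subseteq> J" "w \<in> T.SS" "\<And>i. i \<in> J - K \<Longrightarrow> w i = u i" for K w
    using that
  proof (induct K arbitrary: w rule: finite_induct)
    case empty
    have eq: "w = uu" using empty by (intro PiE_ext[OF empty(2) uuS]) simp
    show ?case unfolding eq by (rule u)
  next
    case (insert i K)
    have i: "i \<in> J" using insert by simp
    note w = insert.prems(2)
    let ?S = "{y \<in> carrier (W i). T.gen (w(i := y)) \<in> R}"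
    have "?S = carrier (W i)"
    proof (rule W_gen[OF i])
      show "subsp (W i) ?S"
        unfolding subsp_def
      proof (intro conjI ballI allI)
        show "\<zero>\<^bsub>W i\<^esub> \<in> ?S" using T.gen_zero[OF w i] RD(2) T.Vcl(3)[OF i] by simp
        show "c \<odot>\<^bsub>W i\<^esub> y \<in> ?S" if "y \<in> ?S" for c y using that T.gen_smult[OF w i] RD(4) T.Vcl(2)[OF i] by simp
        show "y \<oplus>\<^bsub>W i\<^esub> y' \<in> ?S" if "y \<in> ?S" "y' \<in> ?S" for y y' using that T.gen_add[OF w i] RD(3) T.Vcl(1)[OF i] by simp
      qed auto
      have "T.gen (w(i := u i)) \<in> R"
        by (rule insert.hyps(3)) (use insert.prems T.upd[OF w i uc[OF i]] in auto)
      then show "u i \<in> ?S" using uc[OF i] by simp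
      fix s y assume s: "s \<in> carrier TT" and "y \<in> ?S"
      then have y: "y \<in> carrier (W i)" "T.gen (w(i := y)) \<in> R" by auto
      obtain t where t: "t \<in> carrier TT" "act T.TM (j0 t) (T.gen (w(i := y))) = T.gen ((w(i := y))(i := act (W i) (j0 s) ((w(i := y)) i)))"
        using slot_act[OF i T.upd[OF w i y(1)] s] by blast
      have "T.gen (w(i := act (W i) (j0 s) y)) \<in> R"
        using RA[OF j0_closed[OF t(1)] y(2)] unfolding t(2) by (simp only: fun_upd_same fun_upd_upd)
      then show "act (W i) (j0 s) y \<in> ?S" using T.Vcl(4)[OF i j0_closed[OF s] y(1)] by simp
    qed
    then have "w i \<in> ?S" using T.SSD[OF w i] by blast
    then show ?case by simp
  qed
  have "T.gen w \<in> R" if "w \<in> T.SS" for w by (rule P[of J]) (use that in auto)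
  note gR = this
  have "x \<in> R" if "x \<in> carrier T.TF" for x using that
    by (induct rule: T.PF.pres_induct) (erule gR | rule RD(2) | erule (1) RD(3) | erule RD(4))+
  then show ?thesis using RD(1) unfolding T.TM_simps by blast
qed

text \<open>The composition with \<open>\<Psi>\<close> fixes \<open>v\<close> and commutes with
  \<open>g' \<otimes> A\<close>, which generates \<open>V\<close>; so \<open>f\<close> is injective.
  Its image is a submodule that contains the generator of the tensor product.\<close>

lemma family_iso:
  assumes f: "lhom Lc V T.TM f" and fv: "f v = T.gen uu"
  shows "lmod_iso Lc V T.TM"
proof -
  interpret TM: lie_module Lc T.TM by (rule T.TM_module)
  obtain \<Psi> where \<Psi>: "lin_map T.TF V \<Psi>" "\<Psi> (T.gen uu) = v"
    "\<And>t x. \<lbrakk>t \<in> carrier TT; x \<in> carrier T.TF\<rbrakk> \<Longrightarrow> \<Psi> (act T.TM (j0 t) x) = act V (j0 t) (\<Psi> x)"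
    using Psi_ex by blast
  note fD = lin_mapD[OF lhomD(1)[OF f]] and fA = lhomD(2)[OF f]
  have fl: "lin_map V T.TF f" using lhomD(1)[OF f] unfolding lin_map_def T.TM_simps .
  note l = lin_map_comp[OF fl \<Psi>(1)]
  have "{w \<in> carrier V. \<Psi> (f w) = w} = carrier V"
  proof (rule j0_generated[OF hwV])
    show "subsp V {w \<in> carrier V. \<Psi> (f w) = w}"
      using lin_mapD[OF l] lin_map_zero[OF l V.VV.vspace_axioms V.VV.vspace_axioms] by (simp add: subsp_def)
    show "v \<in> {w \<in> carrier V. \<Psi> (f w) = w}" using vc fv \<Psi>(2) by simp
    fix t w assume t: "t \<in> carrier TT" and w: "w \<in> {w \<in> carrier V. \<Psi> (f w) = w}"
    then show "act V (j0 t) w \<in> {w \<in> carrier V. \<Psi> (f w) = w}"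
      using fA[OF j0_closed[OF t], of w] \<Psi>(3)[OF t lin_mapD(1)[OF fl], of w] V.act_closed[OF j0_closed[OF t], of w] by simp
  qed
  then have inv: "\<Psi> (f w) = w" if "w \<in> carrier V" for w using that by blast
  then have inj: "inj_on f (carrier V)" by (rule inj_on_inverseI)
  have "f ` carrier V = carrier T.TM"
  proof (rule TM_generated)
    show "lie_submodule Lc T.TM (f ` carrier V)" unfolding TM.lie_submodule_iff
    proof (intro conjI ballI)
      show "subsp T.TM (f ` carrier V)" unfolding subsp_def
      proof (intro conjI ballI allI)
        show "f ` carrier V \<subseteq> carrier T.TM" using fD(1) by blast
        show "\<zero>\<^bsub>T.TM\<^esub> \<in> f ` carrier V"
          by (rule image_eqI[where f = f, OF lin_map_zero[OF lhomD(1)[OF f] V.VV.vspace_axioms TM.VV.vspace_axioms, symmetric] V.VV.zc])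
        fix y c assume "y \<in> f ` carrier V"
        then obtain a where a: "a \<in> carrier V" "y = f a" by (rule imageE)
        show "c \<odot>\<^bsub>T.TM\<^esub> y \<in> f ` carrier V"
          unfolding a(2) by (rule image_eqI[where f = f, OF fD(3)[OF a(1), symmetric] V.VV.sm_closed[OF a(1)]])
        fix y' assume "y' \<in> f ` carrier V"
        then obtain b where b: "b \<in> carrier V" "y' = f b" by (rule imageE)
        show "y \<oplus>\<^bsub>T.TM\<^esub> y' \<in> f ` carrier V"
          unfolding a(2) b(2) by (rule image_eqI[where f = f, OF fD(2)[OF a(1) b(1), symmetric] V.VV.acl[OF a(1) b(1)]])
      qed
      fix x y assume x: "x \<in> carrier Lc" and "y \<in> f ` carrier V"
      then obtain a where a: "a \<in> carrier V" "y = f a" by (elim imageE)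
      show "act T.TM x y \<in> f ` carrier V"
        unfolding a(2) by (rule image_eqI[where f = f, OF fA[OF x a(1), symmetric] V.act_closed[OF x a(1)]])
    qed
    show "T.gen uu \<in> f ` carrier V" using fv vc by (metis imageI)
  qed
  then have b: "bij_betw f (carrier V) (carrier T.TM)" using inj by (simp only: bij_betw_def)
  show ?thesis unfolding lmod_iso_def
    by (intro conjI exI[of _ f] V.lie_module_axioms TM.lie_module_axioms b ballI allI fD(2,3) fA; assumption)
qed

end

context cur_family
begin

text \<open>The universal property enters twice: for the Weyl module on the left with the tensor
  product as target, and for each factor with the twisted copy \<open>Vt i\<close> of the left side
  as target.\<close>

lemma weyl_family_iso: "lmod_iso Lc (weyl G A H2 pss MI) (tensor_family J (\<lambda>i. weyl G A H2 (ps i) (M i)))"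
proof -
  let ?V = "weyl G A H2 pss MI" and ?W = "\<lambda>i. weyl G A H2 (ps i) (M i)"
  obtain v where v: "hwmod ?V pss v" "fnilp ?V v"
    and V: "\<forall>z. lie_module Lc (tensor_family J ?W) \<and> hwv (tensor_family J ?W) pss z \<and> fnilp (tensor_family J ?W) z
      \<longrightarrow> (\<exists>f. lhom Lc ?V (tensor_family J ?W) f \<and> f v = z)"
    using weyl_props[OF MI_ideal pss_kill pss_dom, of "tensor_family J ?W"] by (elim exE conjE)
  interpret fam_module C G H2 A k M ps ?V v by unfold_locales (rule v)+
  have "\<forall>i\<in>J. \<exists>u. hwmod (?W i) (ps i) u \<and> fnilp (?W i) u \<and> (\<exists>f. lhom Lc (?W i) (Vt i) f \<and> f u = v)"
  proof
    fix i assume i: "i \<in> J"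
    obtain u where u: "hwmod (?W i) (ps i) u" "fnilp (?W i) u"
      "\<forall>z. lie_module Lc (Vt i) \<and> hwv (Vt i) (ps i) z \<and> fnilp (Vt i) z \<longrightarrow> (\<exists>f. lhom Lc (?W i) (Vt i) f \<and> f u = z)"
      using weyl_props[OF Mi[OF i] ps_kill[OF i] ps_dom[OF i], of "Vt i"] by (elim exE conjE)
    have "\<exists>f. lhom Lc (?W i) (Vt i) f \<and> f u = v"
      by (rule u(3)[rule_format, OF conjI[OF Vt_module[OF i] conjI[OF Vt_hwv[OF i] Vt_fnilp[OF i]]]])
    then show "\<exists>u. hwmod (?W i) (ps i) u \<and> fnilp (?W i) u \<and> (\<exists>f. lhom Lc (?W i) (Vt i) f \<and> f u = v)"
      by (intro exI[of _ u] conjI u(1,2))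
  qed
  from bchoice[OF this] obtain u where u: "\<forall>i\<in>J. hwmod (?W i) (ps i) (u i) \<and> fnilp (?W i) (u i) \<and> (\<exists>f. lhom Lc (?W i) (Vt i) f \<and> f (u i) = v)" ..
  interpret fam_hom C G H2 A k M ps ?V v ?W u
    by (intro fam_hom.intro fam_hom_axioms.intro fam_module_axioms) (use u in blast)+
  from V[rule_format, OF conjI[OF T.TM_module conjI[OF TM_hwv TM_fnilp]]]
  obtain f where f: "lhom Lc ?V T.TM f" "f v = T.gen uu" by (elim exE conjE)
  show ?thesis by (rule family_iso[OF f])
qed

end

theorem corollary4p4:
  fixes C :: "int^'n^'n"
    and G :: "('g, 'n::finite) km"
    and H2 :: "'g set"
    and A :: "(complex, 'a) module"
    and I :: "'a set"
    and k :: nat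
    and m :: "nat \<Rightarrow> 'a set"
    and \<psi> :: "nat \<Rightarrow> ('g, 'a) cur \<Rightarrow> complex"
  assumes "kac_moody C G"
    and "cartan_complement G H2"
    and "fg_comm_algebra A"
    and "cofinite_ideal A I"
    and "1 \<le> k"
    and "\<And>i. i \<in> {1..k} \<Longrightarrow> maximalideal (m i) A"
    and "inj_on m {1..k}"
    and "I = (\<Inter>i\<in>{1..k}. m i)"
    and "\<And>i. i \<in> {1..k} \<Longrightarrow> lin_form (current G A H2) (cur_cartan G A H2) (\<psi> i)"
    and "\<And>i x. \<lbrakk>i \<in> {1..k}; x \<in> cur_sub G A H2 (cartan' G) (m i)\<rbrakk> \<Longrightarrow> \<psi> i x = 0"
    and "\<And>i. i \<in> {1..k} \<Longrightarrow> dominant G (cur_weight G A H2 (\<psi> i))"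
  shows "lmod_iso (current G A H2)
           (weyl G A H2 (\<lambda>x. \<Sum>i\<in>{1..k}. \<psi> i x) I)
           (tensor_family {1..k} (\<lambda>i. weyl G A H2 (\<psi> i) (m i)))"
proof -
  interpret cur C G H2 A
    using assms(1-3) by (intro cur.intro cur_axioms.intro kac_moody_core) (auto simp: fg_comm_algebra_def)
  have kill: "wkill (\<psi> i) (m i)" if i: "i \<in> {1..k}" for i
    unfolding wkill_def
  proof (intro ballI)
    fix X a assume "X \<in> cartan' G" "a \<in> m i"
    then have "ct X a \<in> cur_sub G A H2 (cartan' G) (m i)" unfolding cur_sub_def by (intro Lie.LV.vspan_base) blast
    then show "\<psi> i (ct X a) = 0" by (rule assms(10)[OF i])
  qed
  \<comment> \<open>Coroots lie in the derived algebra, so the identification of \<open>G\<close>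
    inside the current algebra sends them to \<open>hA i\<close> with coefficient 1, where dominance
    is tested.\<close>
  have d: "dom (\<psi> i)" if i: "i \<in> {1..k}" for i
    using assms(9)[OF i] assms(11)[OF i] emb_derived[OF coroot_derived]
    by (simp add: dom_def wform_def dominant_def cur_weight_def)
  interpret cur_family C G H2 A k m \<psi>
    by (intro cur_family.intro cur_family_axioms.intro cur_axioms assms(5-7) kill d)
  show ?thesis unfolding assms(8) by (rule weyl_family_iso)
qed

end
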